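(* Let $k$ be a field. Then every $G$-algebra over $k$ and every $k$-subalgebra of a $G$-algebra over $k$ is a finite factorization domain. In particular, the following are finite factorization domains: (1) the Weyl algebras and the shift algebras over $k$; (2) the universal enveloping algebras of finite-dimensional Lie algebras over $k$; (3) the coordinate rings of quantum affine spaces over $k$; (4) the $q$-shift algebras and the $q$-Weyl algebras over $k$; as well as polynomial rings over the algebras listed in (1)–(4).
   Context: $\mathbb{N}$ includes $0$; $[a,b]=ab-ba$; $\delta_{i,j}$ is the Kronecker delta; $k^*=k\setminus\{0\}$. Algebras are associative and unital. Polynomial rings are in commuting indeterminates that commute with the coefficients. A (not necessarily commutative) domain $A$ is a finite factorization domain (FFD) if every nonzero non-unit element of $A$ has at least one factorization $a=a_1\cdots a_m$ into irreducible elements (nonzero non-units that are not a product of two non-units) and at most finitely many distinct such factorizations up to multiplication of the irreducible factors by central units of $A$. (Factorizations are ordered sequences of factors.) $G$-algebra: let $n\in\mathbb{N}$ and, for $1\le i<j\le n$, let $c_{ij}\in k^*$ and $d_{ij}\in k[x_1,\ldots,x_n]$ (read in the free algebra by writing each monomial as $x_1^{a_1}\cdots x_n^{a_n}$). Suppose there is a monomial total well-ordering $\prec$ on $k[x_1,\ldots,x_n]$ such that for all $i<j$ either $d_{ij}=0$ or the leading monomial of $d_{ij}$ is smaller than $x_ix_j$ with respect to $\prec$. The $k$-algebra $A=k\langle x_1,\ldots,x_n \mid x_jx_i=c_{ij}x_ix_j+d_{ij},\ 1\le i<j\le n\rangle$ is a $G$-algebra if $\{x_1^{a_1}\cdots x_n^{a_n}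 : a_i\in\mathbb{N}\}$ is a $k$-basis of $A$. The $n$-th Weyl algebra is generated over $k$ by $x_1,\ldots,x_n,\partial_1,\ldots,\partial_n$ with relations $[x_i,x_j]=[\partial_i,\partial_j]=0$, $[\partial_i,x_j]=\delta_{i,j}$. The first shift algebra is $k\langle x,s \mid sx=xs+s\rangle$; for $q\in k^*$, the first $q$-shift algebra is $k\langle x,s_q\mid s_qx=q\,x s_q\rangle$. The $n$-th shift (resp. $q$-shift) algebra is the tensor product over $k$ of $n$ first shift (resp. first $q$-shift, with possibly different parameters) algebras. The coordinate ring of quantum affine $n$-space $\mathcal{O}_{\mathbf q}(k^n)$, for nonzero $q_{i,j}\in k$ with $q_{i,j}q_{j,i}=1$ for $i\ne j$ and $q_{i,i}=1$, is the $k$-algebra generated by $x_1,\ldots,x_n$ with relations $x_ix_j=q_{i,j}x_jx_i$. The $n$-th $q$-Weyl algebra, for $(q_1,\ldots,q_n)\in(k^* )^n$, is generated over $k$ by $x_1,\ldots,x_n,\partial_1,\ldots,\partial_n$ with relations $\partial_ix_j=(1+\delta_{i,j}(q_i-1))x_j\partial_i+\delta_{i,j}$ and $[x_i,x_j]=[\partial_i,\partial_j]=0$. *)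

theory Defs
  imports
    "HOL-Algebra.Algebra"
    "HOL-Algebra.Algebraic_Closure_Type"
    "HOL-Library.Multiset"
begin

section \<open>Finite factorization domains\<close>

text \<open>The library's \<^locale>\<open>domain\<close> is commutative.\<close>

definition nc_domain :: "('a, 'm) ring_scheme \<Rightarrow> bool" where
  "nc_domain R \<longleftrightarrow> ring R \<and> \<one>\<^bsub>R\<^esub> \<noteq> \<zero>\<^bsub>R\<^esub> \<and>
     (\<forall>a\<in>carrier R. \<forall>b\<in>carrier R. a \<otimes>\<^bsub>R\<^esub> b = \<zero>\<^bsub>R\<^esub> \<longrightarrow> a = \<zero>\<^bsub>R\<^esub> \<or> b = \<zero>\<^bsub>R\<^esub>)"

definition nc_irreducible :: "('a, 'm) ring_scheme \<Rightarrow> 'a \<Rightarrow> bool" where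
  "nc_irreducible R a \<longleftrightarrow> a \<in> carrier R \<and> a \<noteq> \<zero>\<^bsub>R\<^esub> \<and> a \<notin> Units R \<and>
     \<not> (\<exists>b\<in>carrier R - Units R. \<exists>c\<in>carrier R - Units R. a = b \<otimes>\<^bsub>R\<^esub> c)"

definition central_units :: "('a, 'm) ring_scheme \<Rightarrow> 'a set" where
  "central_units R = {u \<in> Units R. \<forall>a\<in>carrier R. u \<otimes>\<^bsub>R\<^esub> a = a \<otimes>\<^bsub>R\<^esub> u}"

text \<open>The empty list is a factorization of the unit 1 only, so it plays no role for non-units.\<close>

definition factorizations :: "('a, 'm) ring_scheme \<Rightarrow> 'a \<Rightarrow> 'a list set" where
  "factorizations R a =
     {as. (\<forall>b\<in>set as. nc_irreducible R b) \<and> foldr (\<otimes>\<^bsub>R\<^esub>) as \<one>\<^bsub>R\<^esub> = a}"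

definition same_factorization :: "('a, 'm) ring_scheme \<Rightarrow> 'a \<Rightarrow> ('a list \<times> 'a list) set" where
  "same_factorization R a =
     {(as, bs). as \<in> factorizations R a \<and> bs \<in> factorizations R a \<and>
        list_all2 (\<lambda>x y. \<exists>u\<in>central_units R. y = u \<otimes>\<^bsub>R\<^esub> x) as bs}"

definition FFD :: "('a, 'm) ring_scheme \<Rightarrow> bool" where
  "FFD R \<longleftrightarrow> nc_domain R \<and>
     (\<forall>a\<in>carrier R. a \<noteq> \<zero>\<^bsub>R\<^esub> \<longrightarrow> a \<notin> Units R \<longrightarrow>
        factorizations R a \<noteq> {} \<and> finite (factorizations R a // same_factorization R a))"

section \<open>Algebras over a field\<close>

text \<open>
  The ground field is a type \<open>'k\<close> of class \<^class>\<open>field\<close>, seen as a ring record through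
  \<^const>\<open>ring_of_type_algebra\<close>. A \<open>'k\<close>-algebra is a \<^typ>\<open>('k, 'a) module\<close> record, whose ring part
  carries the (noncommutative) product and whose scalar product is \<^const>\<open>module.smult\<close>.
\<close>

abbreviation kfield :: "'k::field ring" where
  "kfield \<equiv> ring_of_type_algebra"

definition k_subalgebra :: "'a set \<Rightarrow> ('k::field, 'a, 'm) module_scheme \<Rightarrow> bool" where
  "k_subalgebra S A \<longleftrightarrow> subring S A \<and> (\<forall>c. \<forall>x\<in>S. c \<odot>\<^bsub>A\<^esub> x \<in> S)"

text \<open>
  A basis is an indexed family, so members with different indices are distinct vectors.
\<close>

definition k_basis :: "('k::field, 'a, 'm) module_scheme \<Rightarrow> 'i set \<Rightarrow> ('i \<Rightarrow> 'a) \<Rightarrow> bool" where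
  "k_basis A I b \<longleftrightarrow> b \<in> I \<rightarrow> carrier A \<and>
     (\<forall>F c. finite F \<and> F \<subseteq> I \<and> (\<Oplus>\<^bsub>A\<^esub>i\<in>F. c i \<odot>\<^bsub>A\<^esub> b i) = \<zero>\<^bsub>A\<^esub> \<longrightarrow> (\<forall>i\<in>F. c i = 0)) \<and>
     (\<forall>x\<in>carrier A. \<exists>F c. finite F \<and> F \<subseteq> I \<and> x = (\<Oplus>\<^bsub>A\<^esub>i\<in>F. c i \<odot>\<^bsub>A\<^esub> b i))"

section \<open>Monoid algebras, free algebras and polynomial rings\<close>

text \<open>
  The monoid algebra \<open>R[M]\<close>: finitely supported functions from \<open>M\<close> to \<open>R\<close> with convolution.
  \<open>R\<close> need not be commutative; the elements of \<open>M\<close> commute with the coefficients.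
\<close>

definition supp :: "('r, 'm) ring_scheme \<Rightarrow> ('a \<Rightarrow> 'r) \<Rightarrow> 'a set" where
  "supp R f = {a. f a \<noteq> \<zero>\<^bsub>R\<^esub>}"

definition monoid_algebra ::
    "('r, 'm) ring_scheme \<Rightarrow> ('a, 'n) monoid_scheme \<Rightarrow> ('r, 'a \<Rightarrow> 'r) module" where
  "monoid_algebra R M =
    \<lparr>carrier = {f. (\<forall>a. f a \<in> carrier R) \<and> finite (supp R f) \<and> supp R f \<subseteq> carrier M},
     monoid.mult = (\<lambda>f g a. \<Oplus>\<^bsub>R\<^esub>p\<in>{p \<in> supp R f \<times> supp R g. fst p \<otimes>\<^bsub>M\<^esub> snd p = a}.
                              f (fst p) \<otimes>\<^bsub>R\<^esub> g (snd p)),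
     one = (\<lambda>a. if a = \<one>\<^bsub>M\<^esub> then \<one>\<^bsub>R\<^esub> else \<zero>\<^bsub>R\<^esub>),
     ring.zero = (\<lambda>a. \<zero>\<^bsub>R\<^esub>),
     add = (\<lambda>f g a. f a \<oplus>\<^bsub>R\<^esub> g a),
     module.smult = (\<lambda>c f a. c \<otimes>\<^bsub>R\<^esub> f a)\<rparr>"

definition basis_elt :: "'a \<Rightarrow> 'a \<Rightarrow> 'k::field" where
  "basis_elt a = (\<lambda>b. if b = a then 1 else 0)"

definition free_monoid :: "'v set \<Rightarrow> 'v list monoid" where
  "free_monoid V = \<lparr>carrier = lists V, monoid.mult = (@), one = []\<rparr>"

text \<open>Monomials in commuting indeterminates from \<open>V\<close> are the finite multisets over \<open>V\<close>.\<close>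

definition monomials :: "'v set \<Rightarrow> 'v multiset set" where
  "monomials V = {m. set_mset m \<subseteq> V}"

definition free_comm_monoid :: "'v set \<Rightarrow> 'v multiset monoid" where
  "free_comm_monoid V = \<lparr>carrier = monomials V, monoid.mult = (+), one = {#}\<rparr>"

definition free_algebra :: "'v set \<Rightarrow> ('k::field, 'v list \<Rightarrow> 'k) module" where
  "free_algebra V = monoid_algebra kfield (free_monoid V)"

definition gen :: "'v \<Rightarrow> 'v list \<Rightarrow> 'k::field" where
  "gen v = basis_elt [v]"

definition polynomial_ring :: "('r, 'm) ring_scheme \<Rightarrow> 'v set \<Rightarrow> ('r, 'v multiset \<Rightarrow> 'r) module" where
  "polynomial_ring R V = monoid_algebra R (free_comm_monoid V)"

section \<open>Quotients and presentations\<close>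

text \<open>\<^const>\<open>FactRing\<close> together with the induced scalar multiplication.\<close>

definition quotient_algebra ::
    "('k, 'a, 'm) module_scheme \<Rightarrow> 'a set \<Rightarrow> ('k, 'a set) module" where
  "quotient_algebra A I = ring.extend (A Quot I)
     (module.fields (\<lambda>c C. \<Union>x\<in>C. I +>\<^bsub>A\<^esub> (c \<odot>\<^bsub>A\<^esub> x)))"

text \<open>The two-sided ideal imposing the equations \<open>l = r\<close> for \<open>(l, r)\<close> in \<open>E\<close>.\<close>

definition relation_ideal ::
    "('a, 'm) ring_scheme \<Rightarrow> ('a \<times> 'a) set \<Rightarrow> 'a set" where
  "relation_ideal A E = Idl\<^bsub>A\<^esub> {l \<ominus>\<^bsub>A\<^esub> r | l r. (l, r) \<in> E}"

definition impose ::
    "('k, 'a, 'm) module_scheme \<Rightarrow> ('a \<times> 'a) set \<Rightarrow> ('k, 'a set) module" where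
  "impose A E = quotient_algebra A (relation_ideal A E)"

definition commutator :: "('a, 'm) ring_scheme \<Rightarrow> 'a \<Rightarrow> 'a \<Rightarrow> 'a" where
  "commutator R a b = a \<otimes>\<^bsub>R\<^esub> b \<ominus>\<^bsub>R\<^esub> b \<otimes>\<^bsub>R\<^esub> a"

definition kdelta :: "nat \<Rightarrow> nat \<Rightarrow> 'k::field" where
  "kdelta i j = (if i = j then 1 else 0)"

section \<open>G-algebras\<close>

text \<open>
  The indeterminate \<open>x\<^sub>i\<close> is the index \<open>i\<close> in \<open>{1..n}\<close>. The standard word of a monomial \<open>m\<close> is
  \<^term>\<open>sorted_list_of_multiset m\<close>, and these are exactly the sorted words.
\<close>

definition standard_form :: "(nat multiset \<Rightarrow> 'k::field) \<Rightarrow> nat list \<Rightarrow> 'k" where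
  "standard_form d = (\<lambda>w. if sorted w then d (mset w) else 0)"

definition monomial_well_ordering :: "nat \<Rightarrow> (nat multiset \<times> nat multiset) set \<Rightarrow> bool" where
  "monomial_well_ordering n r \<longleftrightarrow> well_order_on (monomials {1..n}) r \<and>
     (\<forall>(a, b)\<in>r. \<forall>m\<in>monomials {1..n}. (a + m, b + m) \<in> r)"

definition leading_monomial ::
    "(nat multiset \<times> nat multiset) set \<Rightarrow> (nat multiset \<Rightarrow> 'k::field) \<Rightarrow> nat multiset" where
  "leading_monomial r d = (THE m. d m \<noteq> 0 \<and> (\<forall>m'. d m' \<noteq> 0 \<longrightarrow> (m', m) \<in> r))"

definition G_relations ::
    "nat \<Rightarrow> (nat \<Rightarrow> nat \<Rightarrow> 'k::field) \<Rightarrow> (nat \<Rightarrow> nat \<Rightarrow> nat multiset \<Rightarrow> 'k) \<Rightarrow>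
     ((nat list \<Rightarrow> 'k) \<times> (nat list \<Rightarrow> 'k)) set" where
  "G_relations n c d = (let F = free_algebra {1..n} in
     {(gen j \<otimes>\<^bsub>F\<^esub> gen i, c i j \<odot>\<^bsub>F\<^esub> (gen i \<otimes>\<^bsub>F\<^esub> gen j) \<oplus>\<^bsub>F\<^esub> standard_form (d i j)) | i j.
        1 \<le> i \<and> i < j \<and> j \<le> n})"

definition G_presentation ::
    "nat \<Rightarrow> (nat \<Rightarrow> nat \<Rightarrow> 'k::field) \<Rightarrow> (nat \<Rightarrow> nat \<Rightarrow> nat multiset \<Rightarrow> 'k) \<Rightarrow>
     ('k, (nat list \<Rightarrow> 'k) set) module" where
  "G_presentation n c d = impose (free_algebra {1..n}) (G_relations n c d)"

definition standard_monomial ::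
    "nat \<Rightarrow> (nat \<Rightarrow> nat \<Rightarrow> 'k::field) \<Rightarrow> (nat \<Rightarrow> nat \<Rightarrow> nat multiset \<Rightarrow> 'k) \<Rightarrow>
     nat multiset \<Rightarrow> (nat list \<Rightarrow> 'k) set" where
  "standard_monomial n c d m =
     relation_ideal (free_algebra {1..n} :: ('k, nat list \<Rightarrow> 'k) module) (G_relations n c d)
       +>\<^bsub>(free_algebra {1..n} :: ('k, nat list \<Rightarrow> 'k) module)\<^esub>
         basis_elt (sorted_list_of_multiset m)"

text \<open>\<^term>\<open>(r - Id)\<close> is the strict part of the reflexive well-order \<open>r\<close>.\<close>

definition is_G_algebra ::
    "nat \<Rightarrow> (nat \<Rightarrow> nat \<Rightarrow> 'k::field) \<Rightarrow> (nat \<Rightarrow> nat \<Rightarrow> nat multiset \<Rightarrow> 'k) \<Rightarrow> bool" where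
  "is_G_algebra n c d \<longleftrightarrow>
     (\<forall>i j. 1 \<le> i \<and> i < j \<and> j \<le> n \<longrightarrow>
        c i j \<noteq> 0 \<and> d i j \<in> carrier (polynomial_ring kfield {1..n})) \<and>
     (\<exists>r. monomial_well_ordering n r \<and>
        (\<forall>i j. 1 \<le> i \<and> i < j \<and> j \<le> n \<longrightarrow>
           d i j = \<zero>\<^bsub>polynomial_ring kfield {1..n}\<^esub> \<or>
           (leading_monomial r (d i j), {#i, j#}) \<in> r - Id)) \<and>
     k_basis (G_presentation n c d) (monomials {1..n}) (standard_monomial n c d)"

section \<open>Weyl and \<open>q\<close>-Weyl algebras\<close>

datatype weyl_gen = WX nat | WD nat

definition weyl_gens :: "nat \<Rightarrow> weyl_gen set" where
  "weyl_gens n = WX ` {1..n} \<union> WD ` {1..n}"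

definition weyl_algebra :: "nat \<Rightarrow> ('k::field, (weyl_gen list \<Rightarrow> 'k) set) module" where
  "weyl_algebra n = (let F = free_algebra (weyl_gens n) in impose F
     ({(commutator F (gen (WX i)) (gen (WX j)), \<zero>\<^bsub>F\<^esub>) | i j. i \<in> {1..n} \<and> j \<in> {1..n}} \<union>
      {(commutator F (gen (WD i)) (gen (WD j)), \<zero>\<^bsub>F\<^esub>) | i j. i \<in> {1..n} \<and> j \<in> {1..n}} \<union>
      {(commutator F (gen (WD i)) (gen (WX j)), kdelta i j \<odot>\<^bsub>F\<^esub> \<one>\<^bsub>F\<^esub>) | i j.
         i \<in> {1..n} \<and> j \<in> {1..n}}))"

definition q_weyl_algebra ::
    "nat \<Rightarrow> (nat \<Rightarrow> 'k::field) \<Rightarrow> ('k, (weyl_gen list \<Rightarrow> 'k) set) module" where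
  "q_weyl_algebra n q = (let F = free_algebra (weyl_gens n) in impose F
     ({(commutator F (gen (WX i)) (gen (WX j)), \<zero>\<^bsub>F\<^esub>) | i j. i \<in> {1..n} \<and> j \<in> {1..n}} \<union>
      {(commutator F (gen (WD i)) (gen (WD j)), \<zero>\<^bsub>F\<^esub>) | i j. i \<in> {1..n} \<and> j \<in> {1..n}} \<union>
      {(gen (WD i) \<otimes>\<^bsub>F\<^esub> gen (WX j),
        (1 + kdelta i j * (q i - 1)) \<odot>\<^bsub>F\<^esub> (gen (WX j) \<otimes>\<^bsub>F\<^esub> gen (WD i)) \<oplus>\<^bsub>F\<^esub>
          kdelta i j \<odot>\<^bsub>F\<^esub> \<one>\<^bsub>F\<^esub>) | i j. i \<in> {1..n} \<and> j \<in> {1..n}}))"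

section \<open>Tensor products; shift and \<open>q\<close>-shift algebras\<close>

text \<open>
  The tensor product over \<open>'k\<close> of a family of algebras: the free vector space on the cartesian
  product of the carriers, modulo multilinearity. With the product of pure tensors taken
  componentwise, the free vector space is the monoid algebra of the cartesian product of the
  multiplicative monoids. (The record-level \<^const>\<open>product_group\<close> does not need inverses.)
  The linear span of the multilinearity relations is already a two-sided ideal there.
\<close>

definition multilinear_relations ::
    "'i set \<Rightarrow> ('i \<Rightarrow> ('k::field, 'a) module) \<Rightarrow>
     ((('i \<Rightarrow> 'a) \<Rightarrow> 'k) \<times> (('i \<Rightarrow> 'a) \<Rightarrow> 'k)) set" where
  "multilinear_relations I A = (let T = monoid_algebra kfield (product_group I A) in
     {(basis_elt (f(i := a \<oplus>\<^bsub>A i\<^esub> b)), basis_elt (f(i := a)) \<oplus>\<^bsub>T\<^esub> basis_elt (f(i := b))) | f i a b.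
        f \<in> (\<Pi>\<^sub>E i\<in>I. carrier (A i)) \<and> i \<in> I \<and> a \<in> carrier (A i) \<and> b \<in> carrier (A i)} \<union>
     {(basis_elt (f(i := c \<odot>\<^bsub>A i\<^esub> a)), c \<odot>\<^bsub>T\<^esub> basis_elt (f(i := a))) | f i a c.
        f \<in> (\<Pi>\<^sub>E i\<in>I. carrier (A i)) \<and> i \<in> I \<and> a \<in> carrier (A i)})"

definition tensor_product ::
    "'i set \<Rightarrow> ('i \<Rightarrow> ('k::field, 'a) module) \<Rightarrow> ('k, (('i \<Rightarrow> 'a) \<Rightarrow> 'k) set) module" where
  "tensor_product I A =
     impose (monoid_algebra kfield (product_group I A)) (multilinear_relations I A)"

datatype shift_gen = Var | Shift

definition first_shift_algebra :: "('k::field, (shift_gen list \<Rightarrow> 'k) set) module" where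
  "first_shift_algebra = (let F = free_algebra UNIV in impose F
     {(gen Shift \<otimes>\<^bsub>F\<^esub> gen Var, gen Var \<otimes>\<^bsub>F\<^esub> gen Shift \<oplus>\<^bsub>F\<^esub> gen Shift)})"

definition first_q_shift_algebra ::
    "'k::field \<Rightarrow> ('k, (shift_gen list \<Rightarrow> 'k) set) module" where
  "first_q_shift_algebra q = (let F = free_algebra UNIV in impose F
     {(gen Shift \<otimes>\<^bsub>F\<^esub> gen Var, q \<odot>\<^bsub>F\<^esub> (gen Var \<otimes>\<^bsub>F\<^esub> gen Shift))})"

definition shift_algebra ::
    "nat \<Rightarrow> ('k::field, ((nat \<Rightarrow> (shift_gen list \<Rightarrow> 'k) set) \<Rightarrow> 'k) set) module" where
  "shift_algebra n = tensor_product {1..n} (\<lambda>i. first_shift_algebra)"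

definition q_shift_algebra ::
    "nat \<Rightarrow> (nat \<Rightarrow> 'k::field) \<Rightarrow>
     ('k, ((nat \<Rightarrow> (shift_gen list \<Rightarrow> 'k) set) \<Rightarrow> 'k) set) module" where
  "q_shift_algebra n q = tensor_product {1..n} (\<lambda>i. first_q_shift_algebra (q i))"

section \<open>Universal enveloping algebras\<close>

text \<open>
  A Lie algebra is a vector space \<open>L\<close> with a separate bracket; the fields \<^const>\<open>monoid.mult\<close> and
  \<^const>\<open>one\<close> of the record \<open>L\<close> are ignored.
\<close>

definition lie_algebra :: "('k::field, 'l) module \<Rightarrow> ('l \<Rightarrow> 'l \<Rightarrow> 'l) \<Rightarrow> bool" where
  "lie_algebra L br \<longleftrightarrow> module kfield L \<and>
     (\<forall>x\<in>carrier L. \<forall>y\<in>carrier L. br x y \<in> carrier L) \<and>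
     (\<forall>x\<in>carrier L. \<forall>y\<in>carrier L. \<forall>z\<in>carrier L.
        br (x \<oplus>\<^bsub>L\<^esub> y) z = br x z \<oplus>\<^bsub>L\<^esub> br y z \<and> br z (x \<oplus>\<^bsub>L\<^esub> y) = br z x \<oplus>\<^bsub>L\<^esub> br z y) \<and>
     (\<forall>c. \<forall>x\<in>carrier L. \<forall>y\<in>carrier L.
        br (c \<odot>\<^bsub>L\<^esub> x) y = c \<odot>\<^bsub>L\<^esub> br x y \<and> br x (c \<odot>\<^bsub>L\<^esub> y) = c \<odot>\<^bsub>L\<^esub> br x y) \<and>
     (\<forall>x\<in>carrier L. br x x = \<zero>\<^bsub>L\<^esub>) \<and>
     (\<forall>x\<in>carrier L. \<forall>y\<in>carrier L. \<forall>z\<in>carrier L.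
        br x (br y z) \<oplus>\<^bsub>L\<^esub> br y (br z x) \<oplus>\<^bsub>L\<^esub> br z (br x y) = \<zero>\<^bsub>L\<^esub>)"

definition finite_dimensional :: "('k::field, 'l) module \<Rightarrow> bool" where
  "finite_dimensional L \<longleftrightarrow> (\<exists>B. finite B \<and> k_basis L B (\<lambda>x. x))"

text \<open>
  The first two families of relations turn the free algebra on the set \<open>L\<close> into the tensor
  algebra of the vector space \<open>L\<close>; the third one is \<open>x \<otimes> y - y \<otimes> x = [x, y]\<close>.
\<close>

definition enveloping_algebra ::
    "('k::field, 'l) module \<Rightarrow> ('l \<Rightarrow> 'l \<Rightarrow> 'l) \<Rightarrow> ('k, ('l list \<Rightarrow> 'k) set) module" where
  "enveloping_algebra L br = (let F = free_algebra (carrier L) in impose F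
     ({(gen (x \<oplus>\<^bsub>L\<^esub> y), gen x \<oplus>\<^bsub>F\<^esub> gen y) | x y. x \<in> carrier L \<and> y \<in> carrier L} \<union>
      {(gen (c \<odot>\<^bsub>L\<^esub> x), c \<odot>\<^bsub>F\<^esub> gen x) | c x. x \<in> carrier L} \<union>
      {(commutator F (gen x) (gen y), gen (br x y)) | x y. x \<in> carrier L \<and> y \<in> carrier L}))"

section \<open>Quantum affine spaces\<close>

definition quantum_parameters :: "nat \<Rightarrow> (nat \<Rightarrow> nat \<Rightarrow> 'k::field) \<Rightarrow> bool" where
  "quantum_parameters n q \<longleftrightarrow> (\<forall>i\<in>{1..n}. \<forall>j\<in>{1..n}.
     q i j \<noteq> 0 \<and> (i \<noteq> j \<longrightarrow> q i j * q j i = 1)) \<and> (\<forall>i\<in>{1..n}. q i i = 1)"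

definition quantum_affine_space ::
    "nat \<Rightarrow> (nat \<Rightarrow> nat \<Rightarrow> 'k::field) \<Rightarrow> ('k, (nat list \<Rightarrow> 'k) set) module" where
  "quantum_affine_space n q = (let F = free_algebra {1..n} in impose F
     {(gen i \<otimes>\<^bsub>F\<^esub> gen j, q i j \<odot>\<^bsub>F\<^esub> (gen j \<otimes>\<^bsub>F\<^esub> gen i)) | i j. i \<in> {1..n} \<and> j \<in> {1..n}})"

end

(*
  Let an algebra have a basis of monomials such that, for a total monomial order, the product of two
  basis elements is a nonzero multiple of the basis element of the product monomial plus smaller terms.
  Leading monomials are then multiplicative, so a left factor a of a fixed f has one of finitely many
  monomials as its leading monomial, and a may be normalised to be monic. On the set Z of all
  factorizations f = a b with prescribed leading monomials and a monic, the coefficients of a and b are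
  functions, whereas the coefficients of a b are constant. Triangularity of the multiplication gives the
  Dedekind-Mertens inclusion (with P, Q, C the spans of the coefficient functions of a, b, a b)
  P^n P Q <= P^n C for n + 1 coefficients of b. As b has an invertible constant among its coefficients
  and C consists of constants, P^(n+1) <= P^n. Hence the powers of a coefficient of a stay in a finite
  dimensional space, the coefficient takes finitely many values, and f has finitely many monic left
  factors; this implies the finite factorization property. Only coordinates are used, so it passes
  to subalgebras and, ordering pairs lexicographically, to polynomial rings.

  Monomials of a given weight must be finite in number, which a monomial order alone does not ensure.
  Only finitely many monomials occur in the relations of a G-algebra, so its order can be replaced by
  positive integer weights (Gordan's theorem). The other algebras have such weights for their PBW bases;
  linear independence of these bases is read off from a linear functional on words: a representation by
  operators for the (q-)Weyl and (q-)shift algebras, Jacobson's straightening map for enveloping algebras.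
*)
theory Submission
  imports Defs "HOL-Library.Set_Algebras" "HOL-Library.Function_Algebras" "HOL-Library.Product_Plus"
begin

section \<open>Factorizations in triangular algebras\<close>

text \<open>A coefficient all of whose powers lie in a finite-dimensional space takes finitely many
  values because a nonzero polynomial has finitely many roots: infinitely many values would make the
  powers linearly independent. This argument lives in the commutative algebra of functions on Z with
  pointwise operations, although the algebra under study is noncommutative.

  The passage from left factors to factorizations rests on a length: the number of classes of left
  factors modulo central units. It drops whenever a non-unit is split off on either side, which
  gives existence of factorizations by one induction and finiteness by another.

  Finite down-sets matter because the support of a factor is controlled only through its leading
  monomial: in a lexicographic order with 1 < x < x^2 < ... < y, infinitely many monomials lie below
  y.

  A functional on words descends to a quotient once every relation is respected between any two
  words u and v. Independence is then read off on sorted words and takes the place of a confluence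
  argument; overlapping rewritings are compared only for enveloping algebras, where the Jacobi
  identity enters.\<close>

definition fscale :: "'k::field \<Rightarrow> ('x \<Rightarrow> 'k) \<Rightarrow> 'x \<Rightarrow> 'k" where
  "fscale c f = (\<lambda>x. c * f x)"

global_interpretation fv: vector_space "fscale :: 'k::field \<Rightarrow> ('x \<Rightarrow> 'k) \<Rightarrow> 'x \<Rightarrow> 'k"
  by unfold_locales (auto simp: fscale_def algebra_simps)

lemma fscale_mult: "fscale c u * v = fscale c (u * v)" "u * fscale c v = fscale c (u * v)"
  by (auto simp: fscale_def)

lemma span_mult_left:
  assumes v: "v \<in> fv.span B" and u: "\<And>b. b \<in> B \<Longrightarrow> u * b \<in> fv.span C"
  shows "u * v \<in> fv.span C"
  using v
proof (induction rule: fv.span_induct_alt)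
  case base
  then show ?case by (metis mult_zero_right fv.span_zero)
next
  case (step c x y)
  have "u * (fscale c x + y) = fscale c (u * x) + u * y"
    by (simp add: distrib_left fscale_mult)
  with step u show ?case by (metis fv.span_add fv.span_scale)
qed

text \<open>Otherwise the first \<open>card S + 1\<close> powers would be linearly independent: a
  linear relation among them is a polynomial vanishing at the infinitely many values of
  \<open>g\<close>. Extension by zero outside \<open>Z\<close> keeps the powers total and makes the
  zeroth one the indicator of \<open>Z\<close>.\<close>

lemma finite_values:
  fixes g :: "'x \<Rightarrow> 'k::field"
  assumes S: "finite S" and sp: "\<And>m. (\<lambda>x. if x \<in> Z then g x ^ m else 0) \<in> fv.span S"
  shows "finite (g ` Z)"
proof (rule ccontr)
  assume inf: "infinite (g ` Z)"
  define h where "h m = (\<lambda>x. if x \<in> Z then g x ^ m else 0)" for m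
  define N where "N = card S"
  have zero: "\<forall>m\<le>N. c m = 0" if "(\<Sum>m\<le>N. fscale (c m) (h m)) = 0" for c
  proof -
    define p where "p = (\<Sum>m\<le>N. Polynomial.monom (c m) m)"
    have "poly p (g x) = 0" if x: "x \<in> Z" for x
    proof -
      have "(\<Sum>m\<le>N. fscale (c m) (h m)) x = 0" using that \<open>(\<Sum>m\<le>N. fscale (c m) (h m)) = 0\<close> by simp
      moreover have "(\<Sum>m\<le>N. fscale (c m) (h m)) x = (\<Sum>m\<le>N. c m * g x ^ m)"
        using x by (induction N) (auto simp: fscale_def h_def)
      ultimately show ?thesis by (simp add: p_def poly_sum Polynomial.poly_monom)
    qed
    then have "g ` Z \<subseteq> {x. poly p x = 0}" by auto
    with inf have "p = 0" using poly_roots_finite finite_subset by blast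
    then have "Polynomial.coeff p m = 0" for m by simp
    moreover have "Polynomial.coeff p m = c m" if "m \<le> N" for m
      using that by (simp add: p_def Polynomial.coeff_sum)
    ultimately show ?thesis by simp
  qed
  have inj: "inj_on h {..N}"
  proof (rule inj_onI, rule ccontr)
    fix a b assume ab: "a \<in> {..N}" "b \<in> {..N}" "h a = h b" "a \<noteq> b"
    define c :: "nat \<Rightarrow> 'k" where "c m = (if m = a then 1 else if m = b then -1 else 0)" for m
    have "(\<Sum>m\<le>N. fscale (c m) (h m)) = (\<Sum>m\<in>{a,b}. fscale (c m) (h m))"
      by (rule sum.mono_neutral_right) (use ab in \<open>auto simp: c_def fscale_def fun_eq_iff\<close>)
    also have "\<dots> = 0" using ab by (auto simp: c_def fscale_def fun_eq_iff)
    finally have "c a = 0" using zero ab by auto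
    then show False by (simp add: c_def)
  qed
  have "\<not> fv.dependent (h ` {..N})"
  proof
    assume "fv.dependent (h ` {..N})"
    then obtain u v where uv: "v \<in> h ` {..N}" "u v \<noteq> 0" "(\<Sum>v\<in>h ` {..N}. fscale (u v) v) = 0"
      using fv.dependent_finite[of "h ` {..N}"] by auto
    have "(\<Sum>v\<in>h ` {..N}. fscale (u v) v) = (\<Sum>m\<le>N. fscale (u (h m)) (h m))"
      using inj by (simp add: sum.reindex)
    with uv zero[of "\<lambda>m. u (h m)"] show False by auto
  qed
  moreover have "h ` {..N} \<subseteq> fv.span S" using sp by (auto simp: h_def)
  ultimately have "card (h ` {..N}) \<le> card S"
    using fv.independent_span_bound[OF S] by blast
  then show False using inj by (simp add: card_image N_def)
qed

section \<open>Monomial orders and the Dedekind-Mertens inclusion\<close>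

locale mono_order =
  fixes I :: "'i::comm_monoid_add set" and less :: "'i \<Rightarrow> 'i \<Rightarrow> bool" (infix "\<lless>" 50)
  assumes add_closed: "\<lbrakk>p \<in> I; q \<in> I\<rbrakk> \<Longrightarrow> p + q \<in> I"
    and irrefl: "p \<in> I \<Longrightarrow> \<not> p \<lless> p"
    and trans: "\<lbrakk>p \<in> I; q \<in> I; r \<in> I; p \<lless> q; q \<lless> r\<rbrakk> \<Longrightarrow> p \<lless> r"
    and total: "\<lbrakk>p \<in> I; q \<in> I; p \<noteq> q\<rbrakk> \<Longrightarrow> p \<lless> q \<or> q \<lless> p"
    and add_mono: "\<lbrakk>p \<in> I; q \<in> I; r \<in> I; p \<lless> q\<rbrakk> \<Longrightarrow> p + r \<lless> q + r"
begin

lemma add_mono_left: "\<lbrakk>p \<in> I; q \<in> I; r \<in> I; p \<lless> q\<rbrakk> \<Longrightarrow> r + p \<lless> r + q"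
  using add_mono by (simp add: add.commute)

lemma add_mono_both:
  "\<lbrakk>p \<in> I; q \<in> I; r \<in> I; s \<in> I; p \<lless> q; r \<lless> s\<rbrakk> \<Longrightarrow> p + r \<lless> q + s"
  by (meson add_closed add_mono add_mono_left trans)

text \<open>Orders serve to pick greatest elements of finite sets, which is why
  \<open>mono_order\<close> asks for no well-foundedness; finiteness of down-sets is imposed
  separately in \<open>FFD_coord\<close>.\<close>

lemma finite_max:
  assumes "finite S" "S \<noteq> {}" "S \<subseteq> I"
  shows "\<exists>m\<in>S. \<forall>p\<in>S. p = m \<or> p \<lless> m"
  using assms
proof (induction rule: finite_ne_induct)
  case (singleton x)
  then show ?case by simp
next
  case (insert x F)
  then obtain m where m: "m \<in> F" "\<forall>p\<in>F. p = m \<or> p \<lless> m" by auto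
  show ?case
  proof (cases "x \<lless> m")
    case True
    then show ?thesis using m by blast
  next
    case False
    then have "m \<lless> x" using total[of x m] insert m by blast
    then have "p = x \<or> p \<lless> x" if "p \<in> insert x F" for p
      using m that insert.prems trans[of p m x] by (cases "p = m") auto
    then show ?thesis by blast
  qed
qed

end

text \<open>\<open>\<gamma> p q l\<close> plays the role of the coefficient at \<open>l\<close> in
  the product of the basis elements \<open>p\<close> and \<open>q\<close>. The results of this
  locale concern these structure constants alone, before any ring appears.\<close>

locale triangular_product = mono_order I less
  for I :: "'i::comm_monoid_add set" and less :: "'i \<Rightarrow> 'i \<Rightarrow> bool" (infix "\<lless>" 50) +
  fixes \<gamma> :: "'i \<Rightarrow> 'i \<Rightarrow> 'i \<Rightarrow> 'k::field"
  assumes lead_nonzero: "\<lbrakk>p \<in> I; q \<in> I\<rbrakk> \<Longrightarrow> \<gamma> p q (p + q) \<noteq> 0"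
    and lower: "\<lbrakk>p \<in> I; q \<in> I; \<gamma> p q l \<noteq> 0\<rbrakk> \<Longrightarrow> l \<in> I \<and> (l = p + q \<or> l \<lless> p + q)"
begin

text \<open>The coefficient at \<open>l\<close> of a product of two generic elements with supports
  in \<open>P\<close> and \<open>J\<close>. The coefficients \<open>\<alpha> p\<close> and
  \<open>\<beta> q\<close> are functions of a parameter, which in the application is the
  factorization itself.\<close>

definition prod_coeff :: "('i \<Rightarrow> 'x \<Rightarrow> 'k) \<Rightarrow> ('i \<Rightarrow> 'x \<Rightarrow> 'k) \<Rightarrow> 'i set \<Rightarrow> 'i set \<Rightarrow> 'i \<Rightarrow> 'x \<Rightarrow> 'k" where
  "prod_coeff \<alpha> \<beta> P J l = (\<Sum>p\<in>P. \<Sum>q\<in>J. fscale (\<gamma> p q l) (\<alpha> p * \<beta> q))"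

text \<open>Induction on the number of coefficients of the second factor, removing its greatest
  index \<open>q\<close>. Dropping \<open>\<beta> q\<close> alters the product coefficients only by
  multiples of the products \<open>\<alpha> p * \<beta> q\<close>, and these are recovered from the
  coefficients at \<open>p + q\<close>, beginning with the greatest \<open>p\<close>.\<close>

lemma dedekind_mertens:
  fixes \<alpha> \<beta> :: "'i \<Rightarrow> 'x \<Rightarrow> 'k"
  assumes P: "finite P" "P \<subseteq> I"
  shows "\<lbrakk>finite J; J \<subseteq> I; card J \<le> Suc n\<rbrakk> \<Longrightarrow>
    (\<alpha> ` P) ^ Suc n * \<beta> ` J \<subseteq> fv.span ((\<alpha> ` P) ^ n * range (prod_coeff \<alpha> \<beta> P J))"
proof (induction n arbitrary: J)
  \<comment> \<open>Shared by the base case and the induction step. Hypothesis \<open>B\<close>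
    trades each \<open>\<beta> q'\<close> for \<open>\<beta> q\<close> modulo the target span; it is
    void when \<open>q\<close> is the only index in \<open>J\<close>.\<close>
  have step: "(\<alpha> ` P) ^ Suc n * \<beta> ` J \<subseteq> fv.span ((\<alpha> ` P) ^ n * range (prod_coeff \<alpha> \<beta> P J))"
    if J: "finite J" "J \<subseteq> I"
      and q: "q \<in> J" "\<And>q'. q' \<in> J \<Longrightarrow> q' = q \<or> q' \<lless> q"
      and B: "\<And>g p' q'. \<lbrakk>g \<in> (\<alpha> ` P) ^ n; p' \<in> P; q' \<in> J - {q}\<rbrakk> \<Longrightarrow>
        \<alpha> p' * (g * \<beta> q') \<in> fv.span ((\<alpha> ` P) ^ n * range (prod_coeff \<alpha> \<beta> P J)
            \<union> (\<lambda>g'. \<alpha> p' * (g' * \<beta> q)) ` ((\<alpha> ` P) ^ n))"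
    for n J q
  proof -
    let ?S = "fv.span ((\<alpha> ` P) ^ n * range (prod_coeff \<alpha> \<beta> P J))"
    \<comment> \<open>Downward induction on \<open>p\<close>, measured by the number of greater
      indices in \<open>P\<close>: the coefficient at \<open>p + q\<close> is solved for its term
      \<open>\<alpha> p * \<beta> q\<close>, whose constant is nonzero.\<close>
    have C: "\<forall>g\<in>(\<alpha> ` P) ^ n. \<alpha> p * (g * \<beta> q) \<in> ?S" if "p \<in> P" for p
      using that
    proof (induction "card {p' \<in> P. p \<lless> p'}" arbitrary: p rule: less_induct)
      case less
      have IH: "\<alpha> p' * (g * \<beta> q) \<in> ?S" if "p' \<in> P" "p \<lless> p'" "g \<in> (\<alpha> ` P) ^ n" for p' g
      proof -
        have "{r \<in> P. p' \<lless> r} \<subset> {r \<in> P. p \<lless> r}"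
          using that less.prems P irrefl trans[of p p'] by blast
        then have "card {r \<in> P. p' \<lless> r} < card {r \<in> P. p \<lless> r}"
          using P by (intro psubset_card_mono) auto
        then show ?thesis using less.hyps that by blast
      qed
      have B': "\<alpha> p' * (g * \<beta> q') \<in> ?S"
        if p': "p' \<in> P" "p \<lless> p'" "q' \<in> J" "g \<in> (\<alpha> ` P) ^ n" for p' q' g
      proof (cases "q' = q")
        case True
        then show ?thesis using IH that by simp
      next
        case False
        have "(\<alpha> ` P) ^ n * range (prod_coeff \<alpha> \<beta> P J) \<union> (\<lambda>g'. \<alpha> p' * (g' * \<beta> q)) ` ((\<alpha> ` P) ^ n) \<subseteq> ?S"
          using IH that(1,2) by (intro Un_least fv.span_superset image_subsetI) blast
        then have "fv.span ((\<alpha> ` P) ^ n * range (prod_coeff \<alpha> \<beta> P J) \<union> (\<lambda>g'. \<alpha> p' * (g' * \<beta> q)) ` ((\<alpha> ` P) ^ n)) \<subseteq> ?S"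
          by (simp add: fv.span_minimal)
        with B[of g p' q'] that False show ?thesis by blast
      qed
      show ?case
      proof
        fix g assume g: "g \<in> (\<alpha> ` P) ^ n"
        let ?t = "\<lambda>(p', q'). fscale (\<gamma> p' q' (p + q)) (\<alpha> p' * (g * \<beta> q'))"
        have pI: "p \<in> I" "q \<in> I" using less.prems P J q by auto
        have "g * prod_coeff \<alpha> \<beta> P J (p + q) = (\<Sum>z\<in>P \<times> J. ?t z)"
          unfolding prod_coeff_def sum.cartesian_product sum_distrib_left
          by (intro sum.cong) (auto simp: fscale_mult mult_ac)
        also have "\<dots> = ?t (p, q) + (\<Sum>z\<in>P \<times> J - {(p, q)}. ?t z)"
          using less.prems q P J by (intro sum.remove) auto
        finally have eq: "?t (p, q) = g * prod_coeff \<alpha> \<beta> P J (p + q) - (\<Sum>z\<in>P \<times> J - {(p, q)}. ?t z)"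
          by simp
        have "?t z \<in> ?S" if z: "z \<in> P \<times> J - {(p, q)}" for z
        proof -
          obtain p' q' where z': "z = (p', q')" "p' \<in> P" "q' \<in> J" "(p', q') \<noteq> (p, q)" using z by auto
          have I': "p' \<in> I" "q' \<in> I" using z' P J by auto
          show ?thesis
          proof (cases "\<gamma> p' q' (p + q) = 0")
            case True
            then show ?thesis using fv.span_zero by (simp add: z')
          next
            case False
            then have le: "p + q = p' + q' \<or> p + q \<lless> p' + q'" using lower I' by blast
            \<comment> \<open>A term reaching \<open>p + q\<close> has \<open>p' + q'\<close> at
              least \<open>p + q\<close>. As \<open>q'\<close> is at most \<open>q\<close> and the
              pair differs from \<open>(p, q)\<close>, the index \<open>p'\<close> must be greater
              than \<open>p\<close>.\<close>
            have "p \<lless> p'"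
            proof (rule ccontr)
              assume "\<not> p \<lless> p'"
              then have p': "p' = p \<or> p' \<lless> p" using total[of p p'] I' pI by blast
              have q': "q' = q \<or> q' \<lless> q" using q z' by blast
              have "p' + q' \<lless> p + q"
                using p' q' z'(4) I' pI add_mono add_mono_left add_mono_both by blast
              with le show False
                using irrefl trans[of "p + q" "p' + q'" "p + q"] add_closed I' pI by metis
            qed
            then show ?thesis using B'[of p' q' g] z' g by (simp add: fv.span_scale)
          qed
        qed
        moreover have "g * prod_coeff \<alpha> \<beta> P J (p + q) \<in> ?S"
          using g by (intro fv.span_base set_times_intro) auto
        ultimately have "?t (p, q) \<in> ?S"
          unfolding eq by (intro fv.span_diff fv.span_sum) auto
        then have "fscale (inverse (\<gamma> p q (p + q))) (?t (p, q)) \<in> ?S" by (rule fv.span_scale)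
        then show "\<alpha> p * (g * \<beta> q) \<in> ?S" using lead_nonzero[OF pI] by simp
      qed
    qed
    show ?thesis
    proof
      fix y assume "y \<in> (\<alpha> ` P) ^ Suc n * \<beta> ` J"
      then obtain p' g q' where y: "y = \<alpha> p' * (g * \<beta> q')" "p' \<in> P" "g \<in> (\<alpha> ` P) ^ n" "q' \<in> J"
        by (auto elim!: set_times_elim simp: mult.assoc)
      show "y \<in> ?S"
      proof (cases "q' = q")
        case True
        then show ?thesis using C y by blast
      next
        case False
        have "(\<alpha> ` P) ^ n * range (prod_coeff \<alpha> \<beta> P J) \<union> (\<lambda>g'. \<alpha> p' * (g' * \<beta> q)) ` ((\<alpha> ` P) ^ n) \<subseteq> ?S"
          using C y(2) by (intro Un_least fv.span_superset image_subsetI) blast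
        then have "fv.span ((\<alpha> ` P) ^ n * range (prod_coeff \<alpha> \<beta> P J) \<union> (\<lambda>g'. \<alpha> p' * (g' * \<beta> q)) ` ((\<alpha> ` P) ^ n)) \<subseteq> ?S"
          by (simp add: fv.span_minimal)
        with B[of g p' q'] y False show ?thesis by blast
      qed
    qed
  qed
  {
    case 0
    show ?case
    proof (cases "J = {}")
      case True
      then show ?thesis by (auto elim: set_times_elim)
    next
      case False
      then obtain q where q: "q \<in> J" "\<forall>p\<in>J. p = q \<or> p \<lless> q" using finite_max[OF 0(1) False 0(2)] by blast
      have "card J = 1" using 0 False by (simp add: le_Suc_eq)
      then have "J - {q} = {}" using q by (auto simp: card_1_singleton_iff)
      then show ?thesis using step[of J q 0] 0 q by blast
    qed
  next
    case (Suc n)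
    show ?case
    proof (cases "J = {}")
      case True
      then show ?thesis by (auto elim: set_times_elim)
    next
      case False
      then obtain q where q: "q \<in> J" "\<forall>p\<in>J. p = q \<or> p \<lless> q" using finite_max[OF Suc.prems(1) False Suc.prems(2)] by blast
      let ?J = "J - {q}"
      have "card ?J \<le> Suc n" using Suc.prems q by simp
      then have IH: "(\<alpha> ` P) ^ Suc n * \<beta> ` ?J \<subseteq> fv.span ((\<alpha> ` P) ^ n * range (prod_coeff \<alpha> \<beta> P ?J))"
        using Suc.IH[of ?J] Suc.prems by blast
      show ?thesis
      proof (rule step[OF Suc.prems(1,2) q(1)])
        fix g p' q'
        assume a: "g \<in> (\<alpha> ` P) ^ Suc n" "p' \<in> P" "q' \<in> ?J"
        let ?T = "(\<alpha> ` P) ^ Suc n * range (prod_coeff \<alpha> \<beta> P J) \<union> (\<lambda>g'. \<alpha> p' * (g' * \<beta> q)) ` ((\<alpha> ` P) ^ Suc n)"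
        have "g * \<beta> q' \<in> fv.span ((\<alpha> ` P) ^ n * range (prod_coeff \<alpha> \<beta> P ?J))"
          using IH a by (meson image_eqI set_times_intro subsetD)
        then show "\<alpha> p' * (g * \<beta> q') \<in> fv.span ?T"
        proof (rule span_mult_left)
          fix b assume "b \<in> (\<alpha> ` P) ^ n * range (prod_coeff \<alpha> \<beta> P ?J)"
          then obtain h l where b: "h \<in> (\<alpha> ` P) ^ n" "b = h * prod_coeff \<alpha> \<beta> P ?J l"
            by (auto elim!: set_times_elim)
          have "prod_coeff \<alpha> \<beta> P J l = prod_coeff \<alpha> \<beta> P ?J l + (\<Sum>p\<in>P. fscale (\<gamma> p q l) (\<alpha> p * \<beta> q))"
            unfolding prod_coeff_def sum.distrib[symmetric]
            by (intro sum.cong refl) (use Suc.prems q in \<open>simp add: sum.remove[of J q] add.commute\<close>)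
          then have J': "prod_coeff \<alpha> \<beta> P ?J l = prod_coeff \<alpha> \<beta> P J l - (\<Sum>p\<in>P. fscale (\<gamma> p q l) (\<alpha> p * \<beta> q))"
            by (simp only: add_diff_cancel_right')
          have "\<alpha> p' * b = (\<alpha> p' * h) * prod_coeff \<alpha> \<beta> P J l
              - (\<Sum>p\<in>P. fscale (\<gamma> p q l) (\<alpha> p' * ((\<alpha> p * h) * \<beta> q)))"
            unfolding b(2) J' by (simp only: right_diff_distrib sum_distrib_left fscale_mult mult_ac)
          moreover have "(\<alpha> p' * h) * prod_coeff \<alpha> \<beta> P J l \<in> fv.span ?T"
            using a(2) b(1) unfolding power_Suc by (intro fv.span_base UnI1 set_times_intro imageI rangeI)
          moreover have "fscale (\<gamma> p q l) (\<alpha> p' * ((\<alpha> p * h) * \<beta> q)) \<in> fv.span ?T" if "p \<in> P" for p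
            using b(1) that unfolding power_Suc by (intro fv.span_scale fv.span_base UnI2 imageI set_times_intro)
          ultimately show "\<alpha> p' * b \<in> fv.span ?T"
            by (simp add: fv.span_diff fv.span_sum)
        qed
      qed (use q in blast)
    qed
  }
qed

text \<open>The two normalisations have separate uses: \<open>a i = 1\<close> places the indicator
  of \<open>Z\<close> among the coefficients of the left factor, so small powers embed in larger
  ones; \<open>b j = c\<close> makes one coefficient of the right factor an invertible multiple of
  that indicator, so it can be cancelled from the Dedekind-Mertens inclusion.\<close>

lemma finite_monic_left_factors:
  fixes f :: "'i \<Rightarrow> 'k"
  assumes P: "finite P" "P \<subseteq> I" and ij: "i \<in> P" "j \<in> P" and c: "c \<noteq> 0"
  shows "finite {a. (\<forall>p. a p \<noteq> 0 \<longrightarrow> p \<in> P) \<and> a i = 1 \<and>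
     (\<exists>b. b j = c \<and> (\<forall>l. f l = (\<Sum>p\<in>P. \<Sum>q\<in>P. a p * b q * \<gamma> p q l)))}" (is "finite ?A")
proof -
  define Z where "Z = {(a, b). (\<forall>p. a p \<noteq> 0 \<longrightarrow> p \<in> P) \<and> a i = 1 \<and> b j = c \<and>
      (\<forall>l. f l = (\<Sum>p\<in>P. \<Sum>q\<in>P. a p * b q * \<gamma> p q l))}"
  define \<alpha> where "\<alpha> p = (\<lambda>x. if x \<in> Z then fst x p else 0)" for p
  define \<beta> where "\<beta> p = (\<lambda>x. if x \<in> Z then snd x p else 0)" for p
  \<comment> \<open>The identity element for functions supported on \<open>Z\<close>.\<close>
  define e :: "('i \<Rightarrow> 'k) \<times> ('i \<Rightarrow> 'k) \<Rightarrow> 'k" where "e = (\<lambda>x. if x \<in> Z then 1 else 0)"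
  define A where "A = \<alpha> ` P"
  define n where "n = card P"
  have e: "e * e = e" "\<alpha> i = e" "\<beta> j = fscale c e" "\<And>p. \<alpha> p * e = \<alpha> p"
    by (auto simp: e_def \<alpha>_def \<beta>_def fun_eq_iff Z_def fscale_def)
  have eA: "e \<in> A" using e(2) ij by (auto simp: A_def)
  have sum_app: "(\<Sum>p\<in>S. F p) x = (\<Sum>p\<in>S. F p x)" for F :: "'i \<Rightarrow> ('i \<Rightarrow> 'k) \<times> ('i \<Rightarrow> 'k) \<Rightarrow> 'k" and S x
    by (induction S rule: infinite_finite_induct) auto
  have F: "prod_coeff \<alpha> \<beta> P P l = fscale (f l) e" for l
  proof
    fix x
    show "prod_coeff \<alpha> \<beta> P P l x = fscale (f l) e x"
      by (cases "x \<in> Z")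
        (auto simp: prod_coeff_def sum_app fscale_def e_def \<alpha>_def \<beta>_def Z_def mult_ac intro!: sum.cong)
  qed
  have "A ^ Suc n * \<beta> ` P \<subseteq> fv.span (A ^ n * range (prod_coeff \<alpha> \<beta> P P))"
    unfolding A_def by (rule dedekind_mertens) (use P in \<open>simp_all add: n_def\<close>)
  also have "fv.span (A ^ n * range (prod_coeff \<alpha> \<beta> P P)) \<subseteq> fv.span (A ^ n * {e})"
  proof (rule fv.span_minimal, safe elim!: set_times_elim)
    fix g l assume "g \<in> A ^ n"
    then have "fscale (f l) (g * e) \<in> fv.span (A ^ n * {e})"
      by (intro fv.span_scale fv.span_base) (auto intro: set_times_intro)
    then show "g * prod_coeff \<alpha> \<beta> P P l \<in> fv.span (A ^ n * {e})" by (simp add: F fscale_mult)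
  qed
  finally have *: "A ^ Suc n * \<beta> ` P \<subseteq> fv.span (A ^ n * {e})" .
  have red: "A ^ Suc n * {e} \<subseteq> fv.span (A ^ n * {e})"
  proof (safe elim!: set_times_elim)
    fix g assume g: "g \<in> A ^ Suc n"
    then have "g * \<beta> j \<in> fv.span (A ^ n * {e})"
      using * ij by (meson image_eqI set_times_intro subsetD)
    then have "fscale (inverse c) (g * \<beta> j) \<in> fv.span (A ^ n * {e})" by (rule fv.span_scale)
    then show "g * e \<in> fv.span (A ^ n * {e})" using c by (simp add: e fscale_mult)
  qed
  \<comment> \<open>For exponents above \<open>n\<close>, iterate \<open>red\<close>; for exponents
    below \<open>n\<close>, multiply by \<open>e\<close>, which lies in \<open>A\<close>, until the
    exponent is \<open>n\<close>.\<close>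
  have up: "A ^ m * {e} \<subseteq> fv.span (A ^ n * {e})" if "m = n + k \<or> n = m + k" for m k
    using that
  proof (induction k arbitrary: m)
    case 0
    then show ?case using fv.span_superset by auto
  next
    case (Suc k)
    from Suc.prems show ?case
    proof
      assume m: "m = n + Suc k"
      show ?thesis
      proof
        fix y assume "y \<in> A ^ m * {e}"
        then obtain a g where y: "a \<in> A" "g \<in> A ^ (n + k)" "y = a * (g * e)"
          by (auto elim!: set_times_elim simp: m mult.assoc)
        have "g * e \<in> fv.span (A ^ n * {e})" using Suc.IH[of "n + k"] y by (auto intro: set_times_intro)
        then have "a * (g * e) \<in> fv.span (A ^ Suc n * {e})"
        proof (rule span_mult_left)
          fix b assume "b \<in> A ^ n * {e}"
          then obtain h where h: "h \<in> A ^ n" "b = h * e" by (auto elim!: set_times_elim)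
          show "a * b \<in> fv.span (A ^ Suc n * {e})"
            unfolding h(2) mult.assoc[symmetric] power_Suc using y(1) h(1)
            by (intro fv.span_base set_times_intro singletonI)
        qed
        moreover have "fv.span (A ^ Suc n * {e}) \<subseteq> fv.span (A ^ n * {e})"
          using red by (simp add: fv.span_minimal)
        ultimately show "y \<in> fv.span (A ^ n * {e})" using y by blast
      qed
    next
      assume n: "n = m + Suc k"
      have "A ^ m * {e} \<subseteq> A ^ Suc m * {e}"
      proof (safe elim!: set_times_elim)
        fix g assume g: "g \<in> A ^ m"
        have "g * e = (e * g) * e" using e(1) by (metis mult.assoc mult.commute)
        moreover have "e * g \<in> A ^ Suc m" unfolding power_Suc using eA g by (rule set_times_intro)
        ultimately show "g * e \<in> A ^ Suc m * {e}" by (metis set_times_intro singletonI)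
      qed
      also have "A ^ Suc m * {e} \<subseteq> fv.span (A ^ n * {e})" using Suc.IH[of "Suc m"] n by simp
      finally show ?thesis .
    qed
  qed
  have fin: "finite (A ^ n * {e})"
  proof -
    have "finite (A ^ n)" by (induction n) (use P in \<open>auto simp: A_def intro: finite_set_times\<close>)
    then show ?thesis by (intro finite_set_times) auto
  qed
  have "finite ((\<lambda>x. fst x p) ` Z)" if p: "p \<in> P" for p
  proof (rule finite_values[OF fin])
    fix m
    have "\<alpha> p ^ m \<in> A ^ m"
    proof (induction m)
      case (Suc m)
      then show ?case unfolding power_Suc using p by (intro set_times_intro) (simp_all add: A_def)
    qed (auto simp: fun_eq_iff)
    then have "\<alpha> p ^ m * e \<in> fv.span (A ^ n * {e})"
      using up[of m "m - n"] up[of m "n - m"] set_times_intro[of "\<alpha> p ^ m" "A ^ m" e "{e}"]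
      by (cases "m \<le> n") auto
    moreover have "(\<alpha> p ^ m) x = \<alpha> p x ^ m" for x by (induction m) auto
    then have "\<alpha> p ^ m * e = (\<lambda>x. if x \<in> Z then fst x p ^ m else 0)"
      by (auto simp: fun_eq_iff \<alpha>_def e_def)
    ultimately show "(\<lambda>x. if x \<in> Z then fst x p ^ m else 0) \<in> fv.span (A ^ n * {e})" by simp
  qed
  then have finB: "finite (\<Union>p\<in>P. (\<lambda>x. fst x p) ` Z)" using P by auto
  have "?A \<subseteq> {a. \<forall>p. (p \<in> P \<longrightarrow> a p \<in> (\<Union>p\<in>P. (\<lambda>x. fst x p) ` Z)) \<and> (p \<notin> P \<longrightarrow> a p = 0)}"
  proof
    fix a assume a: "a \<in> ?A"
    then obtain b where "(a, b) \<in> Z" unfolding Z_def by blast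
    then have "a p \<in> (\<lambda>x. fst x p) ` Z" for p by force
    with a show "a \<in> {a. \<forall>p. (p \<in> P \<longrightarrow> a p \<in> (\<Union>p\<in>P. (\<lambda>x. fst x p) ` Z)) \<and> (p \<notin> P \<longrightarrow> a p = 0)}"
      by blast
  qed
  then show ?thesis using finite_set_of_finite_funs[OF P(1) finB, of 0] finite_subset by blast
qed

end

section \<open>From left factors to factorizations in a noncommutative domain\<close>

definition left_factors :: "('a, 'm) ring_scheme \<Rightarrow> 'a \<Rightarrow> 'a set" where
  "left_factors R f = {a \<in> carrier R. \<exists>b\<in>carrier R. a \<otimes>\<^bsub>R\<^esub> b = f}"

locale nc_dom = ring R for R (structure) +
  assumes one_not_zero: "\<one> \<noteq> \<zero>"
    and no_zero_div: "\<lbrakk>a \<in> carrier R; b \<in> carrier R; a \<otimes> b = \<zero>\<rbrakk> \<Longrightarrow> a = \<zero> \<or> b = \<zero>"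
begin

lemma left_cancel:
  assumes "a \<in> carrier R" "b \<in> carrier R" "c \<in> carrier R" "a \<noteq> \<zero>" "a \<otimes> b = a \<otimes> c"
  shows "b = c"
proof -
  have "a \<otimes> (b \<ominus> c) = \<zero>" using assms by (simp add: a_minus_def r_distr r_minus r_neg)
  then have "b \<ominus> c = \<zero>" using no_zero_div assms by blast
  then show ?thesis using assms by simp
qed

lemma right_cancel:
  assumes "a \<in> carrier R" "b \<in> carrier R" "c \<in> carrier R" "a \<noteq> \<zero>" "b \<otimes> a = c \<otimes> a"
  shows "b = c"
proof -
  have "(b \<ominus> c) \<otimes> a = \<zero>" using assms by (simp add: a_minus_def l_distr l_minus r_neg)
  then have "b \<ominus> c = \<zero>" using no_zero_div assms by blast
  then show ?thesis using assms by simp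
qed

text \<open>Cancel \<open>b\<close> on the right in \<open>b a b = b\<close>. This makes the
  comparisons of class numbers below strict for non-units.\<close>

lemma one_sided_units:
  assumes ab: "a \<in> carrier R" "b \<in> carrier R" "a \<otimes> b = \<one>"
  shows "a \<in> Units R" "b \<in> Units R"
proof -
  have "b \<noteq> \<zero>" using ab one_not_zero by auto
  moreover have "(b \<otimes> a) \<otimes> b = \<one> \<otimes> b" using ab by (simp add: m_assoc)
  ultimately have "b \<otimes> a = \<one>" using right_cancel[of b "b \<otimes> a" \<one>] ab by simp
  then show "a \<in> Units R" "b \<in> Units R" using ab by (auto simp: Units_def)
qed

lemma mult_nonzero: "\<lbrakk>a \<in> carrier R; b \<in> carrier R; a \<noteq> \<zero>; b \<noteq> \<zero>\<rbrakk> \<Longrightarrow> a \<otimes> b \<noteq> \<zero>"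
  using no_zero_div by blast

abbreviation "U \<equiv> central_units R"

lemma cu_carrier: "u \<in> U \<Longrightarrow> u \<in> carrier R"
  by (auto simp: central_units_def)

lemma cu_comm: "\<lbrakk>u \<in> U; a \<in> carrier R\<rbrakk> \<Longrightarrow> u \<otimes> a = a \<otimes> u"
  by (auto simp: central_units_def)

lemma cu_one: "\<one> \<in> U"
  by (auto simp: central_units_def)

lemma cu_mult:
  assumes "u \<in> U" "v \<in> U" shows "u \<otimes> v \<in> U"
proof -
  have "u \<otimes> v \<otimes> a = a \<otimes> (u \<otimes> v)" if "a \<in> carrier R" for a
  proof -
    have "u \<otimes> v \<otimes> a = u \<otimes> (a \<otimes> v)" using assms that cu_carrier cu_comm by (simp add: m_assoc)
    also have "\<dots> = a \<otimes> u \<otimes> v" using assms that cu_carrier cu_comm by (simp add: m_assoc[symmetric])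
    finally show ?thesis using assms that cu_carrier by (simp add: m_assoc)
  qed
  then show ?thesis using assms by (auto simp: central_units_def)
qed

lemma cu_inv:
  assumes u: "u \<in> U" shows "inv u \<in> U" "inv u \<otimes> u = \<one>" "u \<otimes> inv u = \<one>"
proof -
  have uU: "u \<in> Units R" using u by (simp add: central_units_def)
  then show inv: "inv u \<otimes> u = \<one>" "u \<otimes> inv u = \<one>" by simp_all
  have "inv u \<otimes> a = a \<otimes> inv u" if a: "a \<in> carrier R" for a
  proof -
    have "inv u \<otimes> a = inv u \<otimes> (a \<otimes> u) \<otimes> inv u" using uU a inv by (simp add: m_assoc Units_closed)
    also have "\<dots> = inv u \<otimes> (u \<otimes> a) \<otimes> inv u" using u a cu_comm by simp
    also have "\<dots> = a \<otimes> inv u" using uU a inv by (simp add: m_assoc[symmetric] Units_closed)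
    finally show ?thesis .
  qed
  then show "inv u \<in> U" using uU by (auto simp: central_units_def)
qed

text \<open>The orbit under central units. Two factorizations are identified by
  \<open>same_factorization\<close> exactly when their lists of orbits agree, so counting can be
  done with lists of orbits.\<close>

definition cls :: "'a \<Rightarrow> 'a set" where
  "cls a = (\<lambda>u. u \<otimes> a) ` U"

lemma cls_self: "a \<in> carrier R \<Longrightarrow> a \<in> cls a"
  unfolding cls_def using cu_one by (intro image_eqI[of _ _ \<one>]) auto

lemma cls_mult: assumes "u \<in> U" "a \<in> carrier R" shows "cls (u \<otimes> a) = cls a"
proof
  show "cls (u \<otimes> a) \<subseteq> cls a"
    using assms cu_mult cu_carrier by (auto simp: cls_def m_assoc[symmetric])
  show "cls a \<subseteq> cls (u \<otimes> a)"
  proof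
    fix x assume "x \<in> cls a"
    then obtain v where v: "v \<in> U" "x = v \<otimes> a" by (auto simp: cls_def)
    have "x = (v \<otimes> inv u) \<otimes> (u \<otimes> a)"
    proof -
      have "(v \<otimes> inv u) \<otimes> (u \<otimes> a) = v \<otimes> (inv u \<otimes> u) \<otimes> a"
        using v(1) assms cu_inv(1) cu_carrier by (simp add: m_assoc)
      then show ?thesis using v assms cu_inv cu_carrier by simp
    qed
    then show "x \<in> cls (u \<otimes> a)" using cu_mult v assms cu_inv by (auto simp: cls_def)
  qed
qed

lemma cls_eqD: "\<lbrakk>a \<in> carrier R; cls a = cls b\<rbrakk> \<Longrightarrow> \<exists>u\<in>U. a = u \<otimes> b"
  using cls_self by (auto simp: cls_def)

lemma cls_eq_iff: "\<lbrakk>a \<in> carrier R; b \<in> carrier R\<rbrakk> \<Longrightarrow> cls a = cls b \<longleftrightarrow> (\<exists>u\<in>U. a = u \<otimes> b)"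
  using cls_eqD cls_mult by metis

lemma unit_swap:
  assumes "u \<in> U" "a \<in> carrier R" "b \<in> carrier R"
  shows "u \<otimes> (a \<otimes> b) = a \<otimes> (u \<otimes> b)"
  using assms cu_carrier by (metis cu_comm m_assoc)

lemma cu_mult_Units: assumes "u \<in> U" "a \<in> carrier R" "u \<otimes> a \<in> Units R" shows "a \<in> Units R"
proof -
  have "a = inv u \<otimes> (u \<otimes> a)" using assms cu_inv cu_carrier by (simp add: m_assoc[symmetric])
  moreover have "inv u \<in> Units R" using cu_inv[OF assms(1)] by (simp add: central_units_def)
  ultimately show ?thesis using assms Units_m_closed by metis
qed

lemma cu_mult_nc_irreducible:
  assumes u: "u \<in> U" and a: "nc_irreducible R a"
  shows "nc_irreducible R (u \<otimes> a)"
proof -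
  have ac: "a \<in> carrier R" "a \<noteq> \<zero>" "a \<notin> Units R" using a by (auto simp: nc_irreducible_def)
  have u0: "u \<noteq> \<zero>" using u cu_inv one_not_zero cu_carrier by (metis l_null r_null)
  have False if bc: "b \<in> carrier R - Units R" "c \<in> carrier R - Units R" "u \<otimes> a = b \<otimes> c" for b c
  proof -
    have "a = inv u \<otimes> (b \<otimes> c)"
      using u ac cu_inv cu_carrier by (simp add: m_assoc[symmetric] flip: bc(3))
    then have "a = (inv u \<otimes> b) \<otimes> c" using bc u cu_inv cu_carrier by (simp add: m_assoc)
    moreover have "inv u \<otimes> b \<in> carrier R - Units R" using bc u cu_inv cu_carrier cu_mult_Units by blast
    ultimately show False using a bc by (auto simp: nc_irreducible_def)
  qed
  moreover have "u \<otimes> a \<notin> Units R" using ac u cu_mult_Units by blast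
  ultimately show ?thesis using ac u u0 cu_carrier mult_nonzero unfolding nc_irreducible_def by auto
qed

lemma foldr_closed: "set as \<subseteq> carrier R \<Longrightarrow> foldr (\<otimes>) as \<one> \<in> carrier R"
  by (induction as) auto

lemma foldr_append_mult:
  "\<lbrakk>set as \<subseteq> carrier R; set bs \<subseteq> carrier R\<rbrakk> \<Longrightarrow>
    foldr (\<otimes>) (as @ bs) \<one> = foldr (\<otimes>) as \<one> \<otimes> foldr (\<otimes>) bs \<one>"
  by (induction as) (auto simp: foldr_closed m_assoc simp del: foldr_append simp flip: foldr_append)

lemma factorizations_carrier: "as \<in> factorizations R f \<Longrightarrow> set as \<subseteq> carrier R"
  by (auto simp: factorizations_def nc_irreducible_def)

lemma factorizations_append:
  "\<lbrakk>as \<in> factorizations R f; bs \<in> factorizations R g\<rbrakk> \<Longrightarrow> as @ bs \<in> factorizations R (f \<otimes> g)"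
  using foldr_append_mult[of as bs] factorizations_carrier[of as f] factorizations_carrier[of bs g]
  by (auto simp: factorizations_def simp del: foldr_append)

text \<open>The length function for both inductions below; it takes the place of a degree.\<close>

definition nclasses :: "'a \<Rightarrow> nat" where
  "nclasses f = card (cls ` left_factors R f)"

context
  assumes fin: "\<And>f. \<lbrakk>f \<in> carrier R; f \<noteq> \<zero>\<rbrakk> \<Longrightarrow> finite (cls ` left_factors R f)"
begin

text \<open>Left factors of \<open>a\<close> are left factors of \<open>a b\<close>, and the class
  of \<open>a b\<close> is new: if \<open>u a b c = a\<close> with \<open>u\<close> a central unit,
  cancelling \<open>a\<close> gives \<open>b\<close> a right inverse.\<close>

lemma nclasses_left:
  assumes ab: "a \<in> carrier R" "b \<in> carrier R" "a \<noteq> \<zero>" "b \<noteq> \<zero>" and b: "b \<notin> Units R"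
  shows "nclasses a < nclasses (a \<otimes> b)"
  unfolding nclasses_def
proof (rule psubset_card_mono)
  show "finite (cls ` left_factors R (a \<otimes> b))" using fin ab mult_nonzero by blast
  have sub: "left_factors R a \<subseteq> left_factors R (a \<otimes> b)"
    using ab by (auto simp: left_factors_def m_assoc intro!: bexI[of _ "_ \<otimes> b"])
  have "cls (a \<otimes> b) \<notin> cls ` left_factors R a"
  proof
    assume "cls (a \<otimes> b) \<in> cls ` left_factors R a"
    then obtain d c where d: "d \<in> carrier R" "c \<in> carrier R" "d \<otimes> c = a" "cls d = cls (a \<otimes> b)"
      by (auto simp: left_factors_def)
    then obtain u where u: "u \<in> U" "d = u \<otimes> (a \<otimes> b)" using cls_eqD by blast
    have "a \<otimes> (b \<otimes> (u \<otimes> c)) = u \<otimes> (a \<otimes> b) \<otimes> c"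
      using ab d u(1) cu_carrier unit_swap by (simp add: m_assoc)
    also have "\<dots> = a \<otimes> \<one>" using d u ab by simp
    finally have "b \<otimes> (u \<otimes> c) = \<one>"
      using left_cancel[of a "b \<otimes> (u \<otimes> c)" \<one>] ab d u cu_carrier by simp
    then show False using one_sided_units ab d u cu_carrier b by (meson m_closed)
  qed
  moreover have "a \<otimes> b \<in> left_factors R (a \<otimes> b)"
    using ab by (auto simp: left_factors_def intro!: bexI[of _ \<one>])
  ultimately show "cls ` left_factors R a \<subset> cls ` left_factors R (a \<otimes> b)" using sub by blast
qed

text \<open>Left multiplication by \<open>a\<close> embeds the classes of left factors of
  \<open>b\<close> into those of \<open>a b\<close>. The class of 1 is missed, since reaching it
  would give \<open>a\<close> a right inverse.\<close>

lemma nclasses_right: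
  assumes ab: "a \<in> carrier R" "b \<in> carrier R" "a \<noteq> \<zero>" "b \<noteq> \<zero>" and a: "a \<notin> Units R"
  shows "nclasses b < nclasses (a \<otimes> b)"
proof -
  have img: "(\<lambda>x. a \<otimes> x) ` cls c = cls (a \<otimes> c)" if "c \<in> carrier R" for c
    using that ab by (auto simp: cls_def image_image intro!: image_cong unit_swap[symmetric])
  have inj: "inj_on (\<lambda>C. (\<lambda>x. a \<otimes> x) ` C) (cls ` left_factors R b)"
  proof (rule inj_on_subset[OF inj_on_image_Pow[of _ "carrier R"]])
    show "inj_on (\<lambda>x. a \<otimes> x) (carrier R)" 
      by (rule inj_onI) (rule left_cancel[OF ab(1) _ _ ab(3)])
    show "cls ` left_factors R b \<subseteq> Pow (carrier R)"
      using cu_carrier by (auto simp: cls_def left_factors_def)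
  qed
  have "nclasses b = card ((\<lambda>C. (\<lambda>x. a \<otimes> x) ` C) ` cls ` left_factors R b)"
    using card_image[OF inj] by (simp add: nclasses_def)
  also have "\<dots> < nclasses (a \<otimes> b)"
    unfolding nclasses_def
  proof (rule psubset_card_mono)
    show "finite (cls ` left_factors R (a \<otimes> b))" using fin ab mult_nonzero by blast
    have "(\<lambda>C. (\<lambda>x. a \<otimes> x) ` C) ` cls ` left_factors R b \<subseteq> cls ` left_factors R (a \<otimes> b)"
    proof safe
      fix c assume c: "c \<in> left_factors R b"
      then have "a \<otimes> c \<in> left_factors R (a \<otimes> b)"
        using ab by (auto simp: left_factors_def m_assoc)
      then show "(\<lambda>x. a \<otimes> x) ` cls c \<in> cls ` left_factors R (a \<otimes> b)"
        using img c by (auto simp: left_factors_def)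
    qed
    moreover have "cls \<one> \<notin> (\<lambda>C. (\<lambda>x. a \<otimes> x) ` C) ` cls ` left_factors R b"
    proof
      assume "cls \<one> \<in> (\<lambda>C. (\<lambda>x. a \<otimes> x) ` C) ` cls ` left_factors R b"
      then obtain c where c: "c \<in> carrier R" "cls \<one> = cls (a \<otimes> c)"
        using img by (auto simp: left_factors_def)
      then obtain u where u: "u \<in> U" "\<one> = u \<otimes> (a \<otimes> c)" using cls_eqD[of \<one>] by blast
      then have "a \<otimes> (u \<otimes> c) = \<one>" using unit_swap ab c by simp
      then show False using one_sided_units ab c u cu_carrier a by (meson m_closed)
    qed
    moreover have "\<one> \<in> left_factors R (a \<otimes> b)" using ab by (auto simp: left_factors_def)
    ultimately show "(\<lambda>C. (\<lambda>x. a \<otimes> x) ` C) ` cls ` left_factors R b \<subset> cls ` left_factors R (a \<otimes> b)"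
      by blast
  qed
  finally show ?thesis .
qed

lemma factorizations_exist:
  "\<lbrakk>f \<in> carrier R; f \<noteq> \<zero>; f \<notin> Units R\<rbrakk> \<Longrightarrow> factorizations R f \<noteq> {}"
proof (induction "nclasses f" arbitrary: f rule: less_induct)
  case less
  show ?case
  proof (cases "nc_irreducible R f")
    case True
    then have "[f] \<in> factorizations R f" using less by (auto simp: factorizations_def)
    then show ?thesis by blast
  next
    case False
    then obtain b c where bc: "b \<in> carrier R - Units R" "c \<in> carrier R - Units R" "f = b \<otimes> c"
      using less.prems by (auto simp: nc_irreducible_def)
    then have nz: "b \<noteq> \<zero>" "c \<noteq> \<zero>" using less.prems by auto
    then have "factorizations R b \<noteq> {}" "factorizations R c \<noteq> {}"
      using less.hyps[of b] less.hyps[of c] nclasses_left[of b c] nclasses_right[of b c] bc by auto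
    then show ?thesis using factorizations_append bc by blast
  qed
qed

text \<open>The first factor absorbs \<open>inv u\<close> without changing its class. The empty list
  is added because \<open>u f\<close> may be 1, with the empty factorization, while \<open>f\<close>
  is a different unit.\<close>

lemma cls_lists_mult:
  assumes u: "u \<in> U" and f: "f \<in> carrier R"
  shows "map cls ` factorizations R (u \<otimes> f) \<subseteq> map cls ` factorizations R f \<union> {[]}"
proof
  fix L assume "L \<in> map cls ` factorizations R (u \<otimes> f)"
  then obtain as where as: "as \<in> factorizations R (u \<otimes> f)" "L = map cls as" by blast
  show "L \<in> map cls ` factorizations R f \<union> {[]}"
  proof (cases as)
    case (Cons a r)
    have car: "a \<in> carrier R" "foldr (\<otimes>) r \<one> \<in> carrier R"
      using factorizations_carrier[OF as(1)] Cons foldr_closed by auto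
    have eq: "a \<otimes> foldr (\<otimes>) r \<one> = u \<otimes> f" using as Cons by (simp add: factorizations_def)
    have "(inv u \<otimes> a) \<otimes> foldr (\<otimes>) r \<one> = inv u \<otimes> (u \<otimes> f)"
      using car u cu_inv cu_carrier eq by (simp add: m_assoc)
    also have "\<dots> = f" using u f cu_inv cu_carrier by (simp add: m_assoc[symmetric])
    finally have "(inv u \<otimes> a) # r \<in> factorizations R f"
      using as Cons u cu_inv cu_mult_nc_irreducible by (auto simp: factorizations_def)
    moreover have "map cls ((inv u \<otimes> a) # r) = L" using as Cons car u cu_inv cls_mult by simp
    ultimately show ?thesis by blast
  qed (use as in simp)
qed

text \<open>For each class \<open>C\<close> of non-unit left factors fix a representative
  \<open>g C\<close> with cofactor \<open>h C\<close>. If a factorization of \<open>f\<close> begins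
  with \<open>u\<close> times \<open>g C\<close>, the remaining factors multiply to
  \<open>inv u\<close> times \<open>h C\<close>, so their class lists are among the finitely many
  obtained from \<open>h C\<close> by induction.\<close>

lemma finite_cls_lists:
  "\<lbrakk>f \<in> carrier R; f \<noteq> \<zero>\<rbrakk> \<Longrightarrow> finite (map cls ` factorizations R f)"
proof (induction "nclasses f" arbitrary: f rule: less_induct)
  case less
  define CS where "CS = cls ` {a \<in> left_factors R f. a \<notin> Units R}"
  have "\<exists>a b. a \<in> carrier R \<and> a \<notin> Units R \<and> b \<in> carrier R \<and> a \<otimes> b = f \<and> cls a = C" if "C \<in> CS" for C
    using that by (auto simp: CS_def left_factors_def)
  then obtain g h where gh: "\<And>C. C \<in> CS \<Longrightarrow> g C \<in> carrier R \<and> g C \<notin> Units R \<and> h C \<in> carrier R \<and>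
      g C \<otimes> h C = f \<and> cls (g C) = C" by metis
  have "finite CS" using fin[OF less.prems] unfolding CS_def by (rule finite_subset[rotated]) auto
  moreover have "finite (map cls ` factorizations R (h C))" if "C \<in> CS" for C
  proof -
    have "h C \<noteq> \<zero>" "g C \<noteq> \<zero>" using gh[OF that] less.prems by auto
    then show ?thesis using less.hyps[of "h C"] nclasses_right[of "g C" "h C"] gh[OF that] by simp
  qed
  ultimately have "finite ({[]} \<union> (\<Union>C\<in>CS. (\<lambda>L. C # L) ` (map cls ` factorizations R (h C) \<union> {[]})))"
    by auto
  moreover have "map cls ` factorizations R f \<subseteq>
      {[]} \<union> (\<Union>C\<in>CS. (\<lambda>L. C # L) ` (map cls ` factorizations R (h C) \<union> {[]}))"
  proof
    fix L assume "L \<in> map cls ` factorizations R f"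
    then obtain as where as: "as \<in> factorizations R f" "L = map cls as" by blast
    show "L \<in> {[]} \<union> (\<Union>C\<in>CS. (\<lambda>L. C # L) ` (map cls ` factorizations R (h C) \<union> {[]}))"
    proof (cases as)
      case (Cons a r)
      define b where "b = foldr (\<otimes>) r \<one>"
      have car: "a \<in> carrier R" "b \<in> carrier R"
        using factorizations_carrier[OF as(1)] Cons foldr_closed by (auto simp: b_def)
      have ab: "a \<otimes> b = f" and irr: "nc_irreducible R a" and r: "r \<in> factorizations R b"
        using as Cons by (auto simp: factorizations_def b_def)
      have C: "cls a \<in> CS" using ab car irr by (auto simp: CS_def left_factors_def nc_irreducible_def)
      obtain u where u: "u \<in> U" "a = u \<otimes> g (cls a)" using cls_eqD[of a "g (cls a)"] gh[OF C] car by metis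
      have "g (cls a) \<otimes> (u \<otimes> b) = f"
        using u gh[OF C] car ab unit_swap cu_carrier by (metis m_assoc)
      then have "h (cls a) = u \<otimes> b"
        using left_cancel[of "g (cls a)" "u \<otimes> b" "h (cls a)"] gh[OF C] car u cu_carrier less.prems
        by (metis l_null m_closed)
      then have "b = inv u \<otimes> h (cls a)"
        using car u cu_inv cu_carrier by (simp add: m_assoc[symmetric])
      then have "map cls r \<in> map cls ` factorizations R (h (cls a)) \<union> {[]}"
        using cls_lists_mult[of "inv u" "h (cls a)"] r u cu_inv gh[OF C] by blast
      then show ?thesis using C as Cons by auto
    qed (use as in simp)
  qed
  ultimately show ?case by (rule finite_subset[rotated])
qed

text \<open>The equivalence classes are the fibres of the map sending a factorization to its list of
  classes.\<close>

lemma finite_factorizations: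
  assumes f: "f \<in> carrier R" "f \<noteq> \<zero>"
  shows "finite (factorizations R f // same_factorization R f)"
proof -
  have rel: "(as, bs) \<in> same_factorization R f \<longleftrightarrow> map cls as = map cls bs"
    if "as \<in> factorizations R f" "bs \<in> factorizations R f" for as bs
  proof -
    have "(map cls bs = map cls as) = list_all2 (\<lambda>x y. cls y = cls x) as bs"
      by (auto simp: list_all2_conv_all_nth list_eq_iff_nth_eq)
    also have "\<dots> = list_all2 (\<lambda>x y. \<exists>u\<in>U. y = u \<otimes> x) as bs"
      using factorizations_carrier[OF that(1)] factorizations_carrier[OF that(2)] cls_eq_iff
      by (intro list.rel_cong) (auto simp: subset_iff)
    finally show ?thesis using that by (auto simp: same_factorization_def)
  qed
  have "same_factorization R f `` {as} = {bs \<in> factorizations R f. map cls bs = map cls as}"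
    if "as \<in> factorizations R f" for as
  proof -
    have "bs \<in> factorizations R f" if "(as, bs) \<in> same_factorization R f" for bs
      using that by (simp add: same_factorization_def)
    with rel[OF that] have "(as, bs) \<in> same_factorization R f \<longleftrightarrow>
        bs \<in> factorizations R f \<and> map cls bs = map cls as" for bs by metis
    then show ?thesis by blast
  qed
  then have "factorizations R f // same_factorization R f \<subseteq>
     (\<lambda>L. {bs \<in> factorizations R f. map cls bs = L}) ` map cls ` factorizations R f"
    by (auto simp: quotient_def)
  then show ?thesis using finite_cls_lists[OF f] finite_subset by blast
qed

end

lemma FFD_criterion:
  assumes "V \<subseteq> U" and "\<And>f. \<lbrakk>f \<in> carrier R; f \<noteq> \<zero>\<rbrakk> \<Longrightarrow>
     \<exists>D. finite D \<and> D \<subseteq> carrier R \<and> (\<forall>a\<in>left_factors R f. \<exists>u\<in>V. \<exists>d\<in>D. a = u \<otimes> d)"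
  shows "FFD R"
proof -
  have fin: "finite (cls ` left_factors R f)" if f: "f \<in> carrier R" "f \<noteq> \<zero>" for f
  proof -
    obtain D where D: "finite D" "D \<subseteq> carrier R" "\<forall>a\<in>left_factors R f. \<exists>u\<in>V. \<exists>d\<in>D. a = u \<otimes> d"
      using assms(2)[OF f] by blast
    have "cls ` left_factors R f \<subseteq> cls ` D"
    proof
      fix C assume "C \<in> cls ` left_factors R f"
      then obtain a u d where "C = cls a" "u \<in> V" "d \<in> D" "a = u \<otimes> d" using D(3) by blast
      then show "C \<in> cls ` D" using cls_mult assms(1) D(2) by blast
    qed
    then show ?thesis using D(1) finite_subset by blast
  qed
  have "nc_domain R"
    using ring_axioms one_not_zero no_zero_div by (auto simp: nc_domain_def)
  then show ?thesis
    using factorizations_exist[OF fin] finite_factorizations[OF fin] by (auto simp: FFD_def)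
qed

end

text \<open>The coordinates need not come from a basis of the ring: they are additive, jointly
  injective and finitely supported, and products are computed by structure constants. For this
  reason the carrier can be restricted to a subring that keeps the scalars.\<close>

locale coord_ring = ring R for R (structure) +
  fixes I :: "'i::comm_monoid_add set" and scal :: "'k::field \<Rightarrow> 'a"
    and \<phi> :: "'a \<Rightarrow> 'i \<Rightarrow> 'k" and \<gamma> :: "'i \<Rightarrow> 'i \<Rightarrow> 'i \<Rightarrow> 'k"
  assumes one_neq_zero: "\<one> \<noteq> \<zero>"
    and coord_inj: "\<lbrakk>a \<in> carrier R; \<And>p. \<phi> a p = 0\<rbrakk> \<Longrightarrow> a = \<zero>"
    and coord_add: "\<lbrakk>a \<in> carrier R; b \<in> carrier R\<rbrakk> \<Longrightarrow> \<phi> (a \<oplus> b) p = \<phi> a p + \<phi> b p"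
    and coord_finite: "a \<in> carrier R \<Longrightarrow> finite {p. \<phi> a p \<noteq> 0}"
    and coord_supp: "\<lbrakk>a \<in> carrier R; \<phi> a p \<noteq> 0\<rbrakk> \<Longrightarrow> p \<in> I"
    and coord_mult: "\<lbrakk>a \<in> carrier R; b \<in> carrier R\<rbrakk> \<Longrightarrow>
      \<phi> (a \<otimes> b) l = (\<Sum>p | \<phi> a p \<noteq> 0. \<Sum>q | \<phi> b q \<noteq> 0. \<phi> a p * \<phi> b q * \<gamma> p q l)"
    and scal_central_unit: "c \<noteq> 0 \<Longrightarrow> scal c \<in> central_units R"
    and coord_scal: "\<lbrakk>c \<noteq> 0; a \<in> carrier R\<rbrakk> \<Longrightarrow> \<phi> (scal c \<otimes> a) p = c * \<phi> a p"
begin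

lemma coord_zero: "\<phi> \<zero> p = 0"
  using coord_add[of \<zero> \<zero> p] by (metis add_cancel_right_right l_zero zero_closed)

lemma coord_minus: "a \<in> carrier R \<Longrightarrow> \<phi> (\<ominus> a) p = - \<phi> a p"
  using coord_add[of a "\<ominus> a" p] coord_zero by (simp add: r_neg eq_neg_iff_add_eq_0 add.commute)

lemma coord_eqI:
  assumes "a \<in> carrier R" "b \<in> carrier R" "\<And>p. \<phi> a p = \<phi> b p"
  shows "a = b"
proof -
  have "a \<ominus> b = \<zero>"
    using assms by (intro coord_inj) (auto simp: a_minus_def coord_add coord_minus)
  then show ?thesis using assms by simp
qed

lemma coord_mult_superset:
  assumes "a \<in> carrier R" "b \<in> carrier R" "finite P" "{p. \<phi> a p \<noteq> 0} \<subseteq> P" "{p. \<phi> b p \<noteq> 0} \<subseteq> P"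
  shows "\<phi> (a \<otimes> b) l = (\<Sum>p\<in>P. \<Sum>q\<in>P. \<phi> a p * \<phi> b q * \<gamma> p q l)"
proof -
  have "(\<Sum>p\<in>P. \<Sum>q\<in>P. \<phi> a p * \<phi> b q * \<gamma> p q l)
      = (\<Sum>p | \<phi> a p \<noteq> 0. \<Sum>q\<in>P. \<phi> a p * \<phi> b q * \<gamma> p q l)"
    by (rule sum.mono_neutral_right) (use assms in auto)
  also have "\<dots> = (\<Sum>p | \<phi> a p \<noteq> 0. \<Sum>q | \<phi> b q \<noteq> 0. \<phi> a p * \<phi> b q * \<gamma> p q l)"
    by (intro sum.cong refl sum.mono_neutral_right) (use assms in auto)
  finally show ?thesis using assms by (simp add: coord_mult)
qed

definition is_lead :: "('i \<Rightarrow> 'i \<Rightarrow> bool) \<Rightarrow> 'a \<Rightarrow> 'i \<Rightarrow> bool" where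
  "is_lead lt a i \<longleftrightarrow> \<phi> a i \<noteq> 0 \<and> (\<forall>p. \<phi> a p \<noteq> 0 \<longrightarrow> p = i \<or> lt p i)"

lemma is_lead_exists:
  assumes "mono_order I lt" "a \<in> carrier R" "a \<noteq> \<zero>"
  shows "\<exists>i. is_lead lt a i"
proof -
  interpret mono_order I lt by fact
  have "{p. \<phi> a p \<noteq> 0} \<noteq> {}" using coord_inj assms by blast
  then show ?thesis
    using finite_max[of "{p. \<phi> a p \<noteq> 0}"] coord_finite coord_supp assms by (auto simp: is_lead_def)
qed

text \<open>Any pair of occurring indices other than the two leading ones has a strictly smaller
  sum, hence cannot contribute at \<open>i + j\<close>.\<close>

lemma is_lead_mult:
  assumes "triangular_product I lt \<gamma>" and ab: "a \<in> carrier R" "b \<in> carrier R"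
    and i: "is_lead lt a i" and j: "is_lead lt b j"
  shows "is_lead lt (a \<otimes> b) (i + j)" "\<phi> (a \<otimes> b) (i + j) = \<phi> a i * \<phi> b j * \<gamma> i j (i + j)"
proof -
  interpret triangular_product I lt \<gamma> by fact
  have le: "p + q = i + j \<longrightarrow> p = i \<and> q = j" "p = i \<and> q = j \<or> lt (p + q) (i + j)"
    if "\<phi> a p \<noteq> 0" "\<phi> b q \<noteq> 0" for p q
  proof -
    have I': "p \<in> I" "q \<in> I" "i \<in> I" "j \<in> I" using that i j coord_supp ab by (auto simp: is_lead_def)
    show *: "p = i \<and> q = j \<or> lt (p + q) (i + j)"
      using i j that I' add_mono add_mono_left add_mono_both unfolding is_lead_def by metis
    then show "p + q = i + j \<longrightarrow> p = i \<and> q = j" using irrefl add_closed I' by metis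
  qed
  have ijI: "i \<in> I" "j \<in> I" using i j coord_supp ab by (auto simp: is_lead_def)
  have z: "\<gamma> p q (i + j) = 0" if "\<phi> a p \<noteq> 0" "\<phi> b q \<noteq> 0" "(p, q) \<noteq> (i, j)" for p q
  proof (rule ccontr)
    assume "\<gamma> p q (i + j) \<noteq> 0"
    moreover have "p \<in> I" "q \<in> I" using that coord_supp ab by auto
    ultimately show False
      using lower[of p q "i + j"] le[OF that(1,2)] that(3) irrefl trans add_closed ijI by (metis prod.inject)
  qed
  have "\<phi> (a \<otimes> b) (i + j)
      = (\<Sum>(p, q)\<in>{p. \<phi> a p \<noteq> 0} \<times> {q. \<phi> b q \<noteq> 0}. \<phi> a p * \<phi> b q * \<gamma> p q (i + j))"
    using ab by (simp add: coord_mult sum.cartesian_product)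
  also have "\<dots> = (\<Sum>(p, q)\<in>{(i, j)}. \<phi> a p * \<phi> b q * \<gamma> p q (i + j))"
  proof (rule sum.mono_neutral_right)
    show "\<forall>x\<in>{p. \<phi> a p \<noteq> 0} \<times> {q. \<phi> b q \<noteq> 0} - {(i, j)}. (case x of (p, q) \<Rightarrow> \<phi> a p * \<phi> b q * \<gamma> p q (i + j)) = 0"
      using z by fastforce
  qed (use ab coord_finite i j in \<open>auto simp: is_lead_def\<close>)
  finally show eq: "\<phi> (a \<otimes> b) (i + j) = \<phi> a i * \<phi> b j * \<gamma> i j (i + j)" by simp
  have "l = i + j \<or> lt l (i + j)" if "\<phi> (a \<otimes> b) l \<noteq> 0" for l
  proof -
    have "\<exists>p q. \<phi> a p \<noteq> 0 \<and> \<phi> b q \<noteq> 0 \<and> \<gamma> p q l \<noteq> 0"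
    proof (rule ccontr)
      assume "\<not> ?thesis"
      then have "\<phi> a p * \<phi> b q * \<gamma> p q l = 0" for p q by auto
      then have "\<phi> (a \<otimes> b) l = 0" unfolding coord_mult[OF ab] by (simp only: sum.neutral_const)
      with that show False by simp
    qed
    then obtain p q where pq: "\<phi> a p \<noteq> 0" "\<phi> b q \<noteq> 0" "\<gamma> p q l \<noteq> 0" by blast
    then have "p \<in> I" "q \<in> I" using coord_supp ab by auto
    then show ?thesis
      using lower[of p q l] le(2)[OF pq(1,2)] pq(3) trans[of l "p + q" "i + j"] add_closed ijI by metis
  qed
  then show "is_lead lt (a \<otimes> b) (i + j)"
    using eq i j lead_nonzero ijI by (simp add: is_lead_def)
qed

text \<open>The order is allowed to depend on \<open>f\<close>, which polynomial rings in infinitely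
  many indeterminates exploit. In a factorization of \<open>f\<close> the leading indices of the two
  factors add up to that of \<open>f\<close>, so the finiteness condition bounds the supports of
  both factors at once.\<close>

theorem FFD_coord:
  assumes ord: "\<And>f. \<lbrakk>f \<in> carrier R; f \<noteq> \<zero>\<rbrakk> \<Longrightarrow> \<exists>lt. triangular_product I lt \<gamma> \<and>
    (\<forall>l. \<phi> f l \<noteq> 0 \<longrightarrow>
      finite {p \<in> I. \<exists>i\<in>I. \<exists>j\<in>I. i + j = l \<and> (p = i \<or> lt p i \<or> p = j \<or> lt p j)})"
  shows "FFD R"
proof -
  have "a \<otimes> b \<noteq> \<zero>" if ab: "a \<in> carrier R" "b \<in> carrier R" "a \<noteq> \<zero>" "b \<noteq> \<zero>" for a b
  proof -
    obtain lt where lt: "triangular_product I lt \<gamma>" using ord[of \<one>] one_neq_zero by auto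
    then have mo: "mono_order I lt" by (simp add: triangular_product_def)
    obtain i j where "is_lead lt a i" "is_lead lt b j" using is_lead_exists[OF mo] ab by metis
    then have "is_lead lt (a \<otimes> b) (i + j)" using is_lead_mult lt ab by blast
    then show ?thesis using coord_zero by (auto simp: is_lead_def)
  qed
  then interpret nc_dom R by unfold_locales (use one_neq_zero in auto)
  show ?thesis
  proof (rule FFD_criterion[OF subset_refl])
    fix f assume f: "f \<in> carrier R" "f \<noteq> \<zero>"
    obtain lt where lt: "triangular_product I lt \<gamma>"
      and fin: "\<forall>l. \<phi> f l \<noteq> 0 \<longrightarrow>
        finite {p \<in> I. \<exists>i\<in>I. \<exists>j\<in>I. i + j = l \<and> (p = i \<or> lt p i \<or> p = j \<or> lt p j)}"
      using ord f by blast
    interpret triangular_product I lt \<gamma> by fact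
    have mo: "mono_order I lt" by unfold_locales
    obtain l where l: "is_lead lt f l" using is_lead_exists mo f by blast
    \<comment> \<open>Contains the supports of both factors in every factorization of
      \<open>f\<close>.\<close>
    define B where "B = {p \<in> I. \<exists>i\<in>I. \<exists>j\<in>I. i + j = l \<and> (p = i \<or> lt p i \<or> p = j \<or> lt p j)}"
    have finB: "finite B" "B \<subseteq> I" using fin l by (auto simp: B_def is_lead_def)
    define M where "M i j = {\<alpha>. (\<forall>p. \<alpha> p \<noteq> 0 \<longrightarrow> p \<in> B) \<and> \<alpha> i = 1 \<and>
      (\<exists>\<beta>. \<beta> j = \<phi> f l / \<gamma> i j l \<and> (\<forall>m. \<phi> f m = (\<Sum>p\<in>B. \<Sum>q\<in>B. \<alpha> p * \<beta> q * \<gamma> p q m)))}" for i j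
    define S where "S = {(i, j) \<in> B \<times> B. i + j = l}"
    have "finite (M i j)" if "(i, j) \<in> S" for i j
      unfolding M_def
    proof (rule finite_monic_left_factors[OF finB])
      show "\<phi> f l / \<gamma> i j l \<noteq> 0"
        using that l lead_nonzero finB by (auto simp: S_def is_lead_def)
    qed (use that in \<open>auto simp: S_def\<close>)
    moreover have "finite S" by (rule finite_subset[of _ "B \<times> B"]) (use finB in \<open>auto simp: S_def\<close>)
    ultimately have finM: "finite (\<Union>(i, j)\<in>S. M i j)" by auto
    \<comment> \<open>Coordinates determine the element, so \<open>D\<close> is finite. Coordinate
      families in \<open>M i j\<close> that no ring element realises are discarded here; this is the
      point where the argument also covers subrings.\<close>
    define D where "D = {a \<in> carrier R. \<phi> a \<in> (\<Union>(i, j)\<in>S. M i j)}"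
    have "inj_on \<phi> D" by (rule inj_onI, rule coord_eqI) (auto simp: D_def)
    moreover have "\<phi> ` D \<subseteq> (\<Union>(i, j)\<in>S. M i j)" by (auto simp: D_def)
    ultimately have "finite D" using finM by (meson finite_imageD finite_subset)
    moreover have "\<exists>u\<in>U. \<exists>d\<in>D. a = u \<otimes> d" if "a \<in> left_factors R f" for a
    proof -
      from that obtain b where ab: "a \<in> carrier R" "b \<in> carrier R" "a \<otimes> b = f"
        by (auto simp: left_factors_def)
      then have "a \<noteq> \<zero>" "b \<noteq> \<zero>" using f by auto
      then obtain i j where ij: "is_lead lt a i" "is_lead lt b j" using is_lead_exists[OF mo] ab by metis
      then have "is_lead lt f (i + j)" using is_lead_mult(1)[OF lt ab(1,2)] ab by simp
      moreover have ijI: "i \<in> I" "j \<in> I" using ij coord_supp ab by (auto simp: is_lead_def)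
      ultimately have lij: "l = i + j"
        using l irrefl trans[of l "i + j" l] add_closed by (metis coord_supp f(1) is_lead_def)
      define c where "c = \<phi> a i"
      have c: "c \<noteq> 0" using ij by (simp add: c_def is_lead_def)
      \<comment> \<open>Makes \<open>a\<close> monic; \<open>b\<close> is scaled inversely, so the
        product remains \<open>f\<close>.\<close>
      define u where "u = scal (1 / c)"
      have u: "u \<in> U" using c scal_central_unit by (simp add: u_def)
      note uc = cu_carrier[OF u] cu_inv[OF u] cu_carrier[OF cu_inv(1)[OF u]]
      define a' where "a' = u \<otimes> a"
      define b' where "b' = inv u \<otimes> b"
      have car: "a' \<in> carrier R" "b' \<in> carrier R" using uc ab by (auto simp: a'_def b'_def)
      have aa: "a = inv u \<otimes> a'" using uc ab by (simp add: a'_def m_assoc[symmetric])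
      have f': "a' \<otimes> b' = f"
      proof -
        have "a' \<otimes> b' = u \<otimes> (inv u \<otimes> (a \<otimes> b))"
          using unit_swap[OF uc(2) ab(1,2)] uc ab by (simp add: a'_def b'_def m_assoc)
        also have "\<dots> = f" using uc ab f by (simp add: m_assoc[symmetric])
        finally show ?thesis .
      qed
      have pa: "\<phi> a' p = \<phi> a p / c" for p
        using coord_scal[of "1 / c" a p] c ab by (simp add: a'_def u_def)
      have pb: "\<phi> b' p = c * \<phi> b p" for p
      proof -
        have "b = u \<otimes> b'" using uc ab by (simp add: b'_def m_assoc[symmetric])
        then have "\<phi> b p = \<phi> b' p / c"
          using coord_scal[of "1 / c" b' p] c car by (simp add: u_def)
        then show ?thesis using c by simp
      qed
      have sB: "{p. \<phi> a p \<noteq> 0} \<subseteq> B" "{p. \<phi> b p \<noteq> 0} \<subseteq> B"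
        using ij ijI coord_supp ab lij unfolding B_def is_lead_def by blast+
      have "\<phi> f l = \<phi> a i * \<phi> b j * \<gamma> i j l"
        using is_lead_mult(2)[OF lt ab(1,2) ij] lij ab by simp
      then have "\<phi> b' j = \<phi> f l / \<gamma> i j l" using lead_nonzero[OF ijI] by (simp add: pb c_def lij)
      moreover have "\<phi> a' i = 1" using c by (simp add: pa c_def)
      moreover have "\<phi> f m = (\<Sum>p\<in>B. \<Sum>q\<in>B. \<phi> a' p * \<phi> b' q * \<gamma> p q m)" for m
        using coord_mult_superset[OF car finB(1)] sB c f' by (simp add: pa pb)
      moreover have "\<forall>p. \<phi> a' p \<noteq> 0 \<longrightarrow> p \<in> B" using sB pa c by auto
      ultimately have "\<phi> a' \<in> M i j" unfolding M_def by blast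
      moreover have "(i, j) \<in> S" using sB ij lij by (auto simp: S_def is_lead_def)
      ultimately have "a' \<in> D" using car by (auto simp: D_def)
      with aa uc(2) show ?thesis by blast
    qed
    ultimately show "\<exists>D. finite D \<and> D \<subseteq> carrier R \<and> (\<forall>a\<in>left_factors R f. \<exists>u\<in>U. \<exists>d\<in>D. a = u \<otimes> d)"
      by (intro exI[of _ D]) (auto simp: D_def)
  qed
qed

text \<open>A scalar has to be a unit of the subring and not only of \<open>R\<close>, hence the
  condition that its inverse is again a scalar in \<open>S\<close>.\<close>

lemma coord_ring_subring:
  assumes S: "subring S R" and sc: "\<And>c. c \<noteq> 0 \<Longrightarrow> scal c \<in> S"
    and inv: "\<And>c. c \<noteq> 0 \<Longrightarrow> scal c \<otimes> scal (inverse c) = \<one>"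
  shows "coord_ring (R\<lparr>carrier := S\<rparr>) I scal \<phi> \<gamma>"
proof -
  have sub: "a \<in> carrier R" if "a \<in> S" for a using S that by (meson subringE(1) subsetD)
  have cu: "scal c \<in> central_units (R\<lparr>carrier := S\<rparr>)" if c: "c \<noteq> 0" for c
  proof -
    have "scal c \<otimes> a = a \<otimes> scal c" if "a \<in> S" for a
      using scal_central_unit[OF c] sub that by (auto simp: central_units_def)
    moreover have "scal (inverse c) \<otimes> scal c = \<one>" using inv[of "inverse c"] c by simp
    ultimately show ?thesis
      using sc[OF c] sc[of "inverse c"] c inv[OF c] by (auto simp: central_units_def Units_def)
  qed
  show ?thesis
  proof (intro coord_ring.intro coord_ring_axioms.intro)
    show "ring (R\<lparr>carrier := S\<rparr>)" using S subring_is_ring by blast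
  qed (use sub cu in \<open>auto intro: coord_inj coord_supp coord_finite simp: coord_add coord_mult coord_scal one_neq_zero\<close>)
qed

end

section \<open>Constructions of monomial orders\<close>

lemma mono_order_key:
  fixes \<kappa> :: "'i::comm_monoid_add \<Rightarrow> nat"
  assumes "mono_order I lt" and add: "\<And>p q. \<lbrakk>p \<in> I; q \<in> I\<rbrakk> \<Longrightarrow> \<kappa> (p + q) = \<kappa> p + \<kappa> q"
  shows "mono_order I (\<lambda>p q. \<kappa> p < \<kappa> q \<or> \<kappa> p = \<kappa> q \<and> lt p q)"
proof -
  interpret mono_order I lt by fact
  show ?thesis
  proof
    fix p q r assume I: "p \<in> I" "q \<in> I" "r \<in> I"
    show "\<lbrakk>\<kappa> p < \<kappa> q \<or> \<kappa> p = \<kappa> q \<and> lt p q; \<kappa> q < \<kappa> r \<or> \<kappa> q = \<kappa> r \<and> lt q r\<rbrakk> \<Longrightarrow>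
      \<kappa> p < \<kappa> r \<or> \<kappa> p = \<kappa> r \<and> lt p r" using trans[OF I] by auto
  next
    fix p q r assume I: "p \<in> I" "q \<in> I" "r \<in> I" and lt: "\<kappa> p < \<kappa> q \<or> \<kappa> p = \<kappa> q \<and> lt p q"
    then show "\<kappa> (p + r) < \<kappa> (q + r) \<or> \<kappa> (p + r) = \<kappa> (q + r) \<and> lt (p + r) (q + r)"
      using add_mono[OF I] by (auto simp: add)
  next
    fix p q assume I: "p \<in> I" "q \<in> I" "p \<noteq> q"
    then show "(\<kappa> p < \<kappa> q \<or> \<kappa> p = \<kappa> q \<and> lt p q) \<or> \<kappa> q < \<kappa> p \<or> \<kappa> q = \<kappa> p \<and> lt q p"
      using total[OF I] by auto
  qed (auto simp: add_closed irrefl)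
qed

lemma mono_order_prod:
  assumes "mono_order I lt1" "mono_order J lt2"
  shows "mono_order (I \<times> J) (\<lambda>p q. lt1 (fst p) (fst q) \<or> fst p = fst q \<and> lt2 (snd p) (snd q))"
proof -
  interpret A: mono_order I lt1 by fact
  interpret B: mono_order J lt2 by fact
  show ?thesis
  proof
    fix p q r assume I: "p \<in> I \<times> J" "q \<in> I \<times> J" "r \<in> I \<times> J"
    then show "\<lbrakk>lt1 (fst p) (fst q) \<or> fst p = fst q \<and> lt2 (snd p) (snd q);
        lt1 (fst q) (fst r) \<or> fst q = fst r \<and> lt2 (snd q) (snd r)\<rbrakk> \<Longrightarrow>
      lt1 (fst p) (fst r) \<or> fst p = fst r \<and> lt2 (snd p) (snd r)"
      using A.trans[of "fst p" "fst q" "fst r"] B.trans[of "snd p" "snd q" "snd r"] by (auto simp: mem_Times_iff)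
    show "lt1 (fst p) (fst q) \<or> fst p = fst q \<and> lt2 (snd p) (snd q) \<Longrightarrow>
      lt1 (fst (p + r)) (fst (q + r)) \<or> fst (p + r) = fst (q + r) \<and> lt2 (snd (p + r)) (snd (q + r))"
      using I A.add_mono[of "fst p" "fst q" "fst r"] B.add_mono[of "snd p" "snd q" "snd r"]
      by (auto simp: mem_Times_iff)
  next
    fix p q assume "p \<in> I \<times> J" "q \<in> I \<times> J" "p \<noteq> q"
    then show "(lt1 (fst p) (fst q) \<or> fst p = fst q \<and> lt2 (snd p) (snd q)) \<or>
        lt1 (fst q) (fst p) \<or> fst q = fst p \<and> lt2 (snd q) (snd p)"
      using A.total[of "fst p" "fst q"] B.total[of "snd p" "snd q"]
      by (cases "fst p = fst q") (auto simp: mem_Times_iff prod_eq_iff)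
  qed (auto simp: A.add_closed B.add_closed A.irrefl B.irrefl)
qed

lemma mono_order_subset:
  assumes "mono_order I lt" "J \<subseteq> I" "\<And>p q. \<lbrakk>p \<in> J; q \<in> J\<rbrakk> \<Longrightarrow> p + q \<in> J"
  shows "mono_order J lt"
proof -
  interpret mono_order I lt by fact
  have J: "p \<in> I" if "p \<in> J" for p using that assms(2) by blast
  show ?thesis
  proof
    fix p q r assume "p \<in> J" "q \<in> J" "r \<in> J"
    then have I: "p \<in> I" "q \<in> I" "r \<in> I" using J by auto
    show "\<lbrakk>lt p q; lt q r\<rbrakk> \<Longrightarrow> lt p r" using trans[OF I] .
    show "lt p q \<Longrightarrow> lt (p + r) (q + r)" using add_mono[OF I] .
  next
    fix p q assume "p \<in> J" "q \<in> J" "p \<noteq> q"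
    then show "lt p q \<or> lt q p" using total J by blast
  qed (use J assms(3) irrefl in auto)
qed

text \<open>The multiset extension of an arbitrary well-order of the indeterminates, of which there
  may be infinitely many.\<close>

lemma mono_order_multiset: "\<exists>lt. mono_order (UNIV :: 'v multiset set) lt"
proof -
  obtain r :: "('v \<times> 'v) set" where r: "well_order_on UNIV r" using well_order_on by blast
  define s where "s = r - Id"
  have s: "trans s" "irrefl s" "total s"
    using r unfolding s_def
    by (auto simp: well_order_on_def linear_order_on_def partial_order_on_def preorder_on_def
        total_on_def irrefl_def intro: trans_diff_Id)
  have "mono_order UNIV (\<lambda>a b. (a, b) \<in> mult s)"
  proof
    fix p q :: "'v multiset"
    show "(p, p) \<notin> mult s" using irrefl_mult[OF s(1,2)] by (simp add: irrefl_def)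
    show "p \<noteq> q \<Longrightarrow> (p, q) \<in> mult s \<or> (q, p) \<in> mult s"
      using total_mult[OF s(3,1)] by (auto simp: total_on_def)
  next
    fix p q t :: "'v multiset"
    show "\<lbrakk>(p, q) \<in> mult s; (q, t) \<in> mult s\<rbrakk> \<Longrightarrow> (p, t) \<in> mult s"
      using trans_mult[OF s(1)] by (meson transD)
    show "(p, q) \<in> mult s \<Longrightarrow> (p + t, q + t) \<in> mult s"
      using mult_cancel[of s t p q] s by (auto simp: irrefl_on_def irrefl_def)
  qed auto
  then show ?thesis by blast
qed

lemma finite_bounded_monomials:
  assumes "finite V"
  shows "finite {m \<in> monomials V. size m \<le> n}"
proof -
  have "{m \<in> monomials V. size m \<le> n} \<subseteq> mset ` {xs. set xs \<subseteq> V \<and> length xs \<le> n}"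
  proof
    fix m assume m: "m \<in> {m \<in> monomials V. size m \<le> n}"
    obtain xs where "m = mset xs" using ex_mset by metis
    with m show "m \<in> mset ` {xs. set xs \<subseteq> V \<and> length xs \<le> n}" by (auto simp: monomials_def)
  qed
  then show ?thesis using finite_lists_length_le[OF assms] finite_subset by blast
qed

text \<open>
  Products of basis elements are leading term plus terms of smaller weight. Weights need finite
  fibres, but the tie-breaking order between monomials of equal weight is arbitrary.
\<close>

locale weighted_coord_ring = coord_ring R I scal \<phi> \<gamma>
  for R (structure) and I :: "'i::comm_monoid_add set" and scal :: "'k::field \<Rightarrow> 'a"
    and \<phi> :: "'a \<Rightarrow> 'i \<Rightarrow> 'k" and \<gamma> +
  fixes W :: "'i \<Rightarrow> nat"
  assumes index_order: "\<exists>lt. mono_order I lt"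
    and weight_add: "\<lbrakk>p \<in> I; q \<in> I\<rbrakk> \<Longrightarrow> W (p + q) = W p + W q"
    and weight_finite: "finite {p \<in> I. W p \<le> n}"
    and lead_nonzero: "\<lbrakk>p \<in> I; q \<in> I\<rbrakk> \<Longrightarrow> \<gamma> p q (p + q) \<noteq> 0"
    and lower_weight: "\<lbrakk>p \<in> I; q \<in> I; \<gamma> p q l \<noteq> 0\<rbrakk> \<Longrightarrow> l \<in> I \<and> (l = p + q \<or> W l < W (p + q))"
begin

lemma FFD_weighted: "FFD R"
proof (rule FFD_coord)
  fix f
  obtain lt0 where lt0: "mono_order I lt0" using index_order by blast
  define lt where "lt = (\<lambda>p q. W p < W q \<or> W p = W q \<and> lt0 p q)"
  have mo: "mono_order I lt" unfolding lt_def using mono_order_key[of I lt0 W] lt0 weight_add by simp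
  have "triangular_product I lt \<gamma>"
  proof (intro triangular_product.intro mo triangular_product_axioms.intro)
    fix p q l assume "p \<in> I" "q \<in> I" "\<gamma> p q l \<noteq> 0"
    then show "l \<in> I \<and> (l = p + q \<or> lt l (p + q))" using lower_weight[of p q l] by (auto simp: lt_def)
  qed (rule lead_nonzero)
  moreover have "finite {p \<in> I. \<exists>i\<in>I. \<exists>j\<in>I. i + j = l \<and> (p = i \<or> lt p i \<or> p = j \<or> lt p j)}" for l
    by (rule finite_subset[OF _ weight_finite[of "W l"]]) (auto simp: lt_def weight_add)
  ultimately show "\<exists>lt. triangular_product I lt \<gamma> \<and> (\<forall>l. \<phi> f l \<noteq> 0 \<longrightarrow>
      finite {p \<in> I. \<exists>i\<in>I. \<exists>j\<in>I. i + j = l \<and> (p = i \<or> lt p i \<or> p = j \<or> lt p j)})" by blast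
qed

lemma weighted_subring:
  assumes "subring S R" "\<And>c. c \<noteq> 0 \<Longrightarrow> scal c \<in> S" "\<And>c. c \<noteq> 0 \<Longrightarrow> scal c \<otimes> scal (inverse c) = \<one>"
  shows "weighted_coord_ring (R\<lparr>carrier := S\<rparr>) I scal \<phi> \<gamma> W"
  by (intro weighted_coord_ring.intro weighted_coord_ring_axioms.intro coord_ring_subring assms
      index_order weight_add weight_finite lead_nonzero lower_weight)

end

section \<open>Algebras with a basis of standard monomials\<close>

text \<open>Constrains only the additive group and the scalar multiplication, so it applies to the
  record of a Lie algebra, whose product fields are meaningless.\<close>

locale k_space = abelian_group A for A :: "('k::field, 'a, 'm) module_scheme" (structure) +
  assumes smult_closed [simp, intro]: "x \<in> carrier A \<Longrightarrow> c \<odot> x \<in> carrier A"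
    and smult_r_distr: "\<lbrakk>x \<in> carrier A; y \<in> carrier A\<rbrakk> \<Longrightarrow> c \<odot> (x \<oplus> y) = c \<odot> x \<oplus> c \<odot> y"
    and smult_l_distr: "x \<in> carrier A \<Longrightarrow> (c + d) \<odot> x = c \<odot> x \<oplus> d \<odot> x"
    and smult_assoc: "x \<in> carrier A \<Longrightarrow> (c * d) \<odot> x = c \<odot> (d \<odot> x)"
    and smult_one [simp]: "x \<in> carrier A \<Longrightarrow> 1 \<odot> x = x"
begin

lemma smult_zero [simp]: "x \<in> carrier A \<Longrightarrow> 0 \<odot> x = \<zero>"
  using smult_l_distr[of x 0 0] by (metis add.r_cancel_one' add_0 smult_closed)

lemma smult_r_zero [simp]: "c \<odot> \<zero> = \<zero>"
  using smult_r_distr[of \<zero> \<zero> c] by (metis add.r_cancel_one' l_zero smult_closed zero_closed)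

lemma smult_minus_one: "x \<in> carrier A \<Longrightarrow> (- 1) \<odot> x = \<ominus> x"
  using smult_l_distr[of x "- 1" 1] by (simp add: minus_equality)

inductive_set lspan :: "'a set \<Rightarrow> 'a set" for S :: "'a set" where
  lspan_zero: "\<zero> \<in> lspan S"
| lspan_base: "x \<in> S \<Longrightarrow> x \<in> lspan S"
| lspan_add: "\<lbrakk>x \<in> lspan S; y \<in> lspan S\<rbrakk> \<Longrightarrow> x \<oplus> y \<in> lspan S"
| lspan_smult: "x \<in> lspan S \<Longrightarrow> c \<odot> x \<in> lspan S"

lemma lspan_carrier: "\<lbrakk>x \<in> lspan S; S \<subseteq> carrier A\<rbrakk> \<Longrightarrow> x \<in> carrier A"
  by (induction rule: lspan.induct) auto

lemma lspan_minimal: "\<lbrakk>x \<in> lspan S; \<And>s. s \<in> S \<Longrightarrow> s \<in> lspan T\<rbrakk> \<Longrightarrow> x \<in> lspan T"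
  by (induction rule: lspan.induct) (auto intro: lspan.intros)

lemma lspan_mono: "S \<subseteq> T \<Longrightarrow> x \<in> lspan S \<Longrightarrow> x \<in> lspan T"
  by (erule lspan_minimal) (auto intro: lspan_base)

lemma lspan_finsum: "\<lbrakk>finite F; \<And>i. i \<in> F \<Longrightarrow> f i \<in> lspan S; S \<subseteq> carrier A\<rbrakk> \<Longrightarrow> (\<Oplus>i\<in>F. f i) \<in> lspan S"
proof (induction F rule: finite_induct)
  case (insert i F)
  then have "f j \<in> carrier A" if "j \<in> insert i F" for j using that lspan_carrier by blast
  then show ?case using insert by (subst finsum_insert) (auto intro: lspan_add)
qed (simp add: lspan_zero)

lemma smult_finsum:
  assumes "finite F" "f \<in> F \<rightarrow> carrier A" shows "c \<odot> (\<Oplus>i\<in>F. f i) = (\<Oplus>i\<in>F. c \<odot> f i)"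
  using assms
proof (induction F rule: finite_induct)
  case (insert i F)
  then have "f i \<in> carrier A" "f \<in> F \<rightarrow> carrier A" "(\<lambda>i. c \<odot> f i) \<in> F \<rightarrow> carrier A" by auto
  then show ?case using insert by (simp add: finsum_insert smult_r_distr)
qed simp

text \<open>On the space \<open>H\<close> of finitely supported coefficient functions, summation
  \<open>C\<close> is linear; independence of the basis makes it injective and spanning makes it
  surjective. The coordinates are its inverse, put to use as total functions with value 0 outside
  the index set.\<close>

lemma basis_coordinates:
  assumes basis: "k_basis A B b"
  shows "\<exists>\<phi>. (\<forall>x\<in>carrier A. \<forall>y\<in>carrier A. \<forall>i. \<phi> (x \<oplus> y) i = \<phi> x i + \<phi> y i) \<and>
    (\<forall>x\<in>carrier A. \<forall>c i. \<phi> (c \<odot> x) i = c * \<phi> x i) \<and>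
    (\<forall>i\<in>B. \<forall>j. \<phi> (b i) j = (if j = i then 1 else 0)) \<and> (\<forall>x\<in>carrier A. \<forall>i. i \<notin> B \<longrightarrow> \<phi> x i = 0)"
proof -
  have bc: "b i \<in> carrier A" if "i \<in> B" for i using basis that by (auto simp: k_basis_def)
  define comb where "comb F h = (\<Oplus>i\<in>F. h i \<odot> b i)" for F and h :: "'b \<Rightarrow> 'k"
  define H where "H = {h :: 'b \<Rightarrow> 'k. finite {i. h i \<noteq> 0} \<and> {i. h i \<noteq> 0} \<subseteq> B}"
  define C where "C h = comb {i. h i \<noteq> 0} h" for h :: "'b \<Rightarrow> 'k"
  have sup: "C h = comb F h" if "{i. h i \<noteq> 0} \<subseteq> F" "F \<subseteq> B" "finite F" for h F
    unfolding C_def comb_def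
  proof (rule add.finprod_mono_neutral_cong_left)
    fix i assume "i \<in> F - {i. h i \<noteq> 0}"
    then show "h i \<odot> b i = \<zero>" using bc that by auto
  qed (use that bc in auto)
  have comb_closed: "comb F h \<in> carrier A" if "F \<subseteq> B" for F h
    unfolding comb_def using bc that by (intro finsum_closed) auto
  have addH: "(\<lambda>i. h i + g i) \<in> H" "C (\<lambda>i. h i + g i) = C h \<oplus> C g" if "h \<in> H" "g \<in> H" for h g
  proof -
    let ?F = "{i. h i \<noteq> 0} \<union> {i. g i \<noteq> 0}"
    have F: "finite ?F" "?F \<subseteq> B" "{i. h i + g i \<noteq> 0} \<subseteq> ?F" using that by (auto simp: H_def)
    then show "(\<lambda>i. h i + g i) \<in> H" by (auto simp: H_def intro: finite_subset)
    have "C (\<lambda>i. h i + g i) = comb ?F (\<lambda>i. h i + g i)" using F by (intro sup) auto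
    also have "\<dots> = (\<Oplus>i\<in>?F. h i \<odot> b i \<oplus> g i \<odot> b i)"
      unfolding comb_def using F bc by (intro finsum_cong') (auto simp: smult_l_distr subset_iff)
    also have "\<dots> = comb ?F h \<oplus> comb ?F g"
      unfolding comb_def using F bc by (intro finsum_addf) auto
    also have "\<dots> = C h \<oplus> C g" using F sup[of h ?F] sup[of g ?F] by simp
    finally show "C (\<lambda>i. h i + g i) = C h \<oplus> C g" .
  qed
  have smultH: "(\<lambda>i. c * h i) \<in> H" "C (\<lambda>i. c * h i) = c \<odot> C h" if "h \<in> H" for h c
  proof -
    let ?F = "{i. h i \<noteq> 0}"
    have F: "finite ?F" "?F \<subseteq> B" "{i. c * h i \<noteq> 0} \<subseteq> ?F" using that by (auto simp: H_def)
    then show "(\<lambda>i. c * h i) \<in> H" by (auto simp: H_def intro: finite_subset)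
    have "C (\<lambda>i. c * h i) = comb ?F (\<lambda>i. c * h i)" using F by (intro sup) auto
    also have "\<dots> = (\<Oplus>i\<in>?F. c \<odot> (h i \<odot> b i))"
      unfolding comb_def using F bc by (intro finsum_cong') (auto simp: smult_assoc subset_iff)
    also have "\<dots> = c \<odot> comb ?F h"
      unfolding comb_def using F bc by (intro smult_finsum[symmetric]) auto
    finally show "C (\<lambda>i. c * h i) = c \<odot> C h" by (simp add: C_def)
  qed
  have indep: "\<forall>F c. finite F \<and> F \<subseteq> B \<and> (\<Oplus>i\<in>F. c i \<odot> b i) = \<zero> \<longrightarrow> (\<forall>i\<in>F. c i = 0)"
    using basis unfolding k_basis_def by (elim conjE)
  have spans: "\<forall>x\<in>carrier A. \<exists>F c. finite F \<and> F \<subseteq> B \<and> x = (\<Oplus>i\<in>F. c i \<odot> b i)"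
    using basis unfolding k_basis_def by (elim conjE)
  have inj: "h = g" if hg: "h \<in> H" "g \<in> H" "C h = C g" for h g
  proof -
    let ?k = "\<lambda>i. h i + (- 1) * g i"
    have cc: "C g \<in> carrier A" using hg(2) comb_closed by (auto simp: C_def H_def)
    have k: "?k \<in> H" "C ?k = C h \<oplus> (- 1) \<odot> C g" 
      using addH(1)[OF hg(1) smultH(1)[OF hg(2)], of "- 1"] addH(2)[OF hg(1) smultH(1)[OF hg(2)], of "- 1"]
      by (simp_all only: smultH(2)[OF hg(2)])
    then have "C ?k = \<zero>" using hg cc by (simp add: smult_minus_one r_neg)
    then have "comb {i. ?k i \<noteq> 0} ?k = \<zero>" by (simp only: C_def)
    moreover have "finite {i. ?k i \<noteq> 0}" "{i. ?k i \<noteq> 0} \<subseteq> B" using k by (simp_all only: H_def mem_Collect_eq)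
    ultimately have "finite {i. ?k i \<noteq> 0} \<and> {i. ?k i \<noteq> 0} \<subseteq> B \<and> (\<Oplus>i\<in>{i. ?k i \<noteq> 0}. ?k i \<odot> b i) = \<zero>"
      unfolding comb_def by (intro conjI)
    from indep[THEN spec, THEN spec, THEN mp, OF this]
    have "h i + (- 1) * g i = 0" for i by (cases "h i + (- 1) * g i = 0") (simp only:, drule bspec, simp, simp)
    then show ?thesis by (simp add: fun_eq_iff)
  qed
  have surj: "\<exists>h\<in>H. C h = x" if x: "x \<in> carrier A" for x
  proof -
    obtain F c where F: "finite F" "F \<subseteq> B" "x = (\<Oplus>i\<in>F. c i \<odot> b i)"
      using spans x by blast
    define h where "h i = (if i \<in> F then c i else 0)" for i
    have "C h = comb F h" using F by (intro sup) (auto simp: h_def)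
    also have "\<dots> = x" unfolding comb_def F(3) using F bc by (intro finsum_cong') (auto simp: h_def)
    finally have "C h = x" .
    moreover have "{i. h i \<noteq> 0} \<subseteq> F" by (auto simp: h_def)
    then have "h \<in> H" using F by (auto simp: H_def intro: finite_subset)
    ultimately show ?thesis by blast
  qed
  define \<phi> where "\<phi> x = (SOME h. h \<in> H \<and> C h = x)" for x
  have phi: "\<phi> x \<in> H \<and> C (\<phi> x) = x" if "x \<in> carrier A" for x
  proof -
    have "\<exists>h. h \<in> H \<and> C h = x" using surj[OF that] by blast
    from someI_ex[OF this] show ?thesis unfolding \<phi>_def .
  qed
  have phi_eq: "\<phi> x = h" if "x \<in> carrier A" "h \<in> H" "C h = x" for x h
    using inj[of "\<phi> x" h] phi[OF that(1)] that by simp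
  have "\<phi> (x \<oplus> y) = (\<lambda>i. \<phi> x i + \<phi> y i)" if "x \<in> carrier A" "y \<in> carrier A" for x y
    using phi_eq[of "x \<oplus> y" "\<lambda>i. \<phi> x i + \<phi> y i"] addH[of "\<phi> x" "\<phi> y"] phi that by simp
  moreover have "\<phi> (c \<odot> x) = (\<lambda>i. c * \<phi> x i)" if "x \<in> carrier A" for x c
    using phi_eq[of "c \<odot> x" "\<lambda>i. c * \<phi> x i"] smultH[of "\<phi> x" c] phi that by simp
  moreover have "\<phi> (b i) = (\<lambda>j. if j = i then 1 else 0)" if "i \<in> B" for i
  proof (rule phi_eq[OF bc[OF that]])
    show "(\<lambda>j. if j = i then 1 else 0) \<in> H" using that by (auto simp: H_def)
    have "C (\<lambda>j. if j = i then 1 else 0) = comb {i} (\<lambda>j. if j = i then 1 else 0)"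
      using that by (intro sup) auto
    then show "C (\<lambda>j. if j = i then 1 else 0) = b i" using bc[OF that] by (simp add: comb_def)
  qed
  moreover have "\<phi> x i = 0" if "x \<in> carrier A" "i \<notin> B" for x i
    using phi[OF that(1)] that(2) by (auto simp: H_def)
  ultimately show ?thesis by (intro exI[of _ \<phi>]) simp
qed

end

locale k_algebra = ring A + k_space A for A :: "('k::field, 'a, 'm) module_scheme" (structure) +
  assumes smult_mult_left: "\<lbrakk>x \<in> carrier A; y \<in> carrier A\<rbrakk> \<Longrightarrow> (c \<odot> x) \<otimes> y = c \<odot> (x \<otimes> y)"
    and smult_mult_right: "\<lbrakk>x \<in> carrier A; y \<in> carrier A\<rbrakk> \<Longrightarrow> x \<otimes> (c \<odot> y) = c \<odot> (x \<otimes> y)"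
begin

lemma lspan_mult_left:
  assumes "y \<in> lspan S" "S \<subseteq> carrier A" "x \<in> carrier A" "\<And>s. s \<in> S \<Longrightarrow> x \<otimes> s \<in> lspan T"
  shows "x \<otimes> y \<in> lspan T"
  using assms(1)
proof (induction rule: lspan.induct)
  case (lspan_smult y c)
  then show ?case using lspan_carrier[OF lspan_smult(1) assms(2)] assms(3)
    by (simp add: smult_mult_right lspan.lspan_smult)
next
  case (lspan_add y z)
  then show ?case
    using lspan_carrier[OF lspan_add(1) assms(2)] lspan_carrier[OF lspan_add(2) assms(2)] assms(3)
    by (simp add: r_distr lspan.lspan_add)
qed (use assms in \<open>simp_all add: lspan.lspan_zero\<close>)

lemma lspan_mult_right:
  assumes "y \<in> lspan S" "S \<subseteq> carrier A" "x \<in> carrier A" "\<And>s. s \<in> S \<Longrightarrow> s \<otimes> x \<in> lspan T"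
  shows "y \<otimes> x \<in> lspan T"
  using assms(1)
proof (induction rule: lspan.induct)
  case (lspan_smult y c)
  then show ?case using lspan_carrier[OF lspan_smult(1) assms(2)] assms(3)
    by (simp add: smult_mult_left lspan.lspan_smult)
next
  case (lspan_add y z)
  then show ?case
    using lspan_carrier[OF lspan_add(1) assms(2)] lspan_carrier[OF lspan_add(2) assms(2)] assms(3)
    by (simp add: l_distr lspan.lspan_add)
qed (use assms in \<open>simp_all add: lspan.lspan_zero\<close>)

lemma scalar_central_unit:
  assumes c: "c \<noteq> 0" shows "c \<odot> \<one> \<in> central_units A"
proof -
  have "c \<odot> \<one> \<otimes> (inverse c \<odot> \<one>) = \<one>" "inverse c \<odot> \<one> \<otimes> (c \<odot> \<one>) = \<one>"
    using c by (simp_all add: smult_mult_left smult_assoc[symmetric])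
  moreover have "c \<odot> \<one> \<otimes> a = a \<otimes> (c \<odot> \<one>)" if "a \<in> carrier A" for a
    using that by (simp add: smult_mult_left smult_mult_right)
  ultimately show ?thesis unfolding central_units_def Units_def by blast
qed

lemma scalar_inverse: "c \<noteq> 0 \<Longrightarrow> c \<odot> \<one> \<otimes> (inverse c \<odot> \<one>) = \<one>"
  by (simp add: smult_mult_left smult_assoc[symmetric])

definition wprod :: "('v \<Rightarrow> 'a) \<Rightarrow> 'v list \<Rightarrow> 'a" where
  "wprod x v = foldr (\<lambda>i a. x i \<otimes> a) v \<one>"

lemma wprod_Nil [simp]: "wprod x [] = \<one>"
  by (simp add: wprod_def)

lemma wprod_Cons [simp]: "wprod x (i # v) = x i \<otimes> wprod x v"
  by (simp add: wprod_def)

lemma wprod_closed: "(\<And>i. i \<in> set v \<Longrightarrow> x i \<in> carrier A) \<Longrightarrow> wprod x v \<in> carrier A"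
  by (induction v) auto

lemma wprod_append:
  "(\<And>i. i \<in> set u \<union> set v \<Longrightarrow> x i \<in> carrier A) \<Longrightarrow> wprod x (u @ v) = wprod x u \<otimes> wprod x v"
  by (induction u) (auto simp: m_assoc wprod_closed)

lemma wprod_append_lists:
  "\<lbrakk>\<And>i. i \<in> V \<Longrightarrow> x i \<in> carrier A; u \<in> lists V; v \<in> lists V\<rbrakk> \<Longrightarrow>
    wprod x (u @ v) = wprod x u \<otimes> wprod x v"
  by (rule wprod_append) (auto simp: in_lists_conv_set)

lemma lspan_words_mult:
  assumes x: "\<And>i. i \<in> V \<Longrightarrow> x i \<in> carrier A"
    and a: "a \<in> lspan (wprod x ` lists V)" and b: "b \<in> lspan (wprod x ` lists V)"
  shows "a \<otimes> b \<in> lspan (wprod x ` lists V)"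
proof -
  have sub: "wprod x ` lists V \<subseteq> carrier A" using x by (auto intro: wprod_closed)
  show ?thesis
  proof (rule lspan_mult_left[OF b sub lspan_carrier[OF a sub]], rule lspan_mult_right[OF a sub])
    fix s t assume "s \<in> wprod x ` lists V" "t \<in> wprod x ` lists V"
    then obtain u v where uv: "u \<in> lists V" "v \<in> lists V" "s = wprod x u" "t = wprod x v" by auto
    then have "t \<otimes> s = wprod x (v @ u)" using wprod_append_lists[of V x v u] x by simp
    then show "t \<otimes> s \<in> lspan (wprod x ` lists V)" using uv by (simp add: lspan_base imageI)
  qed (use sub in auto)
qed

end

lemma unsorted_descent:
  "\<not> sorted (v :: nat list) \<Longrightarrow> \<exists>u j i r. v = u @ j # i # r \<and> i < j"
proof (induction v)
  case (Cons a v)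
  show ?case
  proof (cases "sorted v")
    case True
    then obtain b r where v: "v = b # r" using Cons by (cases v) auto
    then have "b < a" using Cons.prems True by auto
    then show ?thesis using v by (intro exI[of _ "[]"]) auto
  next
    case False
    then obtain u j i r where "v = u @ j # i # r" "i < j" using Cons by blast
    then show ?thesis by (intro exI[of _ "a # u"]) auto
  qed
qed simp

text \<open>\<open>words_span\<close> and \<open>straighten\<close> make the standard monomials
  span; the functionals \<open>\<phi>\<close>, dual to them by \<open>phi_std\<close>, make them
  independent. The correction in \<open>straighten\<close> is smaller in weight but may consist of
  longer words.\<close>

locale pbw_algebra = k_algebra A for A :: "('k::field, 'a, 'm) module_scheme" (structure) +
  fixes N :: nat and x :: "nat \<Rightarrow> 'a" and w :: "nat \<Rightarrow> nat" and \<phi> :: "'a \<Rightarrow> nat multiset \<Rightarrow> 'k"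
  assumes x_closed: "i \<in> {1..N} \<Longrightarrow> x i \<in> carrier A"
    and weight_pos: "i \<in> {1..N} \<Longrightarrow> w i > 0"
    and words_span: "a \<in> carrier A \<Longrightarrow> a \<in> lspan (wprod x ` lists {1..N})"
    and straighten: "\<lbrakk>1 \<le> i; i < j; j \<le> N\<rbrakk> \<Longrightarrow> \<exists>c d. c \<noteq> 0 \<and> x j \<otimes> x i = c \<odot> (x i \<otimes> x j) \<oplus> d \<and>
      d \<in> lspan {wprod x (sorted_list_of_multiset m) | m. m \<in> monomials {1..N} \<and> sum_mset (image_mset w m) < w i + w j}"
    and phi_add: "\<lbrakk>a \<in> carrier A; b \<in> carrier A\<rbrakk> \<Longrightarrow> \<phi> (a \<oplus> b) p = \<phi> a p + \<phi> b p"
    and phi_smult: "a \<in> carrier A \<Longrightarrow> \<phi> (c \<odot> a) p = c * \<phi> a p"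
    and phi_std: "\<lbrakk>m \<in> monomials {1..N}; p \<in> monomials {1..N}\<rbrakk> \<Longrightarrow>
      \<phi> (wprod x (sorted_list_of_multiset m)) p = (if p = m then 1 else 0)"
    and phi_supp: "\<lbrakk>a \<in> carrier A; p \<notin> monomials {1..N}\<rbrakk> \<Longrightarrow> \<phi> a p = 0"
begin

abbreviation "I \<equiv> monomials {1..N}"
definition "W m = sum_mset (image_mset w m)"
definition "std m = wprod x (sorted_list_of_multiset m)"
definition "L n = lspan {std m | m. m \<in> I \<and> W m < n}"

lemma W_add [simp]: "W (p + q) = W p + W q"
  by (simp add: W_def)

lemma I_add: "p \<in> I \<Longrightarrow> q \<in> I \<Longrightarrow> p + q \<in> I"
  by (auto simp: monomials_def)

lemma words_closed: "v \<in> lists {1..N} \<Longrightarrow> wprod x v \<in> carrier A"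
  using x_closed by (intro wprod_closed) auto

lemma sorted_in_lists: "m \<in> I \<Longrightarrow> sorted_list_of_multiset m \<in> lists {1..N}"
  by (auto simp: monomials_def)

lemma std_closed: "m \<in> I \<Longrightarrow> std m \<in> carrier A"
  unfolding std_def by (rule words_closed[OF sorted_in_lists])

lemma std_set_closed: "{std m | m. m \<in> I \<and> W m < n} \<subseteq> carrier A"
  using std_closed by auto

lemma L_closed: "a \<in> L n \<Longrightarrow> a \<in> carrier A"
  unfolding L_def using lspan_carrier std_set_closed by blast

lemma words_append:
  "\<lbrakk>u \<in> lists {1..N}; v \<in> lists {1..N}\<rbrakk> \<Longrightarrow> wprod x (u @ v) = wprod x u \<otimes> wprod x v"
  by (rule wprod_append_lists[of "{1..N}" x]) (auto simp: x_closed)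

lemma mset_lists: "v \<in> lists {1..N} \<Longrightarrow> mset v \<in> I"
  by (auto simp: monomials_def)

text \<open>Induction on the weight and, for equal weight, on the word in \<open>lenlex\<close>
  order: exchanging a descent keeps the weight and lowers the word, while the corrections have
  smaller weight whatever their length.\<close>

lemma straighten_word:
  "v \<in> lists {1..N} \<Longrightarrow> \<exists>c d. c \<noteq> 0 \<and> wprod x v = c \<odot> std (mset v) \<oplus> d \<and> d \<in> L (W (mset v))"
proof (induction v rule: wf_induct_rule[OF wf_inv_image[OF wf_lex_prod[OF wf_less_than wf_lenlex[OF wf_less_than]],
      of "\<lambda>v. (W (mset v), v)"]])
  case (1 v)
  show ?case
  proof (cases "sorted v")
    case True
    then have "wprod x v = 1 \<odot> std (mset v) \<oplus> \<zero>"
      using words_closed[OF 1(2)] by (simp add: std_def sorted_sort_id)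
    then show ?thesis unfolding L_def using lspan_zero by (intro exI[of _ 1] exI[of _ \<zero>]) simp
  next
    case False
    then obtain u j i r where v: "v = u @ j # i # r" "i < j" using unsorted_descent by blast
    have mem: "u \<in> lists {1..N}" "r \<in> lists {1..N}" "i \<in> {1..N}" "j \<in> {1..N}" using 1(2) v by auto
    obtain c d where cd: "c \<noteq> 0" "x j \<otimes> x i = c \<odot> (x i \<otimes> x j) \<oplus> d" "d \<in> L (w i + w j)"
      using straighten[of i j] mem v unfolding L_def std_def W_def by auto
    note car = words_closed[OF mem(1)] words_closed[OF mem(2)] x_closed[OF mem(3)] x_closed[OF mem(4)]
      L_closed[OF cd(3)]
    let ?v = "u @ i # j # r"
    have "wprod x v = wprod x u \<otimes> ((x j \<otimes> x i) \<otimes> wprod x r)"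
      unfolding v using car mem by (simp add: words_append m_assoc del: One_nat_def)
    also have "\<dots> = c \<odot> (wprod x u \<otimes> (x i \<otimes> (x j \<otimes> wprod x r))) \<oplus> wprod x u \<otimes> (d \<otimes> wprod x r)"
      using car by (simp add: cd l_distr r_distr smult_mult_left smult_mult_right m_assoc)
    also have "wprod x u \<otimes> (x i \<otimes> (x j \<otimes> wprod x r)) = wprod x ?v"
      using car mem by (simp add: words_append del: One_nat_def)
    finally have eq: "wprod x v = c \<odot> wprod x ?v \<oplus> wprod x u \<otimes> (d \<otimes> wprod x r)" .
    have ms: "mset ?v = mset v" by (simp add: v)
    have "(?v, v) \<in> lenlex less_than" using v(2)
      by (auto simp: v lenlex_conv lex_conv intro!: exI[of _ u])
    moreover have v': "?v \<in> lists {1..N}" using mem by simp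
    ultimately obtain c' d' where cd': "c' \<noteq> 0" "wprod x ?v = c' \<odot> std (mset v) \<oplus> d'" "d' \<in> L (W (mset v))"
      using 1(1)[of ?v] ms by auto
    \<comment> \<open>Each standard monomial of \<open>d\<close>, placed between \<open>u\<close>
      and \<open>r\<close>, is a word of smaller weight than \<open>v\<close>, so the induction
      hypothesis applies to it.\<close>
    have low: "wprod x u \<otimes> (d \<otimes> wprod x r) \<in> L (W (mset v))"
      unfolding L_def
    proof (rule lspan_mult_left[where S = "(\<lambda>m. std m \<otimes> wprod x r) ` {m \<in> I. W m < w i + w j}"])
      show "d \<otimes> wprod x r \<in> lspan ((\<lambda>m. std m \<otimes> wprod x r) ` {m \<in> I. W m < w i + w j})"
        by (rule lspan_mult_right[OF cd(3)[unfolded L_def] std_set_closed car(2)])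
          (auto intro: lspan_base)
      fix s assume "s \<in> (\<lambda>m. std m \<otimes> wprod x r) ` {m \<in> I. W m < w i + w j}"
      then obtain m where m: "m \<in> I" "W m < w i + w j" "s = std m \<otimes> wprod x r" by auto
      let ?z = "u @ sorted_list_of_multiset m @ r"
      have z: "?z \<in> lists {1..N}" using mem sorted_in_lists[OF m(1)] by simp
      have "wprod x u \<otimes> s = wprod x ?z"
        using m mem sorted_in_lists[OF m(1)] words_append by (simp add: std_def del: One_nat_def)
      moreover have Wz: "W (mset ?z) < W (mset v)" using m by (simp add: v W_def)
      then obtain c'' d'' where "c'' \<noteq> 0" "wprod x ?z = c'' \<odot> std (mset ?z) \<oplus> d''" "d'' \<in> L (W (mset ?z))"
        using 1(1)[of ?z] z by auto
      moreover have "std (mset ?z) \<in> lspan {std m | m. m \<in> I \<and> W m < W (mset v)}"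
        using Wz mset_lists[OF z] by (intro lspan_base) blast
      moreover have "L (W (mset ?z)) \<subseteq> lspan {std m | m. m \<in> I \<and> W m < W (mset v)}"
        using Wz unfolding L_def by (intro subsetI, elim lspan_mono[rotated]) auto
      ultimately show "wprod x u \<otimes> s \<in> lspan {std m | m. m \<in> I \<and> W m < W (mset v)}"
        by (auto intro!: lspan_add lspan_smult)
    qed (use car std_closed in auto)
    have "wprod x v = (c * c') \<odot> std (mset v) \<oplus> (c \<odot> d' \<oplus> wprod x u \<otimes> (d \<otimes> wprod x r))"
      using car std_closed[OF mset_lists[OF 1(2)]] L_closed[OF cd'(3)]
      by (simp add: eq cd'(2) smult_r_distr smult_assoc a_assoc)
    moreover have "c \<odot> d' \<oplus> wprod x u \<otimes> (d \<otimes> wprod x r) \<in> L (W (mset v))"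
      using low cd'(3) unfolding L_def by (intro lspan_add lspan_smult)
    ultimately show ?thesis using cd(1) cd'(1) by (metis mult_eq_0_iff)
  qed
qed

lemma std_span: "a \<in> carrier A \<Longrightarrow> a \<in> lspan (std ` I)"
proof (rule lspan_minimal[OF words_span], assumption)
  fix s assume "s \<in> wprod x ` lists {1..N}"
  then obtain v where v: "v \<in> lists {1..N}" "s = wprod x v" by blast
  then obtain c d where cd: "s = c \<odot> std (mset v) \<oplus> d" "d \<in> L (W (mset v))"
    using straighten_word by metis
  have "d \<in> lspan (std ` I)" using cd(2) unfolding L_def by (rule lspan_mono[rotated]) auto
  moreover have "std (mset v) \<in> lspan (std ` I)" using mset_lists[OF v(1)] by (intro lspan_base) auto
  ultimately show "s \<in> lspan (std ` I)" unfolding cd(1) by (intro lspan_add lspan_smult)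
qed

lemma phi_zero: "\<phi> \<zero> p = 0"
  using phi_smult[of \<zero> 0 p] by simp

lemma phi_finsum:
  assumes "finite F" "f \<in> F \<rightarrow> carrier A" shows "\<phi> (\<Oplus>i\<in>F. f i) p = (\<Sum>i\<in>F. \<phi> (f i) p)"
  using assms by (induction F rule: finite_induct) (auto simp: phi_zero phi_add finsum_insert finsum_closed)

lemma phi_std': "\<lbrakk>m \<in> I; p \<in> I\<rbrakk> \<Longrightarrow> \<phi> (std m) p = (if p = m then 1 else 0)"
  unfolding std_def by (rule phi_std)

text \<open>The expansion is claimed over every finite index set containing the support, because the
  supports of two elements and of their sum differ and the sums must be taken over a common
  set.\<close>

lemma expand_aux:
  assumes "a \<in> lspan (std ` I)"
  shows "finite {m. \<phi> a m \<noteq> 0} \<and>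
    (\<forall>F. finite F \<and> {m. \<phi> a m \<noteq> 0} \<subseteq> F \<and> F \<subseteq> I \<longrightarrow> a = (\<Oplus>m\<in>F. \<phi> a m \<odot> std m))"
  using assms
proof (induction rule: lspan.induct)
  case lspan_zero
  have "(\<Oplus>m\<in>F. \<phi> \<zero> m \<odot> std m) = \<zero>" if "F \<subseteq> I" for F
    using that std_closed by (intro add.finprod_one_eqI) (auto simp: phi_zero)
  then show ?case by (simp add: phi_zero)
next
  case (lspan_base a)
  then obtain m where m: "m \<in> I" "a = std m" by blast
  have supp: "{p. \<phi> a p \<noteq> 0} = {m}"
    using m phi_std' phi_supp std_closed by (auto split: if_splits) metis
  have "(\<Oplus>p\<in>F. \<phi> a p \<odot> std p) = a" if F: "finite F" "m \<in> F" "F \<subseteq> I" for F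
  proof -
    have "(\<Oplus>p\<in>F. \<phi> a p \<odot> std p) = (\<Oplus>p\<in>F. if m = p then std p else \<zero>)"
      using F m std_closed by (intro finsum_cong') (auto simp: phi_std' subset_iff)
    also have "\<dots> = std m" using F std_closed by (intro finsum_singleton) auto
    finally show ?thesis by (simp add: m)
  qed
  then show ?case by (simp add: supp)
next
  case (lspan_add a b)
  have sub: "std ` I \<subseteq> carrier A" using std_closed by auto
  have car: "a \<in> carrier A" "b \<in> carrier A"
    using lspan_carrier[OF lspan_add(1) sub] lspan_carrier[OF lspan_add(2) sub] .
  define S where "S = {m. \<phi> a m \<noteq> 0} \<union> {m. \<phi> b m \<noteq> 0}"
  have S: "finite S" "S \<subseteq> I" using lspan_add.IH phi_supp[OF car(1)] phi_supp[OF car(2)] by (auto simp: S_def)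
  have sup: "{m. \<phi> (a \<oplus> b) m \<noteq> 0} \<subseteq> S" using car by (auto simp: S_def phi_add)
  have "a \<oplus> b = (\<Oplus>m\<in>F. \<phi> (a \<oplus> b) m \<odot> std m)"
    if F: "finite F" "{m. \<phi> (a \<oplus> b) m \<noteq> 0} \<subseteq> F" "F \<subseteq> I" for F
  proof -
    have c: "m \<in> F \<union> S \<Longrightarrow> std m \<in> carrier A" for m using F S std_closed by auto
    have u: "finite (F \<union> S)" "F \<union> S \<subseteq> I" "{m. \<phi> a m \<noteq> 0} \<subseteq> F \<union> S" "{m. \<phi> b m \<noteq> 0} \<subseteq> F \<union> S"
      using F S(2) S(1) unfolding S_def by blast+
    have "a = (\<Oplus>m\<in>F \<union> S. \<phi> a m \<odot> std m)"
      by (rule lspan_add.IH(1)[THEN conjunct2, rule_format, OF conjI[OF u(1) conjI[OF u(3) u(2)]]])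
    moreover have "b = (\<Oplus>m\<in>F \<union> S. \<phi> b m \<odot> std m)"
      by (rule lspan_add.IH(2)[THEN conjunct2, rule_format, OF conjI[OF u(1) conjI[OF u(4) u(2)]]])
    ultimately have "a \<oplus> b = (\<Oplus>m\<in>F \<union> S. \<phi> a m \<odot> std m) \<oplus> (\<Oplus>m\<in>F \<union> S. \<phi> b m \<odot> std m)" by simp
    also have "\<dots> = (\<Oplus>m\<in>F \<union> S. \<phi> a m \<odot> std m \<oplus> \<phi> b m \<odot> std m)"
      using c by (intro finsum_addf[symmetric]) auto
    also have "\<dots> = (\<Oplus>m\<in>F \<union> S. \<phi> (a \<oplus> b) m \<odot> std m)"
      using c car by (intro finsum_cong') (auto simp: phi_add smult_l_distr)
    also have "\<dots> = (\<Oplus>m\<in>F. \<phi> (a \<oplus> b) m \<odot> std m)"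
    proof (rule add.finprod_mono_neutral_cong_right)
      have "\<phi> (a \<oplus> b) m = 0" if "m \<notin> F" for m using F(2) that by blast
      then show "\<And>m. m \<in> F \<union> S - F \<Longrightarrow> \<phi> (a \<oplus> b) m \<odot> std m = \<zero>" using c by auto
    qed (use u c in auto)
    finally show ?thesis .
  qed
  then show ?case using sup S finite_subset by blast
next
  case (lspan_smult a c)
  have sub: "std ` I \<subseteq> carrier A" using std_closed by auto
  have car: "a \<in> carrier A" using lspan_carrier[OF lspan_smult(1) sub] .
  have "{m. \<phi> (c \<odot> a) m \<noteq> 0} \<subseteq> {m. \<phi> a m \<noteq> 0}" using car by (auto simp: phi_smult)
  moreover have "c \<odot> a = (\<Oplus>m\<in>F. \<phi> (c \<odot> a) m \<odot> std m)"
    if F: "finite F" "{m. \<phi> (c \<odot> a) m \<noteq> 0} \<subseteq> F" "F \<subseteq> I" for F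
  proof -
    have cs: "m \<in> F \<Longrightarrow> std m \<in> carrier A" for m using F std_closed by auto
    show ?thesis
    proof (cases "c = 0")
      case True
      have "(\<Oplus>m\<in>F. \<phi> (c \<odot> a) m \<odot> std m) = \<zero>"
        using cs car True by (intro add.finprod_one_eqI) (auto simp: phi_zero)
      then show ?thesis using True car by simp
    next
      case False
      then have "a = (\<Oplus>m\<in>F. \<phi> a m \<odot> std m)"
        by (intro lspan_smult.IH[THEN conjunct2, rule_format]) (use F car in \<open>simp add: phi_smult\<close>)
      then have "c \<odot> a = c \<odot> (\<Oplus>m\<in>F. \<phi> a m \<odot> std m)" by simp
      also have "\<dots> = (\<Oplus>m\<in>F. c \<odot> (\<phi> a m \<odot> std m))" using F cs by (intro smult_finsum) auto
      also have "\<dots> = (\<Oplus>m\<in>F. \<phi> (c \<odot> a) m \<odot> std m)"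
        using cs car by (intro finsum_cong') (auto simp: phi_smult smult_assoc)
      finally show ?thesis .
    qed
  qed
  ultimately show ?case using lspan_smult.IH by (blast intro: finite_subset)
qed

lemma phi_finite: "a \<in> carrier A \<Longrightarrow> finite {m. \<phi> a m \<noteq> 0}"
  using expand_aux std_span by blast

lemma expand: "a \<in> carrier A \<Longrightarrow> a = (\<Oplus>m\<in>{m. \<phi> a m \<noteq> 0}. \<phi> a m \<odot> std m)"
  using expand_aux[OF std_span] phi_supp by blast

lemma phi_L: assumes "d \<in> L n" "\<phi> d p \<noteq> 0" shows "p \<in> I \<and> W p < n"
proof -
  have "\<phi> d p \<noteq> 0 \<longrightarrow> p \<in> I \<and> W p < n" using assms(1)[unfolded L_def]
  proof (induction rule: lspan.induct)
    case (lspan_base a)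
    then obtain m where m: "m \<in> I" "W m < n" "a = std m" by blast
    then show ?case using phi_supp[OF std_closed] phi_std' by (cases "p \<in> I") (auto split: if_splits)
  next
    case (lspan_add a b)
    then have "a \<in> carrier A" "b \<in> carrier A" using lspan_carrier std_set_closed by blast+
    then show ?case using lspan_add by (auto simp: phi_add)
  next
    case (lspan_smult a c)
    then have "a \<in> carrier A" using lspan_carrier std_set_closed by blast
    then show ?case using lspan_smult by (auto simp: phi_smult)
  qed (simp add: phi_zero)
  then show ?thesis using assms by blast
qed

definition "\<gamma> p q l = \<phi> (std p \<otimes> std q) l"

lemma std_mult:
  assumes "p \<in> I" "q \<in> I"
  shows "\<exists>c d. c \<noteq> 0 \<and> std p \<otimes> std q = c \<odot> std (p + q) \<oplus> d \<and> d \<in> L (W (p + q))"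
proof -
  let ?v = "sorted_list_of_multiset p @ sorted_list_of_multiset q"
  have v: "?v \<in> lists {1..N}" using assms sorted_in_lists by simp
  then have "wprod x ?v = std p \<otimes> std q"
    unfolding std_def using wprod_append_lists[of "{1..N}" x] x_closed assms sorted_in_lists by simp
  with straighten_word[OF v] show ?thesis by simp
qed

lemma phi_mult:
  assumes a: "a \<in> carrier A" and b: "b \<in> carrier A"
  shows "\<phi> (a \<otimes> b) l = (\<Sum>p | \<phi> a p \<noteq> 0. \<Sum>q | \<phi> b q \<noteq> 0. \<phi> a p * \<phi> b q * \<gamma> p q l)"
proof -
  let ?S = "{m. \<phi> a m \<noteq> 0}" and ?T = "{m. \<phi> b m \<noteq> 0}"
  have c: "m \<in> ?S \<Longrightarrow> std m \<in> carrier A" "m \<in> ?T \<Longrightarrow> std m \<in> carrier A" for m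
    using phi_supp a b std_closed by blast+
  have inner: "\<phi> (std p \<otimes> b) l = (\<Sum>q\<in>?T. \<phi> b q * \<gamma> p q l)" if p: "p \<in> ?S" for p
  proof -
    have "std p \<otimes> b = std p \<otimes> (\<Oplus>q\<in>?T. \<phi> b q \<odot> std q)" using expand[OF b] by simp
    also have "\<dots> = (\<Oplus>q\<in>?T. std p \<otimes> (\<phi> b q \<odot> std q))"
      using c p by (intro finsum_rdistr phi_finite[OF b]) auto
    also have "\<phi> \<dots> l = (\<Sum>q\<in>?T. \<phi> (std p \<otimes> (\<phi> b q \<odot> std q)) l)"
      using c p by (intro phi_finsum phi_finite[OF b]) auto
    also have "\<dots> = (\<Sum>q\<in>?T. \<phi> b q * \<gamma> p q l)"
      using c p by (intro sum.cong) (auto simp: smult_mult_right phi_smult \<gamma>_def)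
    finally show ?thesis .
  qed
  have "a \<otimes> b = (\<Oplus>p\<in>?S. \<phi> a p \<odot> std p) \<otimes> b" using expand[OF a] by simp
  also have "\<dots> = (\<Oplus>p\<in>?S. \<phi> a p \<odot> std p \<otimes> b)"
    using c b by (intro finsum_ldistr phi_finite[OF a]) auto
  also have "\<phi> \<dots> l = (\<Sum>p\<in>?S. \<phi> (\<phi> a p \<odot> std p \<otimes> b) l)"
    using c b by (intro phi_finsum phi_finite[OF a]) auto
  also have "\<dots> = (\<Sum>p\<in>?S. \<phi> a p * (\<Sum>q\<in>?T. \<phi> b q * \<gamma> p q l))"
    using c b inner by (intro sum.cong) (auto simp: smult_mult_left phi_smult)
  finally show ?thesis by (simp add: sum_distrib_left mult.assoc)
qed

sublocale weighted_coord_ring A I "\<lambda>c. c \<odot> \<one>" \<phi> \<gamma> W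
proof
  have "\<phi> \<one> {#} = 1" using phi_std[of "{#}" "{#}"] by (simp add: monomials_def)
  then show "\<one> \<noteq> \<zero>" using phi_zero[of "{#}"] by auto
next
  fix a assume a: "a \<in> carrier A" "\<And>p. \<phi> a p = 0"
  then show "a = \<zero>" using expand[OF a(1)] by simp
next
  fix c :: 'k and a p assume "c \<noteq> 0" "a \<in> carrier A"
  then show "\<phi> (c \<odot> \<one> \<otimes> a) p = c * \<phi> a p" by (simp add: smult_mult_left phi_smult)
next
  obtain lt where "mono_order (UNIV :: nat multiset set) lt" using mono_order_multiset by blast
  then have "mono_order I lt" using mono_order_subset[of UNIV lt I] I_add by blast
  then show "\<exists>lt. mono_order I lt" by blast
next
  fix n
  \<comment> \<open>Weights are positive integers, so a bound on the weight bounds the degree, and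
    there are finitely many indeterminates.\<close>
  have "size m \<le> W m" if "m \<in> I" for m
    using that
  proof (induction m)
    case (add i m)
    then have "w i > 0" "m \<in> I" using weight_pos by (auto simp: monomials_def)
    then show ?case using add by (simp add: W_def)
  qed simp
  then have "{p \<in> I. W p \<le> n} \<subseteq> {m \<in> I. size m \<le> n}" using order_trans by blast
  then show "finite {p \<in> I. W p \<le> n}" using finite_bounded_monomials finite_subset by blast
next
  fix p q assume pq: "p \<in> I" "q \<in> I"
  then obtain c d where cd: "c \<noteq> 0" "std p \<otimes> std q = c \<odot> std (p + q) \<oplus> d" "d \<in> L (W (p + q))"
    using std_mult by blast
  have g: "\<gamma> p q l = c * \<phi> (std (p + q)) l + \<phi> d l" for l
    using std_closed[OF I_add[OF pq]] L_closed[OF cd(3)] by (simp add: \<gamma>_def cd(2) phi_add phi_smult)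
  have "\<phi> d (p + q) = 0" using phi_L[OF cd(3), of "p + q"] by blast
  then show "\<gamma> p q (p + q) \<noteq> 0" using cd(1) phi_std'[OF I_add[OF pq] I_add[OF pq]] by (simp add: g)
  fix l assume "\<gamma> p q l \<noteq> 0"
  then have "\<phi> (std (p + q)) l \<noteq> 0 \<or> \<phi> d l \<noteq> 0" by (auto simp: g)
  then show "l \<in> I \<and> (l = p + q \<or> W l < W (p + q))"
    using phi_L[OF cd(3), of l] phi_std'[OF I_add[OF pq], of l] phi_supp[OF std_closed[OF I_add[OF pq]], of l]
    by (cases "l \<in> I") (auto split: if_splits)
qed (use phi_finite phi_supp phi_mult phi_add scalar_central_unit in auto)

text \<open>A subalgebra contains 1 and therefore all scalar multiples of it, so the coordinates of
  the whole algebra restrict to it.\<close>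

lemma FFD_subalgebra:
  assumes "k_subalgebra S A" shows "FFD (A\<lparr>carrier := S\<rparr>)"
proof -
  have S: "subring S A" using assms by (simp add: k_subalgebra_def)
  moreover have "c \<odot> \<one> \<in> S" for c
    using assms subringE(3)[OF S] by (simp add: k_subalgebra_def)
  ultimately interpret S: weighted_coord_ring "A\<lparr>carrier := S\<rparr>" I "\<lambda>c. c \<odot> \<one>" \<phi> \<gamma> W
    using scalar_inverse by (intro weighted_subring) auto
  show ?thesis by (rule S.FFD_weighted)
qed

end

section \<open>Monoid algebras and polynomial rings\<close>

definition single :: "('r, 'm) ring_scheme \<Rightarrow> 'a \<Rightarrow> 'r \<Rightarrow> 'a \<Rightarrow> 'r" where
  "single R a r = (\<lambda>b. if b = a then r else \<zero>\<^bsub>R\<^esub>)"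

locale monoid_alg = R: ring R + M: monoid M
  for R :: "('r, 'm) ring_scheme" (structure) and M :: "('a, 'n) monoid_scheme"
begin

abbreviation "MA \<equiv> monoid_algebra R M"

lemma MA_simps:
  "f \<in> carrier MA \<longleftrightarrow> (\<forall>a. f a \<in> carrier R) \<and> finite (supp R f) \<and> supp R f \<subseteq> carrier M"
  "\<one>\<^bsub>MA\<^esub> = single R \<one>\<^bsub>M\<^esub> \<one>" "\<zero>\<^bsub>MA\<^esub> = (\<lambda>a. \<zero>)" "f \<oplus>\<^bsub>MA\<^esub> g = (\<lambda>a. f a \<oplus> g a)"
  "c \<odot>\<^bsub>MA\<^esub> f = (\<lambda>a. c \<otimes> f a)"
  by (auto simp: monoid_algebra_def single_def)

text \<open>Summing over arbitrary finite supersets lets products with different supports be written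
  over one index set, as the distributive laws require.\<close>

lemma MA_mult:
  assumes f: "f \<in> carrier MA" and g: "g \<in> carrier MA"
    and S: "finite S" "supp R f \<subseteq> S" and T: "finite T" "supp R g \<subseteq> T"
  shows "(f \<otimes>\<^bsub>MA\<^esub> g) a = (\<Oplus>p\<in>{p \<in> S \<times> T. fst p \<otimes>\<^bsub>M\<^esub> snd p = a}. f (fst p) \<otimes> g (snd p))"
proof -
  have fg: "f b \<in> carrier R" "g b \<in> carrier R" for b using f g by (auto simp: MA_simps)
  have z: "b \<notin> supp R f \<Longrightarrow> f b = \<zero>" "b \<notin> supp R g \<Longrightarrow> g b = \<zero>" for b by (auto simp: supp_def)
  have "(f \<otimes>\<^bsub>MA\<^esub> g) a
      = (\<Oplus>p\<in>{p \<in> supp R f \<times> supp R g. fst p \<otimes>\<^bsub>M\<^esub> snd p = a}. f (fst p) \<otimes> g (snd p))"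
    by (simp add: monoid_algebra_def)
  also have "\<dots> = (\<Oplus>p\<in>{p \<in> S \<times> T. fst p \<otimes>\<^bsub>M\<^esub> snd p = a}. f (fst p) \<otimes> g (snd p))"
  proof (rule R.add.finprod_mono_neutral_cong_left)
    fix p assume "p \<in> {p \<in> S \<times> T. fst p \<otimes>\<^bsub>M\<^esub> snd p = a} - {p \<in> supp R f \<times> supp R g. fst p \<otimes>\<^bsub>M\<^esub> snd p = a}"
    then have "fst p \<notin> supp R f \<or> snd p \<notin> supp R g" by (auto simp: mem_Times_iff)
    then show "f (fst p) \<otimes> g (snd p) = \<zero>" using z fg by auto
  qed (use S T fg in auto)
  finally show ?thesis .
qed

lemma single_closed: "\<lbrakk>a \<in> carrier M; r \<in> carrier R\<rbrakk> \<Longrightarrow> single R a r \<in> carrier MA"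
  by (auto simp: MA_simps single_def supp_def)

lemma zero_closed: "\<zero>\<^bsub>MA\<^esub> \<in> carrier MA"
  by (simp add: MA_simps supp_def)

lemma add_closed:
  assumes f: "f \<in> carrier MA" and g: "g \<in> carrier MA" shows "f \<oplus>\<^bsub>MA\<^esub> g \<in> carrier MA"
proof -
  have "supp R (f \<oplus>\<^bsub>MA\<^esub> g) \<subseteq> supp R f \<union> supp R g" by (auto simp: supp_def MA_simps)
  moreover have "finite (supp R f \<union> supp R g)" "supp R f \<union> supp R g \<subseteq> carrier M"
    using f g by (auto simp: MA_simps)
  ultimately have "finite (supp R (f \<oplus>\<^bsub>MA\<^esub> g)) \<and> supp R (f \<oplus>\<^bsub>MA\<^esub> g) \<subseteq> carrier M"
    by (meson finite_subset subset_trans)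
  then show ?thesis using f g by (simp add: MA_simps)
qed

lemma mult_closed:
  assumes f: "f \<in> carrier MA" and g: "g \<in> carrier MA" shows "f \<otimes>\<^bsub>MA\<^esub> g \<in> carrier MA"
proof -
  have fin: "finite (supp R f)" "finite (supp R g)" and fg: "\<And>b. f b \<in> carrier R" "\<And>b. g b \<in> carrier R"
    using f g by (auto simp: MA_simps)
  have sub: "supp R (f \<otimes>\<^bsub>MA\<^esub> g) \<subseteq> (\<lambda>p. fst p \<otimes>\<^bsub>M\<^esub> snd p) ` (supp R f \<times> supp R g)"
  proof
    fix a assume a: "a \<in> supp R (f \<otimes>\<^bsub>MA\<^esub> g)"
    show "a \<in> (\<lambda>p. fst p \<otimes>\<^bsub>M\<^esub> snd p) ` (supp R f \<times> supp R g)"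
    proof (rule ccontr)
      assume "a \<notin> (\<lambda>p. fst p \<otimes>\<^bsub>M\<^esub> snd p) ` (supp R f \<times> supp R g)"
      then have "{p \<in> supp R f \<times> supp R g. fst p \<otimes>\<^bsub>M\<^esub> snd p = a} = {}" by blast
      then have "(f \<otimes>\<^bsub>MA\<^esub> g) a = \<zero>"
        unfolding MA_mult[OF f g fin(1) subset_refl fin(2) subset_refl] by (simp only: R.finsum_empty)
      with a show False by (simp add: supp_def)
    qed
  qed
  moreover have "(\<lambda>p. fst p \<otimes>\<^bsub>M\<^esub> snd p) ` (supp R f \<times> supp R g) \<subseteq> carrier M"
    using f g by (auto simp: MA_simps intro!: M.m_closed)
  moreover have "(f \<otimes>\<^bsub>MA\<^esub> g) a \<in> carrier R" for a
    unfolding MA_mult[OF f g fin(1) subset_refl fin(2) subset_refl] using fg by (intro R.finsum_closed) auto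
  ultimately show ?thesis using fin by (simp add: MA_simps) (meson finite_SigmaI finite_imageI finite_subset subset_trans)
qed

lemma single_mult:
  assumes "a \<in> carrier M" "b \<in> carrier M" "r \<in> carrier R" "s \<in> carrier R"
  shows "single R a r \<otimes>\<^bsub>MA\<^esub> single R b s = single R (a \<otimes>\<^bsub>M\<^esub> b) (r \<otimes> s)"
proof
  fix c
  have "(single R a r \<otimes>\<^bsub>MA\<^esub> single R b s) c
      = (\<Oplus>p\<in>{p \<in> {a} \<times> {b}. fst p \<otimes>\<^bsub>M\<^esub> snd p = c}. single R a r (fst p) \<otimes> single R b s (snd p))"
    by (intro MA_mult single_closed) (use assms in \<open>auto simp: supp_def single_def\<close>)
  also have "{p \<in> {a} \<times> {b}. fst p \<otimes>\<^bsub>M\<^esub> snd p = c} = (if a \<otimes>\<^bsub>M\<^esub> b = c then {(a, b)} else {})" by auto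
  also have "(\<Oplus>p\<in>\<dots>. single R a r (fst p) \<otimes> single R b s (snd p)) = single R (a \<otimes>\<^bsub>M\<^esub> b) (r \<otimes> s) c"
    using assms by (auto simp: single_def)
  finally show "(single R a r \<otimes>\<^bsub>MA\<^esub> single R b s) c = single R (a \<otimes>\<^bsub>M\<^esub> b) (r \<otimes> s) c" .
qed

lemma MA_induct [consumes 1, case_names zero single add]:
  assumes f: "f \<in> carrier MA" and P0: "P \<zero>\<^bsub>MA\<^esub>"
    and Ps: "\<And>a r. \<lbrakk>a \<in> carrier M; r \<in> carrier R\<rbrakk> \<Longrightarrow> P (single R a r)"
    and Pa: "\<And>f g. \<lbrakk>f \<in> carrier MA; g \<in> carrier MA; P f; P g\<rbrakk> \<Longrightarrow> P (f \<oplus>\<^bsub>MA\<^esub> g)"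
  shows "P f"
proof -
  have "finite (supp R f)" using f by (simp add: MA_simps)
  then show ?thesis using f
  proof (induction "supp R f" arbitrary: f rule: finite_induct)
    case empty
    then have "f = \<zero>\<^bsub>MA\<^esub>" by (auto simp: MA_simps supp_def)
    then show ?case using P0 by simp
  next
    case (insert a F)
    define g where "g = f(a := \<zero>)"
    have fr: "f b \<in> carrier R" for b using insert.prems by (simp add: MA_simps)
    have a: "a \<in> carrier M" using insert by (auto simp: MA_simps)
    have gF: "supp R g = F" using insert(2,4) by (auto simp: g_def supp_def)
    then have g: "g \<in> carrier MA" using insert by (auto simp: MA_simps g_def)
    have "f = single R a (f a) \<oplus>\<^bsub>MA\<^esub> g" using fr by (auto simp: MA_simps single_def g_def fun_eq_iff)
    moreover have "P (single R a (f a) \<oplus>\<^bsub>MA\<^esub> g)"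
      using a fr g gF insert(3)[of g] by (intro Pa Ps single_closed) auto
    ultimately show ?case by simp
  qed
qed

lemma mult_distrib:
  assumes f: "f \<in> carrier MA" and g: "g \<in> carrier MA" and h: "h \<in> carrier MA"
  shows "(f \<oplus>\<^bsub>MA\<^esub> g) \<otimes>\<^bsub>MA\<^esub> h = f \<otimes>\<^bsub>MA\<^esub> h \<oplus>\<^bsub>MA\<^esub> g \<otimes>\<^bsub>MA\<^esub> h"
    and "h \<otimes>\<^bsub>MA\<^esub> (f \<oplus>\<^bsub>MA\<^esub> g) = h \<otimes>\<^bsub>MA\<^esub> f \<oplus>\<^bsub>MA\<^esub> h \<otimes>\<^bsub>MA\<^esub> g"
proof -
  let ?S = "supp R f \<union> supp R g"
  have fin: "finite ?S" "finite (supp R h)" using f g h by (auto simp: MA_simps)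
  have sub: "supp R f \<subseteq> ?S" "supp R g \<subseteq> ?S" "supp R (f \<oplus>\<^bsub>MA\<^esub> g) \<subseteq> ?S" by (auto simp: supp_def MA_simps)
  have car: "f b \<in> carrier R" "g b \<in> carrier R" "h b \<in> carrier R" for b using f g h by (auto simp: MA_simps)
  note 1 = MA_mult[OF add_closed[OF f g] h fin(1) sub(3) fin(2) subset_refl]
    MA_mult[OF f h fin(1) sub(1) fin(2) subset_refl] MA_mult[OF g h fin(1) sub(2) fin(2) subset_refl]
  note 2 = MA_mult[OF h add_closed[OF f g] fin(2) subset_refl fin(1) sub(3)]
    MA_mult[OF h f fin(2) subset_refl fin(1) sub(1)] MA_mult[OF h g fin(2) subset_refl fin(1) sub(2)]
  show "(f \<oplus>\<^bsub>MA\<^esub> g) \<otimes>\<^bsub>MA\<^esub> h = f \<otimes>\<^bsub>MA\<^esub> h \<oplus>\<^bsub>MA\<^esub> g \<otimes>\<^bsub>MA\<^esub> h"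
  proof
    fix a
    have "((f \<oplus>\<^bsub>MA\<^esub> g) \<otimes>\<^bsub>MA\<^esub> h) a = (f \<otimes>\<^bsub>MA\<^esub> h) a \<oplus> (g \<otimes>\<^bsub>MA\<^esub> h) a"
      unfolding 1 using car
      by (subst R.finsum_addf[symmetric]) (auto simp: MA_simps R.l_distr intro!: R.finsum_cong')
    then show "((f \<oplus>\<^bsub>MA\<^esub> g) \<otimes>\<^bsub>MA\<^esub> h) a = (f \<otimes>\<^bsub>MA\<^esub> h \<oplus>\<^bsub>MA\<^esub> g \<otimes>\<^bsub>MA\<^esub> h) a" by (simp add: MA_simps)
  qed
  show "h \<otimes>\<^bsub>MA\<^esub> (f \<oplus>\<^bsub>MA\<^esub> g) = h \<otimes>\<^bsub>MA\<^esub> f \<oplus>\<^bsub>MA\<^esub> h \<otimes>\<^bsub>MA\<^esub> g"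
  proof
    fix a
    have "(h \<otimes>\<^bsub>MA\<^esub> (f \<oplus>\<^bsub>MA\<^esub> g)) a = (h \<otimes>\<^bsub>MA\<^esub> f) a \<oplus> (h \<otimes>\<^bsub>MA\<^esub> g) a"
      unfolding 2 using car
      by (subst R.finsum_addf[symmetric]) (auto simp: MA_simps R.r_distr intro!: R.finsum_cong')
    then show "(h \<otimes>\<^bsub>MA\<^esub> (f \<oplus>\<^bsub>MA\<^esub> g)) a = (h \<otimes>\<^bsub>MA\<^esub> f \<oplus>\<^bsub>MA\<^esub> h \<otimes>\<^bsub>MA\<^esub> g) a" by (simp add: MA_simps)
  qed
qed

lemma mult_zero: "f \<in> carrier MA \<Longrightarrow> \<zero>\<^bsub>MA\<^esub> \<otimes>\<^bsub>MA\<^esub> f = \<zero>\<^bsub>MA\<^esub>" "f \<in> carrier MA \<Longrightarrow> f \<otimes>\<^bsub>MA\<^esub> \<zero>\<^bsub>MA\<^esub> = \<zero>\<^bsub>MA\<^esub>"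
  by (auto simp: monoid_algebra_def supp_def)

text \<open>Both sides are additive in each argument, which reduces the claim to elements supported
  at single points.\<close>

lemma mult_assoc:
  assumes f: "f \<in> carrier MA" and g: "g \<in> carrier MA" and h: "h \<in> carrier MA"
  shows "(f \<otimes>\<^bsub>MA\<^esub> g) \<otimes>\<^bsub>MA\<^esub> h = f \<otimes>\<^bsub>MA\<^esub> (g \<otimes>\<^bsub>MA\<^esub> h)"
  using f
proof (induction rule: MA_induct)
  case (single a r)
  show ?case using g
  proof (induction rule: MA_induct)
    case (single b s)
    show ?case using h
    proof (induction rule: MA_induct)
      case (single c t)
      then show ?case
        using \<open>a \<in> carrier M\<close> \<open>r \<in> carrier R\<close> \<open>b \<in> carrier M\<close> \<open>s \<in> carrier R\<close>
        by (simp add: single_mult M.m_assoc R.m_assoc)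
    next
      case (add h h')
      then show ?case
        using single_closed[OF \<open>a \<in> carrier M\<close> \<open>r \<in> carrier R\<close>] single_closed[OF \<open>b \<in> carrier M\<close> \<open>s \<in> carrier R\<close>]
        by (simp add: mult_distrib mult_closed)
    qed (use single_closed \<open>a \<in> carrier M\<close> \<open>r \<in> carrier R\<close> \<open>b \<in> carrier M\<close> \<open>s \<in> carrier R\<close> in
        \<open>simp add: mult_zero mult_closed\<close>)
  next
    case (add g g')
    then show ?case using single_closed[OF single] h by (simp add: mult_distrib mult_closed)
  qed (use single_closed[OF single] h in \<open>simp add: mult_zero mult_closed\<close>)
next
  case (add f f')
  then show ?case using g h by (simp add: mult_distrib mult_closed)
qed (use g h in \<open>simp add: mult_zero mult_closed\<close>)

lemma one_mult: "f \<in> carrier MA \<Longrightarrow> \<one>\<^bsub>MA\<^esub> \<otimes>\<^bsub>MA\<^esub> f = f" "f \<in> carrier MA \<Longrightarrow> f \<otimes>\<^bsub>MA\<^esub> \<one>\<^bsub>MA\<^esub> = f"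
proof -
  have one: "\<one>\<^bsub>MA\<^esub> \<in> carrier MA" by (simp only: MA_simps(2) single_closed M.one_closed R.one_closed)
  show "f \<in> carrier MA \<Longrightarrow> \<one>\<^bsub>MA\<^esub> \<otimes>\<^bsub>MA\<^esub> f = f"
  proof (induction rule: MA_induct)
    case (single a r)
    then show ?case by (simp add: MA_simps(2) single_mult)
  qed (use one in \<open>simp_all add: mult_zero mult_distrib\<close>)
  show "f \<in> carrier MA \<Longrightarrow> f \<otimes>\<^bsub>MA\<^esub> \<one>\<^bsub>MA\<^esub> = f"
  proof (induction rule: MA_induct)
    case (single a r)
    then show ?case by (simp add: MA_simps(2) single_mult)
  qed (use one in \<open>simp_all add: mult_zero mult_distrib\<close>)
qed

lemma MA_ring: "ring MA"
proof (rule ringI)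
  show "abelian_group MA"
  proof (rule abelian_groupI)
    fix f assume f: "f \<in> carrier MA"
    let ?g = "\<lambda>a. \<ominus> f a"
    have "supp R ?g = supp R f" using f by (auto simp: supp_def MA_simps)
    then have "?g \<in> carrier MA" using f by (simp add: MA_simps)
    moreover have "?g \<oplus>\<^bsub>MA\<^esub> f = \<zero>\<^bsub>MA\<^esub>" using f by (simp add: MA_simps R.l_neg)
    ultimately show "\<exists>g\<in>carrier MA. g \<oplus>\<^bsub>MA\<^esub> f = \<zero>\<^bsub>MA\<^esub>" by blast
  qed (simp_all add: add_closed zero_closed, simp_all add: MA_simps R.a_ac)
  show "monoid MA"
    by (rule monoidI)
      (simp_all add: mult_closed mult_assoc one_mult, simp_all only: MA_simps(2) single_closed M.one_closed R.one_closed)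
qed (simp_all add: mult_distrib)

end

lemma free_comm_monoid_monoid: "monoid (free_comm_monoid V)"
  by (rule monoidI) (auto simp: free_comm_monoid_def monomials_def add.assoc)

section \<open>Coordinates on polynomial rings\<close>

context weighted_coord_ring
begin

lemma coord_finsum:
  assumes "finite F" "f \<in> F \<rightarrow> carrier R" shows "\<phi> (\<Oplus>i\<in>F. f i) p = (\<Sum>i\<in>F. \<phi> (f i) p)"
  using assms by (induction F rule: finite_induct) (auto simp: coord_zero coord_add finsum_insert finsum_closed)

context
  fixes V :: "'v set"
begin

interpretation P: monoid_alg R "free_comm_monoid V"
  using free_comm_monoid_monoid ring_axioms by (simp add: monoid_alg_def)

abbreviation "PR \<equiv> polynomial_ring R V"

text \<open>Flattens a polynomial over \<open>R\<close> to scalar coordinates indexed by pairs of an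
  index of \<open>R\<close> and a monomial, so that the polynomial ring becomes a
  \<open>coord_ring\<close> over the same field.\<close>

definition pcoord :: "('v multiset \<Rightarrow> 'a) \<Rightarrow> 'i \<times> 'v multiset \<Rightarrow> 'k" where
  "pcoord f = (\<lambda>(p, m). \<phi> (f m) p)"

text \<open>The adjoined indeterminates are central and their monomials multiply exactly; lower
  terms arise in the first component only.\<close>

definition p\<gamma> :: "'i \<times> 'v multiset \<Rightarrow> 'i \<times> 'v multiset \<Rightarrow> 'i \<times> 'v multiset \<Rightarrow> 'k" where
  "p\<gamma> x y z = (if snd z = snd x + snd y then \<gamma> (fst x) (fst y) (fst z) else 0)"

lemma PR_eq: "PR = monoid_algebra R (free_comm_monoid V)"
  by (simp add: polynomial_ring_def)

lemma PR_carrier: "f \<in> carrier PR \<longleftrightarrow> (\<forall>a. f a \<in> carrier R) \<and> finite (supp R f) \<and> supp R f \<subseteq> monomials V"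
  unfolding PR_eq P.MA_simps by (simp add: free_comm_monoid_def)

lemma pcoord_supp:
  assumes f: "f \<in> carrier PR"
  shows "{x. pcoord f x \<noteq> 0} \<subseteq> (\<Union>m\<in>supp R f. {p. \<phi> (f m) p \<noteq> 0}) \<times> supp R f"
proof
  fix x assume "x \<in> {x. pcoord f x \<noteq> 0}"
  then obtain p m where x: "x = (p, m)" "pcoord f (p, m) \<noteq> 0" by (cases x) auto
  from x(2) have "\<phi> (f m) p \<noteq> 0" by (simp add: pcoord_def)
  moreover from this have "m \<in> supp R f" using coord_zero by (auto simp: supp_def)
  ultimately show "x \<in> (\<Union>m\<in>supp R f. {p. \<phi> (f m) p \<noteq> 0}) \<times> supp R f" unfolding x(1) by blast
qed

text \<open>The convolution over \<open>R\<close> is expanded by the coordinate formula for products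
  in \<open>R\<close>. One common finite box \<open>B \<times> S\<close> for both factors makes the
  four summations independent, so they can be interchanged and then cut down to the
  supports.\<close>

lemma pcoord_mult:
  assumes f: "f \<in> carrier PR" and g: "g \<in> carrier PR"
  shows "pcoord (f \<otimes>\<^bsub>PR\<^esub> g) z
    = (\<Sum>x | pcoord f x \<noteq> 0. \<Sum>y | pcoord g y \<noteq> 0. pcoord f x * pcoord g y * p\<gamma> x y z)"
proof -
  obtain l n where z: "z = (l, n)" by (cases z)
  define S where "S = supp R f \<union> supp R g"
  define B where "B = (\<Union>m\<in>S. {p. \<phi> (f m) p \<noteq> 0} \<union> {p. \<phi> (g m) p \<noteq> 0})"
  have car: "f m \<in> carrier R" "g m \<in> carrier R" for m using f g by (auto simp: PR_carrier)
  have fS: "finite S" using f g by (auto simp: S_def PR_carrier)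
  have fB: "finite B" using fS car by (auto simp: B_def coord_finite)
  have B: "{p. \<phi> (f m) p \<noteq> 0} \<subseteq> B" "{p. \<phi> (g m) p \<noteq> 0} \<subseteq> B" if "m \<in> S" for m
    using that by (auto simp: B_def)
  have sf: "{x. pcoord f x \<noteq> 0} \<subseteq> B \<times> S"
    by (rule order_trans[OF pcoord_supp[OF f]]) (auto simp: B_def S_def)
  have sg: "{x. pcoord g x \<noteq> 0} \<subseteq> B \<times> S"
    by (rule order_trans[OF pcoord_supp[OF g]]) (auto simp: B_def S_def)
  let ?h = "\<lambda>m m'. \<Sum>p\<in>B. \<Sum>q\<in>B. \<phi> (f m) p * \<phi> (g m') q * \<gamma> p q l"
  have "(f \<otimes>\<^bsub>PR\<^esub> g) n = (\<Oplus>x\<in>{x \<in> S \<times> S. fst x + snd x = n}. f (fst x) \<otimes> g (snd x))"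
    using P.MA_mult[of f g S S n] f g fS by (simp add: PR_eq S_def free_comm_monoid_def)
  then have "pcoord (f \<otimes>\<^bsub>PR\<^esub> g) z
      = (\<Sum>x\<in>{x \<in> S \<times> S. fst x + snd x = n}. \<phi> (f (fst x) \<otimes> g (snd x)) l)"
    unfolding z pcoord_def using car fS by (simp add: coord_finsum)
  also have "\<dots> = (\<Sum>x\<in>{x \<in> S \<times> S. fst x + snd x = n}. ?h (fst x) (snd x))"
    using car fB B by (intro sum.cong refl coord_mult_superset) (simp_all add: mem_Times_iff)
  also have "\<dots> = (\<Sum>x\<in>S \<times> S. if fst x + snd x = n then ?h (fst x) (snd x) else 0)"
    using fS by (intro sum.inter_filter) auto
  also have "\<dots> = (\<Sum>m\<in>S. \<Sum>m'\<in>S. if m + m' = n then ?h m m' else 0)"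
    by (simp add: sum.cartesian_product split_beta)
  also have "\<dots> = (\<Sum>m\<in>S. \<Sum>m'\<in>S. \<Sum>p\<in>B. \<Sum>q\<in>B. pcoord f (p, m) * pcoord g (q, m') * p\<gamma> (p, m) (q, m') z)"
    by (intro sum.cong refl) (simp add: pcoord_def p\<gamma>_def z)
  also have "\<dots> = (\<Sum>m\<in>S. \<Sum>p\<in>B. \<Sum>m'\<in>S. \<Sum>q\<in>B. pcoord f (p, m) * pcoord g (q, m') * p\<gamma> (p, m) (q, m') z)"
    by (intro sum.cong refl sum.swap)
  also have "\<dots> = (\<Sum>p\<in>B. \<Sum>m\<in>S. \<Sum>q\<in>B. \<Sum>m'\<in>S. pcoord f (p, m) * pcoord g (q, m') * p\<gamma> (p, m) (q, m') z)"
    by (subst sum.swap) (intro sum.cong refl sum.swap)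
  also have "\<dots> = (\<Sum>x\<in>B \<times> S. \<Sum>y\<in>B \<times> S. pcoord f x * pcoord g y * p\<gamma> x y z)"
    by (simp only: sum.cartesian_product')
  also have "\<dots> = (\<Sum>x | pcoord f x \<noteq> 0. \<Sum>y\<in>B \<times> S. pcoord f x * pcoord g y * p\<gamma> x y z)"
    by (rule sum.mono_neutral_right) (use sf sg fB fS in auto)
  also have "\<dots> = (\<Sum>x | pcoord f x \<noteq> 0. \<Sum>y | pcoord g y \<noteq> 0. pcoord f x * pcoord g y * p\<gamma> x y z)"
    by (intro sum.cong refl sum.mono_neutral_right) (use sf sg fB fS in auto)
  finally show ?thesis .
qed

lemma PR_const_mult:
  assumes r: "r \<in> carrier R" and f: "f \<in> carrier PR"
  shows "single R {#} r \<otimes>\<^bsub>PR\<^esub> f = (\<lambda>m. r \<otimes> f m)" "f \<otimes>\<^bsub>PR\<^esub> single R {#} r = (\<lambda>m. f m \<otimes> r)"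
proof -
  have car: "f m \<in> carrier R" for m using f by (auto simp: PR_carrier)
  have fin: "finite (supp R f)" using f by (simp add: PR_carrier)
  have s: "single R {#} r \<in> carrier PR" "supp R (single R {#} r) \<subseteq> {{#}}"
    using P.single_closed[of "{#}" r] r
    by (auto simp: PR_eq free_comm_monoid_def monomials_def supp_def single_def)
  have z: "m \<notin> supp R f \<Longrightarrow> f m = \<zero>" for m by (auto simp: supp_def)
  show "single R {#} r \<otimes>\<^bsub>PR\<^esub> f = (\<lambda>m. r \<otimes> f m)"
  proof
    fix m
    have "(single R {#} r \<otimes>\<^bsub>PR\<^esub> f) m = (\<Oplus>x\<in>{x \<in> {{#}} \<times> insert m (supp R f). fst x + snd x = m}.
        single R {#} r (fst x) \<otimes> f (snd x))"
      using P.MA_mult[of "single R {#} r" f "{{#}}" "insert m (supp R f)" m] s f fin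
      by (auto simp: PR_eq free_comm_monoid_def)
    also have "{x \<in> {{#}} \<times> insert m (supp R f). fst x + snd x = m} = {({#}, m)}" by auto
    finally show "(single R {#} r \<otimes>\<^bsub>PR\<^esub> f) m = r \<otimes> f m" using r car by (simp add: single_def)
  qed
  show "f \<otimes>\<^bsub>PR\<^esub> single R {#} r = (\<lambda>m. f m \<otimes> r)"
  proof
    fix m
    have "(f \<otimes>\<^bsub>PR\<^esub> single R {#} r) m = (\<Oplus>x\<in>{x \<in> insert m (supp R f) \<times> {{#}}. fst x + snd x = m}.
        f (fst x) \<otimes> single R {#} r (snd x))"
      using P.MA_mult[of f "single R {#} r" "insert m (supp R f)" "{{#}}" m] s f fin
      by (auto simp: PR_eq free_comm_monoid_def)
    also have "{x \<in> insert m (supp R f) \<times> {{#}}. fst x + snd x = m} = {(m, {#})}" by auto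
    finally show "(f \<otimes>\<^bsub>PR\<^esub> single R {#} r) m = f m \<otimes> r" using r car by (simp add: single_def)
  qed
qed

lemma PR_central_unit:
  assumes u: "u \<in> central_units R" shows "single R {#} u \<in> central_units PR"
proof -
  have uc: "u \<in> carrier R" "u \<in> Units R" using u by (auto simp: central_units_def)
  then obtain v where v: "v \<in> carrier R" "v \<otimes> u = \<one>" "u \<otimes> v = \<one>" by (auto simp: Units_def)
  have one: "\<one>\<^bsub>PR\<^esub> = single R {#} \<one>"
    unfolding PR_eq P.MA_simps(2) by (simp add: free_comm_monoid_def)
  have s: "single R {#} r \<in> carrier PR" if "r \<in> carrier R" for r
    using P.single_closed[of "{#}" r] that by (simp add: PR_eq free_comm_monoid_def monomials_def)
  have "single R {#} u \<otimes>\<^bsub>PR\<^esub> single R {#} v = \<one>\<^bsub>PR\<^esub>" "single R {#} v \<otimes>\<^bsub>PR\<^esub> single R {#} u = \<one>\<^bsub>PR\<^esub>"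
    unfolding PR_const_mult(1)[OF uc(1) s[OF v(1)]] PR_const_mult(1)[OF v(1) s[OF uc(1)]] one
    using uc v by (auto simp: single_def fun_eq_iff)
  then have "single R {#} u \<in> Units PR" using s[OF uc(1)] s[OF v(1)] unfolding Units_def by blast
  moreover have "single R {#} u \<otimes>\<^bsub>PR\<^esub> f = f \<otimes>\<^bsub>PR\<^esub> single R {#} u" if "f \<in> carrier PR" for f
    using that u uc by (auto simp: PR_const_mult central_units_def PR_carrier)
  ultimately show ?thesis by (simp add: central_units_def)
qed

lemma coord_ring_PR: "coord_ring PR (I \<times> monomials V) (\<lambda>c. single R {#} (scal c)) pcoord p\<gamma>"
proof (intro coord_ring.intro coord_ring_axioms.intro)
  interpret PR: ring PR unfolding PR_eq by (rule P.MA_ring)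
  have zero: "\<zero>\<^bsub>PR\<^esub> = (\<lambda>m. \<zero>)" and add: "\<And>f g. f \<oplus>\<^bsub>PR\<^esub> g = (\<lambda>m. f m \<oplus> g m)"
    by (simp_all add: PR_eq P.MA_simps)
  show "ring PR" by (rule PR.ring_axioms)
  show "\<one>\<^bsub>PR\<^esub> \<noteq> \<zero>\<^bsub>PR\<^esub>"
    using one_neq_zero unfolding zero by (auto simp: PR_eq P.MA_simps(2) single_def fun_eq_iff)
  fix f assume f: "f \<in> carrier PR"
  then have car: "f m \<in> carrier R" for m by (simp add: PR_carrier)
  show "f = \<zero>\<^bsub>PR\<^esub>" if "\<And>x. pcoord f x = 0"
  proof
    fix m
    have "\<phi> (f m) p = 0" for p using that[of "(p, m)"] by (simp add: pcoord_def)
    then show "f m = \<zero>\<^bsub>PR\<^esub> m" using coord_inj car by (simp add: zero)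
  qed
  have "finite ((\<Union>m\<in>supp R f. {p. \<phi> (f m) p \<noteq> 0}) \<times> supp R f)"
    using f car by (auto simp: PR_carrier coord_finite)
  then show "finite {x. pcoord f x \<noteq> 0}" using pcoord_supp[OF f] by (rule finite_subset[rotated])
  fix x
  show "x \<in> I \<times> monomials V" if "pcoord f x \<noteq> 0"
  proof -
    obtain p m where x: "x = (p, m)" by (cases x)
    have "\<phi> (f m) p \<noteq> 0" "m \<in> supp R f" 
      using that subsetD[OF pcoord_supp[OF f], of "(p, m)"] by (auto simp: x pcoord_def)
    then show ?thesis using f coord_supp[OF car] by (auto simp: PR_carrier x)
  qed
  show "pcoord (single R {#} (scal c) \<otimes>\<^bsub>PR\<^esub> f) x = c * pcoord f x" if c: "c \<noteq> 0" for c
  proof -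
    have "scal c \<in> carrier R" using scal_central_unit[OF c] by (auto simp: central_units_def)
    then show ?thesis using car f c by (simp add: PR_const_mult pcoord_def coord_scal split_beta)
  qed
  fix g assume g: "g \<in> carrier PR"
  then show "pcoord (f \<oplus>\<^bsub>PR\<^esub> g) x = pcoord f x + pcoord g x"
    using car by (simp add: PR_carrier pcoord_def add coord_add split_beta)
  show "pcoord (f \<otimes>\<^bsub>PR\<^esub> g) l
    = (\<Sum>x | pcoord f x \<noteq> 0. \<Sum>y | pcoord g y \<noteq> 0. pcoord f x * pcoord g y * p\<gamma> x y l)" for l
    by (rule pcoord_mult[OF f g])
qed (auto intro: PR_central_unit scal_central_unit)

text \<open>
  For infinite \<open>V\<close> no monomial order has finite down-sets. Counting the indeterminates that do not
  occur in \<open>f\<close> first confines the factors of \<open>f\<close> to the finitely many indeterminates of \<open>f\<close>.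
\<close>

lemma FFD_polynomial_ring: "FFD PR"
proof -
  interpret C: coord_ring PR "I \<times> monomials V" "\<lambda>c. single R {#} (scal c)" pcoord p\<gamma>
    by (rule coord_ring_PR)
  show ?thesis
  proof (rule C.FFD_coord)
    fix f assume f: "f \<in> carrier PR"
    define V0 where "V0 = (\<Union>m\<in>supp R f. set_mset m)"
    have V0: "finite V0" using f by (auto simp: V0_def PR_carrier)
    define t where "t x = size (filter_mset (\<lambda>v. v \<notin> V0) (snd x))" for x :: "'i \<times> 'v multiset"
    define T where "T x = W (fst x) + size (snd x)" for x :: "'i \<times> 'v multiset"
    obtain lt1 where lt1: "mono_order I lt1" using index_order by blast
    obtain lt2 where lt2: "mono_order (UNIV :: 'v multiset set) lt2" using mono_order_multiset by blast
    have V_add: "m + m' \<in> monomials V" if "m \<in> monomials V" "m' \<in> monomials V" for m m'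
      using that by (auto simp: monomials_def)
    have lt2': "mono_order (monomials V) lt2"
      using mono_order_subset[OF lt2, of "monomials V"] V_add by blast
    define lt3 where "lt3 = (\<lambda>x y. lt1 (fst x) (fst y) \<or> fst x = fst y \<and> lt2 (snd x) (snd y))"
    define lt4 where "lt4 = (\<lambda>x y. T x < T y \<or> T x = T y \<and> lt3 x y)"
    \<comment> \<open>The key \<open>t\<close> has to precede \<open>T\<close>: for infinite
      \<open>V\<close> a bound on \<open>T\<close> alone leaves infinitely many monomials, whereas
      \<open>t = 0\<close> confines them to the finite set \<open>V0\<close>.\<close>
    define lt where "lt = (\<lambda>x y. t x < t y \<or> t x = t y \<and> lt4 x y)"
    have lt3: "mono_order (I \<times> monomials V) lt3"
      unfolding lt3_def by (rule mono_order_prod[OF lt1 lt2'])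
    have lt4: "mono_order (I \<times> monomials V) lt4"
      unfolding lt4_def using lt3 by (rule mono_order_key) (auto simp: T_def weight_add)
    have t_add: "t (x + y) = t x + t y" for x y by (simp add: t_def)
    have T_add: "T (x + y) = T x + T y" if "x \<in> I \<times> monomials V" "y \<in> I \<times> monomials V" for x y
      using that by (auto simp: T_def weight_add)
    have lt: "mono_order (I \<times> monomials V) lt"
      unfolding lt_def using lt4 by (rule mono_order_key) (rule t_add)
    have "triangular_product (I \<times> monomials V) lt p\<gamma>"
    proof (intro triangular_product.intro lt triangular_product_axioms.intro)
      fix x y assume xy: "x \<in> I \<times> monomials V" "y \<in> I \<times> monomials V"
      then show "p\<gamma> x y (x + y) \<noteq> 0" using lead_nonzero by (auto simp: p\<gamma>_def)
      fix z assume "p\<gamma> x y z \<noteq> 0"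
      then have z: "snd z = snd x + snd y" "\<gamma> (fst x) (fst y) (fst z) \<noteq> 0"
        by (auto simp: p\<gamma>_def split: if_splits)
      then have "fst z \<in> I \<and> (fst z = fst x + fst y \<or> W (fst z) < W (fst x + fst y))"
        using lower_weight[of "fst x" "fst y" "fst z"] xy by auto
      then show "z \<in> I \<times> monomials V \<and> (z = x + y \<or> lt z (x + y))"
        using z(1) xy V_add by (auto simp: prod_eq_iff lt_def lt4_def t_def T_def mem_Times_iff)
    qed
    moreover have "finite {x \<in> I \<times> monomials V. \<exists>i\<in>I \<times> monomials V. \<exists>j\<in>I \<times> monomials V.
        i + j = l \<and> (x = i \<or> lt x i \<or> x = j \<or> lt x j)}" if l: "pcoord f l \<noteq> 0" for l
    proof (rule finite_subset)
      show "finite ({p \<in> I. W p \<le> T l} \<times> {m \<in> monomials V0. size m \<le> T l})"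
        using weight_finite finite_bounded_monomials[OF V0] by simp
      show "{x \<in> I \<times> monomials V. \<exists>i\<in>I \<times> monomials V. \<exists>j\<in>I \<times> monomials V.
          i + j = l \<and> (x = i \<or> lt x i \<or> x = j \<or> lt x j)}
        \<subseteq> {p \<in> I. W p \<le> T l} \<times> {m \<in> monomials V0. size m \<le> T l}"
      proof
        fix x assume "x \<in> {x \<in> I \<times> monomials V. \<exists>i\<in>I \<times> monomials V. \<exists>j\<in>I \<times> monomials V.
          i + j = l \<and> (x = i \<or> lt x i \<or> x = j \<or> lt x j)}"
        then obtain i j where x: "x \<in> I \<times> monomials V" "i \<in> I \<times> monomials V" "j \<in> I \<times> monomials V"
          "i + j = l" "x = i \<or> lt x i \<or> x = j \<or> lt x j" by blast
        have "snd l \<in> supp R f" using l pcoord_supp[OF f] by auto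
        then have "t l = 0" by (auto simp: t_def V0_def)
        then have tT: "t i = 0" "t j = 0" "T i \<le> T l" "T j \<le> T l"
          using t_add[of i j] T_add[OF x(2,3)] x(4) by auto
        have "t x = 0 \<and> T x \<le> T l"
          using x(5)
        proof (elim disjE)
          assume "lt x i" with tT show ?thesis by (auto simp: lt_def lt4_def)
        next
          assume "lt x j" with tT show ?thesis by (auto simp: lt_def lt4_def)
        qed (use tT in simp_all)
        moreover from this have "filter_mset (\<lambda>v. v \<notin> V0) (snd x) = {#}" by (simp add: t_def)
        then have "set_mset (snd x) \<subseteq> V0" by (metis (mono_tags, lifting) empty_not_add_mset
          filter_mset_add_mset multi_member_split subsetI)
        ultimately show "x \<in> {p \<in> I. W p \<le> T l} \<times> {m \<in> monomials V0. size m \<le> T l}"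
          using x(1) by (auto simp: T_def mem_Times_iff monomials_def)
      qed
    qed
    ultimately show "\<exists>lt. triangular_product (I \<times> monomials V) lt p\<gamma> \<and> (\<forall>l. pcoord f l \<noteq> 0 \<longrightarrow>
      finite {x \<in> I \<times> monomials V. \<exists>i\<in>I \<times> monomials V. \<exists>j\<in>I \<times> monomials V.
        i + j = l \<and> (x = i \<or> lt x i \<or> x = j \<or> lt x j)})" by blast
  qed
qed

end

end

section \<open>Quotients of monoid algebras\<close>

lemma kfield_simps [simp]:
  "carrier (kfield :: 'k::field ring) = UNIV" "\<one>\<^bsub>(kfield :: 'k ring)\<^esub> = 1" "\<zero>\<^bsub>(kfield :: 'k ring)\<^esub> = 0"
  "a \<otimes>\<^bsub>(kfield :: 'k ring)\<^esub> b = a * b" "a \<oplus>\<^bsub>(kfield :: 'k ring)\<^esub> b = a + b"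
  by (simp_all add: ring_of_type_algebra_def)

lemma kfield_ring: "ring (kfield :: 'k::field ring)"
  by (rule ring_from_type_algebra)

text \<open>The argument \<open>type_k\<close> fixes the ground field, which is not visible in the
  type of \<open>M\<close>.\<close>

locale k_monoid_alg = M: monoid M for M :: "('a, 'n) monoid_scheme" +
  fixes type_k :: "'k::field itself"
begin

definition "F = (monoid_algebra kfield M :: ('k, 'a \<Rightarrow> 'k) module)"

sublocale MA: monoid_alg "kfield :: 'k ring" M
  using kfield_ring M.monoid_axioms by (simp add: monoid_alg_def)

lemma F_simps:
  "f \<in> carrier F \<longleftrightarrow> finite {a. f a \<noteq> 0} \<and> {a. f a \<noteq> 0} \<subseteq> carrier M"
  "\<zero>\<^bsub>F\<^esub> = (\<lambda>a. 0)" "\<one>\<^bsub>F\<^esub> = basis_elt \<one>\<^bsub>M\<^esub>" "f \<oplus>\<^bsub>F\<^esub> g = (\<lambda>a. f a + g a)" "c \<odot>\<^bsub>F\<^esub> f = (\<lambda>a. c * f a)"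
  by (auto simp: F_def monoid_algebra_def supp_def basis_elt_def fun_eq_iff)

lemma single_basis: "single kfield a r = r \<odot>\<^bsub>F\<^esub> basis_elt a"
  by (auto simp: single_def basis_elt_def F_simps fun_eq_iff)

lemma basis_closed: "a \<in> carrier M \<Longrightarrow> basis_elt a \<in> carrier F"
  by (auto simp: F_simps basis_elt_def)

lemma basis_mult: "\<lbrakk>a \<in> carrier M; b \<in> carrier M\<rbrakk> \<Longrightarrow> basis_elt a \<otimes>\<^bsub>F\<^esub> basis_elt b = basis_elt (a \<otimes>\<^bsub>M\<^esub> b)"
  using MA.single_mult[of a b 1 1] by (simp add: F_def single_def basis_elt_def cong: if_cong)

lemma F_induct [consumes 1, case_names zero basis add]:
  assumes "f \<in> carrier F" "P \<zero>\<^bsub>F\<^esub>" "\<And>a c. a \<in> carrier M \<Longrightarrow> P (c \<odot>\<^bsub>F\<^esub> basis_elt a)"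
    and "\<And>f g. \<lbrakk>f \<in> carrier F; g \<in> carrier F; P f; P g\<rbrakk> \<Longrightarrow> P (f \<oplus>\<^bsub>F\<^esub> g)"
  shows "P f"
  using assms(1)[unfolded F_def]
proof (induction rule: MA.MA_induct)
  case (single a r)
  then show ?case using assms(3) single_basis by simp
qed (use assms in \<open>simp_all add: F_def\<close>)

sublocale F: k_algebra F
proof (intro k_algebra.intro k_space.intro k_space_axioms.intro k_algebra_axioms.intro)
  interpret ring F unfolding F_def by (rule MA.MA_ring)
  have sc: "c \<odot>\<^bsub>F\<^esub> f \<in> carrier F" if "f \<in> carrier F" for c and f :: "'a \<Rightarrow> 'k"
  proof -
    have "{a. c * f a \<noteq> 0} \<subseteq> {a. f a \<noteq> 0}" by auto
    then show ?thesis using that by (auto simp: F_simps intro: finite_subset)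
  qed
  show "ring F" "abelian_group F" by (rule ring_axioms abelian_group_axioms)+
  fix f g :: "'a \<Rightarrow> 'k" and c d assume f: "f \<in> carrier F"
  show "c \<odot>\<^bsub>F\<^esub> f \<in> carrier F" using f by (rule sc)
  show "(c + d) \<odot>\<^bsub>F\<^esub> f = c \<odot>\<^bsub>F\<^esub> f \<oplus>\<^bsub>F\<^esub> d \<odot>\<^bsub>F\<^esub> f" by (simp add: F_simps algebra_simps)
  show "(c * d) \<odot>\<^bsub>F\<^esub> f = c \<odot>\<^bsub>F\<^esub> (d \<odot>\<^bsub>F\<^esub> f)" by (simp add: F_simps algebra_simps)
  show "1 \<odot>\<^bsub>F\<^esub> f = f" by (simp add: F_simps)
  assume g: "g \<in> carrier F"
  have distr: "c \<odot>\<^bsub>F\<^esub> (h \<oplus>\<^bsub>F\<^esub> h') = c \<odot>\<^bsub>F\<^esub> h \<oplus>\<^bsub>F\<^esub> c \<odot>\<^bsub>F\<^esub> h'" for h h'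
    by (simp add: F_simps algebra_simps)
  then show "c \<odot>\<^bsub>F\<^esub> (f \<oplus>\<^bsub>F\<^esub> g) = c \<odot>\<^bsub>F\<^esub> f \<oplus>\<^bsub>F\<^esub> c \<odot>\<^bsub>F\<^esub> g" .
  have sz: "c \<odot>\<^bsub>F\<^esub> \<zero>\<^bsub>F\<^esub> = \<zero>\<^bsub>F\<^esub>" by (simp add: F_simps)
  have bb: "(r \<odot>\<^bsub>F\<^esub> basis_elt a) \<otimes>\<^bsub>F\<^esub> (s \<odot>\<^bsub>F\<^esub> basis_elt b) = (r * s) \<odot>\<^bsub>F\<^esub> basis_elt (a \<otimes>\<^bsub>M\<^esub> b)"
    if "a \<in> carrier M" "b \<in> carrier M" for a b and r s :: 'k
    using MA.single_mult[of a b r s] that unfolding single_basis by (simp add: F_def)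
  have ss: "r \<odot>\<^bsub>F\<^esub> (s \<odot>\<^bsub>F\<^esub> h) = (r * s) \<odot>\<^bsub>F\<^esub> h" for r s h by (simp add: F_simps mult.assoc)
  have "(c \<odot>\<^bsub>F\<^esub> f) \<otimes>\<^bsub>F\<^esub> g = c \<odot>\<^bsub>F\<^esub> (f \<otimes>\<^bsub>F\<^esub> g) \<and> f \<otimes>\<^bsub>F\<^esub> (c \<odot>\<^bsub>F\<^esub> g) = c \<odot>\<^bsub>F\<^esub> (f \<otimes>\<^bsub>F\<^esub> g)"
    using f
  proof (induction rule: F_induct)
    case zero
    show ?case using g sc by (simp add: sz)
  next
    case (basis a r)
    show ?case using g
    proof (induction rule: F_induct)
      case zero
      show ?case using basis_closed[OF basis] sc by (simp add: sz)
    next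
      case (basis b s)
      then show ?case using \<open>a \<in> carrier M\<close> by (simp add: ss bb) (simp add: mult_ac)
    next
      case (add g g')
      then show ?case using basis_closed[OF basis] sc by (simp add: distr r_distr)
    qed
  next
    case (add f f')
    then show ?case using g sc by (simp add: distr l_distr)
  qed
  then show "(c \<odot>\<^bsub>F\<^esub> f) \<otimes>\<^bsub>F\<^esub> g = c \<odot>\<^bsub>F\<^esub> (f \<otimes>\<^bsub>F\<^esub> g)" "f \<otimes>\<^bsub>F\<^esub> (c \<odot>\<^bsub>F\<^esub> g) = c \<odot>\<^bsub>F\<^esub> (f \<otimes>\<^bsub>F\<^esub> g)"
    by auto
qed

end

section \<open>Linear functionals on monoid algebras and their descent to quotients\<close>

definition lin :: "('a \<Rightarrow> 'k::field) \<Rightarrow> ('a \<Rightarrow> 'k) \<Rightarrow> 'k" where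
  "lin \<sigma> f = (\<Sum>a | f a \<noteq> 0. f a * \<sigma> a)"

lemma lin_superset: "\<lbrakk>finite S; {a. f a \<noteq> 0} \<subseteq> S\<rbrakk> \<Longrightarrow> lin \<sigma> f = (\<Sum>a\<in>S. f a * \<sigma> a)"
  unfolding lin_def by (rule sum.mono_neutral_left) auto

lemma lin_basis: "lin \<sigma> (basis_elt a) = \<sigma> a"
  using lin_superset[of "{a}" "basis_elt a" \<sigma>] by (auto simp: basis_elt_def)

lemma lin_add:
  assumes "finite {a. f a \<noteq> 0}" "finite {a. g a \<noteq> 0}"
  shows "lin \<sigma> (\<lambda>a. f a + g a) = lin \<sigma> f + lin \<sigma> g"
proof -
  let ?S = "{a. f a \<noteq> 0} \<union> {a. g a \<noteq> 0}"
  have "lin \<sigma> (\<lambda>a. f a + g a) = (\<Sum>a\<in>?S. (f a + g a) * \<sigma> a)"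
    "lin \<sigma> f = (\<Sum>a\<in>?S. f a * \<sigma> a)" "lin \<sigma> g = (\<Sum>a\<in>?S. g a * \<sigma> a)"
    using assms by (intro lin_superset; auto)+
  then show ?thesis by (simp add: distrib_right sum.distrib)
qed

lemma lin_smult: "lin \<sigma> (\<lambda>a. c * f a) = c * lin \<sigma> f"
  by (cases "c = 0") (simp_all add: lin_def sum_distrib_left mult.assoc)

context k_monoid_alg
begin

lemma lin_F_add: "\<lbrakk>f \<in> carrier F; g \<in> carrier F\<rbrakk> \<Longrightarrow> lin \<sigma> (f \<oplus>\<^bsub>F\<^esub> g) = lin \<sigma> f + lin \<sigma> g"
  unfolding F_simps(4) by (rule lin_add) (auto simp: F_simps)

lemma lin_F_smult: "lin \<sigma> (c \<odot>\<^bsub>F\<^esub> f) = c * lin \<sigma> f"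
  unfolding F_simps(5) by (rule lin_smult)

lemma lin_F_zero: "lin \<sigma> \<zero>\<^bsub>F\<^esub> = 0"
  by (simp add: F_simps lin_def)

lemma lin_F_minus:
  assumes "f \<in> carrier F" "g \<in> carrier F" shows "lin \<sigma> (f \<ominus>\<^bsub>F\<^esub> g) = lin \<sigma> f - lin \<sigma> g"
proof -
  have "f \<ominus>\<^bsub>F\<^esub> g = f \<oplus>\<^bsub>F\<^esub> (- 1) \<odot>\<^bsub>F\<^esub> g" using assms by (simp add: a_minus_def F.smult_minus_one)
  then show ?thesis using assms by (simp add: lin_F_add lin_F_smult)
qed

text \<open>Shifts the context from the element to the functional, so that a relation between two
  words is tested by evaluating a function on words.\<close>

lemma lin_translate:
  assumes f: "f \<in> carrier F" and u: "u \<in> carrier M" and v: "v \<in> carrier M"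
  shows "lin \<sigma> (basis_elt u \<otimes>\<^bsub>F\<^esub> f \<otimes>\<^bsub>F\<^esub> basis_elt v) = lin (\<lambda>w. \<sigma> (u \<otimes>\<^bsub>M\<^esub> w \<otimes>\<^bsub>M\<^esub> v)) f"
  using f
proof (induction rule: F_induct)
  case zero
  then show ?case using u v basis_closed by (simp add: lin_F_zero)
next
  case (basis a c)
  then show ?case using u v
    by (simp add: F.smult_mult_right F.smult_mult_left basis_closed basis_mult lin_F_smult lin_basis)
next
  case (add f g)
  then show ?case using u v basis_closed by (simp add: F.l_distr F.r_distr lin_F_add)
qed

end

locale k_quotient = F: k_algebra F for F :: "('k::field, 'a, 'm) module_scheme" (structure) +
  fixes E :: "('a \<times> 'a) set"
  assumes E_closed: "E \<subseteq> carrier F \<times> carrier F"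
begin

definition "J = relation_ideal F E"
definition "A = impose F E"
definition "\<pi> f = J +> f"

lemma relation_gens: "{l \<ominus> r | l r. (l, r) \<in> E} \<subseteq> carrier F"
  using E_closed by auto

sublocale J: ideal J F
  unfolding J_def relation_ideal_def using F.genideal_ideal[OF relation_gens] .

lemma A_simps:
  "carrier A = a_rcosets J" "x \<otimes>\<^bsub>A\<^esub> y = [mod J:] x \<Otimes> y" "\<one>\<^bsub>A\<^esub> = J +> \<one>" "\<zero>\<^bsub>A\<^esub> = J"
  "x \<oplus>\<^bsub>A\<^esub> y = x <+> y" "c \<odot>\<^bsub>A\<^esub> x = (\<Union>f\<in>x. J +> (c \<odot> f))"
  by (simp_all add: A_def impose_def quotient_algebra_def FactRing_def J_def[symmetric]
      ring.defs module.defs)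

lemma pi_closed: "f \<in> carrier F \<Longrightarrow> \<pi> f \<in> carrier A"
  unfolding A_simps \<pi>_def using F.a_rcosetsI[OF J.a_subset] by blast

lemma pi_surj: "x \<in> carrier A \<Longrightarrow> \<exists>f\<in>carrier F. x = \<pi> f"
  unfolding A_simps \<pi>_def A_RCOSETS_def' by auto

lemma pi_add: "\<lbrakk>f \<in> carrier F; g \<in> carrier F\<rbrakk> \<Longrightarrow> \<pi> (f \<oplus> g) = \<pi> f \<oplus>\<^bsub>A\<^esub> \<pi> g"
  unfolding A_simps \<pi>_def by (simp add: J.a_rcos_sum)

lemma pi_mult: "\<lbrakk>f \<in> carrier F; g \<in> carrier F\<rbrakk> \<Longrightarrow> \<pi> (f \<otimes> g) = \<pi> f \<otimes>\<^bsub>A\<^esub> \<pi> g"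
  unfolding A_simps \<pi>_def by (simp add: J.rcoset_mult_add)

lemma pi_one: "\<pi> \<one> = \<one>\<^bsub>A\<^esub>"
  by (simp add: A_simps \<pi>_def)

lemma pi_zero: "\<pi> \<zero> = \<zero>\<^bsub>A\<^esub>"
  using J.a_rcos_const[of \<zero>] by (simp add: A_simps \<pi>_def J.zero_closed)

lemma pi_eq_iff: "\<lbrakk>f \<in> carrier F; g \<in> carrier F\<rbrakk> \<Longrightarrow> \<pi> f = \<pi> g \<longleftrightarrow> f \<ominus> g \<in> J"
  unfolding \<pi>_def using F.quotient_eq_iff_same_a_r_cos[OF J.is_ideal] by blast

lemma J_smult: "f \<in> J \<Longrightarrow> c \<odot> f \<in> J"
  using J.I_l_closed[of f "c \<odot> \<one>"] J.a_Hcarr by (simp add: F.smult_mult_left)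

lemma pi_smult: assumes f: "f \<in> carrier F" shows "\<pi> (c \<odot> f) = c \<odot>\<^bsub>A\<^esub> \<pi> f"
proof -
  have "J +> (c \<odot> g) = J +> (c \<odot> f)" if g: "g \<in> J +> f" for g
  proof -
    obtain h where h: "h \<in> J" "g = h \<oplus> f" using g by (auto simp: a_r_coset_def')
    then have hc: "h \<in> carrier F" using J.a_Hcarr by blast
    have "c \<odot> g \<ominus> c \<odot> f = c \<odot> h"
      using h hc f by (simp add: F.smult_r_distr a_minus_def F.a_assoc F.r_neg)
    then show ?thesis
      using pi_eq_iff[of "c \<odot> g" "c \<odot> f"] h hc f J_smult[of h c] by (simp add: \<pi>_def)
  qed
  moreover have "f \<in> J +> f" using f J.a_rcos_self by blast
  ultimately show ?thesis unfolding A_simps \<pi>_def by blast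
qed

lemma A_ring: "ring A"
proof -
  interpret Q: ring "F Quot J" by (rule J.quotient_is_ring)
  have eqs: "carrier A = carrier (F Quot J)" "monoid.mult A = monoid.mult (F Quot J)" "\<one>\<^bsub>A\<^esub> = \<one>\<^bsub>F Quot J\<^esub>"
    "\<zero>\<^bsub>A\<^esub> = \<zero>\<^bsub>F Quot J\<^esub>" "add A = add (F Quot J)"
    by (simp_all add: A_def impose_def quotient_algebra_def J_def[symmetric] ring.defs module.defs)
  show ?thesis
  proof (rule ringI)
    show "abelian_group A"
    proof (rule abelian_groupI)
      fix x assume "x \<in> carrier A"
      then show "\<exists>y\<in>carrier A. y \<oplus>\<^bsub>A\<^esub> x = \<zero>\<^bsub>A\<^esub>"
        using Q.l_neg Q.a_inv_closed by (auto simp: eqs)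
    qed (simp_all add: eqs Q.a_ac)
    show "monoid A" by (rule monoidI) (simp_all add: eqs Q.m_assoc)
  qed (simp_all add: eqs Q.l_distr Q.r_distr)
qed

sublocale A: k_algebra A
proof (intro k_algebra.intro k_space.intro k_space_axioms.intro k_algebra_axioms.intro)
  interpret ring A by (rule A_ring)
  show "ring A" "abelian_group A" by (rule A_ring abelian_group_axioms)+
  fix x y c d assume x: "x \<in> carrier A"
  then obtain f where f: "f \<in> carrier F" "x = \<pi> f" using pi_surj by blast
  show "c \<odot>\<^bsub>A\<^esub> x \<in> carrier A" using f by (simp add: pi_smult[symmetric] pi_closed)
  show "(c + d) \<odot>\<^bsub>A\<^esub> x = c \<odot>\<^bsub>A\<^esub> x \<oplus>\<^bsub>A\<^esub> d \<odot>\<^bsub>A\<^esub> x"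
    using f by (simp add: pi_smult[symmetric] pi_add[symmetric] F.smult_l_distr)
  show "(c * d) \<odot>\<^bsub>A\<^esub> x = c \<odot>\<^bsub>A\<^esub> (d \<odot>\<^bsub>A\<^esub> x)" using f by (simp add: pi_smult[symmetric] F.smult_assoc)
  show "1 \<odot>\<^bsub>A\<^esub> x = x" using f by (simp add: pi_smult[symmetric])
  assume y: "y \<in> carrier A"
  then obtain g where g: "g \<in> carrier F" "y = \<pi> g" using pi_surj by blast
  show "c \<odot>\<^bsub>A\<^esub> (x \<oplus>\<^bsub>A\<^esub> y) = c \<odot>\<^bsub>A\<^esub> x \<oplus>\<^bsub>A\<^esub> c \<odot>\<^bsub>A\<^esub> y"
    using f g by (simp add: pi_smult[symmetric] pi_add[symmetric] F.smult_r_distr)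
  show "(c \<odot>\<^bsub>A\<^esub> x) \<otimes>\<^bsub>A\<^esub> y = c \<odot>\<^bsub>A\<^esub> (x \<otimes>\<^bsub>A\<^esub> y)" "x \<otimes>\<^bsub>A\<^esub> (c \<odot>\<^bsub>A\<^esub> y) = c \<odot>\<^bsub>A\<^esub> (x \<otimes>\<^bsub>A\<^esub> y)"
    using f g by (simp_all add: pi_smult[symmetric] pi_mult[symmetric] F.smult_mult_left F.smult_mult_right)
qed

lemma pi_relation: assumes "(l, r) \<in> E" shows "\<pi> l = \<pi> r"
proof -
  have "l \<ominus> r \<in> J"
    unfolding J_def relation_ideal_def using F.genideal_self[OF relation_gens] assms by blast
  then show ?thesis using pi_eq_iff assms E_closed by blast
qed

lemma pi_minus: "\<lbrakk>f \<in> carrier F; g \<in> carrier F\<rbrakk> \<Longrightarrow> \<pi> (f \<ominus> g) = \<pi> f \<ominus>\<^bsub>A\<^esub> \<pi> g"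
  by (simp add: a_minus_def pi_add pi_smult pi_closed flip: F.smult_minus_one A.smult_minus_one)

text \<open>\<open>K\<close> is the largest two-sided ideal on which \<open>\<xi>\<close> vanishes.
  Respecting the relations in every context puts them into \<open>K\<close>, so \<open>K\<close>
  contains the whole relation ideal and the values of \<open>\<xi>\<close> depend on cosets
  only.\<close>

lemma lift_functional:
  fixes \<xi> :: "'a \<Rightarrow> 'p \<Rightarrow> 'k"
  assumes add: "\<And>f g p. \<lbrakk>f \<in> carrier F; g \<in> carrier F\<rbrakk> \<Longrightarrow> \<xi> (f \<oplus> g) p = \<xi> f p + \<xi> g p"
    and smult: "\<And>f c p. f \<in> carrier F \<Longrightarrow> \<xi> (c \<odot> f) p = c * \<xi> f p"
    and rel: "\<And>u v l r p. \<lbrakk>u \<in> carrier F; v \<in> carrier F; (l, r) \<in> E\<rbrakk> \<Longrightarrow> \<xi> (u \<otimes> l \<otimes> v) p = \<xi> (u \<otimes> r \<otimes> v) p"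
  shows "\<exists>\<phi>. (\<forall>f\<in>carrier F. \<phi> (\<pi> f) = \<xi> f) \<and>
    (\<forall>a\<in>carrier A. \<forall>b\<in>carrier A. \<forall>p. \<phi> (a \<oplus>\<^bsub>A\<^esub> b) p = \<phi> a p + \<phi> b p) \<and>
    (\<forall>a\<in>carrier A. \<forall>c p. \<phi> (c \<odot>\<^bsub>A\<^esub> a) p = c * \<phi> a p)"
proof -
  have minus: "\<xi> (f \<ominus> g) p = \<xi> f p - \<xi> g p" if "f \<in> carrier F" "g \<in> carrier F" for f g p
  proof -
    have "f \<ominus> g = f \<oplus> (- 1) \<odot> g" using that by (simp add: a_minus_def F.smult_minus_one)
    then show ?thesis using that by (simp add: add smult)
  qed
  have zero: "\<xi> \<zero> p = 0" for p using smult[of \<zero> 0 p] by simp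
  define K where "K = {f \<in> carrier F. \<forall>u\<in>carrier F. \<forall>v\<in>carrier F. \<forall>p. \<xi> (u \<otimes> f \<otimes> v) p = 0}"
  have "ideal K F"
  proof (rule idealI)
    show "subgroup K (add_monoid F)"
    proof (rule F.add.subgroupI)
      fix f g assume "f \<in> K" "g \<in> K"
      then show "f \<oplus> g \<in> K" by (auto simp: K_def F.l_distr F.r_distr add)
    next
      fix f assume f: "f \<in> K"
      have "\<xi> (u \<otimes> \<ominus> f \<otimes> v) p = 0" if uv: "u \<in> carrier F" "v \<in> carrier F" for u v p
      proof -
        have "u \<otimes> \<ominus> f \<otimes> v = (- 1) \<odot> (u \<otimes> f \<otimes> v)"
          using f uv by (simp add: K_def F.l_minus F.r_minus F.smult_minus_one)
        then show ?thesis using f uv by (simp add: K_def smult)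
      qed
      then show "\<ominus>\<^bsub>F\<^esub> f \<in> K" using f by (simp add: K_def)
    qed (auto simp: K_def zero intro!: exI[of _ \<zero>])
  next
    fix a x assume ax: "a \<in> K" "x \<in> carrier F"
    then have "u \<otimes> (x \<otimes> a) \<otimes> v = (u \<otimes> x) \<otimes> a \<otimes> v" "u \<otimes> (a \<otimes> x) \<otimes> v = u \<otimes> a \<otimes> (x \<otimes> v)"
      if "u \<in> carrier F" "v \<in> carrier F" for u v
      using that by (simp_all add: K_def F.m_assoc)
    then show "x \<otimes> a \<in> K" "a \<otimes> x \<in> K" using ax by (simp_all add: K_def)
  qed (rule F.ring_axioms)
  moreover have "{l \<ominus> r | l r. (l, r) \<in> E} \<subseteq> K"
  proof safe
    fix l r assume lr: "(l, r) \<in> E"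
    then have c: "l \<in> carrier F" "r \<in> carrier F" using E_closed by auto
    have "\<xi> (u \<otimes> (l \<ominus> r) \<otimes> v) p = 0" if uv: "u \<in> carrier F" "v \<in> carrier F" for u v p
    proof -
      have "u \<otimes> (l \<ominus> r) \<otimes> v = u \<otimes> l \<otimes> v \<ominus> u \<otimes> r \<otimes> v"
        using c uv by (simp add: a_minus_def F.r_distr F.l_distr F.l_minus F.r_minus)
      then show ?thesis using c uv rel[OF uv lr] by (simp add: minus)
    qed
    then show "l \<ominus> r \<in> K" using c by (simp add: K_def)
  qed
  ultimately have "J \<subseteq> K" unfolding J_def relation_ideal_def by (rule F.genideal_minimal)
  then have J0: "\<xi> f p = 0" if "f \<in> J" for f p
  proof -
    have f: "f \<in> K" using that \<open>J \<subseteq> K\<close> by blast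
    then have "\<xi> (\<one> \<otimes> f \<otimes> \<one>) p = 0" unfolding K_def by blast
    with f show ?thesis by (simp add: K_def)
  qed
  define \<phi> where "\<phi> x = \<xi> (SOME f. f \<in> carrier F \<and> x = \<pi> f)" for x
  have phi: "\<phi> (\<pi> f) = \<xi> f" if f: "f \<in> carrier F" for f
  proof -
    have "\<exists>g. g \<in> carrier F \<and> \<pi> f = \<pi> g" using f by blast
    then have g: "(SOME g. g \<in> carrier F \<and> \<pi> f = \<pi> g) \<in> carrier F \<and> \<pi> f = \<pi> (SOME g. g \<in> carrier F \<and> \<pi> f = \<pi> g)"
      by (rule someI_ex)
    then have "f \<ominus> (SOME g. g \<in> carrier F \<and> \<pi> f = \<pi> g) \<in> J" using pi_eq_iff f by blast
    then have "\<xi> f p - \<xi> (SOME g. g \<in> carrier F \<and> \<pi> f = \<pi> g) p = 0" for p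
      using J0[of _ p] minus[OF f conjunct1[OF g], of p] by metis
    then show ?thesis by (simp add: \<phi>_def fun_eq_iff)
  qed
  have "\<phi> (a \<oplus>\<^bsub>A\<^esub> b) p = \<phi> a p + \<phi> b p" if ab: "a \<in> carrier A" "b \<in> carrier A" for a b p
  proof -
    obtain f g where "f \<in> carrier F" "g \<in> carrier F" "a = \<pi> f" "b = \<pi> g" using pi_surj ab by meson
    then show ?thesis by (simp add: pi_add[symmetric] phi add)
  qed
  moreover have "\<phi> (c \<odot>\<^bsub>A\<^esub> a) p = c * \<phi> a p" if a: "a \<in> carrier A" for a c p
  proof -
    obtain f where "f \<in> carrier F" "a = \<pi> f" using pi_surj a by meson
    then show ?thesis by (simp add: pi_smult[symmetric] phi smult)
  qed
  ultimately show ?thesis using phi by blast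
qed

end

locale k_monoid_quotient = k_monoid_alg M type_k + k_quotient "F :: ('k, 'a \<Rightarrow> 'k) module" E
  for M :: "('a, 'n) monoid_scheme" and type_k :: "'k::field itself" and E :: "(('a \<Rightarrow> 'k) \<times> ('a \<Rightarrow> 'k)) set"
begin

text \<open>By linearity the contexts can be taken from the monoid. All independence proofs below go
  through this lemma, except for G-algebras, whose basis property is part of their
  definition.\<close>

lemma lift_monoid_functional:
  fixes \<sigma> :: "'p \<Rightarrow> 'a \<Rightarrow> 'k"
  assumes rel: "\<And>u v l r p. \<lbrakk>u \<in> carrier M; v \<in> carrier M; (l, r) \<in> E\<rbrakk> \<Longrightarrow>
    lin (\<lambda>w. \<sigma> p (u \<otimes>\<^bsub>M\<^esub> w \<otimes>\<^bsub>M\<^esub> v)) l = lin (\<lambda>w. \<sigma> p (u \<otimes>\<^bsub>M\<^esub> w \<otimes>\<^bsub>M\<^esub> v)) r"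
  shows "\<exists>\<phi>. (\<forall>w\<in>carrier M. \<forall>p. \<phi> (\<pi> (basis_elt w)) p = \<sigma> p w) \<and>
    (\<forall>a\<in>carrier A. \<forall>b\<in>carrier A. \<forall>p. \<phi> (a \<oplus>\<^bsub>A\<^esub> b) p = \<phi> a p + \<phi> b p) \<and>
    (\<forall>a\<in>carrier A. \<forall>c p. \<phi> (c \<odot>\<^bsub>A\<^esub> a) p = c * \<phi> a p)"
proof -
  have "lin (\<sigma> p) (u \<otimes>\<^bsub>F\<^esub> l \<otimes>\<^bsub>F\<^esub> v) = lin (\<sigma> p) (u \<otimes>\<^bsub>F\<^esub> r \<otimes>\<^bsub>F\<^esub> v)"
    if u: "u \<in> carrier F" and v: "v \<in> carrier F" and lr: "(l, r) \<in> E" for u v l r p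
  proof -
    have c: "l \<in> carrier F" "r \<in> carrier F" using lr E_closed by auto
    show ?thesis using u
    proof (induction rule: F_induct)
      case zero
      show ?case using c v by simp
    next
      case (basis a s)
      show ?case using v
      proof (induction rule: F_induct)
        case zero
        show ?case using c basis_closed[OF basis] by simp
      next
        case (basis b t)
        then show ?case
          using c \<open>a \<in> carrier M\<close> rel[OF \<open>a \<in> carrier M\<close> basis lr] basis_closed
          by (simp add: F.smult_mult_left F.smult_mult_right lin_F_smult lin_translate)
      next
        case (add f g)
        then show ?case using c basis_closed[OF basis] by (simp add: F.r_distr lin_F_add)
      qed
    next
      case (add f g)
      then show ?case using c v by (simp add: F.l_distr lin_F_add)
    qed
  qed
  from lift_functional[of "\<lambda>f p. lin (\<sigma> p) f", OF lin_F_add lin_F_smult this]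
  obtain \<phi> where "\<forall>f\<in>carrier F. \<phi> (\<pi> f) = (\<lambda>p. lin (\<sigma> p) f)"
    "\<forall>a\<in>carrier A. \<forall>b\<in>carrier A. \<forall>p. \<phi> (a \<oplus>\<^bsub>A\<^esub> b) p = \<phi> a p + \<phi> b p"
    "\<forall>a\<in>carrier A. \<forall>c p. \<phi> (c \<odot>\<^bsub>A\<^esub> a) p = c * \<phi> a p" by blast
  then show ?thesis using basis_closed by (intro exI[of _ \<phi>]) (simp add: lin_basis)
qed

lemma quotient_in_lspan:
  assumes "S \<subseteq> carrier A" "\<And>w. w \<in> carrier M \<Longrightarrow> \<pi> (basis_elt w) \<in> A.lspan S" "a \<in> carrier A"
  shows "a \<in> A.lspan S"
proof -
  obtain f where f: "f \<in> carrier F" "a = \<pi> f" using pi_surj assms(3) by blast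
  show ?thesis unfolding f(2) using f(1)
  proof (induction rule: F_induct)
    case zero
    show ?case by (simp add: pi_zero A.lspan_zero)
  next
    case (basis w c)
    then show ?case using assms(2) by (simp add: pi_smult basis_closed A.lspan_smult)
  next
    case (add f g)
    then show ?case by (simp add: pi_add A.lspan_add)
  qed
qed

end

section \<open>Algebras presented by generators and relations\<close>

lemma free_monoid_monoid: "monoid (free_monoid V)"
  by (rule monoidI) (auto simp: free_monoid_def)

lemma free_monoid_simps:
  "carrier (free_monoid V) = lists V" "u \<otimes>\<^bsub>free_monoid V\<^esub> v = u @ v" "\<one>\<^bsub>free_monoid V\<^esub> = []"
  by (simp_all add: free_monoid_def)

locale free_quotient = k_monoid_quotient "free_monoid V" type_k E
  for V :: "'v set" and type_k :: "'k::field itself" and E :: "(('v list \<Rightarrow> 'k) \<times> ('v list \<Rightarrow> 'k)) set"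
begin

lemma F_eq: "F = free_algebra V"
  by (simp add: F_def free_algebra_def)

lemma A_eq: "A = impose (free_algebra V) E"
  by (simp only: A_def) (simp only: F_eq)

lemma word_closed: "w \<in> lists V \<Longrightarrow> basis_elt w \<in> carrier F"
  using basis_closed[of w] by (simp add: free_monoid_simps)

lemma word_mult: "\<lbrakk>u \<in> lists V; v \<in> lists V\<rbrakk> \<Longrightarrow> basis_elt u \<otimes>\<^bsub>F\<^esub> basis_elt v = basis_elt (u @ v)"
  using basis_mult[of u v] by (simp add: free_monoid_simps)

lemma gen_closed: "v \<in> V \<Longrightarrow> gen v \<in> carrier F"
  unfolding gen_def by (rule word_closed) simp

lemma pi_word: "w \<in> lists V \<Longrightarrow> \<pi> (basis_elt w) = A.wprod (\<lambda>v. \<pi> (gen v)) w"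
proof (induction w)
  case Nil
  then show ?case using pi_one by (simp add: F_simps free_monoid_simps)
next
  case (Cons v w)
  then have "basis_elt (v # w) = gen v \<otimes>\<^bsub>F\<^esub> basis_elt w" unfolding gen_def using word_mult[of "[v]" w] by simp
  then show ?case using Cons by (simp add: pi_mult gen_closed word_closed)
qed

lemma words_span_quotient:
  assumes x: "\<And>i. i \<in> B \<Longrightarrow> x i \<in> carrier A"
    and gens: "\<And>v. v \<in> V \<Longrightarrow> \<pi> (gen v) \<in> A.lspan (A.wprod x ` lists B)"
    and a: "a \<in> carrier A"
  shows "a \<in> A.lspan (A.wprod x ` lists B)"
proof (rule quotient_in_lspan[OF _ _ a])
  show "A.wprod x ` lists B \<subseteq> carrier A" using x by (auto intro: A.wprod_closed)
  fix w assume "w \<in> carrier (free_monoid V)"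
  then have w: "w \<in> lists V" by (simp add: free_monoid_simps)
  then have "A.wprod (\<lambda>v. \<pi> (gen v)) w \<in> A.lspan (A.wprod x ` lists B)"
  proof (induction w)
    case Nil
    have "A.wprod x [] \<in> A.wprod x ` lists B" by blast
    then show ?case by (auto intro: A.lspan_base)
  next
    case (Cons v w)
    then show ?case using A.lspan_words_mult[of B x] x gens by simp
  qed
  then show "\<pi> (basis_elt w) \<in> A.lspan (A.wprod x ` lists B)" using pi_word[OF w] by simp
qed

text \<open>\<open>\<sigma> p\<close> assigns to a word its intended coefficient at the standard
  monomial \<open>p\<close>. The map \<open>g\<close> selects the PBW generators among those of the
  presentation, which may be many more: the enveloping algebra is presented on the whole Lie
  algebra.\<close>

lemma pbw_from_words:
  fixes g :: "nat \<Rightarrow> 'v" and \<sigma> :: "nat multiset \<Rightarrow> 'v list \<Rightarrow> 'k"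
  defines "x \<equiv> \<lambda>i. \<pi> (gen (g i))"
  assumes g: "\<And>i. i \<in> {1..N} \<Longrightarrow> g i \<in> V" and w: "\<And>i. i \<in> {1..N} \<Longrightarrow> w i > 0"
    and gens: "\<And>v. v \<in> V \<Longrightarrow> \<pi> (gen v) \<in> A.lspan (A.wprod x ` lists {1..N})"
    and straighten: "\<And>i j. \<lbrakk>1 \<le> i; i < j; j \<le> N\<rbrakk> \<Longrightarrow> \<exists>c d. c \<noteq> 0 \<and> x j \<otimes>\<^bsub>A\<^esub> x i = c \<odot>\<^bsub>A\<^esub> (x i \<otimes>\<^bsub>A\<^esub> x j) \<oplus>\<^bsub>A\<^esub> d \<and>
      d \<in> A.lspan {A.wprod x (sorted_list_of_multiset m) | m. m \<in> monomials {1..N} \<and> sum_mset (image_mset w m) < w i + w j}"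
    and rel: "\<And>u v l r p. \<lbrakk>u \<in> lists V; v \<in> lists V; (l, r) \<in> E\<rbrakk> \<Longrightarrow>
      lin (\<lambda>z. \<sigma> p (u @ z @ v)) l = lin (\<lambda>z. \<sigma> p (u @ z @ v)) r"
    and std: "\<And>m p. \<lbrakk>m \<in> monomials {1..N}; p \<in> monomials {1..N}\<rbrakk> \<Longrightarrow>
      \<sigma> p (map g (sorted_list_of_multiset m)) = (if p = m then 1 else 0)"
  shows "\<exists>\<phi>. pbw_algebra A N x w \<phi>"
proof -
  have "\<exists>\<phi>. (\<forall>w\<in>lists V. \<forall>p. \<phi> (\<pi> (basis_elt w)) p = \<sigma> p w) \<and>
    (\<forall>a\<in>carrier A. \<forall>b\<in>carrier A. \<forall>p. \<phi> (a \<oplus>\<^bsub>A\<^esub> b) p = \<phi> a p + \<phi> b p) \<and>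
    (\<forall>a\<in>carrier A. \<forall>c p. \<phi> (c \<odot>\<^bsub>A\<^esub> a) p = c * \<phi> a p)"
    by (rule lift_monoid_functional[unfolded free_monoid_simps]) (use rel in simp)
  then obtain \<phi> where \<phi>: "\<And>w p. w \<in> lists V \<Longrightarrow> \<phi> (\<pi> (basis_elt w)) p = \<sigma> p w"
    "\<And>a b p. a \<in> carrier A \<Longrightarrow> b \<in> carrier A \<Longrightarrow> \<phi> (a \<oplus>\<^bsub>A\<^esub> b) p = \<phi> a p + \<phi> b p"
    "\<And>a c p. a \<in> carrier A \<Longrightarrow> \<phi> (c \<odot>\<^bsub>A\<^esub> a) p = c * \<phi> a p"
    by blast
  have xc: "x i \<in> carrier A" if "i \<in> {1..N}" for i
    unfolding x_def by (intro pi_closed gen_closed g that)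
  have xw: "A.wprod x v = \<pi> (basis_elt (map g v))" if "v \<in> lists {1..N}" for v
  proof -
    have "A.wprod x v = A.wprod (\<lambda>v. \<pi> (gen v)) (map g v)" by (induction v) (simp_all add: x_def)
    moreover have "map g v \<in> lists V" using g that by (induction v) auto
    ultimately show ?thesis by (simp add: pi_word)
  qed
  \<comment> \<open>The cut-off is needed because nothing is known about \<open>\<sigma> p\<close>
    when \<open>p\<close> is not a monomial in the chosen generators.\<close>
  have "pbw_algebra A N x w (\<lambda>a p. if p \<in> monomials {1..N} then \<phi> a p else 0)"
  proof (intro pbw_algebra.intro pbw_algebra_axioms.intro A.k_algebra_axioms)
    fix m p assume m: "m \<in> monomials {1..N}" "p \<in> monomials {1..N}"
    then have s: "sorted_list_of_multiset m \<in> lists {1..N}" by (auto simp: monomials_def)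
    then have "map g (sorted_list_of_multiset m) \<in> lists V" using g by (auto simp: in_lists_conv_set)
    then have "\<phi> (A.wprod x (sorted_list_of_multiset m)) p = (if p = m then 1 else 0)"
      using s m by (simp only: xw \<phi>(1) std)
    then show "(if p \<in> monomials {1..N} then \<phi> (A.wprod x (sorted_list_of_multiset m)) p else 0) = (if p = m then 1 else 0)"
      using m by simp
  next
    fix a assume "a \<in> carrier A"
    then show "a \<in> A.lspan (A.wprod x ` lists {1..N})" using words_span_quotient[of "{1..N}" x a] xc gens by blast
  qed (use xc w straighten \<phi> in auto)
  then show ?thesis by blast
qed

lemma pi_in_lspan:
  assumes f: "f \<in> carrier F" and T: "\<And>w. f w \<noteq> 0 \<Longrightarrow> \<pi> (basis_elt w) \<in> A.lspan T"
  shows "\<pi> f \<in> A.lspan T"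
proof -
  have "finite {w. f w \<noteq> 0}" using f by (simp add: F_simps)
  then show ?thesis using f T
  proof (induction "{w. f w \<noteq> 0}" arbitrary: f rule: finite_induct)
    case empty
    then have "f = \<zero>\<^bsub>F\<^esub>" by (auto simp: F_simps)
    then show ?case using pi_zero A.lspan_zero by simp
  next
    case (insert w S)
    define h where "h = f(w := 0)"
    have S: "S = {w. h w \<noteq> 0}" using insert(2,4) by (auto simp: h_def)
    have "{w. f w \<noteq> 0} = insert w S" using insert by simp
    then have h: "h \<in> carrier F" using S insert(1) insert.prems(1) by (auto simp: F_simps)
    have wV: "basis_elt w \<in> carrier F"
      using insert.prems(1) insert(4) basis_closed[of w] by (auto simp: F_simps(1))
    have f: "f = f w \<odot>\<^bsub>F\<^esub> basis_elt w \<oplus>\<^bsub>F\<^esub> h" by (auto simp: F_simps h_def basis_elt_def fun_eq_iff)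
    have "\<pi> h \<in> A.lspan T"
    proof (rule insert(3)[OF S h])
      show "\<pi> (basis_elt v) \<in> A.lspan T" if "h v \<noteq> 0" for v
        using that insert.prems(2)[of v] by (auto simp: h_def split: if_splits)
    qed
    moreover have "\<pi> (basis_elt w) \<in> A.lspan T" using insert.prems(2)[of w] insert(4) by auto
    moreover have "\<pi> f = f w \<odot>\<^bsub>A\<^esub> \<pi> (basis_elt w) \<oplus>\<^bsub>A\<^esub> \<pi> h"
      by (subst f) (simp only: pi_add pi_smult wV h F.smult_closed)
    ultimately show ?case by (simp add: A.lspan_add A.lspan_smult)
  qed
qed

end

section \<open>G-algebras\<close>

lemma dense_between:
  fixes L U :: "rat set"
  assumes "finite L" "finite U" "\<And>l u. \<lbrakk>l \<in> L; u \<in> U\<rbrakk> \<Longrightarrow> l < u"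
  shows "\<exists>t. (\<forall>l\<in>L. l < t) \<and> (\<forall>u\<in>U. t < u)"
proof (cases "L = {}")
  case True
  show ?thesis
  proof (cases "U = {}")
    case False
    then have "Min U - 1 < u" if "u \<in> U" for u using Min_le[OF assms(2) that] by simp
    then show ?thesis using True by blast
  qed (use True in auto)
next
  case L: False
  show ?thesis
  proof (cases "U = {}")
    case True
    have "l < Max L + 1" if "l \<in> L" for l using Max_ge[OF assms(1) that] by simp
    then show ?thesis using True by blast
  next
    case False
    then have "Max L < Min U" using assms L by simp
    then obtain t where "Max L < t" "t < Min U" using dense by blast
    then show ?thesis using assms L False by (intro exI[of _ t]) auto
  qed
qed

text \<open>Gordan's alternative, by Fourier-Motzkin elimination of the last coordinate.\<close>

lemma positive_weights:
  fixes P :: "(nat \<Rightarrow> int) set"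
  assumes add: "\<And>d e. \<lbrakk>d \<in> P; e \<in> P\<rbrakk> \<Longrightarrow> (\<lambda>i. d i + e i) \<in> P" and zero: "(\<lambda>i. 0) \<notin> P"
  shows "\<lbrakk>finite D; D \<subseteq> P; \<forall>d\<in>D. \<forall>i. i \<notin> {1..n} \<longrightarrow> d i = 0\<rbrakk> \<Longrightarrow>
    \<exists>w :: nat \<Rightarrow> rat. \<forall>d\<in>D. (\<Sum>i=1..n. w i * of_int (d i)) > 0"
proof (induction n arbitrary: D)
  case 0
  then have "d = (\<lambda>i. 0)" if "d \<in> D" for d using that by auto
  then have "D = {}" using 0 zero by blast
  then show ?case by auto
next
  case (Suc n)
  have scale: "(\<lambda>i. c * d i) \<in> P" if "c > 0" "d \<in> P" for c d
    using that(1)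
  proof (induction c rule: int_gr_induct)
    case base
    then show ?case using that by simp
  next
    case (step c)
    then show ?case using add[OF step(2) that(2)] by (simp add: algebra_simps)
  qed
  let ?m = "Suc n"
  \<comment> \<open>A combination with positive coefficients, when \<open>d\<close> is positive and
    \<open>e\<close> negative in the last coordinate, in which that coordinate cancels.\<close>
  define comb where "comb d e = (\<lambda>i. (- e ?m) * d i + d ?m * e i)" for d e :: "nat \<Rightarrow> int"
  define D' where "D' = {d \<in> D. d ?m = 0} \<union>
    (\<lambda>(d, e). comb d e) ` ({d \<in> D. d ?m > 0} \<times> {e \<in> D. e ?m < 0})"
  have fin: "finite D'" using Suc.prems(1) by (simp add: D'_def)
  have sub: "D' \<subseteq> P"
  proof
    fix h assume "h \<in> D'"
    then consider "h \<in> D" | d e where "d \<in> D" "e \<in> D" "d ?m > 0" "e ?m < 0" "h = comb d e"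
      by (auto simp: D'_def)
    then show "h \<in> P"
    proof cases
      case 1
      then show ?thesis using Suc.prems by blast
    next
      case 2
      have "(\<lambda>i. (- e ?m) * d i) \<in> P" by (rule scale) (use 2 Suc.prems(2) in auto)
      moreover have "(\<lambda>i. d ?m * e i) \<in> P" by (rule scale) (use 2 Suc.prems(2) in auto)
      ultimately show ?thesis unfolding 2(5) comb_def by (rule add)
    qed
  qed
  have van: "\<forall>d\<in>D'. \<forall>i. i \<notin> {1..n} \<longrightarrow> d i = 0"
  proof (intro ballI allI impI)
    fix h i assume h: "h \<in> D'" and i: "i \<notin> {1..n}"
    have z: "d i = 0" if "d \<in> D" "i \<noteq> ?m" for d using Suc.prems(3) that i by auto
    from h consider "h \<in> D" "h ?m = 0" | d e where "d \<in> D" "e \<in> D" "h = comb d e"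
      by (auto simp: D'_def)
    then show "h i = 0"
    proof cases
      case 1
      then show ?thesis using z[of h] by (cases "i = ?m") auto
    next
      case 2
      then show ?thesis using z[of d] z[of e] by (cases "i = ?m") (auto simp: comb_def)
    qed
  qed
  obtain w where w: "\<forall>d\<in>D'. (\<Sum>i=1..n. w i * of_int (d i)) > (0 :: rat)"
    using Suc.IH[OF fin sub van] by blast
  define s where "s d = (\<Sum>i=1..n. w i * of_int (d i))" for d :: "nat \<Rightarrow> int"
  \<comment> \<open>The last weight must exceed every element of \<open>L\<close> and stay below
    every element of \<open>U\<close>. That the vectors \<open>comb d e\<close> have positive value
    under \<open>w\<close> says exactly that these bounds are compatible.\<close>
  define L where "L = (\<lambda>d. - s d / of_int (d ?m)) ` {d \<in> D. d ?m > 0}"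
  define U where "U = (\<lambda>d. s d / of_int (- d ?m)) ` {d \<in> D. d ?m < 0}"
  have "l < u" if "l \<in> L" "u \<in> U" for l u
  proof -
    obtain d e where d: "d \<in> D" "d ?m > 0" "l = - s d / of_int (d ?m)"
      and e: "e \<in> D" "e ?m < 0" "u = s e / of_int (- e ?m)" using \<open>l \<in> L\<close> \<open>u \<in> U\<close> by (auto simp: L_def U_def)
    have "comb d e \<in> D'" using d e by (auto simp: D'_def)
    then have "0 < s (comb d e)" using w by (simp add: s_def)
    also have "s (comb d e) = of_int (- e ?m) * s d + of_int (d ?m) * s e"
      by (simp add: s_def comb_def sum_distrib_left algebra_simps sum.distrib sum_negf sum_subtractf)
    finally have pos: "0 < of_int (- e ?m) * s d + of_int (d ?m) * s e" .
    define p q :: rat where "p = of_int (d ?m)" and "q = of_int (- e ?m)"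
    have pq: "p > 0" "q > 0" using d(2) e(2) unfolding p_def q_def by (simp_all only: of_int_0_less_iff)
    have lu: "l = - s d / p" "u = s e / q" by (simp_all only: d(3) e(3) p_def q_def)
    have "0 < q * s d + p * s e" using pos by (simp only: p_def q_def)
    then have "0 < (q * s d + p * s e) / (p * q)" using pq by simp
    also have "\<dots> = u - l" using pq by (simp add: lu add_divide_distrib)
    finally show ?thesis by simp
  qed
  then obtain t where t: "\<forall>l\<in>L. l < t" "\<forall>u\<in>U. t < u"
    using dense_between[of L U] Suc.prems(1) by (auto simp: L_def U_def)
  have "(\<Sum>i=1..Suc n. (w(?m := t)) i * of_int (d i)) > 0" if d: "d \<in> D" for d
  proof -
    have "(\<Sum>i=1..n. (w(?m := t)) i * of_int (d i)) = s d" unfolding s_def by (intro sum.cong) auto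
    then have eq: "(\<Sum>i=1..Suc n. (w(?m := t)) i * of_int (d i)) = s d + t * of_int (d ?m)" by simp
    consider "d ?m = 0" | "d ?m > 0" | "d ?m < 0" by linarith
    then have "s d + t * of_int (d ?m) > 0"
    proof cases
      case 1
      then have "d \<in> D'" using d by (simp add: D'_def)
      then show ?thesis using w 1 by (simp add: s_def)
    next
      case 2
      then have "- s d / of_int (d ?m) < t" using t(1) d by (auto simp: L_def)
      then show ?thesis using 2 by (simp add: field_simps)
    next
      case 3
      then have "t < s d / of_int (- d ?m)" using t(2) d by (auto simp: U_def)
      then have "t * of_int (- d ?m) < s d" using 3 by (simp add: field_simps)
      then show ?thesis by simp
    qed
    then show ?thesis by (simp only: eq)
  qed
  then show ?case by blast
qed

lemma common_denominator:
  fixes w :: "'i \<Rightarrow> rat"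
  assumes "finite S" shows "\<exists>N::int. N > 0 \<and> (\<forall>i\<in>S. \<exists>z::int. of_int N * w i = of_int z)"
  using assms
proof (induction S rule: finite_induct)
  case empty
  then show ?case by (intro exI[of _ 1]) auto
next
  case (insert i S)
  then obtain N where N: "N > 0" "\<forall>i\<in>S. \<exists>z::int. of_int N * w i = of_int z" by blast
  obtain a b where ab: "w i = of_int a / of_int b" "b > 0" by (metis Fract_of_int_quotient Rat_cases)
  have "of_int (N * b) * w i = of_int (N * a)" using ab by simp
  moreover have "\<exists>z::int. of_int (N * b) * w j = of_int z" if jS: "j \<in> S" for j
  proof -
    obtain z :: int where "of_int N * w j = of_int z" using N(2) jS by blast
    then have "of_int b * (of_int N * w j) = of_int (b * z)" by simp
    then have "of_int (N * b) * w j = of_int (b * z)" by (simp only: of_int_mult mult_ac)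
    then show ?thesis by blast
  qed
  ultimately have "\<forall>j\<in>insert i S. \<exists>z::int. of_int (N * b) * w j = of_int z" by (metis insertE)
  moreover have "N * b > 0" using N(1) ab(2) by simp
  ultimately show ?case by blast
qed

lemma sum_mset_eq_sum_count:
  fixes w :: "nat \<Rightarrow> nat"
  assumes "m \<in> monomials {1..n}"
  shows "sum_mset (image_mset w m) = (\<Sum>i=1..n. w i * count m i)"
  using assms
proof (induction m)
  case (add j m)
  then have j: "j \<in> {1..n}" "m \<in> monomials {1..n}" by (auto simp: monomials_def)
  have "(\<Sum>i=1..n. w i * count (add_mset j m) i) = (\<Sum>i=1..n. w i * count m i + (if i = j then w i else 0))"
    by (intro sum.cong) auto
  also have "\<dots> = (\<Sum>i=1..n. w i * count m i) + w j" using j by (simp add: sum.distrib)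
  finally show ?case using add.IH[OF j(2)] by simp
qed simp

text \<open>The exponent differences of strictly ordered pairs are closed under addition and never
  zero, since the order respects multiplication and is antisymmetric. Hence finitely many of them
  are positive under a common rational weight vector, and clearing denominators makes it
  integral.\<close>

lemma monomial_order_weights:
  assumes r: "monomial_well_ordering n r" and S: "finite S" "S \<subseteq> r - Id"
  shows "\<exists>w :: nat \<Rightarrow> nat. (\<forall>i\<in>{1..n}. w i > 0) \<and>
    (\<forall>(m, p)\<in>S. sum_mset (image_mset w m) < sum_mset (image_mset w p))"
proof -
  let ?I = "monomials {1..n}"
  have wo: "well_order_on ?I r" and mono: "\<And>a b m. \<lbrakk>(a, b) \<in> r; m \<in> ?I\<rbrakk> \<Longrightarrow> (a + m, b + m) \<in> r"
    using r by (auto simp: monomial_well_ordering_def)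
  have lin: "linear_order_on ?I r" and wf: "wf (r - Id)" using wo by (auto simp: well_order_on_def)
  then have po: "trans r" "antisym r" "total_on ?I r" and rI: "r \<subseteq> ?I \<times> ?I"
    by (auto simp: linear_order_on_def partial_order_on_def preorder_on_def)
  \<comment> \<open>If an indeterminate were below 1, its powers would descend forever. This is the
    use made of the well-ordering.\<close>
  have one: "({#}, {#i#}) \<in> r - Id" if i: "i \<in> {1..n}" for i
  proof (rule ccontr)
    assume "({#}, {#i#}) \<notin> r - Id"
    moreover have "{#} \<in> ?I" "{#i#} \<in> ?I" using i by (auto simp: monomials_def)
    ultimately have neg: "({#i#}, {#}) \<in> r" using po(3)[unfolded total_on_def, rule_format, of "{#}" "{#i#}"] by auto
    define Q where "Q = range (\<lambda>k. replicate_mset k i)"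
    have "replicate_mset 0 i \<in> Q" unfolding Q_def by blast
    then obtain z where z: "z \<in> Q" "\<And>y. (y, z) \<in> r - Id \<Longrightarrow> y \<notin> Q" using wfE_min[OF wf] by metis
    then obtain k where k: "z = replicate_mset k i" by (auto simp: Q_def)
    have "z \<in> ?I" using i by (auto simp: k monomials_def)
    then have "({#i#} + z, {#} + z) \<in> r" using mono neg by blast
    moreover have "{#i#} + z = replicate_mset (Suc k) i" by (simp add: k)
    ultimately have "(replicate_mset (Suc k) i, z) \<in> r - Id" by (auto simp: k)
    moreover have "replicate_mset (Suc k) i \<in> Q" unfolding Q_def by blast
    ultimately show False using z(2) by blast
  qed
  define vec where "vec z i = int (count (snd z) i) - int (count (fst z) i)" for z :: "nat multiset \<times> nat multiset" and i
  define P where "P = vec ` (r - Id)"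
  have sI: "m \<in> ?I" "p \<in> ?I" if "(m, p) \<in> r" for m p using that rI by auto
  have addP: "(\<lambda>i. d i + e i) \<in> P" if "d \<in> P" "e \<in> P" for d e
  proof -
    obtain a b a' b' where ab: "(a, b) \<in> r - Id" "d = vec (a, b)" "(a', b') \<in> r - Id" "e = vec (a', b')"
      using \<open>d \<in> P\<close> \<open>e \<in> P\<close> by (auto simp: P_def)
    have I: "a \<in> ?I" "b \<in> ?I" "a' \<in> ?I" "b' \<in> ?I" using ab sI by auto
    have 1: "(a + a', b + a') \<in> r" "(a' + b, b' + b) \<in> r" using mono ab I by auto
    then have 2: "(a + a', b + b') \<in> r" using po(1) by (metis add.commute transD)
    have "a + a' \<noteq> b + b'"
    proof
      assume "a + a' = b + b'"
      then have "(b + b', b + a') \<in> r" using 1 by simp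
      moreover have "(b + a', b + b') \<in> r" using 1(2) by (simp add: add.commute)
      ultimately have "b + b' = b + a'" using po(2) by (meson antisymD)
      then show False using ab(3) by simp
    qed
    then have "(a + a', b + b') \<in> r - Id" using 2 by simp
    moreover have "(\<lambda>i. d i + e i) = vec (a + a', b + b')" by (simp add: vec_def ab fun_eq_iff)
    ultimately show ?thesis unfolding P_def by blast
  qed
  have zeroP: "(\<lambda>i. 0) \<notin> P"
  proof
    assume "(\<lambda>i. 0) \<in> P"
    then obtain a b where ab: "(a, b) \<in> r - Id" "(\<lambda>i. 0) = vec (a, b)" by (auto simp: P_def)
    have "count a i = count b i" for i using fun_cong[OF ab(2), of i] by (simp add: vec_def)
    then have "a = b" by (rule multiset_eqI)
    then show False using ab by simp
  qed
  \<comment> \<open>The added pairs, 1 below each indeterminate, force every single weight to be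
    positive.\<close>
  define S' where "S' = S \<union> (\<lambda>i. ({#}, {#i#})) ` {1..n}"
  have S': "finite S'" "S' \<subseteq> r - Id" using S one by (auto simp: S'_def)
  have van: "\<forall>d\<in>vec ` S'. \<forall>i. i \<notin> {1..n} \<longrightarrow> d i = 0"
  proof clarify
    fix m p i assume mp: "(m, p) \<in> S'" and i: "i \<notin> {1..n}"
    have "(m, p) \<in> r" using S'(2) mp by blast
    then have "i \<notin># m" "i \<notin># p" using sI[of m p] i by (auto simp: monomials_def)
    then show "vec (m, p) i = 0" by (simp add: vec_def not_in_iff)
  qed
  obtain w0 :: "nat \<Rightarrow> rat" where w0: "\<forall>d\<in>vec ` S'. (\<Sum>i=1..n. w0 i * of_int (d i)) > 0"
    using positive_weights[OF addP zeroP, of "vec ` S'" n] S' van by (auto simp: P_def)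
  obtain N :: int where N: "N > 0" "\<forall>i\<in>{1..n}. \<exists>z::int. of_int N * w0 i = of_int z"
    using common_denominator[of "{1..n}" w0] by auto
  then obtain w1 where w1: "\<And>i. i \<in> {1..n} \<Longrightarrow> of_int N * w0 i = of_int (w1 i)" by metis
  have pos: "(\<Sum>i=1..n. w1 i * vec z i) > 0" if "z \<in> S'" for z
  proof -
    have "of_int (\<Sum>i=1..n. w1 i * vec z i) = (\<Sum>i=1..n. (of_int N * w0 i) * of_int (vec z i))"
      unfolding of_int_sum of_int_mult using w1 by (intro sum.cong) auto
    also have "\<dots> = of_int N * (\<Sum>i=1..n. w0 i * of_int (vec z i))" by (simp add: sum_distrib_left mult.assoc)
    also have "\<dots> > 0" using N(1) w0 that by (intro mult_pos_pos) auto
    finally show ?thesis by (simp only: of_int_0_less_iff)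
  qed
  have w1pos: "w1 i > 0" if i: "i \<in> {1..n}" for i
  proof -
    have "(\<Sum>j=1..n. w1 j * vec ({#}, {#i#}) j) = (\<Sum>j=1..n. if j = i then w1 j else 0)"
      by (intro sum.cong) (auto simp: vec_def)
    also have "\<dots> = w1 i" using i by simp
    finally show ?thesis using pos[of "({#}, {#i#})"] i by (auto simp: S'_def)
  qed
  define w where "w i = nat (w1 i)" for i
  have "sum_mset (image_mset w m) < sum_mset (image_mset w p)" if mp: "(m, p) \<in> S" for m p
  proof -
    have I: "m \<in> ?I" "p \<in> ?I" using mp S sI by auto
    have "(\<Sum>i=1..n. w1 i * vec (m, p) i) = (\<Sum>i=1..n. int (w i * count p i)) - (\<Sum>i=1..n. int (w i * count m i))"
      unfolding sum_subtractf[symmetric]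
      by (intro sum.cong refl) (use w1pos in \<open>simp add: w_def vec_def right_diff_distrib less_imp_le\<close>)
    moreover have "(m, p) \<in> S'" using mp by (simp add: S'_def)
    ultimately have "int (\<Sum>i=1..n. w i * count m i) < int (\<Sum>i=1..n. w i * count p i)"
      using pos[of "(m, p)"] by (simp only: of_nat_sum diff_gt_0_iff_gt)
    then show ?thesis by (simp only: sum_mset_eq_sum_count[OF I(1)] sum_mset_eq_sum_count[OF I(2)] of_nat_less_iff)
  qed
  moreover have "\<forall>i\<in>{1..n}. w i > 0" using w1pos by (simp add: w_def)
  ultimately show ?thesis by (intro exI[of _ w]) auto
qed

text \<open>A finite nonempty support in a linear order has a unique greatest element, so the
  definite description in \<open>leading_monomial\<close> denotes it.\<close>

lemma below_leading_monomial:
  assumes lin: "linear_order_on I r" and d: "finite {m. d m \<noteq> 0}" "{m. d m \<noteq> 0} \<subseteq> I" "d m \<noteq> 0"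
  shows "(m, leading_monomial r d) \<in> r"
proof -
  have po: "trans r" "antisym r" "total_on I r" "refl_on I r"
    using lin by (auto simp: linear_order_on_def partial_order_on_def preorder_on_def)
  have "\<exists>l\<in>T. \<forall>m'\<in>T. (m', l) \<in> r" if "finite T" "T \<noteq> {}" "T \<subseteq> I" for T
    using that
  proof (induction rule: finite_ne_induct)
    case (singleton a)
    then show ?case using po(4) by (auto simp: refl_on_def)
  next
    case (insert a T)
    then obtain l where l: "l \<in> T" "\<forall>m'\<in>T. (m', l) \<in> r" by auto
    have aI: "a \<in> I" "l \<in> I" "(a, a) \<in> r" using insert l po(4) by (auto simp: refl_on_def)
    show ?case
    proof (cases "(a, l) \<in> r")
      case True
      then show ?thesis using l by auto
    next
      case False
      then have "(l, a) \<in> r" using po(3) aI by (auto simp: total_on_def)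
      then have "\<forall>m'\<in>T. (m', a) \<in> r" using l(2) po(1) by (meson transD)
      then show ?thesis using aI by auto
    qed
  qed
  from this[OF d(1) _ d(2)] obtain l where l: "d l \<noteq> 0" "\<forall>m'. d m' \<noteq> 0 \<longrightarrow> (m', l) \<in> r" using d(3) by auto
  have "leading_monomial r d = l"
    unfolding leading_monomial_def using l po(2) by (intro the_equality) (auto dest: antisymD)
  then show ?thesis using l d by simp
qed

lemma monomials_mset_iff: "mset v \<in> monomials V \<longleftrightarrow> v \<in> lists V"
  by (auto simp: monomials_def in_lists_conv_set)

lemma sorted_list_in_lists: "m \<in> monomials V \<Longrightarrow> sorted_list_of_multiset m \<in> lists V"
  by (auto simp: monomials_def in_lists_conv_set)

text \<open>Every monomial of \<open>d i j\<close>, and not only the leading one, lies below the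
  product of the two indeterminates. The finitely many pairs arising in this way form
  \<open>S\<close>; the weights found for \<open>S\<close> then take over from the given order. The
  coordinate functionals come from the assumed basis.\<close>

lemma G_algebra_pbw:
  fixes c :: "nat \<Rightarrow> nat \<Rightarrow> 'k::field"
  assumes G: "is_G_algebra n c d"
  shows "\<exists>x w \<phi>. pbw_algebra (G_presentation n c d) n x w \<phi>"
proof -
  note [simp del] = One_nat_def
  let ?I = "monomials {1..n}"
  obtain r where r: "monomial_well_ordering n r" and
    rd: "\<And>i j. \<lbrakk>1 \<le> i; i < j; j \<le> n\<rbrakk> \<Longrightarrow> d i j = \<zero>\<^bsub>polynomial_ring kfield {1..n}\<^esub> \<or>
           (leading_monomial r (d i j), {#i, j#}) \<in> r - Id"
    using G by (auto simp: is_G_algebra_def)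
  have c: "c i j \<noteq> 0" and dfin: "finite {m. d i j m \<noteq> 0}" and dI: "{m. d i j m \<noteq> 0} \<subseteq> ?I"
    if "1 \<le> i" "i < j" "j \<le> n" for i j
    using G that by (auto simp: is_G_algebra_def polynomial_ring_def monoid_algebra_def supp_def free_comm_monoid_def)
  have lin: "linear_order_on ?I r" using r by (auto simp: monomial_well_ordering_def well_order_on_def)
  then have po: "trans r" "antisym r" by (auto simp: linear_order_on_def partial_order_on_def preorder_on_def)
  have dlow: "(m, {#i, j#}) \<in> r - Id" if ij: "1 \<le> i" "i < j" "j \<le> n" and m: "d i j m \<noteq> 0" for i j m
  proof -
    have "d i j \<noteq> \<zero>\<^bsub>polynomial_ring kfield {1..n}\<^esub>"
      using m by (auto simp: polynomial_ring_def monoid_algebra_def)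
    then have "(leading_monomial r (d i j), {#i, j#}) \<in> r - Id" using rd[OF ij] by blast
    moreover have "(m, leading_monomial r (d i j)) \<in> r"
      by (rule below_leading_monomial[OF lin dfin[OF ij] dI[OF ij] m])
    ultimately show ?thesis using po by (metis DiffD1 DiffD2 DiffI antisymD pair_in_Id_conv transD)
  qed
  define S where "S = (\<Union>(i, j)\<in>{(i, j). 1 \<le> i \<and> i < j \<and> j \<le> n}. (\<lambda>m. (m, {#i, j#})) ` {m. d i j m \<noteq> 0})"
  have "finite {(i, j). 1 \<le> i \<and> i < j \<and> j \<le> n}" by (rule finite_subset[of _ "{1..n} \<times> {1..n}"]) auto
  then have "finite S" unfolding S_def by (rule finite_UN_I) (use dfin in auto)
  moreover have "S \<subseteq> r - Id" unfolding S_def using dlow by blast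
  ultimately have S: "finite S" "S \<subseteq> r - Id" by auto
  obtain w :: "nat \<Rightarrow> nat" where w: "\<forall>i\<in>{1..n}. w i > 0"
      "\<forall>(m, p)\<in>S. sum_mset (image_mset w m) < sum_mset (image_mset w p)"
    using monomial_order_weights[OF r S] by blast
  interpret K: k_monoid_alg "free_monoid {1..n}" "TYPE('k)"
    by (rule k_monoid_alg.intro) (rule free_monoid_monoid)
  have F: "K.F = free_algebra {1..n}" by (simp only: K.F_def free_algebra_def)
  have gc: "gen i \<in> carrier K.F" if "i \<in> {1..n}" for i
    unfolding gen_def by (rule K.basis_closed) (use that in \<open>simp add: free_monoid_simps\<close>)
  have sf: "standard_form (d i j) \<in> carrier K.F" if ij: "1 \<le> i" "i < j" "j \<le> n" for i j
  proof -
    have "{v. standard_form (d i j) v \<noteq> 0} \<subseteq> sorted_list_of_multiset ` {m. d i j m \<noteq> 0}"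
    proof
      fix v assume "v \<in> {v. standard_form (d i j) v \<noteq> 0}"
      then have "sorted v" "d i j (mset v) \<noteq> 0" by (auto simp: standard_form_def split: if_splits)
      then show "v \<in> sorted_list_of_multiset ` {m. d i j m \<noteq> 0}"
        by (intro image_eqI[of _ _ "mset v"]) (simp_all add: sorted_sort_id)
    qed
    moreover have "sorted_list_of_multiset ` {m. d i j m \<noteq> 0} \<subseteq> lists {1..n}"
      using dI[OF ij] sorted_list_in_lists by blast
    ultimately show ?thesis
      using dfin[OF ij] unfolding K.F_simps(1) free_monoid_simps by (meson finite_imageI finite_subset subset_trans)
  qed
  have E: "G_relations n c d \<subseteq> carrier K.F \<times> carrier K.F"
    unfolding G_relations_def Let_def F[symmetric] using gc sf by auto
  interpret Q: free_quotient "{1..n}" "TYPE('k)" "G_relations n c d"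
    by (intro free_quotient.intro k_monoid_quotient.intro k_quotient.intro k_quotient_axioms.intro
        K.k_monoid_alg_axioms K.F.k_algebra_axioms E)
  have A: "Q.A = G_presentation n c d" by (simp add: Q.A_eq G_presentation_def)
  define x where "x i = Q.\<pi> (gen i)" for i
  have std: "standard_monomial n c d m = Q.A.wprod x (sorted_list_of_multiset m)" if m: "m \<in> ?I" for m
  proof -
    have "sorted_list_of_multiset m \<in> lists {1..n}" using m by (rule sorted_list_in_lists)
    then have "Q.A.wprod x (sorted_list_of_multiset m) = Q.\<pi> (basis_elt (sorted_list_of_multiset m))"
      unfolding x_def by (rule Q.pi_word[symmetric])
    then show ?thesis
      unfolding standard_monomial_def F[symmetric] by (simp only: Q.\<pi>_def Q.J_def)
  qed
  have kb: "k_basis Q.A ?I (standard_monomial n c d)" using G by (simp add: is_G_algebra_def A)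
  obtain \<phi> where phi: "\<forall>a\<in>carrier Q.A. \<forall>b\<in>carrier Q.A. \<forall>i. \<phi> (a \<oplus>\<^bsub>Q.A\<^esub> b) i = \<phi> a i + \<phi> b i"
    "\<forall>a\<in>carrier Q.A. \<forall>c i. \<phi> (c \<odot>\<^bsub>Q.A\<^esub> a) i = c * \<phi> a i"
    "\<forall>i\<in>?I. \<forall>j. \<phi> (standard_monomial n c d i) j = (if j = i then 1 else 0)"
    "\<forall>a\<in>carrier Q.A. \<forall>i. i \<notin> ?I \<longrightarrow> \<phi> a i = 0"
    using Q.A.basis_coordinates[OF kb] by blast
  have xc: "x i \<in> carrier Q.A" if "i \<in> {1..n}" for i
    unfolding x_def by (intro Q.pi_closed Q.gen_closed that)
  have "pbw_algebra Q.A n x w \<phi>"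
  proof (intro pbw_algebra.intro pbw_algebra_axioms.intro Q.A.k_algebra_axioms)
    fix a assume a: "a \<in> carrier Q.A"
    have "Q.\<pi> (gen v) \<in> Q.A.lspan (Q.A.wprod x ` lists {1..n})" if v: "v \<in> {1..n}" for v
    proof -
      have "Q.A.wprod x [v] = Q.\<pi> (gen v)" using xc[OF v] by (simp add: x_def)
      moreover have "[v] \<in> lists {1..n}" using v by simp
      ultimately show ?thesis by (metis Q.A.lspan_base imageI)
    qed
    then show "a \<in> Q.A.lspan (Q.A.wprod x ` lists {1..n})"
      using Q.words_span_quotient[of "{1..n}" x a] xc a by blast
  next
    fix i j assume ij: "1 \<le> i" "i < j" "j \<le> n"
    then have mem: "i \<in> {1..n}" "j \<in> {1..n}" by auto
    have "(gen j \<otimes>\<^bsub>K.F\<^esub> gen i, c i j \<odot>\<^bsub>K.F\<^esub> (gen i \<otimes>\<^bsub>K.F\<^esub> gen j) \<oplus>\<^bsub>K.F\<^esub> standard_form (d i j)) \<in> G_relations n c d"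
      unfolding G_relations_def Let_def F[symmetric] using ij by blast
    then have "Q.\<pi> (gen j \<otimes>\<^bsub>K.F\<^esub> gen i) = Q.\<pi> (c i j \<odot>\<^bsub>K.F\<^esub> (gen i \<otimes>\<^bsub>K.F\<^esub> gen j) \<oplus>\<^bsub>K.F\<^esub> standard_form (d i j))"
      by (rule Q.pi_relation)
    then have "x j \<otimes>\<^bsub>Q.A\<^esub> x i = c i j \<odot>\<^bsub>Q.A\<^esub> (x i \<otimes>\<^bsub>Q.A\<^esub> x j) \<oplus>\<^bsub>Q.A\<^esub> Q.\<pi> (standard_form (d i j))"
      using gc[OF mem(1)] gc[OF mem(2)] sf[OF ij]
      by (simp add: Q.pi_mult Q.pi_add Q.pi_smult x_def)
    moreover have "Q.\<pi> (standard_form (d i j)) \<in> Q.A.lspan {Q.A.wprod x (sorted_list_of_multiset m) | m.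
        m \<in> ?I \<and> sum_mset (image_mset w m) < w i + w j}"
    proof (rule Q.pi_in_lspan[OF sf[OF ij]])
      fix v assume "standard_form (d i j) v \<noteq> 0"
      then have v: "sorted v" "d i j (mset v) \<noteq> 0" by (auto simp: standard_form_def split: if_splits)
      then have "(mset v, {#i, j#}) \<in> S" using ij by (auto simp: S_def)
      then have "sum_mset (image_mset w (mset v)) < w i + w j" using w(2) by auto
      moreover have I: "mset v \<in> ?I" using dI[OF ij] v by auto
      moreover have "Q.\<pi> (basis_elt v) = Q.A.wprod x (sorted_list_of_multiset (mset v))"
        using Q.pi_word[OF I[unfolded monomials_mset_iff]] v(1) by (simp add: x_def[abs_def] sorted_sort_id)
      ultimately show "Q.\<pi> (basis_elt v) \<in> Q.A.lspan {Q.A.wprod x (sorted_list_of_multiset m) | m.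
        m \<in> ?I \<and> sum_mset (image_mset w m) < w i + w j}" by (intro Q.A.lspan_base) blast
    qed
    ultimately show "\<exists>c d. c \<noteq> 0 \<and> x j \<otimes>\<^bsub>Q.A\<^esub> x i = c \<odot>\<^bsub>Q.A\<^esub> (x i \<otimes>\<^bsub>Q.A\<^esub> x j) \<oplus>\<^bsub>Q.A\<^esub> d \<and>
        d \<in> Q.A.lspan {Q.A.wprod x (sorted_list_of_multiset m) | m. m \<in> ?I \<and> sum_mset (image_mset w m) < w i + w j}"
      using c[OF ij] by blast
  next
    fix m p assume "m \<in> ?I" "p \<in> ?I"
    then show "\<phi> (Q.A.wprod x (sorted_list_of_multiset m)) p = (if p = m then 1 else 0)"
      using phi(3) std by simp
  qed (use xc w(1) phi in auto)
  then show ?thesis unfolding A by blast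
qed

lemma k_monoid_alg_free: "k_monoid_alg (free_monoid V)"
  by (rule k_monoid_alg.intro) (rule free_monoid_monoid)

lemma free_quotientI:
  fixes E :: "(('v list \<Rightarrow> 'k::field) \<times> ('v list \<Rightarrow> 'k)) set"
  assumes "E \<subseteq> carrier (free_algebra V) \<times> carrier (free_algebra V)"
  shows "free_quotient V E"
proof -
  interpret K: k_monoid_alg "free_monoid V" "TYPE('k)" by (rule k_monoid_alg_free)
  have "K.F = free_algebra V" by (simp only: K.F_def free_algebra_def)
  then show ?thesis
    by (intro free_quotient.intro k_monoid_quotient.intro k_quotient.intro k_quotient_axioms.intro
        K.k_monoid_alg_axioms K.F.k_algebra_axioms) (simp add: assms)
qed

locale free_alg = k_monoid_alg "free_monoid V" type_k for V :: "'v set" and type_k :: "'k::field itself"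
begin

lemma F_free_algebra: "F = free_algebra V"
  by (simp only: F_def free_algebra_def)

lemma gen_in_F [simp]: "v \<in> V \<Longrightarrow> gen v \<in> carrier F"
  unfolding gen_def by (rule basis_closed) (simp add: free_monoid_simps)

lemma gen_times_gen: "\<lbrakk>u \<in> V; v \<in> V\<rbrakk> \<Longrightarrow> gen u \<otimes>\<^bsub>F\<^esub> gen v = basis_elt [u, v]"
  unfolding gen_def using basis_mult[of "[u]" "[v]"] by (simp add: free_monoid_simps)

lemma lin_gen_mult: "\<lbrakk>u \<in> V; v \<in> V\<rbrakk> \<Longrightarrow> lin \<sigma> (gen u \<otimes>\<^bsub>F\<^esub> gen v) = \<sigma> [u, v]"
  by (simp add: gen_times_gen lin_basis)

lemma lin_gen: "lin \<sigma> (gen v) = \<sigma> [v]"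
  by (simp add: gen_def lin_basis)

lemma lin_one: "lin \<sigma> \<one>\<^bsub>F\<^esub> = \<sigma> []"
  by (simp add: F_simps(3) free_monoid_simps lin_basis)

lemma commutator_closed: "\<lbrakk>u \<in> V; v \<in> V\<rbrakk> \<Longrightarrow> commutator F (gen u) (gen v) \<in> carrier F"
  by (simp add: commutator_def)

lemma lin_commutator:
  "\<lbrakk>u \<in> V; v \<in> V\<rbrakk> \<Longrightarrow> lin \<sigma> (commutator F (gen u) (gen v)) = \<sigma> [u, v] - \<sigma> [v, u]"
  by (simp add: commutator_def lin_F_minus lin_gen_mult)

end

context free_quotient
begin

lemma one_in_low_span:
  assumes "\<And>i. i \<in> {1..N} \<Longrightarrow> w i > (0::nat)" "i \<in> {1..N}"
  shows "\<one>\<^bsub>A\<^esub> \<in> A.lspan {A.wprod x (sorted_list_of_multiset m) | m.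
    m \<in> monomials {1..N} \<and> sum_mset (image_mset w m) < w i + w j}"
proof (rule A.lspan_base)
  have "\<one>\<^bsub>A\<^esub> = A.wprod x (sorted_list_of_multiset {#})" "{#} \<in> monomials {1..N}"
    "sum_mset (image_mset w {#}) < w i + w j" using assms by (simp_all add: monomials_def)
  then show "\<one>\<^bsub>A\<^esub> \<in> {A.wprod x (sorted_list_of_multiset m) | m.
    m \<in> monomials {1..N} \<and> sum_mset (image_mset w m) < w i + w j}" by blast
qed

lemma gens_in_span:
  assumes "\<And>i. i \<in> {1..N} \<Longrightarrow> g i \<in> V" and "v \<in> g ` {1..N}"
  shows "\<pi> (gen v) \<in> A.lspan (A.wprod (\<lambda>i. \<pi> (gen (g i))) ` lists {1..N})"
proof -
  obtain i where i: "i \<in> {1..N}" "v = g i" using assms by blast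
  have "A.wprod (\<lambda>i. \<pi> (gen (g i))) [i] = \<pi> (gen v)"
    using pi_closed[OF gen_closed[OF assms(1)[OF i(1)]]] by (simp add: i)
  moreover have "[i] \<in> lists {1..N}" using i by simp
  ultimately show ?thesis by (metis A.lspan_base imageI)
qed

end

section \<open>Quantum affine spaces\<close>

text \<open>The product of \<open>q i j\<close> over the inversions of a word: the scalar by which
  the word should differ from its sorted rearrangement.\<close>

fun reorder_factor :: "(nat \<Rightarrow> nat \<Rightarrow> 'k::field) \<Rightarrow> nat list \<Rightarrow> 'k" where
  "reorder_factor q [] = 1"
| "reorder_factor q (i # v) = prod_list (map (\<lambda>j. if j < i then q i j else 1) v) * reorder_factor q v"

text \<open>Among all pairs of positions only the exchanged one changes its status as an inversion.
  The conditions \<open>q i j * q j i = 1\<close> and \<open>q i i = 1\<close> settle the three ways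
  in which \<open>i\<close> and \<open>j\<close> can compare.\<close>

lemma reorder_factor_swap:
  assumes q: "quantum_parameters n q" and ij: "i \<in> {1..n}" "j \<in> {1..n}"
  shows "reorder_factor q (u @ i # j # v) = q i j * reorder_factor q (u @ j # i # v)"
proof (induction u)
  case Nil
  have "(if j < i then q i j else 1) = q i j * (if i < j then q j i else 1)"
    using q ij by (cases "i = j") (auto simp: quantum_parameters_def)
  then show ?case by (simp add: mult_ac)
next
  case (Cons a u)
  then show ?case by (simp add: mult_ac)
qed

lemma reorder_factor_sorted: "sorted v \<Longrightarrow> reorder_factor q v = 1"
proof (induction v)
  case (Cons i v)
  then have "map (\<lambda>j. if j < i then q i j else 1) v = map (\<lambda>_. 1) v" by (intro map_cong) auto
  then have "prod_list (map (\<lambda>j. if j < i then q i j else 1) v) = 1" by (simp add: map_replicate_const prod_list_replicate)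
  then show ?case using Cons by simp
qed simp

lemma quantum_affine_pbw:
  fixes q :: "nat \<Rightarrow> nat \<Rightarrow> 'k::field"
  assumes q: "quantum_parameters n q"
  shows "\<exists>x w \<phi>. pbw_algebra (quantum_affine_space n q) n x w \<phi>"
proof -
  note [simp del] = One_nat_def
  interpret K: free_alg "{1..n}" "TYPE('k)" by (intro free_alg.intro k_monoid_alg_free)
  define E where "E = {(gen i \<otimes>\<^bsub>K.F\<^esub> gen j, q i j \<odot>\<^bsub>K.F\<^esub> (gen j \<otimes>\<^bsub>K.F\<^esub> gen i)) | i j. i \<in> {1..n} \<and> j \<in> {1..n}}"
  have A: "quantum_affine_space n q = impose (free_algebra {1..n}) E"
    by (simp only: quantum_affine_space_def Let_def E_def K.F_free_algebra)
  have "E \<subseteq> carrier K.F \<times> carrier K.F" by (auto simp: E_def)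
  then interpret Q: free_quotient "{1..n}" "TYPE('k)" E
    unfolding K.F_free_algebra by (rule free_quotientI)
  define \<sigma> where "\<sigma> p v = (if mset v = p then reorder_factor q v else 0)" for p v
  have "\<exists>\<phi>. pbw_algebra Q.A n (\<lambda>i. Q.\<pi> (gen i)) (\<lambda>_. 1) \<phi>"
  proof (rule Q.pbw_from_words[where g = "\<lambda>i. i" and \<sigma> = \<sigma>])
    show "Q.\<pi> (gen v) \<in> Q.A.lspan (Q.A.wprod (\<lambda>i. Q.\<pi> (gen i)) ` lists {1..n})" if "v \<in> {1..n}" for v
      using Q.gens_in_span[of n "\<lambda>i. i" v] that by simp
  next
    fix i j assume ij: "1 \<le> i" "i < j" "j \<le> n"
    then have mem: "i \<in> {1..n}" "j \<in> {1..n}" by auto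
    then have "Q.\<pi> (gen j \<otimes>\<^bsub>K.F\<^esub> gen i) = Q.\<pi> (q j i \<odot>\<^bsub>K.F\<^esub> (gen i \<otimes>\<^bsub>K.F\<^esub> gen j))"
      by (intro Q.pi_relation) (auto simp: E_def)
    then have "Q.\<pi> (gen j) \<otimes>\<^bsub>Q.A\<^esub> Q.\<pi> (gen i) = q j i \<odot>\<^bsub>Q.A\<^esub> (Q.\<pi> (gen i) \<otimes>\<^bsub>Q.A\<^esub> Q.\<pi> (gen j)) \<oplus>\<^bsub>Q.A\<^esub> \<zero>\<^bsub>Q.A\<^esub>"
      using mem by (simp add: Q.pi_mult Q.pi_smult Q.pi_closed)
    moreover have "q j i \<noteq> 0" using q mem by (simp add: quantum_parameters_def)
    ultimately show "\<exists>c d. c \<noteq> 0 \<and> Q.\<pi> (gen j) \<otimes>\<^bsub>Q.A\<^esub> Q.\<pi> (gen i) = c \<odot>\<^bsub>Q.A\<^esub> (Q.\<pi> (gen i) \<otimes>\<^bsub>Q.A\<^esub> Q.\<pi> (gen j)) \<oplus>\<^bsub>Q.A\<^esub> d \<and>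
        d \<in> Q.A.lspan {Q.A.wprod (\<lambda>i. Q.\<pi> (gen i)) (sorted_list_of_multiset m) | m.
          m \<in> monomials {1..n} \<and> sum_mset (image_mset (\<lambda>_. 1) m) < (1::nat) + 1}"
      using Q.A.lspan_zero by blast
  next
    fix u v l r p assume "(l, r) \<in> E"
    then obtain i j where ij: "i \<in> {1..n}" "j \<in> {1..n}"
      and lr: "l = gen i \<otimes>\<^bsub>K.F\<^esub> gen j" "r = q i j \<odot>\<^bsub>K.F\<^esub> (gen j \<otimes>\<^bsub>K.F\<^esub> gen i)" by (auto simp: E_def)
    show "lin (\<lambda>z. \<sigma> p (u @ z @ v)) l = lin (\<lambda>z. \<sigma> p (u @ z @ v)) r"
      using ij reorder_factor_swap[OF q ij, of u v]
      by (simp add: lr K.lin_F_smult K.lin_gen_mult \<sigma>_def add_mset_commute)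
  next
    fix m p :: "nat multiset"
    show "\<sigma> p (map (\<lambda>i. i) (sorted_list_of_multiset m)) = (if p = m then 1 else 0)"
      by (auto simp: \<sigma>_def reorder_factor_sorted)
  qed auto
  then show ?thesis unfolding A Q.A_eq by blast
qed

section \<open>Weyl algebras\<close>

context
  fixes n :: nat and q :: "nat \<Rightarrow> 'k::field"
begin

text \<open>The Gaussian integer [a] = 1 + q + ... + q^(a-1), which occurs in \<partial> x^a = q^a
  x^a \<partial> + [a] x^(a-1).\<close>

definition q_number :: "nat \<Rightarrow> nat \<Rightarrow> 'k" where
  "q_number i a = (\<Sum>t<a. q i ^ t)"

text \<open>
  The operator of the letter \<open>i \<le> n\<close> is multiplication by \<open>x\<^sub>i\<close>, the one of \<open>n + i\<close> is left multiplication
  by \<open>\<partial>\<^sub>i\<close>, on normally ordered monomials; elements are coefficient functions on exponent vectors.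
\<close>

definition weyl_op :: "nat \<Rightarrow> ((nat \<Rightarrow> nat) \<Rightarrow> 'k) \<Rightarrow> (nat \<Rightarrow> nat) \<Rightarrow> 'k" where
  "weyl_op i h m = (if i \<le> n then if m i > 0 then h (m(i := m i - 1)) else 0
    else q_number (i - n) (m (i - n) + 1) * h (m(i - n := m (i - n) + 1)) +
      q (i - n) ^ m (i - n) * (if m i > 0 then h (m(i := m i - 1)) else 0))"

definition weyl_act :: "nat list \<Rightarrow> ((nat \<Rightarrow> nat) \<Rightarrow> 'k) \<Rightarrow> (nat \<Rightarrow> nat) \<Rightarrow> 'k" where
  "weyl_act v h = foldr weyl_op v h"

lemma weyl_act_simps [simp]:
  "weyl_act [] h = h" "weyl_act (i # v) h = weyl_op i (weyl_act v h)"
  "weyl_act (u @ v) h = weyl_act u (weyl_act v h)"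
  by (simp_all add: weyl_act_def)

lemma weyl_act_linear:
  "weyl_act u (\<lambda>m. a * h m + b * h' m) = (\<lambda>m. a * weyl_act u h m + b * weyl_act u h' m)"
proof (induction u)
  case (Cons i u)
  then show ?case by (auto simp: weyl_op_def algebra_simps)
qed simp

lemma weyl_op_XX: "\<lbrakk>i \<le> n; j \<le> n\<rbrakk> \<Longrightarrow> weyl_op i (weyl_op j h) = weyl_op j (weyl_op i h)"
  by (cases "i = j") (auto simp: weyl_op_def fun_eq_iff fun_upd_twist)

lemma weyl_op_DD:
  assumes "i \<in> {1..n}" "j \<in> {1..n}"
  shows "weyl_op (n + i) (weyl_op (n + j) h) = weyl_op (n + j) (weyl_op (n + i) h)"
proof (cases "i = j")
  case False
  have ne: "n + i \<noteq> j" "n + j \<noteq> i" "n + i \<noteq> i" "n + j \<noteq> j" "j \<noteq> n + i" "i \<noteq> n + j" "i \<noteq> n + i" "j \<noteq> n + j"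
    using assms by auto
  show ?thesis
    using False ne assms by (auto simp: weyl_op_def fun_eq_iff algebra_simps fun_upd_twist)
qed simp

text \<open>For distinct indices the operators change different exponents and commute. For equal
  indices the identity amounts to [a+1] = 1 + q [a].\<close>

lemma weyl_op_DX:
  assumes "i \<in> {1..n}" "j \<in> {1..n}"
  shows "weyl_op (n + i) (weyl_op j h) =
    (\<lambda>m. (1 + kdelta i j * (q i - 1)) * weyl_op j (weyl_op (n + i) h) m + kdelta i j * h m)"
proof (cases "i = j")
  case False
  have ne: "n + i \<noteq> j" "n + i \<noteq> i" "j \<noteq> n + i" "i \<noteq> n + i" using assms by auto
  show ?thesis
    using False ne assms by (auto simp: weyl_op_def fun_eq_iff algebra_simps fun_upd_twist kdelta_def)
next
  case True
  then have j: "j = i" by simp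
  have ne: "n + i \<noteq> i" "i \<noteq> n + i" using assms by auto
  have qn: "q_number i (Suc a) = 1 + q i * q_number i a" for a
    by (simp add: q_number_def sum.lessThan_Suc_shift sum_distrib_left del: sum.lessThan_Suc)
  show ?thesis unfolding j
  proof
    fix m :: "nat \<Rightarrow> nat"
    show "weyl_op (n + i) (weyl_op i h) m =
      (1 + kdelta i i * (q i - 1)) * weyl_op i (weyl_op (n + i) h) m + kdelta i i * h m"
    proof (cases "m i")
      case 0
      then show ?thesis using ne assms by (simp add: weyl_op_def kdelta_def q_number_def fun_upd_idem)
    next
      case (Suc a)
      then show ?thesis using ne assms
        by (simp add: weyl_op_def kdelta_def qn[of "Suc a"] fun_upd_twist[of i "n + i"] distrib_left distrib_right
            mult_ac fun_upd_idem)
    qed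
  qed
qed

text \<open>Sorted words send the vector 1 to pairwise distinct unit vectors. When the letter
  \<open>n + k\<close> acts, the letters to its right are all at least \<open>n + k\<close>, so the
  vector contains no x with index k; the term with the Gaussian integer vanishes and the power of q
  is 1.\<close>

lemma weyl_act_sorted:
  assumes "sorted v" "set v \<subseteq> {1..2 * n}"
  shows "weyl_act v (\<lambda>m. if m = (\<lambda>_. 0) then 1 else 0) = (\<lambda>m. if m = count (mset v) then 1 else 0)"
  using assms
proof (induction v)
  case Nil
  have "count {#} = (\<lambda>_. 0 :: nat)" by auto
  then show ?case by simp
next
  case (Cons i v)
  let ?c = "count (mset v)"
  have IH: "weyl_act v (\<lambda>m. if m = (\<lambda>_. 0) then 1 else 0) = (\<lambda>m. if m = ?c then 1 else 0)"
    using Cons by simp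
  have cc: "count (mset (i # v)) = ?c(i := ?c i + 1)" by auto
  have dec: "m i > 0 \<and> m(i := m i - 1) = ?c \<longleftrightarrow> m = ?c(i := ?c i + 1)" for m
  proof
    assume a: "m i > 0 \<and> m(i := m i - 1) = ?c"
    then have "?c = m(i := m i - 1)" by simp
    then have "?c(i := ?c i + 1) = m(i := m i - 1 + 1)" by simp
    then show "m = ?c(i := ?c i + 1)" using a by (simp add: fun_upd_idem)
  qed simp
  show ?case
  proof (cases "i \<le> n")
    case True
    show ?thesis unfolding weyl_act_simps IH cc
    proof
      fix m
      show "weyl_op i (\<lambda>m. if m = ?c then 1 else 0) m = (if m = ?c(i := ?c i + 1) then 1 else 0)"
        unfolding weyl_op_def dec[symmetric] using True by simp
    qed
  next
    case False
    have "i - n \<notin> set v"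
    proof
      assume "i - n \<in> set v"
      then have "i \<le> i - n" using Cons.prems by auto
      then show False using False Cons.prems by auto
    qed
    then have c0: "?c (i - n) = 0" by (simp add: count_mset_0_iff)
    have ne: "i - n \<noteq> i" using False Cons.prems by auto
    have 1: "m(i - n := m (i - n) + 1) \<noteq> ?c" for m using c0 by (metis add_is_0 fun_upd_same one_neq_zero)
    have 2: "m (i - n) = 0" if "m = ?c(i := ?c i + 1)" for m using that c0 ne by simp
    show ?thesis unfolding weyl_act_simps IH cc
    proof
      fix m
      show "weyl_op i (\<lambda>m. if m = ?c then 1 else 0) m = (if m = ?c(i := ?c i + 1) then 1 else 0)"
      proof (cases "m = ?c(i := ?c i + 1)")
        case True
        then have "m i > 0 \<and> m(i := m i - 1) = ?c" using dec by blast
        then show ?thesis unfolding weyl_op_def using False 1[of m] 2[OF True] True by simp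
      next
        case neq: False
        then have "\<not> (m i > 0 \<and> m(i := m i - 1) = ?c)" using dec by blast
        then show ?thesis unfolding weyl_op_def using False 1[of m] neq by auto
      qed
    qed
  qed
qed

end

fun weyl_index :: "nat \<Rightarrow> weyl_gen \<Rightarrow> nat" where
  "weyl_index n (WX i) = i"
| "weyl_index n (WD i) = n + i"

text \<open>The letters 1 to n are the variables and n + 1 to 2 n the derivations, all of weight 1.
  The correction in the mixed relation is a scalar, of weight 0 < 2.\<close>

lemma q_weyl_pbw:
  fixes q :: "nat \<Rightarrow> 'k::field"
  assumes q: "\<forall>i\<in>{1..n}. q i \<noteq> 0"
  shows "\<exists>x w \<phi>. pbw_algebra (q_weyl_algebra n q) (2 * n) x w \<phi>"
proof -
  note [simp del] = One_nat_def
  let ?V = "weyl_gens n"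
  interpret K: free_alg ?V "TYPE('k)" by (intro free_alg.intro k_monoid_alg_free)
  define E where "E = {(commutator K.F (gen (WX i)) (gen (WX j)), \<zero>\<^bsub>K.F\<^esub>) | i j. i \<in> {1..n} \<and> j \<in> {1..n}} \<union>
      {(commutator K.F (gen (WD i)) (gen (WD j)), \<zero>\<^bsub>K.F\<^esub>) | i j. i \<in> {1..n} \<and> j \<in> {1..n}} \<union>
      {(gen (WD i) \<otimes>\<^bsub>K.F\<^esub> gen (WX j),
        (1 + kdelta i j * (q i - 1)) \<odot>\<^bsub>K.F\<^esub> (gen (WX j) \<otimes>\<^bsub>K.F\<^esub> gen (WD i)) \<oplus>\<^bsub>K.F\<^esub>
          kdelta i j \<odot>\<^bsub>K.F\<^esub> \<one>\<^bsub>K.F\<^esub>) | i j. i \<in> {1..n} \<and> j \<in> {1..n}}"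
  have A: "q_weyl_algebra n q = impose (free_algebra ?V) E"
    by (simp only: q_weyl_algebra_def Let_def E_def K.F_free_algebra)
  have gV: "WX i \<in> ?V" "WD i \<in> ?V" if "i \<in> {1..n}" for i using that by (auto simp: weyl_gens_def)
  have "E \<subseteq> carrier K.F \<times> carrier K.F"
    using gV unfolding E_def by (auto simp: K.commutator_closed)
  then interpret Q: free_quotient ?V "TYPE('k)" E
    unfolding K.F_free_algebra by (rule free_quotientI)
  have E: "(commutator K.F (gen (WX i)) (gen (WX j)), \<zero>\<^bsub>K.F\<^esub>) \<in> E"
    "(commutator K.F (gen (WD i)) (gen (WD j)), \<zero>\<^bsub>K.F\<^esub>) \<in> E"
    "(gen (WD i) \<otimes>\<^bsub>K.F\<^esub> gen (WX j), (1 + kdelta i j * (q i - 1)) \<odot>\<^bsub>K.F\<^esub>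
      (gen (WX j) \<otimes>\<^bsub>K.F\<^esub> gen (WD i)) \<oplus>\<^bsub>K.F\<^esub> kdelta i j \<odot>\<^bsub>K.F\<^esub> \<one>\<^bsub>K.F\<^esub>) \<in> E"
    if "i \<in> {1..n}" "j \<in> {1..n}" for i j
    unfolding E_def using that by blast+
  define g where "g i = (if i \<le> n then WX i else WD (i - n))" for i
  define x where "x i = Q.\<pi> (gen (g i))" for i
  define \<delta> :: "(nat \<Rightarrow> nat) \<Rightarrow> 'k" where "\<delta> = (\<lambda>m. if m = (\<lambda>_. 0) then 1 else 0)"
  define \<sigma> where "\<sigma> p v = weyl_act n q (map (weyl_index n) v) \<delta> (count p)" for p v
  have g: "g i \<in> ?V" "weyl_index n (g i) = i" if "i \<in> {1..2 * n}" for i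
  proof -
    have "i \<le> n \<or> i - n \<in> {1..n}" using that by auto
    then show "g i \<in> ?V" "weyl_index n (g i) = i" using that by (auto simp: g_def weyl_gens_def)
  qed
  have surj: "?V \<subseteq> g ` {1..2 * n}"
  proof
    fix v assume "v \<in> ?V"
    then obtain i where i: "i \<in> {1..n}" "v = WX i \<or> v = WD i" by (auto simp: weyl_gens_def)
    then have "v = g i \<or> v = g (n + i)" by (auto simp: g_def)
    then show "v \<in> g ` {1..2 * n}" using i(1) by auto
  qed
  have comm: "Q.\<pi> (gen a) \<otimes>\<^bsub>Q.A\<^esub> Q.\<pi> (gen b) = 1 \<odot>\<^bsub>Q.A\<^esub> (Q.\<pi> (gen b) \<otimes>\<^bsub>Q.A\<^esub> Q.\<pi> (gen a)) \<oplus>\<^bsub>Q.A\<^esub> \<zero>\<^bsub>Q.A\<^esub>"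
    if ab: "(commutator K.F (gen a) (gen b), \<zero>\<^bsub>K.F\<^esub>) \<in> E" "a \<in> ?V" "b \<in> ?V" for a b
  proof -
    have "Q.\<pi> (gen a) \<otimes>\<^bsub>Q.A\<^esub> Q.\<pi> (gen b) \<ominus>\<^bsub>Q.A\<^esub> Q.\<pi> (gen b) \<otimes>\<^bsub>Q.A\<^esub> Q.\<pi> (gen a) = \<zero>\<^bsub>Q.A\<^esub>"
      using Q.pi_relation[OF ab(1)] ab by (simp add: commutator_def Q.pi_minus Q.pi_mult Q.pi_zero)
    then show ?thesis using ab by (simp add: Q.pi_closed)
  qed
  have "\<exists>\<phi>. pbw_algebra Q.A (2 * n) (\<lambda>i. Q.\<pi> (gen (g i))) (\<lambda>_. 1) \<phi>"
  proof (rule Q.pbw_from_words[where g = g and \<sigma> = \<sigma>])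
    show "Q.\<pi> (gen v) \<in> Q.A.lspan (Q.A.wprod (\<lambda>i. Q.\<pi> (gen (g i))) ` lists {1..2 * n})" if "v \<in> ?V" for v
      using Q.gens_in_span[of "2 * n" g v] that g(1) surj by blast
  next
    fix i j assume ij: "1 \<le> i" "i < j" "j \<le> 2 * n"
    let ?low = "Q.A.lspan {Q.A.wprod (\<lambda>i. Q.\<pi> (gen (g i))) (sorted_list_of_multiset m) | m.
          m \<in> monomials {1..2 * n} \<and> sum_mset (image_mset (\<lambda>_. 1) m) < (1::nat) + 1}"
    have one: "\<one>\<^bsub>Q.A\<^esub> \<in> ?low"
      using Q.one_in_low_span[of "2 * n" "\<lambda>_. 1" i "\<lambda>i. Q.\<pi> (gen (g i))"] ij by simp
    have zero: "\<zero>\<^bsub>Q.A\<^esub> \<in> ?low" by (rule Q.A.lspan_zero)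
    consider "j \<le> n" | "i \<le> n" "j > n" | "i > n" by linarith
    then show "\<exists>c d. c \<noteq> 0 \<and> Q.\<pi> (gen (g j)) \<otimes>\<^bsub>Q.A\<^esub> Q.\<pi> (gen (g i)) =
        c \<odot>\<^bsub>Q.A\<^esub> (Q.\<pi> (gen (g i)) \<otimes>\<^bsub>Q.A\<^esub> Q.\<pi> (gen (g j))) \<oplus>\<^bsub>Q.A\<^esub> d \<and> d \<in> ?low"
    proof cases
      case 1
      then have "g j = WX j" "g i = WX i" "j \<in> {1..n}" "i \<in> {1..n}" using ij by (auto simp: g_def)
      then have "(commutator K.F (gen (g j)) (gen (g i)), \<zero>\<^bsub>K.F\<^esub>) \<in> E"
        using E(1,2) by simp
      from comm[OF this g(1) g(1)] ij show ?thesis using zero by (intro exI[of _ 1] exI[of _ "\<zero>\<^bsub>Q.A\<^esub>"]) simp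
    next
      case 3
      then have "g j = WD (j - n)" "g i = WD (i - n)" "j - n \<in> {1..n}" "i - n \<in> {1..n}"
        using ij by (auto simp: g_def)
      then have "(commutator K.F (gen (g j)) (gen (g i)), \<zero>\<^bsub>K.F\<^esub>) \<in> E"
        using E(1,2) by simp
      from comm[OF this g(1) g(1)] ij show ?thesis using zero by (intro exI[of _ 1] exI[of _ "\<zero>\<^bsub>Q.A\<^esub>"]) simp
    next
      case 2
      define k where "k = j - n"
      have k: "k \<in> {1..n}" "g j = WD k" "g i = WX i" "i \<in> {1..n}" using 2 ij by (auto simp: k_def g_def)
      let ?c = "1 + kdelta k i * (q k - 1)"
      have "(gen (WD k) \<otimes>\<^bsub>K.F\<^esub> gen (WX i), ?c \<odot>\<^bsub>K.F\<^esub> (gen (WX i) \<otimes>\<^bsub>K.F\<^esub> gen (WD k)) \<oplus>\<^bsub>K.F\<^esub>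
          kdelta k i \<odot>\<^bsub>K.F\<^esub> \<one>\<^bsub>K.F\<^esub>) \<in> E" by (rule E(3)[OF k(1,4)])
      from Q.pi_relation[OF this]
      have "Q.\<pi> (gen (g j)) \<otimes>\<^bsub>Q.A\<^esub> Q.\<pi> (gen (g i)) =
        ?c \<odot>\<^bsub>Q.A\<^esub> (Q.\<pi> (gen (g i)) \<otimes>\<^bsub>Q.A\<^esub> Q.\<pi> (gen (g j))) \<oplus>\<^bsub>Q.A\<^esub> kdelta k i \<odot>\<^bsub>Q.A\<^esub> \<one>\<^bsub>Q.A\<^esub>"
        using gV[OF k(1)] gV[OF k(4)] by (simp add: k Q.pi_add Q.pi_mult Q.pi_smult Q.pi_one)
      moreover have "?c \<noteq> 0" using q k by (simp add: kdelta_def)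
      moreover have "kdelta k i \<odot>\<^bsub>Q.A\<^esub> \<one>\<^bsub>Q.A\<^esub> \<in> ?low" using one by (rule Q.A.lspan_smult)
      ultimately show ?thesis by blast
    qed
  next
    fix u v :: "weyl_gen list" and l r p assume lr: "(l, r) \<in> E"
    let ?u = "map (weyl_index n) u" and ?h = "weyl_act n q (map (weyl_index n) v) \<delta>"
    have \<sigma>: "\<sigma> p (u @ z @ v) = weyl_act n q ?u (weyl_act n q (map (weyl_index n) z) ?h) (count p)" for z
      by (simp add: \<sigma>_def)
    from lr consider
      i j where "i \<in> {1..n}" "j \<in> {1..n}" "l = commutator K.F (gen (WX i)) (gen (WX j))" "r = \<zero>\<^bsub>K.F\<^esub>"
    | i j where "i \<in> {1..n}" "j \<in> {1..n}" "l = commutator K.F (gen (WD i)) (gen (WD j))" "r = \<zero>\<^bsub>K.F\<^esub>"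
    | i j where "i \<in> {1..n}" "j \<in> {1..n}" "l = gen (WD i) \<otimes>\<^bsub>K.F\<^esub> gen (WX j)"
       "r = (1 + kdelta i j * (q i - 1)) \<odot>\<^bsub>K.F\<^esub> (gen (WX j) \<otimes>\<^bsub>K.F\<^esub> gen (WD i)) \<oplus>\<^bsub>K.F\<^esub> kdelta i j \<odot>\<^bsub>K.F\<^esub> \<one>\<^bsub>K.F\<^esub>"
      unfolding E_def by blast
    then show "lin (\<lambda>z. \<sigma> p (u @ z @ v)) l = lin (\<lambda>z. \<sigma> p (u @ z @ v)) r"
    proof cases
      case 1
      then show ?thesis using gV weyl_op_XX[of i n j q ?h]
        by (simp add: K.lin_commutator K.lin_F_zero \<sigma>)
    next
      case 2
      then show ?thesis using gV weyl_op_DD[OF 2(1,2), of q ?h]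
        by (simp add: K.lin_commutator K.lin_F_zero \<sigma>)
    next
      case 3
      then show ?thesis using gV
        by (simp add: K.lin_F_add K.lin_F_smult K.lin_gen_mult K.lin_one \<sigma> weyl_op_DX weyl_act_linear)
    qed
  next
    fix m p assume m: "m \<in> monomials {1..2 * n}" "p \<in> monomials {1..2 * n}"
    let ?v = "sorted_list_of_multiset m"
    have "set ?v \<subseteq> {1..2 * n}" using m by (simp add: monomials_def)
    moreover from this have "map (weyl_index n) (map g ?v) = ?v" 
      using g(2) unfolding map_map by (intro map_idI) auto
    ultimately have "\<sigma> p (map g ?v) = (if count p = count m then 1 else 0)"
      unfolding \<sigma>_def \<delta>_def using weyl_act_sorted[of ?v n q] by simp
    then show "\<sigma> p (map g ?v) = (if p = m then 1 else 0)" by (simp add: count_inject)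
  qed (use g in auto)
  then show ?thesis unfolding A Q.A_eq by blast
qed

text \<open>The two presentations distribute the terms of the mixed relation differently over its
  sides, but for \<open>q = 1\<close> the differences generating the ideal are the same
  elements.\<close>

lemma weyl_eq_q_weyl: "weyl_algebra n = (q_weyl_algebra n (\<lambda>_. 1) :: ('k::field, _) module)"
proof -
  interpret K: free_alg "weyl_gens n" "TYPE('k)" by (intro free_alg.intro k_monoid_alg_free)
  let ?C = "{(commutator K.F (gen (WX i)) (gen (WX j)), \<zero>\<^bsub>K.F\<^esub>) | i j. i \<in> {1..n} \<and> j \<in> {1..n}} \<union>
      {(commutator K.F (gen (WD i)) (gen (WD j)), \<zero>\<^bsub>K.F\<^esub>) | i j. i \<in> {1..n} \<and> j \<in> {1..n}}"
  let ?D = "{(commutator K.F (gen (WD i)) (gen (WX j)), kdelta i j \<odot>\<^bsub>K.F\<^esub> \<one>\<^bsub>K.F\<^esub>) | i j. i \<in> {1..n} \<and> j \<in> {1..n}}"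
  let ?D' = "{(gen (WD i) \<otimes>\<^bsub>K.F\<^esub> gen (WX j),
        (1 + kdelta i j * (1 - 1)) \<odot>\<^bsub>K.F\<^esub> (gen (WX j) \<otimes>\<^bsub>K.F\<^esub> gen (WD i)) \<oplus>\<^bsub>K.F\<^esub>
          kdelta i j \<odot>\<^bsub>K.F\<^esub> \<one>\<^bsub>K.F\<^esub>) | i j. i \<in> {1..n} \<and> j \<in> {1..n}}"
  have eq: "commutator K.F (gen (WD i)) (gen (WX j)) \<ominus>\<^bsub>K.F\<^esub> kdelta i j \<odot>\<^bsub>K.F\<^esub> \<one>\<^bsub>K.F\<^esub> =
      gen (WD i) \<otimes>\<^bsub>K.F\<^esub> gen (WX j) \<ominus>\<^bsub>K.F\<^esub> ((1 + kdelta i j * (1 - 1)) \<odot>\<^bsub>K.F\<^esub> (gen (WX j) \<otimes>\<^bsub>K.F\<^esub> gen (WD i)) \<oplus>\<^bsub>K.F\<^esub>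
          kdelta i j \<odot>\<^bsub>K.F\<^esub> \<one>\<^bsub>K.F\<^esub>)" if "i \<in> {1..n}" "j \<in> {1..n}" for i j
  proof -
    have "WX j \<in> weyl_gens n" "WD i \<in> weyl_gens n" using that by (auto simp: weyl_gens_def)
    then have "gen (WX j) \<in> carrier K.F" "gen (WD i) \<in> carrier K.F" by (simp_all only: K.gen_in_F)
    then show ?thesis by (simp add: commutator_def a_minus_def K.F.minus_add K.F.a_assoc)
  qed
  have s: "{l \<ominus>\<^bsub>K.F\<^esub> r | l r. (l, r) \<in> {(f i j, h i j) | i j. i \<in> {1..n} \<and> j \<in> {1..n}}} =
      (\<lambda>(i, j). f i j \<ominus>\<^bsub>K.F\<^esub> h i j) ` ({1..n} \<times> {1..n})" for f h :: "nat \<Rightarrow> nat \<Rightarrow> weyl_gen list \<Rightarrow> 'k"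
  proof (intro equalityI subsetI)
    fix y assume "y \<in> (\<lambda>(i, j). f i j \<ominus>\<^bsub>K.F\<^esub> h i j) ` ({1..n} \<times> {1..n})"
    then obtain i j where "i \<in> {1..n}" "j \<in> {1..n}" "y = f i j \<ominus>\<^bsub>K.F\<^esub> h i j" by auto
    then show "y \<in> {l \<ominus>\<^bsub>K.F\<^esub> r | l r. (l, r) \<in> {(f i j, h i j) | i j. i \<in> {1..n} \<and> j \<in> {1..n}}}" by blast
  qed auto
  have "{l \<ominus>\<^bsub>K.F\<^esub> r | l r. (l, r) \<in> ?D} = {l \<ominus>\<^bsub>K.F\<^esub> r | l r. (l, r) \<in> ?D'}"
    unfolding s using eq by (intro image_cong refl) (simp only: split_beta mem_Times_iff)
  then have "{l \<ominus>\<^bsub>K.F\<^esub> r | l r. (l, r) \<in> ?C \<union> ?D} = {l \<ominus>\<^bsub>K.F\<^esub> r | l r. (l, r) \<in> ?C \<union> ?D'}" by blast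
  then have "impose K.F (?C \<union> ?D) = impose K.F (?C \<union> ?D')"
    unfolding impose_def relation_ideal_def by simp
  then show ?thesis
    unfolding weyl_algebra_def q_weyl_algebra_def Let_def K.F_free_algebra .
qed

section \<open>Enveloping algebras\<close>

text \<open>This is the leftmost descent. Sortedness of \<open>u @ [j]\<close> forces every other
  descent to lie further to the right.\<close>

lemma sorted_prefix_descent:
  "\<not> sorted (v :: nat list) \<Longrightarrow> \<exists>u j i r. v = u @ j # i # r \<and> i < j \<and> sorted (u @ [j])"
proof (induction v rule: rev_induct)
  case (snoc a v)
  show ?case
  proof (cases "sorted v")
    case False
    then obtain u j i r where "v = u @ j # i # r" "i < j" "sorted (u @ [j])" using snoc by blast
    then show ?thesis by (intro exI[of _ u] exI[of _ j] exI[of _ i] exI[of _ "r @ [a]"]) simp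
  next
    case True
    then have "v \<noteq> []" using snoc.prems by auto
    then obtain u j where v: "v = u @ [j]" by (metis append_butlast_last_id)
    have "\<not> j \<le> a"
    proof
      assume "j \<le> a"
      moreover have "b \<le> j" if "b \<in> set u" for b using True that by (auto simp: v sorted_append)
      ultimately have "\<forall>b\<in>set v. b \<le> a" by (fastforce simp: v)
      then show False using True snoc.prems by (simp add: sorted_append)
    qed
    then show ?thesis using True v by (intro exI[of _ u] exI[of _ j] exI[of _ a] exI[of _ "[]"]) simp
  qed
qed simp

section \<open>Straightening words with the Lie bracket\<close>

context
  fixes N :: nat and s :: "nat \<Rightarrow> nat \<Rightarrow> nat \<Rightarrow> 'k::field"
begin

definition first_descent :: "nat list \<Rightarrow> nat list \<times> nat \<times> nat \<times> nat list" where
  "first_descent w = (SOME (u, j, i, v). w = u @ j # i # v \<and> i < j \<and> sorted (u @ [j]))"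

lemma first_descent:
  assumes "\<not> sorted w" "first_descent w = (u, j, i, v)"
  shows "w = u @ j # i # v" "i < j" "sorted (u @ [j])"
proof -
  have "\<exists>x. case x of (u, j, i, v) \<Rightarrow> w = u @ j # i # v \<and> i < j \<and> sorted (u @ [j])"
    using sorted_prefix_descent[OF assms(1)] by auto
  from someI_ex[OF this] assms(2)
  show "w = u @ j # i # v" "i < j" "sorted (u @ [j])" by (auto simp: first_descent_def)
qed

lemma lenlex_swap: "i < j \<Longrightarrow> (u @ i # j # v, u @ j # i # v) \<in> lenlex less_than"
  by (auto simp: lenlex_conv lex_conv intro!: exI[of _ u])

lemma lenlex_shorter: "length u < length v \<Longrightarrow> (u, v) \<in> lenlex less_than"
  by (simp add: lenlex_conv)

text \<open>
  Jacobson's linear map from words to coefficients of sorted words: it fixes sorted words and rewrites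
  the first descent of any other word by the relation \<open>x\<^sub>j x\<^sub>i = x\<^sub>i x\<^sub>j + [x\<^sub>j, x\<^sub>i]\<close>.
\<close>

function straight :: "nat list \<Rightarrow> nat multiset \<Rightarrow> 'k" where
  "straight w = (if sorted w then \<lambda>p. if mset w = p then 1 else 0
    else (case first_descent w of (u, j, i, v) \<Rightarrow>
      \<lambda>p. straight (u @ i # j # v) p + (\<Sum>l=1..N. s j i l * straight (u @ l # v) p)))"
  by pat_completeness auto
termination
proof (relation "lenlex less_than", goal_cases)
  case 1
  show ?case by (rule wf_lenlex[OF wf_less_than])
next
  case (2 w u y j z i v)
  then have "w = u @ j # i # v" "i < j" using first_descent[of w u j i v] by auto
  then show ?case using lenlex_swap by simp
next
  case (3 w u y j z i v p l)
  then have "w = u @ j # i # v" using first_descent[of w u j i v] by auto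
  then show ?case by (intro lenlex_shorter) simp
qed

declare straight.simps [simp del]

lemma straight_sorted: "sorted w \<Longrightarrow> straight w p = (if p = mset w then 1 else 0)"
  by (auto simp: straight.simps)

context
  assumes alt: "\<And>i l. s i i l = 0" and antisym: "\<And>i j l. s i j l = - s j i l"
    and jacobi: "\<And>a b c m. (\<Sum>l=1..N. s b a l * s l c m + s a c l * s l b m + s c b l * s l a m) = 0"
begin

text \<open>Antisymmetry turns the relation for \<open>i < j\<close> into the one for
  \<open>j < i\<close>, and alternation settles \<open>i = j\<close>. Words of a single length are
  treated so that the lemma can be applied to shorter words inside the next induction.\<close>

lemma straight_any_order:
  assumes "\<And>u j i v. \<lbrakk>length (u @ j # i # v) = n; i < j\<rbrakk> \<Longrightarrow> straight (u @ j # i # v) p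
    = straight (u @ i # j # v) p + (\<Sum>l=1..N. s j i l * straight (u @ l # v) p)"
    and n: "length (u @ j # i # v) = n"
  shows "straight (u @ j # i # v) p
    = straight (u @ i # j # v) p + (\<Sum>l=1..N. s j i l * straight (u @ l # v) p)"
proof -
  consider "i < j" | "i = j" | "j < i" by linarith
  then show ?thesis
  proof cases
    case 1
    then show ?thesis using assms by blast
  next
    case 2
    then show ?thesis by (simp add: alt)
  next
    case 3
    then have "straight (u @ i # j # v) p
      = straight (u @ j # i # v) p + (\<Sum>l=1..N. s i j l * straight (u @ l # v) p)"
      using assms(1)[of u i j v] n by simp
    moreover have "(\<Sum>l=1..N. s i j l * straight (u @ l # v) p) = - (\<Sum>l=1..N. s j i l * straight (u @ l # v) p)"
      unfolding sum_negf[symmetric] by (intro sum.cong refl) (subst antisym, simp)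
    ultimately show ?thesis by simp
  qed
qed

text \<open>The map rewrites the first descent only, and the content of the theorem is that it
  respects the relation at every descent. The given descent is the first one, or disjoint from it so
  that the two rewritings commute, or overlaps it, which is where the Jacobi identity is
  used.\<close>

lemma straight_descent:
  "i < j \<Longrightarrow> w = u @ j # i # v \<Longrightarrow> straight (u @ j # i # v) p
    = straight (u @ i # j # v) p + (\<Sum>l=1..N. s j i l * straight (u @ l # v) p)"
proof (induction w arbitrary: u j i v p rule: wf_induct_rule[OF wf_lenlex[OF wf_less_than]])
  case (1 w)
  have IH: "straight (u' @ j' # i' # v') p' = straight (u' @ i' # j' # v') p' + (\<Sum>l=1..N. s j' i' l * straight (u' @ l # v') p')"
    if "(u' @ j' # i' # v', w) \<in> lenlex less_than" "i' < j'" for u' j' i' v' p'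
    using 1(1)[OF that(1) that(2) refl] .
  have short: "straight (u' @ j' # i' # v') p' = straight (u' @ i' # j' # v') p' + (\<Sum>l=1..N. s j' i' l * straight (u' @ l # v') p')"
    if len: "length (u' @ j' # i' # v') < length w" for u' j' i' v' p'
  proof (rule straight_any_order[OF _ refl])
    fix a d :: "nat list" and b c :: nat
    assume "length (a @ c # b # d) = length (u' @ j' # i' # v')" and lt: "b < c"
    then have "(a @ c # b # d, w) \<in> lenlex less_than" using len by (intro lenlex_shorter) simp
    then show "straight (a @ c # b # d) p' = straight (a @ b # c # d) p' + (\<Sum>l=1..N. s c b l * straight (a @ l # d) p')"
      using lt by (rule IH)
  qed
  have w: "w = u @ j # i # v" and ij: "i < j" using 1 by auto
  have ns: "\<not> sorted w" using ij by (auto simp: w sorted_append)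
  obtain u0 j0 i0 v0 where fd: "first_descent w = (u0, j0, i0, v0)" by (cases "first_descent w")
  note d0 = first_descent[OF ns fd]
  have def: "straight w p = straight (u0 @ i0 # j0 # v0) p + (\<Sum>l=1..N. s j0 i0 l * straight (u0 @ l # v0) p)" for p
    by (subst straight.simps) (simp add: ns fd)
  \<comment> \<open>A descent cannot start inside the sorted prefix \<open>u0 @ [j0]\<close> before
    its last letter.\<close>
  have "length u0 \<le> length u"
  proof (rule ccontr)
    assume "\<not> length u0 \<le> length u"
    then have len: "Suc (length u) < length (u0 @ [j0])" by simp
    have "(u0 @ [j0]) ! k = w ! k" if "k < length (u0 @ [j0])" for k
      using that by (auto simp: d0(1) nth_append less_Suc_eq)
    then have "w ! length u \<le> w ! Suc (length u)"
      using sorted_nth_mono[OF d0(3), of "length u" "Suc (length u)"] len by simp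
    then show False using ij by (simp add: w nth_append)
  qed
  then obtain z where z: "u = u0 @ z" "j0 # i0 # v0 = z @ j # i # v"
    using d0(1) w by (auto simp: append_eq_append_conv2)
  consider "z = []" | "z = [j0]" | y where "z = j0 # i0 # y"
    using z(2) by (cases z; cases "tl z") auto
  then show ?case
  proof cases
    case 1
    then show ?thesis using def z w d0(1) by simp
  next
    case 3
    then have v0: "v0 = y @ j # i # v" using z(2) by simp
    have u: "u = u0 @ j0 # i0 # y" using z 3 by simp
    \<comment> \<open>Disjoint descents: both are rewritten, in either order. After one exchange the
      word is smaller in \<open>lenlex\<close>, and after one bracket it is shorter, so the relation
      is available for all words that occur.\<close>
    have e1: "straight (u0 @ i0 # j0 # y @ j # i # v) p = straight (u0 @ i0 # j0 # y @ i # j # v) p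
        + (\<Sum>l=1..N. s j i l * straight (u0 @ i0 # j0 # y @ l # v) p)"
      using IH[of "u0 @ i0 # j0 # y" j i v p] lenlex_swap[OF d0(2), of u0 v0] ij by (simp add: d0(1) v0)
    have e2: "straight (u0 @ l # y @ j # i # v) p = straight (u0 @ l # y @ i # j # v) p
        + (\<Sum>l'=1..N. s j i l' * straight (u0 @ l # y @ l' # v) p)" for l
      using short[of "u0 @ l # y" j i v p] by (simp add: d0(1) v0)
    have e3: "straight (u0 @ j0 # i0 # y @ i # j # v) p = straight (u0 @ i0 # j0 # y @ i # j # v) p
        + (\<Sum>l=1..N. s j0 i0 l * straight (u0 @ l # y @ i # j # v) p)"
      using IH[of u0 j0 i0 "y @ i # j # v" p] lenlex_swap[OF ij, of u v] d0(2) by (simp add: w u)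
    have e4: "straight (u0 @ j0 # i0 # y @ l # v) p = straight (u0 @ i0 # j0 # y @ l # v) p
        + (\<Sum>l'=1..N. s j0 i0 l' * straight (u0 @ l' # y @ l # v) p)" for l
      using short[of u0 j0 i0 "y @ l # v" p] by (simp add: d0(1) v0)
    have "(\<Sum>l=1..N. s j0 i0 l * (\<Sum>l'=1..N. s j i l' * straight (u0 @ l # y @ l' # v) p))
      = (\<Sum>l'=1..N. s j i l' * (\<Sum>l=1..N. s j0 i0 l * straight (u0 @ l # y @ l' # v) p))"
      unfolding sum_distrib_left by (subst sum.swap) (simp add: mult_ac)
    moreover have "straight w p = straight (u0 @ i0 # j0 # y @ j # i # v) p
        + (\<Sum>l=1..N. s j0 i0 l * straight (u0 @ l # y @ j # i # v) p)" using def by (simp add: v0)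
    ultimately show ?thesis
      unfolding w[symmetric] by (simp add: u e1 e2 e3 e4 distrib_left sum.distrib)
  next
    case 2
    then have eqs: "i0 = j" "v0 = i # v" "u = u0 @ [j0]" using z by auto
    \<comment> \<open>Overlap: the word \<open>c b a\<close> with \<open>a < b < c\<close> is taken
      to \<open>a b c\<close> along the two possible routes, and the collected bracket terms have to
      agree.\<close>
    define a b c where "a = i" and "b = j" and "c = j0"
    have abc: "a < b" "b < c" using ij d0(2) by (auto simp: a_def b_def c_def eqs)
    have w': "w = u0 @ c # b # a # v" by (simp add: d0(1) eqs a_def b_def c_def)
    let ?S = "\<lambda>x y z'. straight (u0 @ x # y # z' # v) p"
    let ?D = "\<lambda>x y. straight (u0 @ x # y # v) p"
    have lt1: "(u0 @ b # c # a # v, w) \<in> lenlex less_than" using lenlex_swap[OF abc(2), of u0 "a # v"] by (simp add: w')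
    have lt2: "(u0 @ c # a # b # v, w) \<in> lenlex less_than" using lenlex_swap[OF abc(1), of "u0 @ [c]" v] by (simp add: w')
    have tr: "trans (lenlex less_than)" by (simp add: lenlex_transI)
    have lt3: "(u0 @ b # a # c # v, w) \<in> lenlex less_than"
      using lenlex_swap[of a c "u0 @ [b]" v] abc transD[OF tr _ lt1] by simp
    have lt4: "(u0 @ a # c # b # v, w) \<in> lenlex less_than"
      using lenlex_swap[of a c u0 "b # v"] abc transD[OF tr _ lt2] by simp
    have f0: "straight w p = ?S b c a + (\<Sum>l=1..N. s c b l * ?D l a)"
      using def by (simp add: eqs a_def b_def c_def)
    have f1: "?S b c a = ?S b a c + (\<Sum>l=1..N. s c a l * ?D b l)"
      using IH[of "u0 @ [b]" c a v p] lt1 abc by simp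
    have f2: "?S b a c = ?S a b c + (\<Sum>l=1..N. s b a l * ?D l c)"
      using IH[of u0 b a "c # v" p] lt3 abc by simp
    have f3: "?S c a b = ?S a c b + (\<Sum>l=1..N. s c a l * ?D l b)"
      using IH[of u0 c a "b # v" p] lt2 abc by simp
    have f4: "?S a c b = ?S a b c + (\<Sum>l=1..N. s c b l * ?D a l)"
      using IH[of "u0 @ [a]" c b v p] lt4 abc by simp
    have g: "?D x y = ?D y x + (\<Sum>m=1..N. s x y m * straight (u0 @ m # v) p)" for x y
      using short[of u0 x y v p] by (simp add: w')
    let ?r = "\<lambda>m. straight (u0 @ m # v) p"
    \<comment> \<open>Exchanging a bracket with the third letter leaves a bracket of brackets; its
      total coefficient at each letter \<open>m\<close> is a Jacobi sum.\<close>
    have "(\<Sum>l=1..N. s c b l * (?D l a - ?D a l)) + (\<Sum>l=1..N. s c a l * (?D b l - ?D l b))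
        + (\<Sum>l=1..N. s b a l * (?D l c - ?D c l))
      = (\<Sum>l=1..N. s c b l * (\<Sum>m=1..N. s l a m * ?r m)) + (\<Sum>l=1..N. s a c l * (\<Sum>m=1..N. s l b m * ?r m))
        + (\<Sum>l=1..N. s b a l * (\<Sum>m=1..N. s l c m * ?r m))"
    proof -
      have "(\<Sum>l=1..N. s c a l * (?D b l - ?D l b)) = (\<Sum>l=1..N. s a c l * (\<Sum>m=1..N. s l b m * ?r m))"
        by (intro sum.cong refl) (subst antisym, subst g[of _ b], simp)
      moreover have "(\<Sum>l=1..N. s c b l * (?D l a - ?D a l)) = (\<Sum>l=1..N. s c b l * (\<Sum>m=1..N. s l a m * ?r m))"
        by (intro sum.cong refl) (subst g[of _ a], simp)
      moreover have "(\<Sum>l=1..N. s b a l * (?D l c - ?D c l)) = (\<Sum>l=1..N. s b a l * (\<Sum>m=1..N. s l c m * ?r m))"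
        by (intro sum.cong refl) (subst g[of _ c], simp)
      ultimately show ?thesis by simp
    qed
    also have "\<dots> = (\<Sum>m=1..N. (\<Sum>l=1..N. s b a l * s l c m + s a c l * s l b m + s c b l * s l a m) * ?r m)"
    proof -
      have sw: "(\<Sum>l=1..N. f l * (\<Sum>m=1..N. h l m * ?r m)) = (\<Sum>m=1..N. (\<Sum>l=1..N. f l * h l m) * ?r m)"
        for f :: "nat \<Rightarrow> 'k" and h
        unfolding sum_distrib_left sum_distrib_right by (subst sum.swap) (simp add: mult_ac)
      show ?thesis unfolding sw by (simp add: sum.distrib distrib_right)
    qed
    also have "\<dots> = 0" by (simp only: jacobi mult_zero_left sum.neutral_const)
    finally have key: "(\<Sum>l=1..N. s c b l * ?D l a) + (\<Sum>l=1..N. s c a l * ?D b l) + (\<Sum>l=1..N. s b a l * ?D l c)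
      = (\<Sum>l=1..N. s c b l * ?D a l) + (\<Sum>l=1..N. s c a l * ?D l b) + (\<Sum>l=1..N. s b a l * ?D c l)"
      by (simp add: right_diff_distrib sum_subtractf algebra_simps)
    have "straight w p = ?S c a b + (\<Sum>l=1..N. s b a l * ?D c l)"
      unfolding f0 f1 f2 f3 f4 using key by (simp add: algebra_simps)
    then show ?thesis unfolding w[symmetric] by (simp add: eqs a_def b_def c_def)
  qed
qed

lemma straight_relation:
  "straight (u @ j # i # v) p = straight (u @ i # j # v) p + (\<Sum>l=1..N. s j i l * straight (u @ l # v) p)"
  by (rule straight_any_order[OF straight_descent[OF _ refl] refl])

end

end

lemma k_space_from_module: "module kfield L \<Longrightarrow> k_space (L :: ('k::field, 'l, 'm) module_scheme)"
  unfolding module_def module_axioms_def k_space_def k_space_axioms_def by auto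

context k_space
begin

lemma lspan_functional_eq:
  fixes G H :: "'a \<Rightarrow> 'k"
  assumes x: "x \<in> lspan S" and S: "S \<subseteq> carrier A"
    and "\<And>x y. \<lbrakk>x \<in> carrier A; y \<in> carrier A\<rbrakk> \<Longrightarrow> G (x \<oplus> y) = G x + G y"
    and "\<And>x y. \<lbrakk>x \<in> carrier A; y \<in> carrier A\<rbrakk> \<Longrightarrow> H (x \<oplus> y) = H x + H y"
    and Gc: "\<And>c x. x \<in> carrier A \<Longrightarrow> G (c \<odot> x) = c * G x" and Hc: "\<And>c x. x \<in> carrier A \<Longrightarrow> H (c \<odot> x) = c * H x"
    and "\<And>s. s \<in> S \<Longrightarrow> G s = H s"
  shows "G x = H x"
  using x
proof (induction rule: lspan.induct)
  case lspan_zero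
  show ?case using Gc[of \<zero> 0] Hc[of \<zero> 0] by simp
qed (use assms lspan_carrier[OF _ S] in simp_all)

lemma basis_lspan:
  assumes "k_basis A B (\<lambda>x. x)" and "x \<in> carrier A"
  shows "x \<in> lspan B"
proof -
  have B: "B \<subseteq> carrier A" using assms(1) by (auto simp: k_basis_def)
  have "\<forall>x\<in>carrier A. \<exists>F c. finite F \<and> F \<subseteq> B \<and> x = (\<Oplus>i\<in>F. c i \<odot> i)"
    using assms(1) unfolding k_basis_def by (elim conjE)
  then obtain F c where F: "finite F" "F \<subseteq> B" "x = (\<Oplus>i\<in>F. c i \<odot> i)" using assms(2) by blast
  show ?thesis unfolding F(3) using F B by (intro lspan_finsum lspan_smult lspan_base) auto
qed

end

section \<open>Multilinear extension of functionals on words\<close>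

context
  fixes N :: nat and f :: "'l \<Rightarrow> nat \<Rightarrow> 'k::field"
begin

text \<open>With \<open>f y i\<close> the i-th coordinate of the vector \<open>y\<close>, this
  extends a functional from words of basis indices to words of arbitrary vectors, that is, to the
  tensor algebra. The words of the enveloping presentation are of the latter kind.\<close>

fun mext :: "(nat list \<Rightarrow> 'k) \<Rightarrow> 'l list \<Rightarrow> 'k" where
  "mext \<tau> [] = \<tau> []"
| "mext \<tau> (y # w) = (\<Sum>i=1..N. f y i * mext (\<lambda>v. \<tau> (i # v)) w)"

lemma mext_append: "mext \<tau> (u @ w) = mext (\<lambda>a. mext (\<lambda>b. \<tau> (a @ b)) w) u"
  by (induction u arbitrary: \<tau>) simp_all

lemma mext_add: "mext (\<lambda>v. \<tau> v + \<tau>' v) w = mext \<tau> w + mext \<tau>' w"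
  by (induction w arbitrary: \<tau> \<tau>') (simp_all add: distrib_left sum.distrib)

lemma mext_smult: "mext (\<lambda>v. c * \<tau> v) w = c * mext \<tau> w"
  by (induction w arbitrary: \<tau>) (simp_all add: sum_distrib_left mult_ac)

lemma mext_sum: "mext (\<lambda>v. \<Sum>l=1..m. \<tau> l v) w = (\<Sum>l=1..m::nat. mext (\<tau> l) w)"
proof (induction m)
  case 0
  have "mext (\<lambda>v. 0) w = 0" using mext_smult[of 0 "\<lambda>_. 0" w] by simp
  then show ?case by simp
qed (simp add: mext_add)

lemma mext_basis:
  assumes "\<And>i j. \<lbrakk>i \<in> {1..N}; j \<in> {1..N}\<rbrakk> \<Longrightarrow> f (e i) j = (if j = i then 1 else 0)"
  shows "set v \<subseteq> {1..N} \<Longrightarrow> mext \<tau> (map e v) = \<tau> v"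
proof (induction v arbitrary: \<tau>)
  case (Cons i v)
  have "mext \<tau> (map e (i # v)) = (\<Sum>j=1..N. (if j = i then 1 else 0) * \<tau> (j # v))"
    using Cons assms by (auto intro!: sum.cong)
  also have "\<dots> = (\<Sum>j=1..N. if j = i then \<tau> (j # v) else 0)" by (intro sum.cong) auto
  finally show ?case using Cons.prems by simp
qed simp

end

lemma enveloping_pbw:
  fixes L :: "('k::field, 'l) module"
  assumes lie: "lie_algebra L br" and fd: "finite_dimensional L"
  shows "\<exists>N x w \<phi>. pbw_algebra (enveloping_algebra L br) N x w \<phi>"
proof -
  note [simp del] = One_nat_def
  interpret L: k_space L using lie by (intro k_space_from_module) (simp add: lie_algebra_def)
  have br_closed: "br x y \<in> carrier L" if "x \<in> carrier L" "y \<in> carrier L" for x y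
    using lie that by (simp add: lie_algebra_def)
  have br_add: "br (x \<oplus>\<^bsub>L\<^esub> y) z = br x z \<oplus>\<^bsub>L\<^esub> br y z" "br z (x \<oplus>\<^bsub>L\<^esub> y) = br z x \<oplus>\<^bsub>L\<^esub> br z y"
    if "x \<in> carrier L" "y \<in> carrier L" "z \<in> carrier L" for x y z
    using lie that by (simp_all add: lie_algebra_def)
  have br_smult: "br (c \<odot>\<^bsub>L\<^esub> x) y = c \<odot>\<^bsub>L\<^esub> br x y" "br x (c \<odot>\<^bsub>L\<^esub> y) = c \<odot>\<^bsub>L\<^esub> br x y"
    if "x \<in> carrier L" "y \<in> carrier L" for c x y
    using lie that by (simp_all add: lie_algebra_def)
  have br_alt: "br x x = \<zero>\<^bsub>L\<^esub>" if "x \<in> carrier L" for x using lie that by (simp add: lie_algebra_def)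
  have br_jacobi: "br x (br y z) \<oplus>\<^bsub>L\<^esub> br y (br z x) \<oplus>\<^bsub>L\<^esub> br z (br x y) = \<zero>\<^bsub>L\<^esub>"
    if "x \<in> carrier L" "y \<in> carrier L" "z \<in> carrier L" for x y z
    using lie that unfolding lie_algebra_def by blast
  obtain B where B: "finite B" "k_basis L B (\<lambda>x. x)" using fd by (auto simp: finite_dimensional_def)
  then have BL: "B \<subseteq> carrier L" by (auto simp: k_basis_def)
  define N where "N = card B"
  obtain e where e: "bij_betw e {1..N} B" using ex_bij_betw_nat_finite_1[OF B(1)] by (auto simp: N_def)
  have eB: "e i \<in> B" and eL: "e i \<in> carrier L" if "i \<in> {1..N}" for i
    using that e BL by (auto simp: bij_betw_def)
  obtain \<psi> where \<psi>: "\<forall>x\<in>carrier L. \<forall>y\<in>carrier L. \<forall>i. \<psi> (x \<oplus>\<^bsub>L\<^esub> y) i = \<psi> x i + \<psi> y i"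
    "\<forall>x\<in>carrier L. \<forall>c i. \<psi> (c \<odot>\<^bsub>L\<^esub> x) i = c * \<psi> x i" "\<forall>i\<in>B. \<forall>j. \<psi> i j = (if j = i then 1 else 0)"
    using L.basis_coordinates[OF B(2)] by blast
  define f where "f x i = \<psi> x (e i)" for x i
  have f_add: "f (x \<oplus>\<^bsub>L\<^esub> y) i = f x i + f y i" if "x \<in> carrier L" "y \<in> carrier L" for x y i
    using \<psi>(1) that by (simp add: f_def)
  have f_smult: "f (c \<odot>\<^bsub>L\<^esub> x) i = c * f x i" if "x \<in> carrier L" for c x i
    using \<psi>(2) that by (simp add: f_def)
  have f_zero: "f \<zero>\<^bsub>L\<^esub> i = 0" for i using f_smult[of "\<zero>\<^bsub>L\<^esub>" 0 i] by simp
  have f_basis: "f (e i) j = (if j = i then 1 else 0)" if "i \<in> {1..N}" "j \<in> {1..N}" for i j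
  proof -
    have "e j = e i \<longleftrightarrow> j = i" 
      using inj_on_eq_iff[OF bij_betw_imp_inj_on[OF e] that(2,1)] .
    then show ?thesis using \<psi>(3) eB[OF that(1)] by (simp add: f_def)
  qed
  have span: "x \<in> L.lspan (e ` {1..N})" if "x \<in> carrier L" for x
    using L.basis_lspan[OF B(2) that] e by (simp add: bij_betw_def)
  have eS: "e ` {1..N} \<subseteq> carrier L" using eL by auto
  \<comment> \<open>Structure constants of the bracket, set to zero outside \<open>{1..N}\<close> so
    that antisymmetry and the Jacobi identity hold for all natural numbers, as the straightening
    lemmas demand.\<close>
  define s where "s i j l = (if i \<in> {1..N} \<and> j \<in> {1..N} \<and> l \<in> {1..N} then f (br (e i) (e j)) l else 0)" for i j l
  have delta: "(\<Sum>i=1..N. f (e k) i * g i) = g k" if "k \<in> {1..N}" for k and g :: "nat \<Rightarrow> 'k"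
  proof -
    have "(\<Sum>i=1..N. f (e k) i * g i) = (\<Sum>i=1..N. if i = k then g i else 0)"
      using that by (intro sum.cong) (auto simp: f_basis)
    then show ?thesis using that by simp
  qed
  have f_br1: "f (br (e i) z) l = (\<Sum>j=1..N. f z j * s i j l)" if i: "i \<in> {1..N}" and l: "l \<in> {1..N}" and z: "z \<in> carrier L" for i l z
  proof (rule L.lspan_functional_eq[OF span[OF z] eS])
    show "f (br (e i) y) l = (\<Sum>j=1..N. f y j * s i j l)" if y: "y \<in> e ` {1..N}" for y
    proof -
      obtain k where k: "k \<in> {1..N}" "y = e k" using y by blast
      show ?thesis unfolding k(2) delta[OF k(1)] using i l k by (simp add: s_def)
    qed
  qed (use eL[OF i] in \<open>simp_all add: br_add br_smult f_add f_smult br_closed sum.distrib distrib_right sum_distrib_left mult.assoc\<close>)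
  have f_br: "f (br y z) l = (\<Sum>i=1..N. \<Sum>j=1..N. f y i * f z j * s i j l)"
    if y: "y \<in> carrier L" and z: "z \<in> carrier L" and l: "l \<in> {1..N}" for y z l
  proof (rule L.lspan_functional_eq[OF span[OF y] eS, where G = "\<lambda>y. f (br y z) l"])
    show "f (br x z) l = (\<Sum>i=1..N. \<Sum>j=1..N. f x i * f z j * s i j l)" if x: "x \<in> e ` {1..N}" for x
    proof -
      obtain k where k: "k \<in> {1..N}" "x = e k" using x by blast
      have "(\<Sum>i=1..N. \<Sum>j=1..N. f x i * f z j * s i j l) = (\<Sum>i=1..N. f (e k) i * (\<Sum>j=1..N. f z j * s i j l))"
        by (simp add: k sum_distrib_left mult.assoc)
      then show ?thesis using f_br1[OF k(1) l z] k delta[OF k(1)] by simp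
    qed
  qed (use z in \<open>simp_all add: br_add br_smult f_add f_smult br_closed sum.distrib distrib_right sum_distrib_left mult.assoc\<close>)
  have alt: "s i i l = 0" for i l using eL by (simp add: s_def br_alt f_zero)
  have antisym: "s i j l = - s j i l" for i j l
  proof (cases "i \<in> {1..N} \<and> j \<in> {1..N} \<and> l \<in> {1..N}")
    case True
    then have c: "e i \<in> carrier L" "e j \<in> carrier L" using eL by auto
    have "0 = f (br (e i \<oplus>\<^bsub>L\<^esub> e j) (e i \<oplus>\<^bsub>L\<^esub> e j)) l" using c by (simp add: br_alt f_zero)
    also have "\<dots> = f (br (e i) (e j)) l + f (br (e j) (e i)) l"
      using c by (subst br_add(1)) (simp_all add: br_add(2) br_closed f_add br_alt f_zero)
    finally have "f (br (e i) (e j)) l = - f (br (e j) (e i)) l" by (simp add: eq_neg_iff_add_eq_0)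
    then show ?thesis using True by (simp add: s_def)
  qed (auto simp: s_def)
  have jac1: "(\<Sum>l=1..N. s b c l * s a l m + s c a l * s b l m + s a b l * s c l m) = 0" for a b c m
  proof (cases "a \<in> {1..N} \<and> b \<in> {1..N} \<and> c \<in> {1..N} \<and> m \<in> {1..N}")
    case True
    then have car: "e a \<in> carrier L" "e b \<in> carrier L" "e c \<in> carrier L" using eL by auto
    have t: "f (br (e x) (br (e y) (e z))) m = (\<Sum>l=1..N. s y z l * s x l m)"
      if xyz: "x \<in> {1..N}" "y \<in> {1..N}" "z \<in> {1..N}" for x y z
    proof -
      have "f (br (e x) (br (e y) (e z))) m = (\<Sum>l=1..N. f (br (e y) (e z)) l * s x l m)"
        using f_br1[OF xyz(1), of m "br (e y) (e z)"] True xyz br_closed eL by simp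
      also have "\<dots> = (\<Sum>l=1..N. s y z l * s x l m)" using xyz by (intro sum.cong) (auto simp: s_def)
      finally show ?thesis .
    qed
    have "0 = f (br (e a) (br (e b) (e c)) \<oplus>\<^bsub>L\<^esub> br (e b) (br (e c) (e a)) \<oplus>\<^bsub>L\<^esub> br (e c) (br (e a) (e b))) m"
      using br_jacobi[OF car] by (simp add: f_zero)
    also have "\<dots> = (\<Sum>l=1..N. s b c l * s a l m) + (\<Sum>l=1..N. s c a l * s b l m) + (\<Sum>l=1..N. s a b l * s c l m)"
      using car True by (simp add: f_add br_closed t)
    finally show ?thesis by (simp add: sum.distrib)
  qed (auto simp: s_def)
  \<comment> \<open>Two sign changes in each term pass from the cyclic form to the one met in the
    overlap computation.\<close>
  have jacobi: "(\<Sum>l=1..N. s b a l * s l c m + s a c l * s l b m + s c b l * s l a m) = 0" for a b c m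
  proof -
    have "s b a l * s l c m + s a c l * s l b m + s c b l * s l a m
      = s b c l * s a l m + s c a l * s b l m + s a b l * s c l m" for l
      using antisym[of b a l] antisym[of l c m] antisym[of a c l] antisym[of l b m] antisym[of c b l] antisym[of l a m]
      by simp
    then show ?thesis using jac1 by simp
  qed
  interpret K: free_alg "carrier L" "TYPE('k)" by (intro free_alg.intro k_monoid_alg_free)
  define E where "E = {(gen (x \<oplus>\<^bsub>L\<^esub> y), gen x \<oplus>\<^bsub>K.F\<^esub> gen y) | x y. x \<in> carrier L \<and> y \<in> carrier L} \<union>
      {(gen (c \<odot>\<^bsub>L\<^esub> x), c \<odot>\<^bsub>K.F\<^esub> gen x) | c x. x \<in> carrier L} \<union>
      {(commutator K.F (gen x) (gen y), gen (br x y)) | x y. x \<in> carrier L \<and> y \<in> carrier L}"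
  have A: "enveloping_algebra L br = impose (free_algebra (carrier L)) E"
    by (simp only: enveloping_algebra_def Let_def E_def K.F_free_algebra)
  have E: "(gen (x \<oplus>\<^bsub>L\<^esub> y), gen x \<oplus>\<^bsub>K.F\<^esub> gen y) \<in> E" "(gen (c \<odot>\<^bsub>L\<^esub> x), c \<odot>\<^bsub>K.F\<^esub> gen x) \<in> E"
    "(commutator K.F (gen x) (gen y), gen (br x y)) \<in> E" if "x \<in> carrier L" "y \<in> carrier L" for x y c
    unfolding E_def using that by blast+
  have "E \<subseteq> carrier K.F \<times> carrier K.F"
    unfolding E_def by (auto simp: K.commutator_closed br_closed)
  then interpret Q: free_quotient "carrier L" "TYPE('k)" E
    unfolding K.F_free_algebra by (rule free_quotientI)
  \<comment> \<open>The linear relations of the presentation express every generator through those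
    belonging to basis vectors.\<close>
  have gens: "Q.\<pi> (gen y) \<in> Q.A.lspan T" if y: "y \<in> carrier L" and T: "\<And>i. i \<in> {1..N} \<Longrightarrow> Q.\<pi> (gen (e i)) \<in> Q.A.lspan T" for y T
    using span[OF y]
  proof (induction rule: L.lspan.induct)
    case lspan_zero
    have "Q.\<pi> (gen \<zero>\<^bsub>L\<^esub>) = \<zero>\<^bsub>Q.A\<^esub>"
      using Q.pi_relation[OF E(2)[of "\<zero>\<^bsub>L\<^esub>" "\<zero>\<^bsub>L\<^esub>" 0]] by (simp add: Q.pi_zero)
    then show ?case using Q.A.lspan_zero by simp
  next
    case (lspan_base y)
    then show ?case using T by auto
  next
    case (lspan_add x y)
    then have c: "x \<in> carrier L" "y \<in> carrier L" using L.lspan_carrier eS by blast+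
    then have "Q.\<pi> (gen (x \<oplus>\<^bsub>L\<^esub> y)) = Q.\<pi> (gen x) \<oplus>\<^bsub>Q.A\<^esub> Q.\<pi> (gen y)"
      using Q.pi_relation[OF E(1)[OF c]] by (simp add: Q.pi_add)
    then show ?case using lspan_add by (simp add: Q.A.lspan_add)
  next
    case (lspan_smult x c)
    then have "x \<in> carrier L" using L.lspan_carrier eS by blast
    then have "Q.\<pi> (gen (c \<odot>\<^bsub>L\<^esub> x)) = c \<odot>\<^bsub>Q.A\<^esub> Q.\<pi> (gen x)"
      using Q.pi_relation[OF E(2)[of x x c]] by (simp add: Q.pi_smult)
    then show ?case using lspan_smult by (simp add: Q.A.lspan_smult)
  qed
  define \<sigma> where "\<sigma> p v = mext N f (\<lambda>a. straight N s a p) v" for p v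
  have "\<exists>\<phi>. pbw_algebra Q.A N (\<lambda>i. Q.\<pi> (gen (e i))) (\<lambda>_. 1) \<phi>"
  proof (rule Q.pbw_from_words[where g = e and \<sigma> = \<sigma>])
    fix y assume "y \<in> carrier L"
    then show "Q.\<pi> (gen y) \<in> Q.A.lspan (Q.A.wprod (\<lambda>i. Q.\<pi> (gen (e i))) ` lists {1..N})"
      by (rule gens) (rule Q.gens_in_span, auto simp: eL)
  next
    fix i j assume ij: "1 \<le> i" "i < j" "j \<le> N"
    let ?low = "Q.A.lspan {Q.A.wprod (\<lambda>i. Q.\<pi> (gen (e i))) (sorted_list_of_multiset m) | m.
          m \<in> monomials {1..N} \<and> sum_mset (image_mset (\<lambda>_. 1) m) < (1::nat) + 1}"
    have c: "e i \<in> carrier L" "e j \<in> carrier L" using eL ij by auto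
    have "Q.\<pi> (gen (br (e j) (e i))) \<in> ?low"
    proof (rule gens[OF br_closed[OF c(2,1)]])
      fix k assume k: "k \<in> {1..N}"
      have "Q.A.wprod (\<lambda>i. Q.\<pi> (gen (e i))) (sorted_list_of_multiset {#k#}) = Q.\<pi> (gen (e k))"
        using eL[OF k] by (simp add: Q.pi_closed)
      moreover have "{#k#} \<in> monomials {1..N} \<and> sum_mset (image_mset (\<lambda>_. 1) {#k#}) < (1::nat) + 1"
        using k by (simp add: monomials_def)
      ultimately show "Q.\<pi> (gen (e k)) \<in> ?low" by (intro Q.A.lspan_base CollectI) metis
    qed
    moreover have "Q.\<pi> (gen (e j)) \<otimes>\<^bsub>Q.A\<^esub> Q.\<pi> (gen (e i)) =
        1 \<odot>\<^bsub>Q.A\<^esub> (Q.\<pi> (gen (e i)) \<otimes>\<^bsub>Q.A\<^esub> Q.\<pi> (gen (e j))) \<oplus>\<^bsub>Q.A\<^esub> Q.\<pi> (gen (br (e j) (e i)))"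
    proof -
      let ?a = "Q.\<pi> (gen (e j)) \<otimes>\<^bsub>Q.A\<^esub> Q.\<pi> (gen (e i))" and ?b = "Q.\<pi> (gen (e i)) \<otimes>\<^bsub>Q.A\<^esub> Q.\<pi> (gen (e j))"
      have cl: "?a \<in> carrier Q.A" "?b \<in> carrier Q.A" using c by (simp_all add: Q.pi_closed)
      have "?a \<ominus>\<^bsub>Q.A\<^esub> ?b = Q.\<pi> (gen (br (e j) (e i)))"
        using Q.pi_relation[OF E(3)[OF c(2,1)]] c by (simp add: commutator_def Q.pi_minus Q.pi_mult)
      then have "1 \<odot>\<^bsub>Q.A\<^esub> ?b \<oplus>\<^bsub>Q.A\<^esub> Q.\<pi> (gen (br (e j) (e i))) = ?b \<oplus>\<^bsub>Q.A\<^esub> (?a \<ominus>\<^bsub>Q.A\<^esub> ?b)" using cl by simp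
      also have "\<dots> = ?a \<oplus>\<^bsub>Q.A\<^esub> (?b \<ominus>\<^bsub>Q.A\<^esub> ?b)" using cl by (simp add: a_minus_def Q.A.a_lcomm)
      finally show ?thesis using cl by (simp add: Q.A.r_right_minus_eq)
    qed
    ultimately show "\<exists>c d. c \<noteq> 0 \<and> Q.\<pi> (gen (e j)) \<otimes>\<^bsub>Q.A\<^esub> Q.\<pi> (gen (e i)) =
        c \<odot>\<^bsub>Q.A\<^esub> (Q.\<pi> (gen (e i)) \<otimes>\<^bsub>Q.A\<^esub> Q.\<pi> (gen (e j))) \<oplus>\<^bsub>Q.A\<^esub> d \<and> d \<in> ?low"
      by (intro exI conjI) (rule one_neq_zero)
  next
    fix u v l r p assume lr: "(l, r) \<in> E"
    \<comment> \<open>The suffix \<open>v\<close> is extended multilinearly once and for all, so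
      that the relation is tested on the middle word \<open>b\<close> after an index prefix
      \<open>a\<close>.\<close>
    define T where "T a b = mext N f (\<lambda>c. straight N s (a @ b @ c) p) v" for a b
    have \<sigma>: "\<sigma> p (u @ z @ v) = mext N f (\<lambda>a. mext N f (T a) z) u" for z
      by (simp add: \<sigma>_def mext_append T_def[abs_def])
    have T_rel: "T a [i, j] = T a [j, i] + (\<Sum>k=1..N. s i j k * T a [k])" for a i j
    proof -
      have "straight N s (a @ [i, j] @ c) p = straight N s (a @ [j, i] @ c) p + (\<Sum>k=1..N. s i j k * straight N s (a @ [k] @ c) p)" for c
        unfolding append_Cons append_Nil by (rule straight_relation[OF alt antisym jacobi])
      then have "(\<lambda>c. straight N s (a @ [i, j] @ c) p)
          = (\<lambda>c. straight N s (a @ [j, i] @ c) p + (\<Sum>k=1..N. s i j k * straight N s (a @ [k] @ c) p))"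
        by (rule ext)
      then show ?thesis unfolding T_def by (simp only: mext_add mext_sum mext_smult)
    qed
    from lr consider
      x y where "x \<in> carrier L" "y \<in> carrier L" "l = gen (x \<oplus>\<^bsub>L\<^esub> y)" "r = gen x \<oplus>\<^bsub>K.F\<^esub> gen y"
    | c x where "x \<in> carrier L" "l = gen (c \<odot>\<^bsub>L\<^esub> x)" "r = c \<odot>\<^bsub>K.F\<^esub> gen x"
    | x y where "x \<in> carrier L" "y \<in> carrier L" "l = commutator K.F (gen x) (gen y)" "r = gen (br x y)"
      unfolding E_def by blast
    then show "lin (\<lambda>z. \<sigma> p (u @ z @ v)) l = lin (\<lambda>z. \<sigma> p (u @ z @ v)) r"
    proof cases
      case 1
      then have "mext N f (T a) [x \<oplus>\<^bsub>L\<^esub> y] = mext N f (T a) [x] + mext N f (T a) [y]" for a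
        by (simp add: f_add distrib_right sum.distrib)
      then show ?thesis using 1 by (simp add: K.lin_F_add K.lin_gen \<sigma> mext_add del: mext.simps)
    next
      case 2
      then have "mext N f (T a) [c \<odot>\<^bsub>L\<^esub> x] = c * mext N f (T a) [x]" for a
        by (simp add: f_smult sum_distrib_left mult.assoc)
      then show ?thesis using 2 by (simp add: K.lin_F_smult K.lin_gen \<sigma> mext_smult del: mext.simps)
    next
      case 3
      have "mext N f (T a) [x, y] = mext N f (T a) [y, x] + mext N f (T a) [br x y]" for a
      proof -
        have "mext N f (T a) [x, y] = (\<Sum>i=1..N. \<Sum>j=1..N. f x i * f y j * T a [i, j])"
          by (simp add: sum_distrib_left mult.assoc)
        also have "\<dots> = (\<Sum>i=1..N. \<Sum>j=1..N. f x i * f y j * T a [j, i])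
            + (\<Sum>i=1..N. \<Sum>j=1..N. \<Sum>k=1..N. f x i * f y j * s i j k * T a [k])"
          by (subst T_rel) (simp add: distrib_left sum.distrib sum_distrib_left mult.assoc)
        also have "(\<Sum>i=1..N. \<Sum>j=1..N. f x i * f y j * T a [j, i]) = mext N f (T a) [y, x]"
          by (subst sum.swap) (simp add: sum_distrib_left mult_ac)
        also have "(\<Sum>i=1..N. \<Sum>j=1..N. \<Sum>k=1..N. f x i * f y j * s i j k * T a [k])
          = (\<Sum>k=1..N. (\<Sum>i=1..N. \<Sum>j=1..N. f x i * f y j * s i j k) * T a [k])"
        proof -
          have "(\<Sum>i=1..N. \<Sum>j=1..N. \<Sum>k=1..N. f x i * f y j * s i j k * T a [k])
            = (\<Sum>i=1..N. \<Sum>k=1..N. \<Sum>j=1..N. f x i * f y j * s i j k * T a [k])"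
            by (intro sum.cong refl sum.swap)
          also have "\<dots> = (\<Sum>k=1..N. \<Sum>i=1..N. \<Sum>j=1..N. f x i * f y j * s i j k * T a [k])" by (rule sum.swap)
          finally show ?thesis by (simp add: sum_distrib_right)
        qed
        also have "\<dots> = mext N f (T a) [br x y]" using f_br[OF 3(1,2)] by simp
        finally show ?thesis .
      qed
      then show ?thesis using 3
        by (simp add: K.lin_commutator K.lin_gen \<sigma> mext_add del: mext.simps)
    qed
  next
    fix m p assume m: "m \<in> monomials {1..N}"
    then have "set (sorted_list_of_multiset m) \<subseteq> {1..N}" by (simp add: monomials_def)
    then have "\<sigma> p (map e (sorted_list_of_multiset m)) = straight N s (sorted_list_of_multiset m) p"
      unfolding \<sigma>_def by (intro mext_basis f_basis)
    then show "\<sigma> p (map e (sorted_list_of_multiset m)) = (if p = m then 1 else 0)"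
      using straight_sorted[of "sorted_list_of_multiset m" N s p] by simp
  qed (use eL in auto)
  then show ?thesis unfolding A Q.A_eq by blast
qed

section \<open>Shift algebras\<close>

text \<open>One relation covers both families: \<open>q = \<epsilon> = 1\<close> gives the shift
  algebra and \<open>\<epsilon> = 0\<close> the q-shift algebra. Standard monomials have the powers
  of \<open>Shift\<close> on the left.\<close>

locale shift_factor = k_algebra A for A :: "('k::field, 'a, 'm) module_scheme" (structure) +
  fixes q \<epsilon> :: 'k and G :: "shift_gen \<Rightarrow> 'a" and \<phi> :: "'a \<Rightarrow> nat \<times> nat \<Rightarrow> 'k"
  assumes q_nonzero: "q \<noteq> 0" and G_closed: "G v \<in> carrier A"
    and words_span: "a \<in> carrier A \<Longrightarrow> a \<in> lspan (wprod G ` UNIV)"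
    and shift_rel: "G Shift \<otimes> G Var = q \<odot> (G Var \<otimes> G Shift) \<oplus> \<epsilon> \<odot> G Shift"
    and phi_add: "\<lbrakk>a \<in> carrier A; b \<in> carrier A\<rbrakk> \<Longrightarrow> \<phi> (a \<oplus> b) p = \<phi> a p + \<phi> b p"
    and phi_smult: "a \<in> carrier A \<Longrightarrow> \<phi> (c \<odot> a) p = c * \<phi> a p"
    and phi_std: "\<phi> (wprod G (replicate r Shift @ replicate s Var)) p = (if p = (r, s) then 1 else 0)"
begin

text \<open>The defining relation solved for the product in the non-standard order, as straightening
  needs it when \<open>Shift\<close> precedes \<open>Var\<close>; this uses the invertibility of
  \<open>q\<close>.\<close>

lemma shift_rel': "G Var \<otimes> G Shift = inverse q \<odot> (G Shift \<otimes> G Var) \<oplus> (- (\<epsilon> / q)) \<odot> G Shift"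
proof -
  have "inverse q \<odot> (G Shift \<otimes> G Var) = G Var \<otimes> G Shift \<oplus> (\<epsilon> / q) \<odot> G Shift"
    using G_closed q_nonzero
    by (simp add: shift_rel smult_r_distr smult_assoc[symmetric] divide_inverse mult.commute)
  then have "inverse q \<odot> (G Shift \<otimes> G Var) \<oplus> (- (\<epsilon> / q)) \<odot> G Shift
      = G Var \<otimes> G Shift \<oplus> ((\<epsilon> / q) \<odot> G Shift \<oplus> (- (\<epsilon> / q)) \<odot> G Shift)"
    using G_closed by (simp add: a_assoc)
  also have "(\<epsilon> / q) \<odot> G Shift \<oplus> (- (\<epsilon> / q)) \<odot> G Shift = \<zero>"
    using G_closed by (simp add: smult_l_distr[symmetric])
  finally show ?thesis using G_closed by simp
qed

end

definition ore_shift :: "'k::field \<Rightarrow> 'k \<Rightarrow> ('k, (shift_gen list \<Rightarrow> 'k) set) module" where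
  "ore_shift q \<epsilon> = (let F = free_algebra UNIV in impose F
     {(gen Shift \<otimes>\<^bsub>F\<^esub> gen Var, q \<odot>\<^bsub>F\<^esub> (gen Var \<otimes>\<^bsub>F\<^esub> gen Shift) \<oplus>\<^bsub>F\<^esub> \<epsilon> \<odot>\<^bsub>F\<^esub> gen Shift)})"

lemma first_shift_eq:
  "first_shift_algebra = (ore_shift 1 1 :: ('k::field, _) module)"
  "first_q_shift_algebra q = (ore_shift q 0 :: ('k, _) module)"
proof -
  interpret K: free_alg "UNIV :: shift_gen set" "TYPE('k)" by (intro free_alg.intro k_monoid_alg_free)
  show "first_shift_algebra = (ore_shift 1 1 :: ('k::field, _) module)"
    unfolding first_shift_algebra_def ore_shift_def Let_def K.F_free_algebra[symmetric] by simp
  show "first_q_shift_algebra q = (ore_shift q 0 :: ('k, _) module)"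
    unfolding first_q_shift_algebra_def ore_shift_def Let_def K.F_free_algebra[symmetric] by simp
qed

context
  fixes q \<epsilon> :: "'k::field"
begin

text \<open>For nonzero \<open>q\<close> this is \<epsilon> times the sum q^-1 + ... + q^-b; the
  recursion comes from moving the variable past one shift at a time.\<close>

fun shift_offset :: "nat \<Rightarrow> 'k" where
  "shift_offset 0 = 0"
| "shift_offset (Suc b) = (shift_offset b + \<epsilon>) / q"

text \<open>Left multiplication on the basis \<open>s\<^sup>b x\<^sup>a\<close>, where \<open>x s\<^sup>b = s\<^sup>b (q\<^sup>-\<^sup>b x - e\<^sub>b)\<close> with \<open>e\<^sub>b\<close> the offset.\<close>

fun shift_op :: "shift_gen \<Rightarrow> (nat \<times> nat \<Rightarrow> 'k) \<Rightarrow> nat \<times> nat \<Rightarrow> 'k" where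
  "shift_op Shift h (b, a) = (if b > 0 then h (b - 1, a) else 0)"
| "shift_op Var h (b, a) = inverse q ^ b * (if a > 0 then h (b, a - 1) else 0) - shift_offset b * h (b, a)"

definition shift_act :: "shift_gen list \<Rightarrow> (nat \<times> nat \<Rightarrow> 'k) \<Rightarrow> nat \<times> nat \<Rightarrow> 'k" where
  "shift_act v h = foldr shift_op v h"

lemma shift_act_simps [simp]:
  "shift_act [] h = h" "shift_act (i # v) h = shift_op i (shift_act v h)"
  "shift_act (u @ v) h = shift_act u (shift_act v h)"
  by (simp_all add: shift_act_def)

lemma shift_op_linear: "shift_op i (\<lambda>m. a * h m + b * h' m) p = a * shift_op i h p + b * shift_op i h' p"
  by (cases i; cases p) (simp_all add: algebra_simps)

lemma shift_act_linear:
  "shift_act u (\<lambda>m. a * h m + b * h' m) = (\<lambda>m. a * shift_act u h m + b * shift_act u h' m)"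
  by (induction u) (auto simp: shift_op_linear)

lemma shift_op_rel:
  assumes q: "q \<noteq> 0"
  shows "shift_op Shift (shift_op Var h) = (\<lambda>p. q * shift_op Var (shift_op Shift h) p + \<epsilon> * shift_op Shift h p)"
proof
  fix p :: "nat \<times> nat"
  obtain b a where p: "p = (b, a)" by (cases p)
  show "shift_op Shift (shift_op Var h) p = q * shift_op Var (shift_op Shift h) p + \<epsilon> * shift_op Shift h p"
    using q by (cases b) (simp_all add: p divide_simps algebra_simps)
qed

lemma shift_act_std:
  "shift_act (replicate a Shift @ replicate b Var) (\<lambda>p. if p = (0, 0) then 1 else 0) = (\<lambda>p. if p = (a, b) then 1 else 0)"
proof (induction a)
  case 0
  show ?case
  proof (induction b)
    case (Suc b)
    then have IH: "shift_act (replicate b Var) (\<lambda>p. if p = (0, 0) then 1 else 0) = (\<lambda>p. if p = (0, b) then 1 else 0)"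
      by simp
    show ?case
    proof
      fix p :: "nat \<times> nat"
      obtain s r where "p = (s, r)" by (cases p)
      then show "shift_act (replicate 0 Shift @ replicate (Suc b) Var) (\<lambda>p. if p = (0, 0) then 1 else 0) p
          = (if p = (0, Suc b) then 1 else 0)"
        by (cases s; cases r) (simp_all add: IH)
    qed
  qed auto
next
  case (Suc a)
  then have "shift_act (replicate (Suc a) Shift @ replicate b Var) (\<lambda>p. if p = (0, 0) then 1 else 0)
      = shift_op Shift (\<lambda>p. if p = (a, b) then 1 else 0)" by simp
  also have "\<dots> = (\<lambda>p. if p = (Suc a, b) then 1 else 0)"
  proof
    fix p :: "nat \<times> nat"
    obtain s r where "p = (s, r)" by (cases p)
    then show "shift_op Shift (\<lambda>p. if p = (a, b) then 1 else 0) p = (if p = (Suc a, b) then 1 else 0)"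
      by (cases s) simp_all
  qed
  finally show ?case .
qed

end

text \<open>The functionals arise by letting a word act on the vector 1 in the regular
  representation; there the standard words give the unit vectors.\<close>

lemma ore_shift_factor:
  fixes q \<epsilon> :: "'k::field"
  assumes q: "q \<noteq> 0"
  shows "\<exists>G \<phi>. shift_factor (ore_shift q \<epsilon>) q \<epsilon> G \<phi>"
proof -
  interpret K: free_alg "UNIV :: shift_gen set" "TYPE('k)" by (intro free_alg.intro k_monoid_alg_free)
  define E where "E = {(gen Shift \<otimes>\<^bsub>K.F\<^esub> gen Var, q \<odot>\<^bsub>K.F\<^esub> (gen Var \<otimes>\<^bsub>K.F\<^esub> gen Shift) \<oplus>\<^bsub>K.F\<^esub> \<epsilon> \<odot>\<^bsub>K.F\<^esub> gen Shift)}"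
  have A: "ore_shift q \<epsilon> = impose (free_algebra UNIV) E"
    by (simp only: ore_shift_def Let_def E_def K.F_free_algebra)
  have "E \<subseteq> carrier K.F \<times> carrier K.F" by (simp add: E_def)
  then interpret Q: free_quotient "UNIV :: shift_gen set" "TYPE('k)" E
    unfolding K.F_free_algebra by (rule free_quotientI)
  define \<delta> :: "nat \<times> nat \<Rightarrow> 'k" where "\<delta> = (\<lambda>p. if p = (0, 0) then 1 else 0)"
  define \<sigma> where "\<sigma> p v = shift_act q \<epsilon> v \<delta> p" for p v
  define G where "G v = Q.\<pi> (gen v)" for v
  have "\<exists>\<phi>. (\<forall>w\<in>lists UNIV. \<forall>p. \<phi> (Q.\<pi> (basis_elt w)) p = \<sigma> p w) \<and>
    (\<forall>a\<in>carrier Q.A. \<forall>b\<in>carrier Q.A. \<forall>p. \<phi> (a \<oplus>\<^bsub>Q.A\<^esub> b) p = \<phi> a p + \<phi> b p) \<and>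
    (\<forall>a\<in>carrier Q.A. \<forall>c p. \<phi> (c \<odot>\<^bsub>Q.A\<^esub> a) p = c * \<phi> a p)"
  proof (rule Q.lift_monoid_functional[unfolded free_monoid_simps])
    fix u v l r p assume "(l, r) \<in> E"
    then have lr: "l = gen Shift \<otimes>\<^bsub>K.F\<^esub> gen Var"
      "r = q \<odot>\<^bsub>K.F\<^esub> (gen Var \<otimes>\<^bsub>K.F\<^esub> gen Shift) \<oplus>\<^bsub>K.F\<^esub> \<epsilon> \<odot>\<^bsub>K.F\<^esub> gen Shift" by (auto simp: E_def)
    show "lin (\<lambda>w. \<sigma> p ((u @ w) @ v)) l = lin (\<lambda>w. \<sigma> p ((u @ w) @ v)) r"
      by (simp add: lr K.lin_F_add K.lin_F_smult K.lin_gen_mult K.lin_gen \<sigma>_def shift_op_rel[OF q] shift_act_linear)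
  qed
  then obtain \<phi> where phi: "\<forall>w\<in>lists UNIV. \<forall>p. \<phi> (Q.\<pi> (basis_elt w)) p = \<sigma> p w"
    "\<forall>a\<in>carrier Q.A. \<forall>b\<in>carrier Q.A. \<forall>p. \<phi> (a \<oplus>\<^bsub>Q.A\<^esub> b) p = \<phi> a p + \<phi> b p"
    "\<forall>a\<in>carrier Q.A. \<forall>c p. \<phi> (c \<odot>\<^bsub>Q.A\<^esub> a) p = c * \<phi> a p" by blast
  have Gc: "G v \<in> carrier Q.A" for v unfolding G_def by (intro Q.pi_closed Q.gen_closed) simp
  have word: "Q.\<pi> (basis_elt v) = Q.A.wprod G v" for v using Q.pi_word[of v] by (simp add: G_def[abs_def])
  have "shift_factor Q.A q \<epsilon> G \<phi>"
  proof (intro shift_factor.intro shift_factor_axioms.intro Q.A.k_algebra_axioms)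
    fix a assume "a \<in> carrier Q.A"
    then show "a \<in> Q.A.lspan (Q.A.wprod G ` UNIV)"
      by (rule Q.quotient_in_lspan[rotated 2])
        (use Gc word in \<open>auto intro: Q.A.wprod_closed Q.A.lspan_base\<close>)
  next
    have "Q.\<pi> (gen Shift \<otimes>\<^bsub>K.F\<^esub> gen Var) = Q.\<pi> (q \<odot>\<^bsub>K.F\<^esub> (gen Var \<otimes>\<^bsub>K.F\<^esub> gen Shift) \<oplus>\<^bsub>K.F\<^esub> \<epsilon> \<odot>\<^bsub>K.F\<^esub> gen Shift)"
      by (rule Q.pi_relation) (simp add: E_def)
    then show "G Shift \<otimes>\<^bsub>Q.A\<^esub> G Var = q \<odot>\<^bsub>Q.A\<^esub> (G Var \<otimes>\<^bsub>Q.A\<^esub> G Shift) \<oplus>\<^bsub>Q.A\<^esub> \<epsilon> \<odot>\<^bsub>Q.A\<^esub> G Shift"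
      by (simp add: G_def Q.pi_mult Q.pi_add Q.pi_smult)
  next
    fix a b p
    show "\<phi> (Q.A.wprod G (replicate a Shift @ replicate b Var)) p = (if p = (a, b) then 1 else 0)"
      using phi(1) by (simp only: word[symmetric] \<sigma>_def \<delta>_def shift_act_std lists_UNIV ball_UNIV)
  qed (use q Gc phi in auto)
  then show ?thesis unfolding A Q.A_eq by blast
qed

lemma product_monoid:
  assumes "\<And>i. i \<in> I \<Longrightarrow> monoid (A i)" shows "monoid (product_group I A)"
proof (rule monoidI)
  fix x y z assume "x \<in> carrier (product_group I A)" "y \<in> carrier (product_group I A)" "z \<in> carrier (product_group I A)"
  then show "x \<otimes>\<^bsub>product_group I A\<^esub> y \<otimes>\<^bsub>product_group I A\<^esub> z = x \<otimes>\<^bsub>product_group I A\<^esub> (y \<otimes>\<^bsub>product_group I A\<^esub> z)"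
    using assms by (auto simp: product_group_def PiE_iff monoid.m_assoc intro!: restrict_ext)
qed (use assms in \<open>auto simp: product_group_def PiE_iff monoid.m_closed extensional_def fun_eq_iff
    intro: monoid.l_one monoid.r_one monoid.one_closed\<close>)

section \<open>Tensor products as quotients of monoid algebras\<close>

locale tensor_algebra =
  fixes I :: "'i set" and A :: "'i \<Rightarrow> ('k::field, 'a) module"
  assumes factor: "\<And>i. i \<in> I \<Longrightarrow> k_algebra (A i)"
begin

lemma factor_monoid: "i \<in> I \<Longrightarrow> monoid (A i)"
  using factor by (simp add: k_algebra_def ring_def)

abbreviation "M \<equiv> product_group I A"

declare carrier_product_group [simp del] one_product_group [simp del] mult_product_group [simp del]

lemma M_simps:
  "f \<in> carrier M \<longleftrightarrow> f \<in> (\<Pi>\<^sub>E i\<in>I. carrier (A i))" "\<one>\<^bsub>M\<^esub> = (\<lambda>i\<in>I. \<one>\<^bsub>A i\<^esub>)"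
  "f \<otimes>\<^bsub>M\<^esub> g = (\<lambda>i\<in>I. f i \<otimes>\<^bsub>A i\<^esub> g i)"
  by (simp_all add: product_group_def)

sublocale P: k_monoid_alg M "TYPE('k)"
  by (rule k_monoid_alg.intro) (rule product_monoid[OF factor_monoid])

lemma upd_closed: "\<lbrakk>f \<in> carrier M; i \<in> I; a \<in> carrier (A i)\<rbrakk> \<Longrightarrow> f(i := a) \<in> carrier M"
  by (auto simp: M_simps PiE_iff extensional_def)

lemma relation_add:
  assumes "f \<in> carrier M" "i \<in> I" "a \<in> carrier (A i)" "b \<in> carrier (A i)"
  shows "(basis_elt (f(i := a \<oplus>\<^bsub>A i\<^esub> b)), basis_elt (f(i := a)) \<oplus>\<^bsub>P.F\<^esub> basis_elt (f(i := b))) \<in> multilinear_relations I A"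
  unfolding multilinear_relations_def Let_def P.F_def[symmetric]
  by (rule UnI1, rule CollectI, rule exI[of _ f], rule exI[of _ i], rule exI[of _ a], rule exI[of _ b],
      intro conjI refl) (use assms in \<open>simp_all add: M_simps(1)\<close>)

lemma relation_smult:
  assumes "f \<in> carrier M" "i \<in> I" "a \<in> carrier (A i)"
  shows "(basis_elt (f(i := c \<odot>\<^bsub>A i\<^esub> a)), c \<odot>\<^bsub>P.F\<^esub> basis_elt (f(i := a))) \<in> multilinear_relations I A"
  unfolding multilinear_relations_def Let_def P.F_def[symmetric]
  by (rule UnI2, rule CollectI, rule exI[of _ f], rule exI[of _ i], rule exI[of _ a], rule exI[of _ c],
      intro conjI refl) (use assms in \<open>simp_all add: M_simps(1)\<close>)

lemma relation_cases:
  assumes "(l, r) \<in> multilinear_relations I A"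
  obtains (add) f i a b where "f \<in> carrier M" "i \<in> I" "a \<in> carrier (A i)" "b \<in> carrier (A i)"
      "l = basis_elt (f(i := a \<oplus>\<^bsub>A i\<^esub> b))" "r = basis_elt (f(i := a)) \<oplus>\<^bsub>P.F\<^esub> basis_elt (f(i := b))"
    | (smult) f i a c where "f \<in> carrier M" "i \<in> I" "a \<in> carrier (A i)"
      "l = basis_elt (f(i := c \<odot>\<^bsub>A i\<^esub> a))" "r = c \<odot>\<^bsub>P.F\<^esub> basis_elt (f(i := a))"
  using assms unfolding multilinear_relations_def Let_def P.F_def[symmetric] M_simps(1)[symmetric]
  by (elim UnE CollectE exE conjE Pair_inject) (iprover+)

lemma factor_closed:
  assumes "i \<in> I" "a \<in> carrier (A i)"
  shows "b \<in> carrier (A i) \<Longrightarrow> a \<oplus>\<^bsub>A i\<^esub> b \<in> carrier (A i)" "c \<odot>\<^bsub>A i\<^esub> a \<in> carrier (A i)"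
proof -
  interpret k_algebra "A i" by (rule factor[OF assms(1)])
  show "b \<in> carrier (A i) \<Longrightarrow> a \<oplus>\<^bsub>A i\<^esub> b \<in> carrier (A i)" "c \<odot>\<^bsub>A i\<^esub> a \<in> carrier (A i)"
    using assms by auto
qed

lemma relations_closed: "multilinear_relations I A \<subseteq> carrier P.F \<times> carrier P.F"
proof
  fix e assume e: "e \<in> multilinear_relations I A"
  obtain l r where lr: "e = (l, r)" by (cases e)
  from e[unfolded lr] have "l \<in> carrier P.F \<and> r \<in> carrier P.F"
    by (cases rule: relation_cases)
      (simp_all add: P.F.smult_closed P.F.add.m_closed P.basis_closed upd_closed factor_closed)
  then show "e \<in> carrier P.F \<times> carrier P.F" by (simp add: lr)
qed

sublocale Q: k_monoid_quotient M "TYPE('k)" "multilinear_relations I A"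
  by (intro k_monoid_quotient.intro k_quotient.intro k_quotient_axioms.intro
      P.k_monoid_alg_axioms P.F.k_algebra_axioms relations_closed)

lemma tensor_eq: "Q.A = tensor_product I A"
  by (simp only: Q.A_def) (simp only: tensor_product_def P.F_def)

definition pure :: "('i \<Rightarrow> 'a) \<Rightarrow> (('i \<Rightarrow> 'a) \<Rightarrow> 'k) set" where
  "pure f = Q.\<pi> (basis_elt f)"

definition \<iota> :: "'i \<Rightarrow> 'a \<Rightarrow> (('i \<Rightarrow> 'a) \<Rightarrow> 'k) set" where
  "\<iota> i a = pure (\<one>\<^bsub>M\<^esub>(i := a))"

lemma pure_closed: "f \<in> carrier M \<Longrightarrow> pure f \<in> carrier Q.A"
  unfolding pure_def by (intro Q.pi_closed P.basis_closed)

lemma pure_mult: "\<lbrakk>f \<in> carrier M; g \<in> carrier M\<rbrakk> \<Longrightarrow> pure f \<otimes>\<^bsub>Q.A\<^esub> pure g = pure (f \<otimes>\<^bsub>M\<^esub> g)"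
  unfolding pure_def by (simp add: Q.pi_mult[symmetric] P.basis_closed P.basis_mult)

lemma pure_one: "pure \<one>\<^bsub>M\<^esub> = \<one>\<^bsub>Q.A\<^esub>"
  unfolding pure_def using Q.pi_one by (simp only: P.F_simps(3))

lemma pure_add:
  assumes "f \<in> carrier M" "i \<in> I" "a \<in> carrier (A i)" "b \<in> carrier (A i)"
  shows "pure (f(i := a \<oplus>\<^bsub>A i\<^esub> b)) = pure (f(i := a)) \<oplus>\<^bsub>Q.A\<^esub> pure (f(i := b))"
proof -
  from Q.pi_relation[OF relation_add[OF assms]] show ?thesis
    using assms by (simp add: pure_def Q.pi_add P.basis_closed upd_closed)
qed

lemma pure_smult:
  assumes "f \<in> carrier M" "i \<in> I" "a \<in> carrier (A i)"
  shows "pure (f(i := c \<odot>\<^bsub>A i\<^esub> a)) = c \<odot>\<^bsub>Q.A\<^esub> pure (f(i := a))"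
proof -
  from Q.pi_relation[OF relation_smult[OF assms]] show ?thesis
    using assms by (simp add: pure_def Q.pi_smult P.basis_closed upd_closed)
qed

lemma one_M: "\<one>\<^bsub>M\<^esub> \<in> carrier M"
  by (rule monoid.one_closed[OF product_monoid[OF factor_monoid]])

lemma iota_closed: "\<lbrakk>i \<in> I; a \<in> carrier (A i)\<rbrakk> \<Longrightarrow> \<iota> i a \<in> carrier Q.A"
  unfolding \<iota>_def by (intro pure_closed upd_closed one_M)

lemma upd_mult:
  assumes "f \<in> carrier M" "i \<in> I" "a \<in> carrier (A i)"
  shows "\<one>\<^bsub>M\<^esub>(i := a) \<otimes>\<^bsub>M\<^esub> f = f(i := a \<otimes>\<^bsub>A i\<^esub> f i)"
    and "f \<otimes>\<^bsub>M\<^esub> \<one>\<^bsub>M\<^esub>(i := a) = f(i := f i \<otimes>\<^bsub>A i\<^esub> a)"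
proof -
  have "\<one>\<^bsub>A j\<^esub> \<otimes>\<^bsub>A j\<^esub> f j = f j" "f j \<otimes>\<^bsub>A j\<^esub> \<one>\<^bsub>A j\<^esub> = f j" if "j \<in> I" for j
    using assms(1) that monoid.l_one[OF factor_monoid[OF that]] monoid.r_one[OF factor_monoid[OF that]]
    by (auto simp: M_simps PiE_iff)
  then show "\<one>\<^bsub>M\<^esub>(i := a) \<otimes>\<^bsub>M\<^esub> f = f(i := a \<otimes>\<^bsub>A i\<^esub> f i)" "f \<otimes>\<^bsub>M\<^esub> \<one>\<^bsub>M\<^esub>(i := a) = f(i := f i \<otimes>\<^bsub>A i\<^esub> a)"
    using assms by (auto simp: M_simps PiE_iff extensional_def fun_eq_iff)
qed

lemma iota_pure:
  assumes "f \<in> carrier M" "i \<in> I" "a \<in> carrier (A i)"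
  shows "\<iota> i a \<otimes>\<^bsub>Q.A\<^esub> pure f = pure (f(i := a \<otimes>\<^bsub>A i\<^esub> f i))"
  unfolding \<iota>_def using assms by (simp add: pure_mult upd_closed one_M upd_mult)

lemma iota_mult:
  assumes "i \<in> I" "a \<in> carrier (A i)" "b \<in> carrier (A i)"
  shows "\<iota> i (a \<otimes>\<^bsub>A i\<^esub> b) = \<iota> i a \<otimes>\<^bsub>Q.A\<^esub> \<iota> i b"
  unfolding \<iota>_def[of i b] using assms by (simp add: iota_pure upd_closed one_M) (simp add: \<iota>_def)

lemma iota_one: "i \<in> I \<Longrightarrow> \<iota> i \<one>\<^bsub>A i\<^esub> = \<one>\<^bsub>Q.A\<^esub>"
proof -
  assume "i \<in> I"
  then have "\<one>\<^bsub>M\<^esub>(i := \<one>\<^bsub>A i\<^esub>) = \<one>\<^bsub>M\<^esub>" by (intro fun_upd_idem) (simp add: M_simps(2))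
  then show ?thesis by (simp only: \<iota>_def pure_one)
qed

lemma iota_commute:
  assumes "i \<in> I" "j \<in> I" "i \<noteq> j" "a \<in> carrier (A i)" "b \<in> carrier (A j)"
  shows "\<iota> i a \<otimes>\<^bsub>Q.A\<^esub> \<iota> j b = \<iota> j b \<otimes>\<^bsub>Q.A\<^esub> \<iota> i a"
proof -
  have "a \<otimes>\<^bsub>A i\<^esub> \<one>\<^bsub>A i\<^esub> = a" "b \<otimes>\<^bsub>A j\<^esub> \<one>\<^bsub>A j\<^esub> = b"
    using assms monoid.r_one[OF factor_monoid] by auto
  then show ?thesis
    unfolding \<iota>_def[of j b] using assms
    by (simp add: iota_pure upd_closed one_M, simp add: \<iota>_def pure_mult upd_closed one_M upd_mult(1))
       (simp add: M_simps(2) fun_upd_twist)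
qed

text \<open>Multiplying on the left by the image of a factor changes one component only. When
  \<open>js\<close> exhausts the index set, every pure tensor is seen to be a product of images of
  the factors.\<close>

lemma pure_eq_wprod:
  assumes "f \<in> carrier M" "distinct js" "set js \<subseteq> I"
  shows "Q.A.wprod (\<lambda>i. \<iota> i (f i)) js = pure (\<lambda>i\<in>I. if i \<in> set js then f i else \<one>\<^bsub>A i\<^esub>)"
  using assms(2,3)
proof (induction js)
  case Nil
  then show ?case using pure_one[unfolded M_simps(2) restrict_def] by (simp add: restrict_def)
next
  case (Cons j js)
  let ?g = "\<lambda>i\<in>I. if i \<in> set js then f i else \<one>\<^bsub>A i\<^esub>"
  have j: "j \<in> I" "f j \<in> carrier (A j)" using Cons.prems assms(1) by (auto simp: M_simps PiE_iff)
  have one: "\<one>\<^bsub>A i\<^esub> \<in> carrier (A i)" "a \<otimes>\<^bsub>A i\<^esub> \<one>\<^bsub>A i\<^esub> = a" if "i \<in> I" "a \<in> carrier (A i)" for i a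
    using that monoid.one_closed[OF factor_monoid] monoid.r_one[OF factor_monoid] by auto
  have g: "?g \<in> carrier M"
    using assms(1) monoid.one_closed[OF factor_monoid] by (auto simp: M_simps PiE_iff)
  have g_upd: "?g(j := f j \<otimes>\<^bsub>A j\<^esub> ?g j) = (\<lambda>i\<in>I. if i \<in> set (j # js) then f i else \<one>\<^bsub>A i\<^esub>)"
    using j one[OF j] Cons.prems by (auto simp: fun_eq_iff)
  have IH: "Q.A.wprod (\<lambda>i. \<iota> i (f i)) js = pure ?g" using Cons.prems by (intro Cons.IH) auto
  show ?case unfolding Q.A.wprod_Cons IH iota_pure[OF g j] g_upd ..
qed

lemma iota_add:
  "\<lbrakk>i \<in> I; a \<in> carrier (A i); b \<in> carrier (A i)\<rbrakk> \<Longrightarrow> \<iota> i (a \<oplus>\<^bsub>A i\<^esub> b) = \<iota> i a \<oplus>\<^bsub>Q.A\<^esub> \<iota> i b"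
  unfolding \<iota>_def by (rule pure_add[OF one_M])

lemma iota_smult: "\<lbrakk>i \<in> I; a \<in> carrier (A i)\<rbrakk> \<Longrightarrow> \<iota> i (c \<odot>\<^bsub>A i\<^esub> a) = c \<odot>\<^bsub>Q.A\<^esub> \<iota> i a"
  unfolding \<iota>_def by (rule pure_smult[OF one_M])

end

text \<open>Numbering of the tensor generators: \<open>2 * i - 1\<close> is the shift and
  \<open>2 * i\<close> the variable of the i-th factor. A sorted word is then a product of standard
  words of the factors, in the order of the factors.\<close>

definition slot :: "nat \<Rightarrow> nat" where "slot k = (k + 1) div 2"
definition letter :: "nat \<Rightarrow> shift_gen" where "letter k = (if odd k then Shift else Var)"

lemma slot_iff: "i \<ge> 1 \<Longrightarrow> slot k = i \<longleftrightarrow> k = 2 * i - 1 \<or> k = 2 * i"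
  by (auto simp: slot_def)

lemma letter_simps: "i \<ge> 1 \<Longrightarrow> letter (2 * i - 1) = Shift" "letter (2 * i) = Var"
  by (auto simp: letter_def)

lemma slot_range: "k \<in> {1..2 * n} \<Longrightarrow> slot k \<in> {1..n}"
  by (auto simp: slot_def)

lemma filter_slot_sorted:
  assumes "i \<ge> 1"
  shows "filter (\<lambda>k. slot k = i) (sorted_list_of_multiset m)
    = replicate (count m (2 * i - 1)) (2 * i - 1) @ replicate (count m (2 * i)) (2 * i)" (is "?l = ?r")
proof -
  have "mset ?l = mset ?r"
  proof (rule multiset_eqI)
    fix k
    show "count (mset ?l) k = count (mset ?r) k"
      using assms by (auto simp: slot_iff[OF assms] mset_replicate)
  qed
  moreover have "sorted ?l" by (simp add: sorted_wrt_filter)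
  moreover have "sorted ?r" by (auto simp: sorted_append)
  ultimately show ?thesis using properties_for_sort by metis
qed

lemma prod_indicator:
  "finite S \<Longrightarrow> (\<Prod>i\<in>S. if P i then 1 else 0) = (if \<forall>i\<in>S. P i then 1 else (0 :: 'k::field))"
  by (induction S rule: finite_induct) auto

locale shift_tensor =
  fixes n :: nat and A :: "nat \<Rightarrow> ('k::field, 'a) module" and q \<epsilon> :: "nat \<Rightarrow> 'k"
    and G :: "nat \<Rightarrow> shift_gen \<Rightarrow> 'a" and \<phi> :: "nat \<Rightarrow> 'a \<Rightarrow> nat \<times> nat \<Rightarrow> 'k"
  assumes shift_factors: "i \<in> {1..n} \<Longrightarrow> shift_factor (A i) (q i) (\<epsilon> i) (G i) (\<phi> i)"
begin

declare One_nat_def [simp del]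

sublocale tensor_algebra "{1..n}" A
  by (rule tensor_algebra.intro) (rule shift_factor.axioms(1)[OF shift_factors])

definition "z k = G (slot k) (letter k)"
definition "y k = \<iota> (slot k) (z k)"

lemma G_closed: "i \<in> {1..n} \<Longrightarrow> G i v \<in> carrier (A i)"
  by (rule shift_factor.G_closed[OF shift_factors])

lemma y_closed: "k \<in> {1..2 * n} \<Longrightarrow> y k \<in> carrier Q.A"
  unfolding y_def z_def using slot_range by (intro iota_closed G_closed) auto

abbreviation "words \<equiv> Q.A.wprod y ` lists {1..2 * n}"

lemma one_words: "\<one>\<^bsub>Q.A\<^esub> \<in> Q.A.lspan words"
  by (rule Q.A.lspan_base, rule image_eqI[of _ _ "[]"]) simp_all

lemma y_words: "k \<in> {1..2 * n} \<Longrightarrow> y k \<in> Q.A.lspan words"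
  by (rule Q.A.lspan_base, rule image_eqI[of _ _ "[k]"]) (simp_all add: y_closed)

lemma words_mult: "\<lbrakk>a \<in> Q.A.lspan words; b \<in> Q.A.lspan words\<rbrakk> \<Longrightarrow> a \<otimes>\<^bsub>Q.A\<^esub> b \<in> Q.A.lspan words"
  by (rule Q.A.lspan_words_mult[OF y_closed])

lemma iota_gen:
  assumes "i \<in> {1..n}" shows "\<iota> i (G i v) \<in> Q.A.lspan words"
proof -
  define k where "k = (if v = Shift then 2 * i - 1 else 2 * i)"
  have k: "k \<in> {1..2 * n}" "slot k = i" using assms by (auto simp: k_def slot_def)
  have "letter k = v" using assms by (cases v) (auto simp: k_def letter_def)
  then have "y k = \<iota> i (G i v)" by (simp add: y_def z_def k)
  then show ?thesis using y_words[OF k(1)] by simp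
qed

lemma iota_span:
  assumes i: "i \<in> {1..n}" and a: "a \<in> carrier (A i)" shows "\<iota> i a \<in> Q.A.lspan words"
proof -
  interpret S: shift_factor "A i" "q i" "\<epsilon> i" "G i" "\<phi> i" by (rule shift_factors[OF i])
  have word: "S.wprod (G i) u \<in> carrier (A i) \<and> \<iota> i (S.wprod (G i) u) \<in> Q.A.lspan words" for u
  proof (induction u)
    case Nil
    show ?case using iota_one[OF i] one_words by simp
  next
    case (Cons v u)
    then show ?case using iota_mult[OF i S.G_closed] words_mult[OF iota_gen[OF i]] S.G_closed by simp
  qed
  from S.words_span[OF a] have "a \<in> carrier (A i) \<and> \<iota> i a \<in> Q.A.lspan words"
  proof (induction rule: S.lspan.induct)
    case lspan_zero
    have "\<iota> i (0 \<odot>\<^bsub>A i\<^esub> \<zero>\<^bsub>A i\<^esub>) = \<zero>\<^bsub>Q.A\<^esub>"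
      by (simp only: iota_smult[OF i S.zero_closed] Q.A.smult_zero[OF iota_closed[OF i S.zero_closed]])
    then show ?case using Q.A.lspan_zero by simp
  next
    case (lspan_base x)
    then show ?case using word by blast
  next
    case (lspan_add x y)
    then show ?case using iota_add[OF i] Q.A.lspan_add by simp
  next
    case (lspan_smult x c)
    then show ?case using iota_smult[OF i] Q.A.lspan_smult by simp
  qed
  then show ?thesis ..
qed

lemma words_span_tensor:
  assumes "a \<in> carrier Q.A" shows "a \<in> Q.A.lspan words"
proof (rule Q.quotient_in_lspan[OF _ _ assms])
  show "words \<subseteq> carrier Q.A" using y_closed by (auto intro!: Q.A.wprod_closed simp: in_lists_conv_set)
next
  fix f assume f: "f \<in> carrier M"
  have span: "Q.A.wprod g js \<in> Q.A.lspan words" if "\<forall>j\<in>set js. g j \<in> Q.A.lspan words" for g and js :: "nat list"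
    using that by (induction js) (simp_all add: one_words words_mult)
  have "Q.A.wprod (\<lambda>i. \<iota> i (f i)) [1..<Suc n] \<in> Q.A.lspan words"
    using f by (intro span ballI iota_span) (auto simp: M_simps PiE_iff)
  also have "Q.A.wprod (\<lambda>i. \<iota> i (f i)) [1..<Suc n] = pure (\<lambda>i\<in>{1..n}. if i \<in> set [1..<Suc n] then f i else \<one>\<^bsub>A i\<^esub>)"
    by (rule pure_eq_wprod[OF f]) auto
  also have "(\<lambda>i\<in>{1..n}. if i \<in> set [1..<Suc n] then f i else \<one>\<^bsub>A i\<^esub>) = f"
    using f by (auto simp: M_simps PiE_iff extensional_def fun_eq_iff)
  finally show "Q.\<pi> (basis_elt f) \<in> Q.A.lspan words" by (simp only: pure_def)
qed

text \<open>A letter acts on the component given by its slot and on no other, so a word is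
  determined by its subwords, one for each slot.\<close>

lemma wprod_pure:
  assumes "v \<in> lists {1..2 * n}"
  shows "Q.A.wprod y v = pure (\<lambda>i\<in>{1..n}. k_algebra.wprod (A i) (G i) (map letter (filter (\<lambda>k. slot k = i) v)))"
    (is "_ = pure (?g v)")
  using assms
proof (induction v)
  case Nil
  have "?g [] = \<one>\<^bsub>M\<^esub>"
    unfolding M_simps(2) by (rule restrict_ext) (simp add: k_algebra.wprod_Nil[OF factor])
  then show ?case by (simp only: pure_one Q.A.wprod_Nil)
next
  case (Cons k v)
  then have k: "slot k \<in> {1..n}" and IH: "Q.A.wprod y v = pure (?g v)" using slot_range by auto
  have g: "?g v \<in> carrier M"
    unfolding M_simps(1) by (auto intro!: k_algebra.wprod_closed[OF factor] G_closed)
  have z: "z k \<in> carrier (A (slot k))" unfolding z_def by (rule G_closed[OF k])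
  have upd: "(?g v)(slot k := z k \<otimes>\<^bsub>A (slot k)\<^esub> ?g v (slot k)) = ?g (k # v)"
  proof
    fix i
    show "((?g v)(slot k := z k \<otimes>\<^bsub>A (slot k)\<^esub> ?g v (slot k))) i = ?g (k # v) i"
      using k by (cases "i = slot k") (simp_all add: z_def k_algebra.wprod_Cons[OF factor])
  qed
  have "Q.A.wprod y (k # v) = \<iota> (slot k) (z k) \<otimes>\<^bsub>Q.A\<^esub> pure (?g v)"
    by (simp only: Q.A.wprod_Cons IH y_def[of k])
  then show ?case by (simp only: iota_pure[OF g k z] upd)
qed

text \<open>The product of the coordinate functionals of the factors. Each of them is linear, so the
  product is multilinear and respects the tensor relations.\<close>

definition \<sigma> :: "nat multiset \<Rightarrow> (nat \<Rightarrow> 'a) \<Rightarrow> 'k" where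
  "\<sigma> p f = (\<Prod>i\<in>{1..n}. \<phi> i (f i) (count p (2 * i - 1), count p (2 * i)))"

lemma sigma_upd:
  assumes "u \<in> carrier M" "f \<in> carrier M" "v \<in> carrier M" "i \<in> {1..n}"
  shows "\<sigma> p (u \<otimes>\<^bsub>M\<^esub> f(i := a) \<otimes>\<^bsub>M\<^esub> v) = \<phi> i (u i \<otimes>\<^bsub>A i\<^esub> a \<otimes>\<^bsub>A i\<^esub> v i) (count p (2 * i - 1), count p (2 * i)) *
    (\<Prod>j\<in>{1..n} - {i}. \<phi> j (u j \<otimes>\<^bsub>A j\<^esub> f j \<otimes>\<^bsub>A j\<^esub> v j) (count p (2 * j - 1), count p (2 * j)))"
proof -
  have "\<sigma> p (u \<otimes>\<^bsub>M\<^esub> f(i := a) \<otimes>\<^bsub>M\<^esub> v) = (\<Prod>j\<in>{1..n}. \<phi> j (u j \<otimes>\<^bsub>A j\<^esub> (f(i := a)) j \<otimes>\<^bsub>A j\<^esub> v j) (count p (2 * j - 1), count p (2 * j)))"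
    unfolding \<sigma>_def by (intro prod.cong refl) (simp add: M_simps(3))
  also have "\<dots> = \<phi> i (u i \<otimes>\<^bsub>A i\<^esub> a \<otimes>\<^bsub>A i\<^esub> v i) (count p (2 * i - 1), count p (2 * i)) *
    (\<Prod>j\<in>{1..n} - {i}. \<phi> j (u j \<otimes>\<^bsub>A j\<^esub> (f(i := a)) j \<otimes>\<^bsub>A j\<^esub> v j) (count p (2 * j - 1), count p (2 * j)))"
    by (subst prod.remove[OF _ assms(4)]) simp_all
  also have "(\<Prod>j\<in>{1..n} - {i}. \<phi> j (u j \<otimes>\<^bsub>A j\<^esub> (f(i := a)) j \<otimes>\<^bsub>A j\<^esub> v j) (count p (2 * j - 1), count p (2 * j)))
    = (\<Prod>j\<in>{1..n} - {i}. \<phi> j (u j \<otimes>\<^bsub>A j\<^esub> f j \<otimes>\<^bsub>A j\<^esub> v j) (count p (2 * j - 1), count p (2 * j)))"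
    by (intro prod.cong refl) simp
  finally show ?thesis .
qed

lemma sigma_relation:
  assumes u: "u \<in> carrier M" and v: "v \<in> carrier M" and lr: "(l, r) \<in> multilinear_relations {1..n} A"
  shows "lin (\<lambda>w. \<sigma> p (u \<otimes>\<^bsub>M\<^esub> w \<otimes>\<^bsub>M\<^esub> v)) l = lin (\<lambda>w. \<sigma> p (u \<otimes>\<^bsub>M\<^esub> w \<otimes>\<^bsub>M\<^esub> v)) r"
  using lr
proof (cases rule: relation_cases)
  case (add f i a b)
  interpret S: shift_factor "A i" "q i" "\<epsilon> i" "G i" "\<phi> i" by (rule shift_factors[OF add(2)])
  have "u i \<in> carrier (A i)" "v i \<in> carrier (A i)" using u v add(2) by (auto simp: M_simps(1))
  then have "\<phi> i (u i \<otimes>\<^bsub>A i\<^esub> (a \<oplus>\<^bsub>A i\<^esub> b) \<otimes>\<^bsub>A i\<^esub> v i) s = \<phi> i (u i \<otimes>\<^bsub>A i\<^esub> a \<otimes>\<^bsub>A i\<^esub> v i) s + \<phi> i (u i \<otimes>\<^bsub>A i\<^esub> b \<otimes>\<^bsub>A i\<^esub> v i) s" for s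
    using add(3,4) by (simp add: S.r_distr S.l_distr S.phi_add)
  moreover have "basis_elt (f(i := a)) \<in> carrier P.F" "basis_elt (f(i := b)) \<in> carrier P.F"
    by (intro P.basis_closed upd_closed add)+
  ultimately show ?thesis
    unfolding add(5,6)
    by (simp only: lin_basis P.lin_F_add sigma_upd[OF u add(1) v add(2)] distrib_right)
next
  case (smult f i a c)
  interpret S: shift_factor "A i" "q i" "\<epsilon> i" "G i" "\<phi> i" by (rule shift_factors[OF smult(2)])
  have "u i \<in> carrier (A i)" "v i \<in> carrier (A i)" using u v smult(2) by (auto simp: M_simps(1))
  then have "\<phi> i (u i \<otimes>\<^bsub>A i\<^esub> (c \<odot>\<^bsub>A i\<^esub> a) \<otimes>\<^bsub>A i\<^esub> v i) s = c * \<phi> i (u i \<otimes>\<^bsub>A i\<^esub> a \<otimes>\<^bsub>A i\<^esub> v i) s" for s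
    using smult(3) by (simp add: S.smult_mult_left S.smult_mult_right S.phi_smult)
  then show ?thesis
    unfolding smult(4,5) by (simp add: lin_basis P.lin_F_smult sigma_upd[OF u smult(1) v smult(2)] mult.assoc)
qed

lemma sigma_std:
  assumes m: "m \<in> monomials {1..2 * n}" and p: "p \<in> monomials {1..2 * n}"
  shows "\<sigma> p (\<lambda>i\<in>{1..n}. k_algebra.wprod (A i) (G i) (map letter (filter (\<lambda>k. slot k = i) (sorted_list_of_multiset m))))
    = (if p = m then 1 else 0)" (is "\<sigma> p ?f = _")
proof -
  let ?P = "\<lambda>i. (count p (2 * i - 1), count p (2 * i)) = (count m (2 * i - 1), count m (2 * i))"
  have "\<sigma> p ?f = (\<Prod>i\<in>{1..n}. if ?P i then 1 else 0)"
    unfolding \<sigma>_def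
  proof (rule prod.cong[OF refl])
    fix i assume i: "i \<in> {1..n}"
    then have "i \<ge> 1" by simp
    then have "?f i = k_algebra.wprod (A i) (G i) (replicate (count m (2 * i - 1)) Shift @ replicate (count m (2 * i)) Var)"
      using i by (simp only: restrict_apply if_True filter_slot_sorted map_append map_replicate letter_simps)
    then show "\<phi> i (?f i) (count p (2 * i - 1), count p (2 * i)) = (if ?P i then 1 else 0)"
      by (simp only: shift_factor.phi_std[OF shift_factors[OF i]])
  qed
  also have "\<dots> = (if \<forall>i\<in>{1..n}. ?P i then 1 else 0)" by (rule prod_indicator) simp
  also have "(\<forall>i\<in>{1..n}. ?P i) \<longleftrightarrow> p = m"
  proof
    assume eq: "\<forall>i\<in>{1..n}. ?P i"
    show "p = m"
    proof (rule multiset_eqI)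
      fix k
      show "count p k = count m k"
      proof (cases "k \<in> {1..2 * n}")
        case True
        from slot_range[OF this] have s: "slot k \<in> {1..n}" .
        then have "k = 2 * slot k - 1 \<or> k = 2 * slot k" using slot_iff[of "slot k" k] by simp
        moreover have "?P (slot k)" using eq s by blast
        ultimately show ?thesis by (metis prod.inject)
      next
        case False
        then have "k \<notin># p" "k \<notin># m" using m p by (auto simp: monomials_def)
        then show ?thesis by (simp add: not_in_iff)
      qed
    qed
  qed simp
  finally show ?thesis .
qed

text \<open>Generators in different slots commute. Two generators in the same slot with
  \<open>i < j\<close> can only be its shift followed by its variable, and the correction in their
  relation is a multiple of a single letter, of weight 1 < 2.\<close>

lemma tensor_straighten:
  assumes "1 \<le> i" "i < j" "j \<le> 2 * n"
  shows "\<exists>c d. c \<noteq> 0 \<and> y j \<otimes>\<^bsub>Q.A\<^esub> y i = c \<odot>\<^bsub>Q.A\<^esub> (y i \<otimes>\<^bsub>Q.A\<^esub> y j) \<oplus>\<^bsub>Q.A\<^esub> d \<and>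
    d \<in> Q.A.lspan {Q.A.wprod y (sorted_list_of_multiset m) | m.
      m \<in> monomials {1..2 * n} \<and> sum_mset (image_mset (\<lambda>_. 1) m) < (1::nat) + 1}" (is "\<exists>c d. _ \<and> _ \<and> d \<in> ?low")
proof -
  have ij: "i \<in> {1..2 * n}" "j \<in> {1..2 * n}" using assms by auto
  note s = slot_range[OF ij(1)] slot_range[OF ij(2)]
  show ?thesis
  proof (cases "slot i = slot j")
    case False
    have "y j \<otimes>\<^bsub>Q.A\<^esub> y i = y i \<otimes>\<^bsub>Q.A\<^esub> y j"
      unfolding y_def using False by (intro iota_commute s) (auto simp: z_def intro!: G_closed s)
    then have "y j \<otimes>\<^bsub>Q.A\<^esub> y i = 1 \<odot>\<^bsub>Q.A\<^esub> (y i \<otimes>\<^bsub>Q.A\<^esub> y j) \<oplus>\<^bsub>Q.A\<^esub> \<zero>\<^bsub>Q.A\<^esub>"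
      using y_closed[OF ij(1)] y_closed[OF ij(2)] by simp
    then show ?thesis using Q.A.lspan_zero[of "{Q.A.wprod y (sorted_list_of_multiset m) | m.
      m \<in> monomials {1..2 * n} \<and> sum_mset (image_mset (\<lambda>_. 1) m) < (1::nat) + 1}"]
      by (intro exI[of _ 1] exI[of _ "\<zero>\<^bsub>Q.A\<^esub>"] conjI) simp_all
  next
    case True
    define e where "e = slot j"
    have e: "e \<in> {1..n}" "slot i = e" "slot j = e" using s True by (simp_all add: e_def)
    interpret S: shift_factor "A e" "q e" "\<epsilon> e" "G e" "\<phi> e" by (rule shift_factors[OF e(1)])
    have "i = 2 * e - 1" "j = 2 * e" using e assms slot_iff[of e i] slot_iff[of e j] by auto
    then have l: "letter i = Shift" "letter j = Var" using e(1) letter_simps[of e] by auto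
    have y: "y i = \<iota> e (G e Shift)" "y j = \<iota> e (G e Var)" by (simp_all add: y_def z_def e l)
    have "y j \<otimes>\<^bsub>Q.A\<^esub> y i = \<iota> e (G e Var \<otimes>\<^bsub>A e\<^esub> G e Shift)"
      unfolding y by (rule iota_mult[symmetric, OF e(1) S.G_closed S.G_closed])
    also have "\<dots> = inverse (q e) \<odot>\<^bsub>Q.A\<^esub> (y i \<otimes>\<^bsub>Q.A\<^esub> y j) \<oplus>\<^bsub>Q.A\<^esub> (- (\<epsilon> e / q e)) \<odot>\<^bsub>Q.A\<^esub> y i"
      unfolding S.shift_rel' y
      by (simp only: iota_add[OF e(1)] iota_smult[OF e(1)] iota_mult[OF e(1)] S.G_closed S.m_closed S.smult_closed)
    finally have rel: "y j \<otimes>\<^bsub>Q.A\<^esub> y i = inverse (q e) \<odot>\<^bsub>Q.A\<^esub> (y i \<otimes>\<^bsub>Q.A\<^esub> y j) \<oplus>\<^bsub>Q.A\<^esub> (- (\<epsilon> e / q e)) \<odot>\<^bsub>Q.A\<^esub> y i" .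
    have "y i = Q.A.wprod y (sorted_list_of_multiset {#i#})" using y_closed[OF ij(1)] by simp
    then have "y i \<in> ?low"
      using ij(1) by (intro Q.A.lspan_base CollectI exI[of _ "{#i#}"] conjI) (simp_all add: monomials_def)
    then have "(- (\<epsilon> e / q e)) \<odot>\<^bsub>Q.A\<^esub> y i \<in> ?low" by (rule Q.A.lspan_smult)
    with rel show ?thesis using S.q_nonzero
      by (intro exI[of _ "inverse (q e)"] exI[of _ "(- (\<epsilon> e / q e)) \<odot>\<^bsub>Q.A\<^esub> y i"] conjI) simp_all
  qed
qed

theorem tensor_pbw: "\<exists>x w \<phi>. pbw_algebra (tensor_product {1..n} A) (2 * n) x w \<phi>"
proof -
  obtain \<psi> where psi: "\<forall>f\<in>carrier M. \<forall>p. \<psi> (Q.\<pi> (basis_elt f)) p = \<sigma> p f"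
    "\<forall>a\<in>carrier Q.A. \<forall>b\<in>carrier Q.A. \<forall>p. \<psi> (a \<oplus>\<^bsub>Q.A\<^esub> b) p = \<psi> a p + \<psi> b p"
    "\<forall>a\<in>carrier Q.A. \<forall>c p. \<psi> (c \<odot>\<^bsub>Q.A\<^esub> a) p = c * \<psi> a p"
    using Q.lift_monoid_functional[of \<sigma>, OF sigma_relation] by blast
  define \<chi> where "\<chi> a p = (if p \<in> monomials {1..2 * n} then \<psi> a p else 0)" for a p
  have "pbw_algebra Q.A (2 * n) y (\<lambda>_. 1) \<chi>"
  proof (intro pbw_algebra.intro pbw_algebra_axioms.intro Q.A.k_algebra_axioms)
    fix m p assume mp: "m \<in> monomials {1..2 * n}" "p \<in> monomials {1..2 * n}"
    let ?f = "\<lambda>i\<in>{1..n}. k_algebra.wprod (A i) (G i) (map letter (filter (\<lambda>k. slot k = i) (sorted_list_of_multiset m)))"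
    have f: "?f \<in> carrier M"
      unfolding M_simps(1) by (auto intro!: k_algebra.wprod_closed[OF factor] G_closed)
    have "sorted_list_of_multiset m \<in> lists {1..2 * n}" using mp(1) by (auto simp: monomials_def)
    then have "Q.A.wprod y (sorted_list_of_multiset m) = Q.\<pi> (basis_elt ?f)"
      by (simp only: wprod_pure pure_def)
    then show "\<chi> (Q.A.wprod y (sorted_list_of_multiset m)) p = (if p = m then 1 else 0)"
      using psi(1) f mp sigma_std[OF mp] by (simp add: \<chi>_def)
  qed (use y_closed words_span_tensor tensor_straighten psi(2,3) in \<open>auto simp: \<chi>_def\<close>)
  then show ?thesis unfolding tensor_eq by blast
qed

end

lemma ore_shift_tensor_pbw:
  fixes q \<epsilon> :: "nat \<Rightarrow> 'k::field"
  assumes "\<forall>i\<in>{1..n}. q i \<noteq> 0"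
  shows "\<exists>x w \<phi>. pbw_algebra (tensor_product {1..n} (\<lambda>i. ore_shift (q i) (\<epsilon> i))) (2 * n) x w \<phi>"
proof -
  have "\<forall>i\<in>{1..n}. \<exists>G \<phi>. shift_factor (ore_shift (q i) (\<epsilon> i)) (q i) (\<epsilon> i) G \<phi>"
    using assms ore_shift_factor by blast
  then obtain G \<phi> where "\<forall>i\<in>{1..n}. shift_factor (ore_shift (q i) (\<epsilon> i)) (q i) (\<epsilon> i) (G i) (\<phi> i)"
    by metis
  then interpret shift_tensor n "\<lambda>i. ore_shift (q i) (\<epsilon> i)" q \<epsilon> G \<phi>
    by (intro shift_tensor.intro) blast
  show ?thesis by (rule tensor_pbw)
qed

lemma pbw_FFD:
  fixes A :: "('k::field, 'a) module"
  assumes "\<exists>x w \<phi>. pbw_algebra A N x w \<phi>"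
  shows "FFD A \<and> FFD (polynomial_ring A V)" "k_subalgebra S A \<Longrightarrow> FFD (A\<lparr>carrier := S\<rparr>)"
proof -
  from assms obtain x w \<phi> where "pbw_algebra A N x w \<phi>" by blast
  then interpret pbw_algebra A N x w \<phi> .
  show "FFD A \<and> FFD (polynomial_ring A V)" using FFD_weighted FFD_polynomial_ring by blast
  show "k_subalgebra S A \<Longrightarrow> FFD (A\<lparr>carrier := S\<rparr>)" by (rule FFD_subalgebra)
qed

theorem theorem1p3:
  fixes V :: "'v set"
  shows
    "(\<forall>n (c :: nat \<Rightarrow> nat \<Rightarrow> 'k::field) d. is_G_algebra n c d \<longrightarrow>
        FFD (G_presentation n c d) \<and>
        (\<forall>S. k_subalgebra S (G_presentation n c d) \<longrightarrow>
           FFD ((G_presentation n c d)\<lparr>carrier := S\<rparr>))) \<and>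
     (\<forall>n. FFD (weyl_algebra n :: ('k, _) module) \<and>
        FFD (polynomial_ring (weyl_algebra n :: ('k, _) module) V)) \<and>
     (\<forall>n. FFD (shift_algebra n :: ('k, _) module) \<and>
        FFD (polynomial_ring (shift_algebra n :: ('k, _) module) V)) \<and>
     (\<forall>(L :: ('k, 'l) module) br. lie_algebra L br \<and> finite_dimensional L \<longrightarrow>
        FFD (enveloping_algebra L br) \<and>
        FFD (polynomial_ring (enveloping_algebra L br) V)) \<and>
     (\<forall>n (q :: nat \<Rightarrow> nat \<Rightarrow> 'k). quantum_parameters n q \<longrightarrow>
        FFD (quantum_affine_space n q) \<and>
        FFD (polynomial_ring (quantum_affine_space n q) V)) \<and>
     (\<forall>n (q :: nat \<Rightarrow> 'k). (\<forall>i\<in>{1..n}. q i \<noteq> 0) \<longrightarrow>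
        FFD (q_shift_algebra n q) \<and>
        FFD (polynomial_ring (q_shift_algebra n q) V)) \<and>
     (\<forall>n (q :: nat \<Rightarrow> 'k). (\<forall>i\<in>{1..n}. q i \<noteq> 0) \<longrightarrow>
        FFD (q_weyl_algebra n q) \<and>
        FFD (polynomial_ring (q_weyl_algebra n q) V))"
proof (intro conjI[OF _ conjI[OF _ conjI[OF _ conjI[OF _ conjI[OF _ conjI]]]]] allI impI; (elim conjE)?)
  fix n and c :: "nat \<Rightarrow> nat \<Rightarrow> 'k" and d assume "is_G_algebra n c d"
  note pbw = G_algebra_pbw[OF this]
  show "FFD (G_presentation n c d) \<and> (\<forall>S. k_subalgebra S (G_presentation n c d) \<longrightarrow>
      FFD ((G_presentation n c d)\<lparr>carrier := S\<rparr>))"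
    using pbw_FFD(1)[OF pbw] pbw_FFD(2)[OF pbw] by blast
next
  fix n
  show "FFD (weyl_algebra n :: ('k, _) module) \<and> FFD (polynomial_ring (weyl_algebra n :: ('k, _) module) V)"
    unfolding weyl_eq_q_weyl by (rule pbw_FFD(1)[OF q_weyl_pbw]) simp
next
  fix n
  show "FFD (shift_algebra n :: ('k, _) module) \<and> FFD (polynomial_ring (shift_algebra n :: ('k, _) module) V)"
    unfolding shift_algebra_def first_shift_eq
    by (rule pbw_FFD(1)[OF ore_shift_tensor_pbw[where q = "\<lambda>_. 1" and \<epsilon> = "\<lambda>_. 1"]]) simp
next
  fix L :: "('k, 'l) module" and br assume "lie_algebra L br" "finite_dimensional L"
  then obtain N where "\<exists>x w \<phi>. pbw_algebra (enveloping_algebra L br) N x w \<phi>"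
    using enveloping_pbw by blast
  then show "FFD (enveloping_algebra L br) \<and> FFD (polynomial_ring (enveloping_algebra L br) V)"
    by (rule pbw_FFD(1))
next
  fix n and q :: "nat \<Rightarrow> nat \<Rightarrow> 'k" assume "quantum_parameters n q"
  then show "FFD (quantum_affine_space n q) \<and> FFD (polynomial_ring (quantum_affine_space n q) V)"
    by (rule pbw_FFD(1)[OF quantum_affine_pbw])
next
  fix n and q :: "nat \<Rightarrow> 'k" assume "\<forall>i\<in>{1..n}. q i \<noteq> 0"
  then show "FFD (q_shift_algebra n q) \<and> FFD (polynomial_ring (q_shift_algebra n q) V)"
    unfolding q_shift_algebra_def first_shift_eq
    by (rule pbw_FFD(1)[OF ore_shift_tensor_pbw[where \<epsilon> = "\<lambda>_. 0"]])
next
  fix n and q :: "nat \<Rightarrow> 'k" assume "\<forall>i\<in>{1..n}. q i \<noteq> 0"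
  then show "FFD (q_weyl_algebra n q) \<and> FFD (polynomial_ring (q_weyl_algebra n q) V)"
    by (rule pbw_FFD(1)[OF q_weyl_pbw])
qed

end
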